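(* The equivalences $K^{brd}\colon\mathrm{BrdShSkMulti}_{lr}\to\mathrm{BrdSkMon}$ and $K^{sym}\colon\mathrm{SymShSkMulti}_{lr}\to\mathrm{SymSkMon}$ (defined in the context) induce equivalences of categories $$K^{brd}\colon\mathrm{BrdShMulti}_{lr}\to\mathrm{BrdMon}\quad\text{and}\quad K^{sym}\colon\mathrm{SymShMulti}_{lr}\to\mathrm{SymMon}$$ between braided (resp. symmetric) left representable short multicategories and braided (resp. symmetric) monoidal categories.
   Context: For $x,y\in\{t,l\}$ put $x\circ_iy=t$ if ($x=y=t$ and $i=1$) or ($x=t$ and $i\ne1$), and $x\circ_iy=l$ otherwise. ($t$ = "tight", $l$ = "loose".) **Short skew multicategories.** A short skew multicategory $\mathbb C$ consists of a category $\mathcal C$; functors $\mathbb C^t_n(-;-)\colon(\mathcal C^n)^{op}\times\mathcal C\to\mathrm{Set}$ for $1\le n\le4$ with $\mathbb C^t_1(-;-)=\mathcal C(-,-)$; functors $\mathbb C^l_n(-;-)\colon(\mathcal C^n)^{op}\times\mathcal C\to\mathrm{Set}$ for $n=0,1,2$; natural transformations $j\colon\mathbb C^t_n\to\mathbb C^l_n$ for $n=1,2$. Nullary maps are loose. The functorial action of tight unary maps (morphisms of $\mathcal C$) is written $q\circ f$ (codomain) and $f\circ_ip$ ($i$-th input). Furthermore there are substitution functions $\circ_i\colon\mathbb C^x_n(\bar b;c)\times\mathbb C^y_m(\bar a;b_i)\to\mathbb C^{x\circ_iy}_{n+m-1}(\bar b_{<i},\bar a,\bar b_{>i};c)$, natural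 in all $a_k$, $b_k$ ($k\neq i$), $c$ and dinatural in $b_i$, in the following cases: tight binary into tight binary or tight ternary; tight ternary into tight binary; nullary into tight binary or tight ternary; nullary into loose unary; loose unary into tight binary; tight binary into loose unary. Axioms: for $f$ tight binary, $g$ $n$-ary, $h$ $p$-ary (all tight except that nullary maps are loose), (A) $f\circ_i(g\circ_jh)=(f\circ_ig)\circ_{j+i-1}h$ for $1\le i\le2$, $1\le j\le n$, when $(n,p)\in\{(2,2),(2,0)\}$; (B) $(f\circ_1g)\circ_{n+1}h=(f\circ_2h)\circ_1g$ when $(n,p)\in\{(2,2),(2,0),(0,2),(0,0)\}$; and compatibility of $j$: for $g$ tight binary, $p,q$ tight unary, $v$ nullary, $g\circ_2jp=g\circ_2p$, $g\circ_1jp=j(g\circ_1p)$, $q\circ jp=j(q\circ p)$, $jp\circ g=j(p\circ g)$, $jp\circ v=p\circ v$. A morphism $F\colon\mathbb C\to\mathbb D$ is a functor $F\colon\mathcal C\to\mathcal D$ with natural families $F^t_n\colon\mathbb C^t_n(\bar a;b)\to\mathbb D^t_n(F\bar a;Fb)$ ($1\le n\le4$, $F^t_1=F$) and $F^l_n\colon\mathbb C^l_n(\bar a;b)\to\mathbb D^l_n(F\bar a;Fb)$ ($0\le n\le2$) commuting with all substitutions and with $j$. A short multicategory is regarded as a short skew multicategory in which tight and loose maps coincide: $\mathbb C^t_n=\mathbb C^l_n$ and $j=1$ for $n=1,2$. **Left representability.** $\mathbb C$ is left representable if there are tight binary maps $\theta_{a,b}\colon a,b\to ab$ (all $a,b$)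 such that $-\circ_1\theta_{a,b}\colon\mathbb C^t_n(ab,\bar x;d)\to\mathbb C^t_{n+1}(a,b,\bar x;d)$ is bijective for $n=1,2,3$, and a nullary map $u\in\mathbb C^l_0(\,;i)$ such that $-\circ_1u\colon\mathbb C^t_{n+1}(i,\bar x;d)\to\mathbb C^l_n(\bar x;d)$ is bijective for $n=0,1,2$. **Short braidings.** A short braiding on $\mathbb C$ consists of natural isomorphisms $\beta^3_2\colon\mathbb C^t_3(a_1,a_2,a_3;b)\to\mathbb C^t_3(a_1,a_3,a_2;b)$, $\beta^4_2\colon\mathbb C^t_4(a_1,a_2,a_3,a_4;b)\to\mathbb C^t_4(a_1,a_3,a_2,a_4;b)$, $\beta^4_3\colon\mathbb C^t_4(a_1,a_2,a_3,a_4;b)\to\mathbb C^t_4(a_1,a_2,a_4,a_3;b)$ such that: $\beta^4_2\beta^4_3\beta^4_2(h)=\beta^4_3\beta^4_2\beta^4_3(h)$ for $h$ tight 4-ary; $g\circ_1\beta^3_2(f)=\beta^4_2(g\circ_1f)$ and $g\circ_2\beta^3_2(f)=\beta^4_3(g\circ_2f)$ for $g$ tight binary, $f$ tight ternary; $\beta^4_3(g\circ_1f)=\beta^3_2(g)\circ_1f$, $\beta^4_2\beta^4_3(g\circ_2f)=\beta^3_2(g)\circ_3f$, $\beta^4_3\beta^4_2(g\circ_3f)=\beta^3_2(g)\circ_2f$ for $g$ tight ternary, $f$ tight binary. It is a short symmetry if moreover $\beta^3_2\beta^3_2=1$. A morphism is braided if it commutes with $\beta^3_2,\beta^4_2,\beta^4_3$.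 $\mathrm{BrdShSkMulti}_{lr}$ is the category of left representable short skew multicategories with a short braiding and braided morphisms, $\mathrm{SymShSkMulti}_{lr}$ its full subcategory on those whose braiding is a short symmetry; $\mathrm{BrdShMulti}_{lr}$ and $\mathrm{SymShMulti}_{lr}$ are the full subcategories of these on short multicategories. **Skew monoidal categories.** A (left) skew monoidal category is a category $\mathcal C$ with a functor $(a,b)\mapsto ab$, $\mathcal C\times\mathcal C\to\mathcal C$, an object $i$, and natural families $\alpha_{a,b,c}\colon(ab)c\to a(bc)$, $\lambda_a\colon ia\to a$, $\rho_a\colon a\to ai$ (not necessarily invertible) satisfying $\alpha_{a,b,cd}\alpha_{ab,c,d}=(a\,\alpha_{b,c,d})\alpha_{a,bc,d}(\alpha_{a,b,c}\,d)$, $\lambda_{ab}\alpha_{i,a,b}=\lambda_a b$, $\alpha_{a,b,i}\rho_{ab}=a\rho_b$, $(a\lambda_b)\alpha_{a,i,b}(\rho_a b)=1_{ab}$, $\lambda_i\rho_i=1_i$. A lax monoidal functor is a functor $F$ with a map $f_0\colon i\to Fi$ and a natural family $f_2\colon FaFb\to F(ab)$ such that $F\alpha\circ f_2\circ(f_2\cdot Fc)=f_2\circ(Fa\cdot f_2)\circ\alpha$, $F\lambda\circ f_2\circ(f_0\cdot Fa)=\lambda$, $f_2\circ(Fa\cdot f_0)\circ\rho=F\rho$. A braiding on a skew monoidal category consists of natural isomorphisms $s_{x,a,b}\colon(xa)b\to(xb)a$ with $s_{xc,a,b}(s_{x,a,c}\,b)s_{xa,b,c}=(s_{x,b,c}\,a)s_{xb,a,c}(s_{x,a,b}\,c)$;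 $s_{x,a,bc}\,\alpha_{xa,b,c}=(\alpha_{x,b,c}\,a)s_{xb,a,c}(s_{x,a,b}\,c)$; $s_{x,ab,c}(\alpha_{x,a,b}\,c)=\alpha_{xc,a,b}(s_{x,a,c}\,b)s_{xa,b,c}$; $(x\,s_{a,b,c})\alpha_{x,ab,c}(\alpha_{x,a,b}\,c)=\alpha_{x,ac,b}(\alpha_{x,a,c}\,b)s_{xa,b,c}$. It is a symmetry if $s_{x,b,a}=s_{x,a,b}^{-1}$. A lax monoidal functor is braided if $Fs\circ f_2\circ(f_2\cdot Fb)=f_2\circ(f_2\cdot Fa)\circ s\colon(FxFa)Fb\to F((xb)a)$. $\mathrm{BrdSkMon}$ (resp. $\mathrm{SymSkMon}$) is the category of braided (resp. symmetric) skew monoidal categories and braided lax monoidal functors. $\mathrm{BrdMon}$ and $\mathrm{SymMon}$ are the full subcategories on those with $\alpha,\lambda,\rho$ all invertible, i.e. braided/symmetric monoidal categories (for a monoidal category, a braiding in the skew monoidal sense, i.e. a natural isomorphism $s_{x,a,b}\colon(xa)b\to(xb)a$ satisfying the four displayed braiding equations, is the same thing as a braiding $c$ in the usual sense, via $s_{x,a,b}=\alpha^{-1}_{x,b,a}\circ(x\,c_{a,b})\circ\alpha_{x,a,b}$). **The functors.** For each left representable short skew multicategory fix a choice of tight binary maps $\theta_{a,b}\colon a,b\to ab$ (all $a,b$) such that $-\circ_1\theta_{a,b}\colon\mathbb C^t_n(ab,\bar x;d)\to\mathbb C^t_{n+1}(a,b,\bar x;d)$ is bijective for $n=1,2,3$,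 and of a nullary map $u\in\mathbb C^l_0(\,;i)$ such that $-\circ_1u\colon\mathbb C^t_{n+1}(i,\bar x;d)\to\mathbb C^l_n(\bar x;d)$ is bijective for $n=0,1,2$. $K^{brd}\mathbb C$ has underlying category $\mathcal C$, tensor $ab$, unit $i$; for tight unary $f\colon a\to b$, $g\colon c\to d$, $fg$ is the unique map with $(fg)\circ\theta_{a,c}=(\theta_{b,d}\circ_1f)\circ_2g$; $\alpha$ is the unique map with $(\alpha\circ\theta_{ab,c})\circ_1\theta_{a,b}=\theta_{a,bc}\circ_2\theta_{b,c}$; $\lambda_a$ is the unique map with $(\lambda_a\circ\theta_{i,a})\circ_1u=j(1_a)$; $\rho_a=\theta_{a,i}\circ_2u$; $s_{x,a,b}$ is the unique map with $s_{x,a,b}\circ(\theta_{xa,b}\circ_1\theta_{x,a})=\beta^3_2(\theta_{xb,a}\circ_1\theta_{x,b})$. On a morphism $F$, $K^{brd}F=(F,f_0,f_2)$ with $f_2$ unique such that $f_2\circ\theta_{Fa,Fb}=F^t_2(\theta_{a,b})$ and $f_0$ unique such that $f_0\circ u=F^l_0(u)$. $K^{sym}$ is the restriction of $K^{brd}$ to symmetric objects. *)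

theory Defs
  imports Main "HOL-Library.FuncSet"
begin

section \<open>Categories\<close>

text \<open>
  Arrows carry their source and target as tags, so a set of arrows is the same thing as a family of
  hom-sets \<open>C(a,b) \<subseteq> 'm\<close>; distinct hom-sets may reuse the same labels. The type variables \<open>'o\<close> and
  \<open>'m\<close> play the role of the universe in which the categories are small.
\<close>

datatype ('o, 'm) arrow = Arrow (src: 'o) (tgt: 'o) (lbl: 'm)

record ('o, 'm) category =
  Ob :: "'o set"
  Arr :: "('o, 'm) arrow set"
  Id :: "'o \<Rightarrow> ('o, 'm) arrow" ("\<one>\<index>")
  Comp :: "('o, 'm) arrow \<Rightarrow> ('o, 'm) arrow \<Rightarrow> ('o, 'm) arrow" (infixr "\<cdot>\<index>" 70)

definition hom :: "('o, 'm, 'z) category_scheme \<Rightarrow> 'o \<Rightarrow> 'o \<Rightarrow> ('o, 'm) arrow set" where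
  "hom C a b = {f \<in> Arr C. src f = a \<and> tgt f = b}"

locale category =
  fixes C :: "('o, 'm, 'z) category_scheme" (structure)
  assumes src_Ob: "f \<in> Arr C \<Longrightarrow> src f \<in> Ob C"
    and tgt_Ob: "f \<in> Arr C \<Longrightarrow> tgt f \<in> Ob C"
    and Id_hom: "a \<in> Ob C \<Longrightarrow> \<one> a \<in> hom C a a"
    and Comp_hom: "f \<in> Arr C \<Longrightarrow> g \<in> Arr C \<Longrightarrow> tgt f = src g \<Longrightarrow> g \<cdot> f \<in> hom C (src f) (tgt g)"
    and Id_left: "f \<in> Arr C \<Longrightarrow> \<one> (tgt f) \<cdot> f = f"
    and Id_right: "f \<in> Arr C \<Longrightarrow> f \<cdot> \<one> (src f) = f"
    and Comp_assoc: "f \<in> Arr C \<Longrightarrow> g \<in> Arr C \<Longrightarrow> h \<in> Arr C \<Longrightarrow> tgt f = src g \<Longrightarrow> tgt g = src h \<Longrightarrow>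
      (h \<cdot> g) \<cdot> f = h \<cdot> (g \<cdot> f)"

definition inverse_arrows ::
  "('o, 'm, 'z) category_scheme \<Rightarrow> ('o, 'm) arrow \<Rightarrow> ('o, 'm) arrow \<Rightarrow> bool" where
  "inverse_arrows C f g \<longleftrightarrow> f \<in> Arr C \<and> g \<in> hom C (tgt f) (src f) \<and>
     g \<cdot>\<^bsub>C\<^esub> f = \<one>\<^bsub>C\<^esub> (src f) \<and> f \<cdot>\<^bsub>C\<^esub> g = \<one>\<^bsub>C\<^esub> (tgt f)"

definition invertible_arrow :: "('o, 'm, 'z) category_scheme \<Rightarrow> ('o, 'm) arrow \<Rightarrow> bool" where
  "invertible_arrow C f \<longleftrightarrow> (\<exists>g. inverse_arrows C f g)"

record ('o, 'm, 'p, 'n) fctr =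
  fob :: "'o \<Rightarrow> 'p"
  farr :: "('o, 'm) arrow \<Rightarrow> ('p, 'n) arrow"

locale functor_on = A: category A + B: category B
  for A :: "('o, 'm, 'z) category_scheme" and B :: "('p, 'n, 'y) category_scheme" +
  fixes F :: "('o, 'm, 'p, 'n, 'x) fctr_scheme"
  assumes fob_Ob: "a \<in> Ob A \<Longrightarrow> fob F a \<in> Ob B"
    and farr_hom: "f \<in> Arr A \<Longrightarrow> farr F f \<in> hom B (fob F (src f)) (fob F (tgt f))"
    and farr_Id: "a \<in> Ob A \<Longrightarrow> farr F (\<one>\<^bsub>A\<^esub> a) = \<one>\<^bsub>B\<^esub> (fob F a)"
    and farr_Comp: "f \<in> Arr A \<Longrightarrow> g \<in> Arr A \<Longrightarrow> tgt f = src g \<Longrightarrow>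
      farr F (g \<cdot>\<^bsub>A\<^esub> f) = farr F g \<cdot>\<^bsub>B\<^esub> farr F f"

definition id_fctr :: "('o, 'm, 'o, 'm) fctr" where
  "id_fctr = \<lparr>fob = (\<lambda>a. a), farr = (\<lambda>f. f)\<rparr>"

definition comp_fctr :: "('p, 'n, 'q, 'k) fctr \<Rightarrow> ('o, 'm, 'p, 'n) fctr \<Rightarrow> ('o, 'm, 'q, 'k) fctr" where
  "comp_fctr G F = \<lparr>fob = fob G \<circ> fob F, farr = farr G \<circ> farr F\<rparr>"

definition nat_iso ::
  "('o, 'm, 'z) category_scheme \<Rightarrow> ('p, 'n, 'y) category_scheme \<Rightarrow>
   ('o, 'm, 'p, 'n) fctr \<Rightarrow> ('o, 'm, 'p, 'n) fctr \<Rightarrow> ('o \<Rightarrow> ('p, 'n) arrow) \<Rightarrow> bool" where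
  "nat_iso A B F G \<tau> \<longleftrightarrow>
     (\<forall>a\<in>Ob A. \<tau> a \<in> hom B (fob F a) (fob G a) \<and> invertible_arrow B (\<tau> a)) \<and>
     (\<forall>f\<in>Arr A. \<tau> (tgt f) \<cdot>\<^bsub>B\<^esub> farr F f = farr G f \<cdot>\<^bsub>B\<^esub> \<tau> (src f))"

definition equivalence_of_categories ::
  "('o, 'm, 'z) category_scheme \<Rightarrow> ('p, 'n, 'y) category_scheme \<Rightarrow> ('o, 'm, 'p, 'n) fctr \<Rightarrow> bool" where
  "equivalence_of_categories A B F \<longleftrightarrow>
     functor_on A B F \<and>
     (\<exists>G \<eta> \<epsilon>. functor_on B A G \<and>
        nat_iso A A id_fctr (comp_fctr G F) \<eta> \<and> nat_iso B B (comp_fctr F G) id_fctr \<epsilon>)"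

definition full_subcategory :: "('o, 'm) category \<Rightarrow> ('o \<Rightarrow> bool) \<Rightarrow> ('o, 'm) category" where
  "full_subcategory A P =
     A\<lparr>Ob := {a \<in> Ob A. P a}, Arr := {f \<in> Arr A. P (src f) \<and> P (tgt f)}\<rparr>"

definition restrict_fctr :: "('o, 'm, 'p, 'n) fctr \<Rightarrow> ('o, 'm) category \<Rightarrow> ('o, 'm, 'p, 'n) fctr" where
  "restrict_fctr F A = \<lparr>fob = restrict (fob F) (Ob A), farr = restrict (farr F) (Arr A)\<rparr>"

text \<open>
  Functors that occur as arrows of a category are required to be undefined outside their domain, so
  that equality of such functors is equality on objects and arrows of the domain.
\<close>

definition fctr_extensional ::
  "('o, 'm, 'z) category_scheme \<Rightarrow> ('o, 'm, 'p, 'n, 'x) fctr_scheme \<Rightarrow> bool" where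
  "fctr_extensional A F \<longleftrightarrow> fob F \<in> extensional (Ob A) \<and> farr F \<in> extensional (Arr A)"


section \<open>Short skew multicategories\<close>

datatype mode = Tight | Loose

text \<open>The operation \<open>x \<circ>\<^sub>i y\<close> on modes. Input positions \<open>i\<close> are counted from 1 throughout.\<close>

definition mode_sub :: "mode \<Rightarrow> nat \<Rightarrow> mode \<Rightarrow> mode" where
  "mode_sub x i y =
     (if (x = Tight \<and> y = Tight \<and> i = 1) \<or> (x = Tight \<and> i \<noteq> 1) then Tight else Loose)"

datatype ('o, 'm) multimap =
  Multimap (mode: mode) (inputs: "'o list") (outcome: 'o) (mlbl: 'm)

abbreviation arity :: "('o, 'm) multimap \<Rightarrow> nat" where
  "arity f \<equiv> length (inputs f)"

definition to_multi :: "('o, 'm) arrow \<Rightarrow> ('o, 'm) multimap" where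
  "to_multi p = Multimap Tight [src p] (tgt p) (lbl p)"

definition to_arrow :: "('o, 'm) multimap \<Rightarrow> ('o, 'm) arrow" where
  "to_arrow f = Arrow (hd (inputs f)) (outcome f) (mlbl f)"

text \<open>
  \<open>Act C [p\<^sub>1,\<dots>,p\<^sub>n] q f\<close> is the value at \<open>f\<close> of the functions
  \<open>\<^bold>C\<^sup>x\<^sub>n(p\<^sub>1,\<dots>,p\<^sub>n; q)\<close> given by the functors \<open>\<^bold>C\<^sup>x\<^sub>n : (\<C>\<^sup>n)\<^sup>o\<^sup>p \<times> \<C> \<rightarrow> Set\<close>; \<open>Sub C f i g\<close> is
  the substitution \<open>f \<circ>\<^sub>i g\<close> in those cases where it is part of the structure.
\<close>

record ('o, 'm) ssmulti = "('o, 'm) category" +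
  Maps :: "('o, 'm) multimap set"
  Act :: "('o, 'm) arrow list \<Rightarrow> ('o, 'm) arrow \<Rightarrow> ('o, 'm) multimap \<Rightarrow> ('o, 'm) multimap"
  Sub :: "('o, 'm) multimap \<Rightarrow> nat \<Rightarrow> ('o, 'm) multimap \<Rightarrow> ('o, 'm) multimap"
  J :: "('o, 'm) multimap \<Rightarrow> ('o, 'm) multimap" ("\<j>\<index>")

definition mhom ::
  "('o, 'm, 'z) ssmulti_scheme \<Rightarrow> mode \<Rightarrow> 'o list \<Rightarrow> 'o \<Rightarrow> ('o, 'm) multimap set" where
  "mhom C x as b = {f \<in> Maps C. mode f = x \<and> inputs f = as \<and> outcome f = b}"

definition into_inputs ::
  "('o, 'm, 'z) category_scheme \<Rightarrow> ('o, 'm) arrow list \<Rightarrow> 'o list \<Rightarrow> bool" where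
  "into_inputs C ps as \<longleftrightarrow> list_all2 (\<lambda>p a. p \<in> Arr C \<and> tgt p = a) ps as"

definition post ::
  "('o, 'm, 'z) ssmulti_scheme \<Rightarrow> ('o, 'm) arrow \<Rightarrow> ('o, 'm) multimap \<Rightarrow> ('o, 'm) multimap" where
  "post C q f = Act C (map (Id C) (inputs f)) q f"

definition pre ::
  "('o, 'm, 'z) ssmulti_scheme \<Rightarrow> ('o, 'm) multimap \<Rightarrow> nat \<Rightarrow> ('o, 'm) arrow \<Rightarrow> ('o, 'm) multimap" where
  "pre C f i p = Act C ((map (Id C) (inputs f))[i - 1 := p]) (Id C (outcome f)) f"

text \<open>
  \<open>f \<bullet>\<langle>i\<rangle> g\<close> is \<open>f \<circ>\<^sub>i g\<close> in the full sense of the notation: the functorial action if \<open>g\<close> or \<open>f\<close> is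
  tight unary, and substitution otherwise. (If both are tight unary, either action gives the
  composite in \<open>\<C>\<close>.)
\<close>

definition circ ::
  "('o, 'm, 'z) ssmulti_scheme \<Rightarrow> ('o, 'm) multimap \<Rightarrow> nat \<Rightarrow> ('o, 'm) multimap \<Rightarrow> ('o, 'm) multimap"
  ("(_ \<bullet>\<index>\<langle>_\<rangle> _)" [71, 0, 72] 71) where
  "f \<bullet>\<^bsub>C\<^esub>\<langle>i\<rangle> g =
     (if mode g = Tight \<and> arity g = 1 then pre C f i (to_arrow g)
      else if mode f = Tight \<and> arity f = 1 then post C (to_arrow f) g
      else Sub C f i g)"

text \<open>The shapes (mode and arity of \<open>f\<close>, then of \<open>g\<close>) for which \<open>Sub C f i g\<close> is given.\<close>

definition sub_shapes :: "(mode \<times> nat \<times> mode \<times> nat) set" where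
  "sub_shapes =
     {(Tight, 2, Tight, 2), (Tight, 3, Tight, 2), (Tight, 2, Tight, 3),
      (Tight, 2, Loose, 0), (Tight, 3, Loose, 0), (Loose, 1, Loose, 0),
      (Tight, 2, Loose, 1), (Loose, 1, Tight, 2)}"

definition substitutable ::
  "('o, 'm, 'z) ssmulti_scheme \<Rightarrow> ('o, 'm) multimap \<Rightarrow> nat \<Rightarrow> ('o, 'm) multimap \<Rightarrow> bool" where
  "substitutable C f i g \<longleftrightarrow>
     f \<in> Maps C \<and> g \<in> Maps C \<and> (mode f, arity f, mode g, arity g) \<in> sub_shapes \<and>
     1 \<le> i \<and> i \<le> arity f \<and> inputs f ! (i - 1) = outcome g"

locale short_skew_multicategory = category C for C :: "('o, 'm, 'z) ssmulti_scheme" (structure) +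
  assumes inputs_Ob: "f \<in> Maps C \<Longrightarrow> set (inputs f) \<subseteq> Ob C"
    and output_Ob: "f \<in> Maps C \<Longrightarrow> outcome f \<in> Ob C"
    and tight_arity: "f \<in> Maps C \<Longrightarrow> mode f = Tight \<Longrightarrow> 1 \<le> arity f \<and> arity f \<le> 4"
    and loose_arity: "f \<in> Maps C \<Longrightarrow> mode f = Loose \<Longrightarrow> arity f \<le> 2"
    \<comment> \<open>functoriality\<close>
    and Act_mhom: "f \<in> Maps C \<Longrightarrow> into_inputs C ps (inputs f) \<Longrightarrow> q \<in> Arr C \<Longrightarrow> src q = outcome f \<Longrightarrow>
      Act C ps q f \<in> mhom C (mode f) (map src ps) (tgt q)"
    and Act_Id: "f \<in> Maps C \<Longrightarrow> Act C (map \<one> (inputs f)) (\<one> (outcome f)) f = f"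
    and Act_Comp: "f \<in> Maps C \<Longrightarrow> into_inputs C ps (inputs f) \<Longrightarrow> into_inputs C ps' (map src ps) \<Longrightarrow>
      q \<in> Arr C \<Longrightarrow> src q = outcome f \<Longrightarrow> q' \<in> Arr C \<Longrightarrow> src q' = tgt q \<Longrightarrow>
      Act C (map2 (\<cdot>) ps ps') (q' \<cdot> q) f = Act C ps' q' (Act C ps q f)"
    \<comment> \<open>the functor of tight unary maps is the hom-functor\<close>
    and unary_mhom: "a \<in> Ob C \<Longrightarrow> b \<in> Ob C \<Longrightarrow> mhom C Tight [a] b = to_multi ` hom C a b"
    and unary_Act: "r \<in> Arr C \<Longrightarrow> p \<in> Arr C \<Longrightarrow> q \<in> Arr C \<Longrightarrow> tgt p = src r \<Longrightarrow> src q = tgt r \<Longrightarrow>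
      Act C [p] q (to_multi r) = to_multi (q \<cdot> r \<cdot> p)"
    \<comment> \<open>the transformations from tight to loose maps\<close>
    and J_mhom: "f \<in> Maps C \<Longrightarrow> mode f = Tight \<Longrightarrow> arity f \<in> {1, 2} \<Longrightarrow>
      \<j> f \<in> mhom C Loose (inputs f) (outcome f)"
    and J_nat: "f \<in> Maps C \<Longrightarrow> mode f = Tight \<Longrightarrow> arity f \<in> {1, 2} \<Longrightarrow>
      into_inputs C ps (inputs f) \<Longrightarrow> q \<in> Arr C \<Longrightarrow> src q = outcome f \<Longrightarrow>
      \<j> (Act C ps q f) = Act C ps q (\<j> f)"
    \<comment> \<open>substitution: natural in the outer variables and dinatural in the variable substituted for\<close>
    and Sub_mhom: "substitutable C f i g \<Longrightarrow>
      Sub C f i g \<in> mhom C (mode_sub (mode f) i (mode g))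
        (take (i - 1) (inputs f) @ inputs g @ drop i (inputs f)) (outcome f)"
    and Sub_nat: "substitutable C f i g \<Longrightarrow>
      into_inputs C rs (inputs f) \<Longrightarrow> rs ! (i - 1) = \<one> (outcome g) \<Longrightarrow> into_inputs C ps (inputs g) \<Longrightarrow>
      q \<in> Arr C \<Longrightarrow> src q = outcome f \<Longrightarrow>
      Sub C (Act C rs q f) i (Act C ps (\<one> (outcome g)) g) =
        Act C (take (i - 1) rs @ ps @ drop i rs) q (Sub C f i g)"
    and Sub_dinat: "f \<in> Maps C \<Longrightarrow> g \<in> Maps C \<Longrightarrow> (mode f, arity f, mode g, arity g) \<in> sub_shapes \<Longrightarrow>
      1 \<le> i \<Longrightarrow> i \<le> arity f \<Longrightarrow> p \<in> Arr C \<Longrightarrow> src p = outcome g \<Longrightarrow> tgt p = inputs f ! (i - 1) \<Longrightarrow>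
      Sub C (pre C f i p) i g = Sub C f i (post C p g)"
    \<comment> \<open>axiom (A)\<close>
    and assoc_nested: "f \<in> Maps C \<Longrightarrow> g \<in> Maps C \<Longrightarrow> h \<in> Maps C \<Longrightarrow>
      mode f = Tight \<Longrightarrow> arity f = 2 \<Longrightarrow>
      (mode g, arity g, mode h, arity h) \<in> {(Tight, 2, Tight, 2), (Tight, 2, Loose, 0)} \<Longrightarrow>
      i \<in> {1..2} \<Longrightarrow> j \<in> {1..arity g} \<Longrightarrow>
      inputs f ! (i - 1) = outcome g \<Longrightarrow> inputs g ! (j - 1) = outcome h \<Longrightarrow>
      f \<bullet>\<langle>i\<rangle> (g \<bullet>\<langle>j\<rangle> h) = (f \<bullet>\<langle>i\<rangle> g) \<bullet>\<langle>j + i - 1\<rangle> h"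
    \<comment> \<open>axiom (B)\<close>
    and assoc_parallel: "f \<in> Maps C \<Longrightarrow> g \<in> Maps C \<Longrightarrow> h \<in> Maps C \<Longrightarrow>
      mode f = Tight \<Longrightarrow> arity f = 2 \<Longrightarrow>
      (mode g, arity g, mode h, arity h) \<in>
        {(Tight, 2, Tight, 2), (Tight, 2, Loose, 0), (Loose, 0, Tight, 2), (Loose, 0, Loose, 0)} \<Longrightarrow>
      inputs f = [outcome g, outcome h] \<Longrightarrow>
      (f \<bullet>\<langle>1\<rangle> g) \<bullet>\<langle>arity g + 1\<rangle> h = (f \<bullet>\<langle>2\<rangle> h) \<bullet>\<langle>1\<rangle> g"
    \<comment> \<open>compatibility of substitution with \<open>j\<close>\<close>
    and Sub2_J: "g \<in> mhom C Tight [a, b] c \<Longrightarrow> h \<in> mhom C Tight [a'] b \<Longrightarrow>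
      g \<bullet>\<langle>2\<rangle> (\<j> h) = g \<bullet>\<langle>2\<rangle> h"
    and Sub1_J: "g \<in> mhom C Tight [a, b] c \<Longrightarrow> h \<in> mhom C Tight [a'] a \<Longrightarrow>
      g \<bullet>\<langle>1\<rangle> (\<j> h) = \<j> (g \<bullet>\<langle>1\<rangle> h)"
    and post_J: "f \<in> mhom C Tight [b] c \<Longrightarrow> h \<in> mhom C Tight [a] b \<Longrightarrow>
      f \<bullet>\<langle>1\<rangle> (\<j> h) = \<j> (f \<bullet>\<langle>1\<rangle> h)"
    and J_Sub_binary: "h \<in> mhom C Tight [c] d \<Longrightarrow> g \<in> mhom C Tight [a, b] c \<Longrightarrow>
      (\<j> h) \<bullet>\<langle>1\<rangle> g = \<j> (h \<bullet>\<langle>1\<rangle> g)"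
    and J_Sub_nullary: "h \<in> mhom C Tight [c] d \<Longrightarrow> v \<in> mhom C Loose [] c \<Longrightarrow>
      (\<j> h) \<bullet>\<langle>1\<rangle> v = h \<bullet>\<langle>1\<rangle> v"

text \<open>
  A short multicategory is a short skew multicategory with \<open>\<^bold>C\<^sup>t\<^sub>n = \<^bold>C\<^sup>l\<^sub>n\<close> and \<open>j = 1\<close> for \<open>n = 1, 2\<close>.
  As multimaps are tagged by their mode, the identity appears as \<open>as_loose\<close>, which only changes the
  tag.
\<close>

definition as_loose :: "('o, 'm) multimap \<Rightarrow> ('o, 'm) multimap" where
  "as_loose f = Multimap Loose (inputs f) (outcome f) (mlbl f)"

definition tight_eq_loose :: "('o, 'm, 'z) ssmulti_scheme \<Rightarrow> bool" where
  "tight_eq_loose C \<longleftrightarrow>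
     (\<forall>as b. length as \<in> {1, 2} \<longrightarrow>
        mhom C Loose as b = as_loose ` mhom C Tight as b \<and>
        (\<forall>f \<in> mhom C Tight as b. J C f = as_loose f))"

record ('o, 'm) mmor = "('o, 'm, 'o, 'm) fctr" +
  fmulti :: "('o, 'm) multimap \<Rightarrow> ('o, 'm) multimap"

locale multifunctor =
  C: short_skew_multicategory C + D: short_skew_multicategory D + functor_on C D F
  for C D :: "('o, 'm) ssmulti" and F :: "('o, 'm) mmor" +
  assumes fmulti_mhom: "f \<in> Maps C \<Longrightarrow>
      fmulti F f \<in> mhom D (mode f) (map (fob F) (inputs f)) (fob F (outcome f))"
    and fmulti_unary: "p \<in> Arr C \<Longrightarrow> fmulti F (to_multi p) = to_multi (farr F p)"
    and fmulti_nat: "f \<in> Maps C \<Longrightarrow> into_inputs C ps (inputs f) \<Longrightarrow> q \<in> Arr C \<Longrightarrow> src q = outcome f \<Longrightarrow>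
      fmulti F (Act C ps q f) = Act D (map (farr F) ps) (farr F q) (fmulti F f)"
    and fmulti_Sub: "substitutable C f i g \<Longrightarrow>
      fmulti F (Sub C f i g) = Sub D (fmulti F f) i (fmulti F g)"
    and fmulti_J: "f \<in> Maps C \<Longrightarrow> mode f = Tight \<Longrightarrow> arity f \<in> {1, 2} \<Longrightarrow>
      fmulti F (J C f) = J D (fmulti F f)"


subsection \<open>Left representability\<close>

text \<open>
  The tensor product \<open>ab\<close> is the codomain of \<open>\<theta> a b\<close> and the unit is the codomain of \<open>u\<close>.
\<close>

record ('o, 'm) lrep =
  Theta :: "'o \<Rightarrow> 'o \<Rightarrow> ('o, 'm) multimap" ("\<theta>\<index>")
  Un :: "('o, 'm) multimap" ("\<u>\<index>")

definition left_representation :: "('o, 'm) ssmulti \<Rightarrow> ('o, 'm) lrep \<Rightarrow> bool" where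
  "left_representation C R \<longleftrightarrow>
     (\<forall>a\<in>Ob C. \<forall>b\<in>Ob C. \<theta>\<^bsub>R\<^esub> a b \<in> mhom C Tight [a, b] (outcome (\<theta>\<^bsub>R\<^esub> a b)) \<and>
        (\<forall>xs d. set xs \<subseteq> Ob C \<longrightarrow> length xs + 1 \<in> {1, 2, 3} \<longrightarrow> d \<in> Ob C \<longrightarrow>
           bij_betw (\<lambda>f. f \<bullet>\<^bsub>C\<^esub>\<langle>1\<rangle> \<theta>\<^bsub>R\<^esub> a b)
             (mhom C Tight (outcome (\<theta>\<^bsub>R\<^esub> a b) # xs) d) (mhom C Tight (a # b # xs) d))) \<and>
     \<u>\<^bsub>R\<^esub> \<in> mhom C Loose [] (outcome \<u>\<^bsub>R\<^esub>) \<and>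
     (\<forall>xs d. set xs \<subseteq> Ob C \<longrightarrow> length xs \<in> {0, 1, 2} \<longrightarrow> d \<in> Ob C \<longrightarrow>
        bij_betw (\<lambda>f. f \<bullet>\<^bsub>C\<^esub>\<langle>1\<rangle> \<u>\<^bsub>R\<^esub>)
          (mhom C Tight (outcome \<u>\<^bsub>R\<^esub> # xs) d) (mhom C Loose xs d))"

definition left_representable :: "('o, 'm) ssmulti \<Rightarrow> bool" where
  "left_representable C \<longleftrightarrow> (\<exists>R. left_representation C R)"

definition choice_of_representations :: "(('o, 'm) ssmulti \<Rightarrow> ('o, 'm) lrep) \<Rightarrow> bool" where
  "choice_of_representations ch \<longleftrightarrow>
     (\<forall>C. short_skew_multicategory C \<and> left_representable C \<longrightarrow> left_representation C (ch C))"


subsection \<open>Short braidings\<close>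

record ('o, 'm) sbraid =
  Br32 :: "('o, 'm) multimap \<Rightarrow> ('o, 'm) multimap"
  Br42 :: "('o, 'm) multimap \<Rightarrow> ('o, 'm) multimap"
  Br43 :: "('o, 'm) multimap \<Rightarrow> ('o, 'm) multimap"

locale short_braiding = short_skew_multicategory C
  for C :: "('o, 'm) ssmulti" (structure) and \<beta> :: "('o, 'm) sbraid" +
  assumes Br32_bij: "{a1, a2, a3, b} \<subseteq> Ob C \<Longrightarrow>
      bij_betw (Br32 \<beta>) (mhom C Tight [a1, a2, a3] b) (mhom C Tight [a1, a3, a2] b)"
    and Br42_bij: "{a1, a2, a3, a4, b} \<subseteq> Ob C \<Longrightarrow>
      bij_betw (Br42 \<beta>) (mhom C Tight [a1, a2, a3, a4] b) (mhom C Tight [a1, a3, a2, a4] b)"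
    and Br43_bij: "{a1, a2, a3, a4, b} \<subseteq> Ob C \<Longrightarrow>
      bij_betw (Br43 \<beta>) (mhom C Tight [a1, a2, a3, a4] b) (mhom C Tight [a1, a2, a4, a3] b)"
    and Br32_nat: "f \<in> mhom C Tight [a1, a2, a3] b \<Longrightarrow> into_inputs C [p1, p2, p3] [a1, a2, a3] \<Longrightarrow>
      q \<in> Arr C \<Longrightarrow> src q = b \<Longrightarrow>
      Br32 \<beta> (Act C [p1, p2, p3] q f) = Act C [p1, p3, p2] q (Br32 \<beta> f)"
    and Br42_nat: "f \<in> mhom C Tight [a1, a2, a3, a4] b \<Longrightarrow>
      into_inputs C [p1, p2, p3, p4] [a1, a2, a3, a4] \<Longrightarrow> q \<in> Arr C \<Longrightarrow> src q = b \<Longrightarrow>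
      Br42 \<beta> (Act C [p1, p2, p3, p4] q f) = Act C [p1, p3, p2, p4] q (Br42 \<beta> f)"
    and Br43_nat: "f \<in> mhom C Tight [a1, a2, a3, a4] b \<Longrightarrow>
      into_inputs C [p1, p2, p3, p4] [a1, a2, a3, a4] \<Longrightarrow> q \<in> Arr C \<Longrightarrow> src q = b \<Longrightarrow>
      Br43 \<beta> (Act C [p1, p2, p3, p4] q f) = Act C [p1, p2, p4, p3] q (Br43 \<beta> f)"
    and Br_braid: "h \<in> Maps C \<Longrightarrow> mode h = Tight \<Longrightarrow> arity h = 4 \<Longrightarrow>
      Br42 \<beta> (Br43 \<beta> (Br42 \<beta> h)) = Br43 \<beta> (Br42 \<beta> (Br43 \<beta> h))"
    and Br_Sub_2_3_1: "g \<in> mhom C Tight [b1, b2] c \<Longrightarrow> f \<in> mhom C Tight [x, y, z] b1 \<Longrightarrow>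
      g \<bullet>\<langle>1\<rangle> Br32 \<beta> f = Br42 \<beta> (g \<bullet>\<langle>1\<rangle> f)"
    and Br_Sub_2_3_2: "g \<in> mhom C Tight [b1, b2] c \<Longrightarrow> f \<in> mhom C Tight [x, y, z] b2 \<Longrightarrow>
      g \<bullet>\<langle>2\<rangle> Br32 \<beta> f = Br43 \<beta> (g \<bullet>\<langle>2\<rangle> f)"
    and Br_Sub_3_2_1: "g \<in> mhom C Tight [b1, b2, b3] c \<Longrightarrow> f \<in> mhom C Tight [x, y] b1 \<Longrightarrow>
      Br43 \<beta> (g \<bullet>\<langle>1\<rangle> f) = Br32 \<beta> g \<bullet>\<langle>1\<rangle> f"
    and Br_Sub_3_2_2: "g \<in> mhom C Tight [b1, b2, b3] c \<Longrightarrow> f \<in> mhom C Tight [x, y] b2 \<Longrightarrow>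
      Br42 \<beta> (Br43 \<beta> (g \<bullet>\<langle>2\<rangle> f)) = Br32 \<beta> g \<bullet>\<langle>3\<rangle> f"
    and Br_Sub_3_2_3: "g \<in> mhom C Tight [b1, b2, b3] c \<Longrightarrow> f \<in> mhom C Tight [x, y] b3 \<Longrightarrow>
      Br43 \<beta> (Br42 \<beta> (g \<bullet>\<langle>3\<rangle> f)) = Br32 \<beta> g \<bullet>\<langle>2\<rangle> f"

definition short_symmetric :: "('o, 'm) ssmulti \<Rightarrow> ('o, 'm) sbraid \<Rightarrow> bool" where
  "short_symmetric C \<beta> \<longleftrightarrow>
     (\<forall>f \<in> Maps C. mode f = Tight \<and> arity f = 3 \<longrightarrow> Br32 \<beta> (Br32 \<beta> f) = f)"

definition braided_multifunctor ::
  "('o, 'm) ssmulti \<times> ('o, 'm) sbraid \<Rightarrow> ('o, 'm) ssmulti \<times> ('o, 'm) sbraid \<Rightarrow> ('o, 'm) mmor \<Rightarrow> bool"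
  where
  "braided_multifunctor X Y F \<longleftrightarrow>
     multifunctor (fst X) (fst Y) F \<and>
     (\<forall>f \<in> Maps (fst X). mode f = Tight \<and> arity f = 3 \<longrightarrow>
        fmulti F (Br32 (snd X) f) = Br32 (snd Y) (fmulti F f)) \<and>
     (\<forall>f \<in> Maps (fst X). mode f = Tight \<and> arity f = 4 \<longrightarrow>
        fmulti F (Br42 (snd X) f) = Br42 (snd Y) (fmulti F f) \<and>
        fmulti F (Br43 (snd X) f) = Br43 (snd Y) (fmulti F f))"


subsection \<open>The categories of braided and symmetric short skew multicategories\<close>

definition mmor_extensional :: "('o, 'm) ssmulti \<Rightarrow> ('o, 'm) mmor \<Rightarrow> bool" where
  "mmor_extensional C F \<longleftrightarrow> fctr_extensional C F \<and> fmulti F \<in> extensional (Maps C)"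

definition id_mmor :: "('o, 'm) ssmulti \<Rightarrow> ('o, 'm) mmor" where
  "id_mmor C = \<lparr>fob = restrict (\<lambda>a. a) (Ob C), farr = restrict (\<lambda>p. p) (Arr C),
                fmulti = restrict (\<lambda>f. f) (Maps C)\<rparr>"

definition comp_mmor :: "('o, 'm) ssmulti \<Rightarrow> ('o, 'm) mmor \<Rightarrow> ('o, 'm) mmor \<Rightarrow> ('o, 'm) mmor" where
  "comp_mmor C G F =
     \<lparr>fob = restrict (fob G \<circ> fob F) (Ob C), farr = restrict (farr G \<circ> farr F) (Arr C),
      fmulti = restrict (fmulti G \<circ> fmulti F) (Maps C)\<rparr>"

type_synonym ('o, 'm) br_ssmulti = "('o, 'm) ssmulti \<times> ('o, 'm) sbraid"

definition BrdShSkMulti_lr :: "(('o, 'm) br_ssmulti, ('o, 'm) mmor) category" where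
  "BrdShSkMulti_lr =
     (let obs = {(C, \<beta>). short_skew_multicategory C \<and> left_representable C \<and> short_braiding C \<beta>} in
      \<lparr>Ob = obs,
       Arr = {Arrow X Y F | X Y F. X \<in> obs \<and> Y \<in> obs \<and>
                braided_multifunctor X Y F \<and> mmor_extensional (fst X) F},
       Id = (\<lambda>X. Arrow X X (id_mmor (fst X))),
       Comp = (\<lambda>g f. Arrow (src f) (tgt g) (comp_mmor (fst (src f)) (lbl g) (lbl f)))\<rparr>)"

definition SymShSkMulti_lr :: "(('o, 'm) br_ssmulti, ('o, 'm) mmor) category" where
  "SymShSkMulti_lr = full_subcategory BrdShSkMulti_lr (\<lambda>(C, \<beta>). short_symmetric C \<beta>)"

definition BrdShMulti_lr :: "(('o, 'm) br_ssmulti, ('o, 'm) mmor) category" where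
  "BrdShMulti_lr = full_subcategory BrdShSkMulti_lr (\<lambda>(C, \<beta>). tight_eq_loose C)"

definition SymShMulti_lr :: "(('o, 'm) br_ssmulti, ('o, 'm) mmor) category" where
  "SymShMulti_lr = full_subcategory SymShSkMulti_lr (\<lambda>(C, \<beta>). tight_eq_loose C)"


section \<open>Skew monoidal categories\<close>

record ('o, 'm) skmon = "('o, 'm) category" +
  Tens :: "'o \<Rightarrow> 'o \<Rightarrow> 'o" (infixl "\<otimes>\<index>" 80)
  TensA :: "('o, 'm) arrow \<Rightarrow> ('o, 'm) arrow \<Rightarrow> ('o, 'm) arrow" (infixl "\<star>\<index>" 80)
  Unit :: 'o ("\<I>\<index>")
  Assoc :: "'o \<Rightarrow> 'o \<Rightarrow> 'o \<Rightarrow> ('o, 'm) arrow" ("\<alpha>\<index>")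
  LUnit :: "'o \<Rightarrow> ('o, 'm) arrow" ("\<l>\<index>")
  RUnit :: "'o \<Rightarrow> ('o, 'm) arrow" ("\<r>\<index>")

locale skew_monoidal = category M for M :: "('o, 'm) skmon" (structure) +
  assumes Tens_Ob: "a \<in> Ob M \<Longrightarrow> b \<in> Ob M \<Longrightarrow> a \<otimes> b \<in> Ob M"
    and TensA_hom: "f \<in> Arr M \<Longrightarrow> g \<in> Arr M \<Longrightarrow> f \<star> g \<in> hom M (src f \<otimes> src g) (tgt f \<otimes> tgt g)"
    and TensA_Id: "a \<in> Ob M \<Longrightarrow> b \<in> Ob M \<Longrightarrow> \<one> a \<star> \<one> b = \<one> (a \<otimes> b)"
    and TensA_Comp: "f \<in> Arr M \<Longrightarrow> f' \<in> Arr M \<Longrightarrow> g \<in> Arr M \<Longrightarrow> g' \<in> Arr M \<Longrightarrow>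
      tgt f = src f' \<Longrightarrow> tgt g = src g' \<Longrightarrow> (f' \<cdot> f) \<star> (g' \<cdot> g) = (f' \<star> g') \<cdot> (f \<star> g)"
    and Unit_Ob: "\<I> \<in> Ob M"
    and Assoc_hom: "a \<in> Ob M \<Longrightarrow> b \<in> Ob M \<Longrightarrow> c \<in> Ob M \<Longrightarrow>
      \<alpha> a b c \<in> hom M (a \<otimes> b \<otimes> c) (a \<otimes> (b \<otimes> c))"
    and Assoc_nat: "f \<in> Arr M \<Longrightarrow> g \<in> Arr M \<Longrightarrow> h \<in> Arr M \<Longrightarrow>
      \<alpha> (tgt f) (tgt g) (tgt h) \<cdot> (f \<star> g \<star> h) = (f \<star> (g \<star> h)) \<cdot> \<alpha> (src f) (src g) (src h)"
    and LUnit_hom: "a \<in> Ob M \<Longrightarrow> \<l> a \<in> hom M (\<I> \<otimes> a) a"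
    and LUnit_nat: "f \<in> Arr M \<Longrightarrow> \<l> (tgt f) \<cdot> (\<one> \<I> \<star> f) = f \<cdot> \<l> (src f)"
    and RUnit_hom: "a \<in> Ob M \<Longrightarrow> \<r> a \<in> hom M a (a \<otimes> \<I>)"
    and RUnit_nat: "f \<in> Arr M \<Longrightarrow> \<r> (tgt f) \<cdot> f = (f \<star> \<one> \<I>) \<cdot> \<r> (src f)"
    and pentagon: "a \<in> Ob M \<Longrightarrow> b \<in> Ob M \<Longrightarrow> c \<in> Ob M \<Longrightarrow> d \<in> Ob M \<Longrightarrow>
      \<alpha> a b (c \<otimes> d) \<cdot> \<alpha> (a \<otimes> b) c d = (\<one> a \<star> \<alpha> b c d) \<cdot> \<alpha> a (b \<otimes> c) d \<cdot> (\<alpha> a b c \<star> \<one> d)"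
    and LUnit_Assoc: "a \<in> Ob M \<Longrightarrow> b \<in> Ob M \<Longrightarrow> \<l> (a \<otimes> b) \<cdot> \<alpha> \<I> a b = \<l> a \<star> \<one> b"
    and Assoc_RUnit: "a \<in> Ob M \<Longrightarrow> b \<in> Ob M \<Longrightarrow> \<alpha> a b \<I> \<cdot> \<r> (a \<otimes> b) = \<one> a \<star> \<r> b"
    and triangle: "a \<in> Ob M \<Longrightarrow> b \<in> Ob M \<Longrightarrow>
      (\<one> a \<star> \<l> b) \<cdot> \<alpha> a \<I> b \<cdot> (\<r> a \<star> \<one> b) = \<one> (a \<otimes> b)"
    and LUnit_RUnit: "\<l> \<I> \<cdot> \<r> \<I> = \<one> \<I>"

definition invertible_constraints :: "('o, 'm) skmon \<Rightarrow> bool" where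
  "invertible_constraints M \<longleftrightarrow>
     (\<forall>a\<in>Ob M. \<forall>b\<in>Ob M. \<forall>c\<in>Ob M. invertible_arrow M (Assoc M a b c)) \<and>
     (\<forall>a\<in>Ob M. invertible_arrow M (LUnit M a)) \<and>
     (\<forall>a\<in>Ob M. invertible_arrow M (RUnit M a))"

record ('o, 'm) laxmor = "('o, 'm, 'o, 'm) fctr" +
  lax0 :: "('o, 'm) arrow"
  lax2 :: "'o \<Rightarrow> 'o \<Rightarrow> ('o, 'm) arrow"

locale lax_monoidal = M: skew_monoidal M + N: skew_monoidal N + functor_on M N F
  for M N :: "('o, 'm) skmon" and F :: "('o, 'm) laxmor" +
  assumes lax0_hom: "lax0 F \<in> hom N \<I>\<^bsub>N\<^esub> (fob F \<I>\<^bsub>M\<^esub>)"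
    and lax2_hom: "a \<in> Ob M \<Longrightarrow> b \<in> Ob M \<Longrightarrow>
      lax2 F a b \<in> hom N (fob F a \<otimes>\<^bsub>N\<^esub> fob F b) (fob F (a \<otimes>\<^bsub>M\<^esub> b))"
    and lax2_nat: "f \<in> Arr M \<Longrightarrow> g \<in> Arr M \<Longrightarrow>
      lax2 F (tgt f) (tgt g) \<cdot>\<^bsub>N\<^esub> (farr F f \<star>\<^bsub>N\<^esub> farr F g) =
      farr F (f \<star>\<^bsub>M\<^esub> g) \<cdot>\<^bsub>N\<^esub> lax2 F (src f) (src g)"
    and lax_Assoc: "a \<in> Ob M \<Longrightarrow> b \<in> Ob M \<Longrightarrow> c \<in> Ob M \<Longrightarrow>
      farr F (\<alpha>\<^bsub>M\<^esub> a b c) \<cdot>\<^bsub>N\<^esub> lax2 F (a \<otimes>\<^bsub>M\<^esub> b) c \<cdot>\<^bsub>N\<^esub> (lax2 F a b \<star>\<^bsub>N\<^esub> \<one>\<^bsub>N\<^esub> (fob F c)) =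
      lax2 F a (b \<otimes>\<^bsub>M\<^esub> c) \<cdot>\<^bsub>N\<^esub> (\<one>\<^bsub>N\<^esub> (fob F a) \<star>\<^bsub>N\<^esub> lax2 F b c) \<cdot>\<^bsub>N\<^esub>
        \<alpha>\<^bsub>N\<^esub> (fob F a) (fob F b) (fob F c)"
    and lax_LUnit: "a \<in> Ob M \<Longrightarrow>
      farr F (\<l>\<^bsub>M\<^esub> a) \<cdot>\<^bsub>N\<^esub> lax2 F \<I>\<^bsub>M\<^esub> a \<cdot>\<^bsub>N\<^esub> (lax0 F \<star>\<^bsub>N\<^esub> \<one>\<^bsub>N\<^esub> (fob F a)) = \<l>\<^bsub>N\<^esub> (fob F a)"
    and lax_RUnit: "a \<in> Ob M \<Longrightarrow>
      lax2 F a \<I>\<^bsub>M\<^esub> \<cdot>\<^bsub>N\<^esub> (\<one>\<^bsub>N\<^esub> (fob F a) \<star>\<^bsub>N\<^esub> lax0 F) \<cdot>\<^bsub>N\<^esub> \<r>\<^bsub>N\<^esub> (fob F a) = farr F (\<r>\<^bsub>M\<^esub> a)"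


subsection \<open>Braidings\<close>

locale skew_braiding = skew_monoidal M
  for M :: "('o, 'm) skmon" (structure) and s :: "'o \<Rightarrow> 'o \<Rightarrow> 'o \<Rightarrow> ('o, 'm) arrow" +
  assumes s_hom: "x \<in> Ob M \<Longrightarrow> a \<in> Ob M \<Longrightarrow> b \<in> Ob M \<Longrightarrow>
      s x a b \<in> hom M (x \<otimes> a \<otimes> b) (x \<otimes> b \<otimes> a)"
    and s_invertible: "x \<in> Ob M \<Longrightarrow> a \<in> Ob M \<Longrightarrow> b \<in> Ob M \<Longrightarrow> invertible_arrow M (s x a b)"
    and s_nat: "f \<in> Arr M \<Longrightarrow> g \<in> Arr M \<Longrightarrow> h \<in> Arr M \<Longrightarrow>
      s (tgt f) (tgt g) (tgt h) \<cdot> (f \<star> g \<star> h) = (f \<star> h \<star> g) \<cdot> s (src f) (src g) (src h)"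
    and s_braid: "x \<in> Ob M \<Longrightarrow> a \<in> Ob M \<Longrightarrow> b \<in> Ob M \<Longrightarrow> c \<in> Ob M \<Longrightarrow>
      s (x \<otimes> c) a b \<cdot> (s x a c \<star> \<one> b) \<cdot> s (x \<otimes> a) b c =
      (s x b c \<star> \<one> a) \<cdot> s (x \<otimes> b) a c \<cdot> (s x a b \<star> \<one> c)"
    and s_Assoc_1: "x \<in> Ob M \<Longrightarrow> a \<in> Ob M \<Longrightarrow> b \<in> Ob M \<Longrightarrow> c \<in> Ob M \<Longrightarrow>
      s x a (b \<otimes> c) \<cdot> \<alpha> (x \<otimes> a) b c =
      (\<alpha> x b c \<star> \<one> a) \<cdot> s (x \<otimes> b) a c \<cdot> (s x a b \<star> \<one> c)"
    and s_Assoc_2: "x \<in> Ob M \<Longrightarrow> a \<in> Ob M \<Longrightarrow> b \<in> Ob M \<Longrightarrow> c \<in> Ob M \<Longrightarrow>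
      s x (a \<otimes> b) c \<cdot> (\<alpha> x a b \<star> \<one> c) =
      \<alpha> (x \<otimes> c) a b \<cdot> (s x a c \<star> \<one> b) \<cdot> s (x \<otimes> a) b c"
    and s_Assoc_3: "x \<in> Ob M \<Longrightarrow> a \<in> Ob M \<Longrightarrow> b \<in> Ob M \<Longrightarrow> c \<in> Ob M \<Longrightarrow>
      (\<one> x \<star> s a b c) \<cdot> \<alpha> x (a \<otimes> b) c \<cdot> (\<alpha> x a b \<star> \<one> c) =
      \<alpha> x (a \<otimes> c) b \<cdot> (\<alpha> x a c \<star> \<one> b) \<cdot> s (x \<otimes> a) b c"

type_synonym ('o, 'm) br_skmon = "('o, 'm) skmon \<times> ('o \<Rightarrow> 'o \<Rightarrow> 'o \<Rightarrow> ('o, 'm) arrow)"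

definition skew_symmetric :: "('o, 'm) skmon \<Rightarrow> ('o \<Rightarrow> 'o \<Rightarrow> 'o \<Rightarrow> ('o, 'm) arrow) \<Rightarrow> bool" where
  "skew_symmetric M s \<longleftrightarrow>
     (\<forall>x\<in>Ob M. \<forall>a\<in>Ob M. \<forall>b\<in>Ob M. inverse_arrows M (s x a b) (s x b a))"

definition braided_lax_monoidal ::
  "('o, 'm) br_skmon \<Rightarrow> ('o, 'm) br_skmon \<Rightarrow> ('o, 'm) laxmor \<Rightarrow> bool" where
  "braided_lax_monoidal X Y F \<longleftrightarrow>
     (let M = fst X; s = snd X; N = fst Y; t = snd Y in
      lax_monoidal M N F \<and>
      (\<forall>x\<in>Ob M. \<forall>a\<in>Ob M. \<forall>b\<in>Ob M.
         farr F (s x a b) \<cdot>\<^bsub>N\<^esub> lax2 F (x \<otimes>\<^bsub>M\<^esub> a) b \<cdot>\<^bsub>N\<^esub> (lax2 F x a \<star>\<^bsub>N\<^esub> \<one>\<^bsub>N\<^esub> (fob F b)) =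
         lax2 F (x \<otimes>\<^bsub>M\<^esub> b) a \<cdot>\<^bsub>N\<^esub> (lax2 F x b \<star>\<^bsub>N\<^esub> \<one>\<^bsub>N\<^esub> (fob F a)) \<cdot>\<^bsub>N\<^esub>
           t (fob F x) (fob F a) (fob F b)))"


subsection \<open>The categories of braided and symmetric skew monoidal categories\<close>

definition laxmor_extensional :: "('o, 'm) skmon \<Rightarrow> ('o, 'm) laxmor \<Rightarrow> bool" where
  "laxmor_extensional M F \<longleftrightarrow>
     fctr_extensional M F \<and> (\<forall>a b. \<not> (a \<in> Ob M \<and> b \<in> Ob M) \<longrightarrow> lax2 F a b = undefined)"

definition id_laxmor :: "('o, 'm) skmon \<Rightarrow> ('o, 'm) laxmor" where
  "id_laxmor M =
     \<lparr>fob = restrict (\<lambda>a. a) (Ob M), farr = restrict (\<lambda>p. p) (Arr M),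
      lax0 = \<one>\<^bsub>M\<^esub> \<I>\<^bsub>M\<^esub>,
      lax2 = (\<lambda>a b. if a \<in> Ob M \<and> b \<in> Ob M then \<one>\<^bsub>M\<^esub> (a \<otimes>\<^bsub>M\<^esub> b) else undefined)\<rparr>"

text \<open>The composite \<open>G \<circ> F\<close> of \<open>F : M \<rightarrow> N\<close> and \<open>G : N \<rightarrow> P\<close>.\<close>

definition comp_laxmor ::
  "('o, 'm) skmon \<Rightarrow> ('o, 'm) skmon \<Rightarrow> ('o, 'm) laxmor \<Rightarrow> ('o, 'm) laxmor \<Rightarrow> ('o, 'm) laxmor" where
  "comp_laxmor M P G F =
     \<lparr>fob = restrict (fob G \<circ> fob F) (Ob M), farr = restrict (farr G \<circ> farr F) (Arr M),
      lax0 = farr G (lax0 F) \<cdot>\<^bsub>P\<^esub> lax0 G,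
      lax2 = (\<lambda>a b. if a \<in> Ob M \<and> b \<in> Ob M
                    then farr G (lax2 F a b) \<cdot>\<^bsub>P\<^esub> lax2 G (fob F a) (fob F b) else undefined)\<rparr>"

definition BrdSkMon :: "(('o, 'm) br_skmon, ('o, 'm) laxmor) category" where
  "BrdSkMon =
     (let obs = {(M, s). skew_monoidal M \<and> skew_braiding M s} in
      \<lparr>Ob = obs,
       Arr = {Arrow X Y F | X Y F. X \<in> obs \<and> Y \<in> obs \<and>
                braided_lax_monoidal X Y F \<and> laxmor_extensional (fst X) F},
       Id = (\<lambda>X. Arrow X X (id_laxmor (fst X))),
       Comp = (\<lambda>g f. Arrow (src f) (tgt g)
                 (comp_laxmor (fst (src f)) (fst (tgt g)) (lbl g) (lbl f)))\<rparr>)"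

definition SymSkMon :: "(('o, 'm) br_skmon, ('o, 'm) laxmor) category" where
  "SymSkMon = full_subcategory BrdSkMon (\<lambda>(M, s). skew_symmetric M s)"

definition BrdMon :: "(('o, 'm) br_skmon, ('o, 'm) laxmor) category" where
  "BrdMon = full_subcategory BrdSkMon (\<lambda>(M, s). invertible_constraints M)"

definition SymMon :: "(('o, 'm) br_skmon, ('o, 'm) laxmor) category" where
  "SymMon = full_subcategory SymSkMon (\<lambda>(M, s). invertible_constraints M)"


section \<open>The functors \<open>K\<^sup>b\<^sup>r\<^sup>d\<close> and \<open>K\<^sup>s\<^sup>y\<^sup>m\<close>\<close>

context
  fixes C :: "('o, 'm) ssmulti" (structure) and R :: "('o, 'm) lrep"
begin

definition K_tens :: "'o \<Rightarrow> 'o \<Rightarrow> 'o" where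
  "K_tens a b = outcome (\<theta>\<^bsub>R\<^esub> a b)"

definition K_unit :: 'o where
  "K_unit = outcome \<u>\<^bsub>R\<^esub>"

definition K_tensA :: "('o, 'm) arrow \<Rightarrow> ('o, 'm) arrow \<Rightarrow> ('o, 'm) arrow" where
  "K_tensA f g =
     (THE h. h \<in> hom C (K_tens (src f) (src g)) (K_tens (tgt f) (tgt g)) \<and>
        to_multi h \<bullet>\<langle>1\<rangle> \<theta>\<^bsub>R\<^esub> (src f) (src g) =
        (\<theta>\<^bsub>R\<^esub> (tgt f) (tgt g) \<bullet>\<langle>1\<rangle> to_multi f) \<bullet>\<langle>2\<rangle> to_multi g)"

definition K_assoc :: "'o \<Rightarrow> 'o \<Rightarrow> 'o \<Rightarrow> ('o, 'm) arrow" where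
  "K_assoc a b c =
     (THE h. h \<in> hom C (K_tens (K_tens a b) c) (K_tens a (K_tens b c)) \<and>
        (to_multi h \<bullet>\<langle>1\<rangle> \<theta>\<^bsub>R\<^esub> (K_tens a b) c) \<bullet>\<langle>1\<rangle> \<theta>\<^bsub>R\<^esub> a b =
        \<theta>\<^bsub>R\<^esub> a (K_tens b c) \<bullet>\<langle>2\<rangle> \<theta>\<^bsub>R\<^esub> b c)"

definition K_lunit :: "'o \<Rightarrow> ('o, 'm) arrow" where
  "K_lunit a =
     (THE h. h \<in> hom C (K_tens K_unit a) a \<and>
        (to_multi h \<bullet>\<langle>1\<rangle> \<theta>\<^bsub>R\<^esub> K_unit a) \<bullet>\<langle>1\<rangle> \<u>\<^bsub>R\<^esub> = \<j> (to_multi (\<one> a)))"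

definition K_runit :: "'o \<Rightarrow> ('o, 'm) arrow" where
  "K_runit a = to_arrow (\<theta>\<^bsub>R\<^esub> a K_unit \<bullet>\<langle>2\<rangle> \<u>\<^bsub>R\<^esub>)"

definition K_braid :: "('o, 'm) sbraid \<Rightarrow> 'o \<Rightarrow> 'o \<Rightarrow> 'o \<Rightarrow> ('o, 'm) arrow" where
  "K_braid \<beta> x a b =
     (THE h. h \<in> hom C (K_tens (K_tens x a) b) (K_tens (K_tens x b) a) \<and>
        to_multi h \<bullet>\<langle>1\<rangle> (\<theta>\<^bsub>R\<^esub> (K_tens x a) b \<bullet>\<langle>1\<rangle> \<theta>\<^bsub>R\<^esub> x a) =
        Br32 \<beta> (\<theta>\<^bsub>R\<^esub> (K_tens x b) a \<bullet>\<langle>1\<rangle> \<theta>\<^bsub>R\<^esub> x b))"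

definition K_skmon :: "('o, 'm) skmon" where
  "K_skmon =
     \<lparr>Ob = Ob C, Arr = Arr C, Id = Id C, Comp = Comp C,
      Tens = K_tens, TensA = K_tensA, Unit = K_unit,
      Assoc = K_assoc, LUnit = K_lunit, RUnit = K_runit\<rparr>"

end

definition K_lax ::
  "('o, 'm) ssmulti \<Rightarrow> ('o, 'm) lrep \<Rightarrow> ('o, 'm) ssmulti \<Rightarrow> ('o, 'm) lrep \<Rightarrow> ('o, 'm) mmor \<Rightarrow>
   ('o, 'm) laxmor" where
  "K_lax C R D S F =
     \<lparr>fob = fob F, farr = farr F,
      lax0 = (THE h. h \<in> hom D (K_unit S) (fob F (K_unit R)) \<and>
                to_multi h \<bullet>\<^bsub>D\<^esub>\<langle>1\<rangle> \<u>\<^bsub>S\<^esub> = fmulti F \<u>\<^bsub>R\<^esub>),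
      lax2 = (\<lambda>a b. if a \<in> Ob C \<and> b \<in> Ob C
                    then (THE h. h \<in> hom D (K_tens S (fob F a) (fob F b)) (fob F (K_tens R a b)) \<and>
                            to_multi h \<bullet>\<^bsub>D\<^esub>\<langle>1\<rangle> \<theta>\<^bsub>S\<^esub> (fob F a) (fob F b) = fmulti F (\<theta>\<^bsub>R\<^esub> a b))
                    else undefined)\<rparr>"

text \<open>The functor \<open>K\<^sup>b\<^sup>r\<^sup>d\<close> for a given choice \<open>ch\<close> of the universal maps \<open>\<theta>\<close> and \<open>u\<close>.\<close>

definition K_ob :: "(('o, 'm) ssmulti \<Rightarrow> ('o, 'm) lrep) \<Rightarrow> ('o, 'm) br_ssmulti \<Rightarrow> ('o, 'm) br_skmon" where
  "K_ob ch X = (K_skmon (fst X) (ch (fst X)), K_braid (fst X) (ch (fst X)) (snd X))"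

definition K_brd ::
  "(('o, 'm) ssmulti \<Rightarrow> ('o, 'm) lrep) \<Rightarrow>
   (('o, 'm) br_ssmulti, ('o, 'm) mmor, ('o, 'm) br_skmon, ('o, 'm) laxmor) fctr" where
  "K_brd ch =
     \<lparr>fob = K_ob ch,
      farr = (\<lambda>f. Arrow (K_ob ch (src f)) (K_ob ch (tgt f))
                (K_lax (fst (src f)) (ch (fst (src f))) (fst (tgt f)) (ch (fst (tgt f))) (lbl f)))\<rparr>"

definition K_sym ::
  "(('o, 'm) ssmulti \<Rightarrow> ('o, 'm) lrep) \<Rightarrow>
   (('o, 'm) br_ssmulti, ('o, 'm) mmor, ('o, 'm) br_skmon, ('o, 'm) laxmor) fctr" where
  "K_sym ch = restrict_fctr (K_brd ch) SymShSkMulti_lr"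

end

theory Submission
  imports Defs
begin

text \<open>
  The functor \<open>K\<close> keeps the underlying category and takes the codomains of the universal maps \<open>\<theta>\<close>
  and \<open>u\<close> as tensor products and unit. It is an equivalence because it is fully faithful and
  essentially surjective (\<open>equivalence_if_fully_faithful_ess_surj\<close>).

  All arguments in a multicategory rest on one consequence of left representability. The composites
  \<open>\<theta>3 = \<theta> \<circ>\<^sub>1 \<theta>\<close> and \<open>\<theta>4 = \<theta> \<circ>\<^sub>1 \<theta>3\<close> are again universal, so every tight map of arity \<open>n\<close> is uniquely
  of the form \<open>p \<circ> \<theta>n\<close> for an arrow \<open>p\<close> out of the left-bracketed tensor product (\<open>factor2\<close>, \<open>factor3\<close>,
  \<open>factor4\<close> and the corresponding \<open>cancel\<close> lemmas). Two parallel composites of constraints of \<open>K\<close>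
  are therefore equal as soon as they agree after precomposition with some \<open>\<theta>n\<close>, and there the
  equation becomes an instance of the axioms (A) and (B). The pentagon says that \<open>\<theta> \<circ>\<^sub>2 (\<theta> \<circ>\<^sub>2 \<theta>)\<close> can
  be reached from \<open>\<theta>4\<close> in two ways. The arrows \<open>s\<^bsub>xa,b,c\<^esub>\<close> and \<open>s\<^bsub>x,a,b\<^esub> c\<close> act on \<open>\<theta>4\<close> as \<open>\<beta>\<^sup>4\<^sub>3\<close> and
  \<open>\<beta>\<^sup>4\<^sub>2\<close>, so that each braiding axiom of \<open>K\<close> is the image of one axiom for \<open>\<beta>\<close>.

  The values of a multifunctor on \<open>\<theta>\<close> and \<open>u\<close> are recorded by the lax structure of its image under
  \<open>K\<close>, and they determine it: this is faithfulness. For fullness, a braided lax monoidal functor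
  \<open>\<phi>\<close> is extended to multimaps by sending \<open>p \<circ> \<theta>n\<close> to \<open>\<phi> p \<circ> \<Phi>n\<close>, where \<open>\<Phi>n\<close> is \<open>\<theta>n\<close> followed by the
  comparison map of \<open>\<phi>\<close>. By construction this extension respects substitution into the first input.
  Substitution of a binary or a nullary map into an input of a binary map is respected because \<open>\<phi>\<close> is
  compatible with \<open>\<alpha>\<close>, \<open>\<lambda>\<close> and \<open>\<rho>\<close>; all cases with a ternary map reduce to these through (A) and (B), and
  loose unary and binary maps are copies of tight ones.

  When tight and loose unary maps coincide, the loose map \<open>\<theta> \<circ>\<^sub>1 u\<close> comes from an arrow inverse to
  \<open>\<lambda>\<close>. In the presence of a braiding, invertibility of \<open>\<lambda>\<close> forces that of \<open>\<alpha>\<close> and \<open>\<rho>\<close>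
  (\<open>invertible_constraints_if_LUnit\<close>), so \<open>K\<close> does land in braided monoidal categories.

  Conversely a braided monoidal category \<open>M\<close> has a short multicategory whose maps \<open>a\<^sub>1,\<dots>,a\<^sub>n \<rightarrow> b\<close> are
  the arrows \<open>a\<^sub>1\<cdots>a\<^sub>n \<rightarrow> b\<close> out of the left-bracketed tensor product. Substituting into a later input
  inserts \<open>\<alpha>\<close>, substituting a nullary map inserts \<open>\<rho>\<close> or the inverse of \<open>\<lambda>\<close>, and (A), (B) and the axioms for
  \<open>\<beta>\<close> turn into the coherence axioms of \<open>M\<close>. With identities as universal maps, \<open>K\<close> gives
  \<open>M\<close> back. Any other choice of universal maps gives an isomorphic result, since the action of \<open>K\<close> on
  morphisms is functorial for arbitrary choices at source and target.
\<close>

section \<open>Invertible arrows and equivalences of categories\<close>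

lemma hom_iff: "f \<in> hom C a b \<longleftrightarrow> f \<in> Arr C \<and> src f = a \<and> tgt f = b"
  by (simp add: hom_def)

context category
begin

lemma Id_Arr [simp]: "a \<in> Ob C \<Longrightarrow> \<one> a \<in> Arr C"
  and src_Id [simp]: "a \<in> Ob C \<Longrightarrow> src (\<one> a) = a"
  and tgt_Id [simp]: "a \<in> Ob C \<Longrightarrow> tgt (\<one> a) = a"
  using Id_hom by (auto simp: hom_iff)

lemma Comp_Arr [simp]: "f \<in> Arr C \<Longrightarrow> g \<in> Arr C \<Longrightarrow> tgt f = src g \<Longrightarrow> g \<cdot> f \<in> Arr C"
  and src_Comp [simp]: "f \<in> Arr C \<Longrightarrow> g \<in> Arr C \<Longrightarrow> tgt f = src g \<Longrightarrow> src (g \<cdot> f) = src f"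
  and tgt_Comp [simp]: "f \<in> Arr C \<Longrightarrow> g \<in> Arr C \<Longrightarrow> tgt f = src g \<Longrightarrow> tgt (g \<cdot> f) = tgt g"
  using Comp_hom by (auto simp: hom_iff)

lemma src_in_Ob [simp]: "f \<in> Arr C \<Longrightarrow> src f \<in> Ob C" by (rule src_Ob)
lemma tgt_in_Ob [simp]: "f \<in> Arr C \<Longrightarrow> tgt f \<in> Ob C" by (rule tgt_Ob)

lemma Id_left' [simp]: "f \<in> Arr C \<Longrightarrow> tgt f = a \<Longrightarrow> \<one> a \<cdot> f = f"
  using Id_left by blast
lemma Id_right' [simp]: "f \<in> Arr C \<Longrightarrow> src f = a \<Longrightarrow> f \<cdot> \<one> a = f"
  using Id_right by blast

lemma Comp_assoc' [simp]: "f \<in> Arr C \<Longrightarrow> g \<in> Arr C \<Longrightarrow> h \<in> Arr C \<Longrightarrow> tgt f = src g \<Longrightarrow> tgt g = src h \<Longrightarrow>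
    (h \<cdot> g) \<cdot> f = h \<cdot> (g \<cdot> f)"
  by (rule Comp_assoc)

lemma inverse_arrowsD:
  assumes "inverse_arrows C f g"
  shows "f \<in> Arr C" "g \<in> Arr C" "src g = tgt f" "tgt g = src f"
    "g \<cdot> f = \<one> (src f)" "f \<cdot> g = \<one> (tgt f)"
  using assms by (auto simp: inverse_arrows_def hom_iff)

lemma inverse_arrows_sym: "inverse_arrows C f g \<Longrightarrow> inverse_arrows C g f"
  by (auto simp: inverse_arrows_def hom_iff)

lemma inverse_arrows_Comp:
  assumes f: "inverse_arrows C f f'" and g: "inverse_arrows C g g'" and "tgt f = src g"
  shows "inverse_arrows C (g \<cdot> f) (f' \<cdot> g')"
proof -
  note [simp] = inverse_arrowsD(1-4)[OF f] inverse_arrowsD(1-4)[OF g]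
  have "f' \<cdot> (g' \<cdot> g) \<cdot> f = \<one> (src f)" "g \<cdot> (f \<cdot> f') \<cdot> g' = \<one> (tgt g)"
    using assms by (simp_all del: Comp_assoc' add: inverse_arrowsD(5,6)[OF f] inverse_arrowsD(5,6)[OF g])
  then show ?thesis
    using assms by (simp add: inverse_arrows_def hom_iff)
qed

lemma invertible_Comp:
  "invertible_arrow C f \<Longrightarrow> invertible_arrow C g \<Longrightarrow> tgt f = src g \<Longrightarrow> invertible_arrow C (g \<cdot> f)"
  unfolding invertible_arrow_def using inverse_arrows_Comp by blast

lemma invertible_Id [simp]: "a \<in> Ob C \<Longrightarrow> invertible_arrow C (\<one> a)"
  by (auto simp: invertible_arrow_def inverse_arrows_def hom_iff intro!: exI[of _ "\<one> a"])

lemma inverse_arrows_swap_left: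
  assumes f: "inverse_arrows C f f'" and "h \<in> Arr C" "tgt h = src f" "k \<in> Arr C" "tgt k = tgt f" "src h = src k"
  shows "f \<cdot> h = k \<longleftrightarrow> h = f' \<cdot> k"
proof -
  note [simp] = inverse_arrowsD(1-4)[OF f]
  have "f' \<cdot> (f \<cdot> h) = h" "f \<cdot> (f' \<cdot> k) = k"
    using assms inverse_arrowsD(5,6)[OF f] by (simp_all flip: Comp_assoc')
  then show ?thesis by auto
qed

lemma inverse_arrows_swap_right:
  assumes f: "inverse_arrows C f f'" and "h \<in> Arr C" "src h = tgt f" "k \<in> Arr C" "src k = src f" "tgt h = tgt k"
  shows "h \<cdot> f = k \<longleftrightarrow> h = k \<cdot> f'"
proof -
  note [simp] = inverse_arrowsD(1-4)[OF f]
  have "(h \<cdot> f) \<cdot> f' = h" "(k \<cdot> f') \<cdot> f = k"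
    using assms inverse_arrowsD(5,6)[OF f] by simp_all
  then show ?thesis by auto
qed

lemma invertible_cancel_left:
  assumes gf: "invertible_arrow C (g \<cdot> f)" and g: "invertible_arrow C g"
    and "f \<in> Arr C" "tgt f = src g"
  shows "invertible_arrow C f"
proof -
  obtain g' where g': "inverse_arrows C g g'" using g by (auto simp: invertible_arrow_def)
  note [simp] = inverse_arrowsD(1-4)[OF g']
  have "f = g' \<cdot> (g \<cdot> f)"
    using inverse_arrows_swap_left[OF g', of f "g \<cdot> f"] assms by simp
  moreover have "invertible_arrow C g'"
    using g' inverse_arrows_sym by (auto simp: invertible_arrow_def)
  ultimately show ?thesis
    using invertible_Comp[OF gf, of g'] assms(3,4) by simp
qed

lemma invertible_cancel_right:
  assumes gf: "invertible_arrow C (g \<cdot> f)" and f: "invertible_arrow C f"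
    and "g \<in> Arr C" "tgt f = src g"
  shows "invertible_arrow C g"
proof -
  obtain f' where f': "inverse_arrows C f f'" using f by (auto simp: invertible_arrow_def)
  note [simp] = inverse_arrowsD(1-4)[OF f']
  have "g = (g \<cdot> f) \<cdot> f'"
    using inverse_arrows_swap_right[OF f', of g "g \<cdot> f"] assms by simp
  moreover have "invertible_arrow C f'"
    using f' inverse_arrows_sym by (auto simp: invertible_arrow_def)
  ultimately show ?thesis
    using invertible_Comp[OF _ gf, of f'] assms(3,4) by simp
qed

end

lemma full_subcategory_category:
  fixes A :: "('o, 'm) category"
  assumes "category A"
  shows "category (full_subcategory A P)"
proof -
  interpret A: category A by fact
  show ?thesis
    by unfold_locales (auto simp: full_subcategory_def hom_iff)
qed

text \<open>
  The inverse functor sends \<open>b\<close> to a chosen \<open>g b\<close> with an isomorphism \<open>e b : F (g b) \<rightarrow> b\<close>, and an arrow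
  \<open>h\<close> to the unique lift of its conjugate \<open>e' \<cdot> h \<cdot> e\<close>; all equations are verified after applying \<open>F\<close>.
\<close>

lemma equivalence_if_fully_faithful_ess_surj:
  fixes F :: "('o, 'm, 'p, 'n) fctr"
  assumes F: "functor_on A B F"
    and full: "\<And>a b g. a \<in> Ob A \<Longrightarrow> b \<in> Ob A \<Longrightarrow> g \<in> hom B (fob F a) (fob F b) \<Longrightarrow>
      \<exists>f\<in>hom A a b. farr F f = g"
    and faithful: "\<And>a b f f'. f \<in> hom A a b \<Longrightarrow> f' \<in> hom A a b \<Longrightarrow> farr F f = farr F f' \<Longrightarrow> f = f'"
    and ess_surj: "\<And>b. b \<in> Ob B \<Longrightarrow> \<exists>a\<in>Ob A. \<exists>e\<in>hom B (fob F a) b. invertible_arrow B e"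
  shows "equivalence_of_categories A B F"
proof -
  interpret functor_on A B F by fact
  have "\<exists>g e e'. \<forall>b\<in>Ob B. g b \<in> Ob A \<and> e b \<in> hom B (fob F (g b)) b \<and> inverse_arrows B (e b) (e' b)"
    using ess_surj unfolding invertible_arrow_def by metis
  then obtain g e e' where
    w: "\<And>b. b \<in> Ob B \<Longrightarrow> g b \<in> Ob A \<and> e b \<in> hom B (fob F (g b)) b \<and> inverse_arrows B (e b) (e' b)"
    by blast
  have [simp]: "g b \<in> Ob A" "e b \<in> Arr B" "src (e b) = fob F (g b)" "tgt (e b) = b"
     "e' b \<in> Arr B" "src (e' b) = b" "tgt (e' b) = fob F (g b)"
     "e' b \<cdot>\<^bsub>B\<^esub> e b = \<one>\<^bsub>B\<^esub> (fob F (g b))" "e b \<cdot>\<^bsub>B\<^esub> e' b = \<one>\<^bsub>B\<^esub> b" if "b \<in> Ob B" for b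
    using w[OF that] B.inverse_arrowsD[of "e b" "e' b"] by (auto simp: hom_iff)
  have cancel_e [simp]: "e b \<cdot>\<^bsub>B\<^esub> e' b \<cdot>\<^bsub>B\<^esub> k = k"
    if "b \<in> Ob B" "k \<in> Arr B" "tgt k = b" for b k
    using that by (simp_all flip: B.Comp_assoc')
  have farr_F [simp]: "farr F f \<in> Arr B" "src (farr F f) = fob F (src f)" "tgt (farr F f) = fob F (tgt f)"
    if "f \<in> Arr A" for f
    using farr_hom[OF that] by (auto simp: hom_iff)
  note [simp] = fob_Ob farr_Id
  define lift where "lift a b k = (SOME f. f \<in> hom A a b \<and> farr F f = k)" for a b k
  have lift: "lift a b k \<in> Arr A" "src (lift a b k) = a" "tgt (lift a b k) = b" "farr F (lift a b k) = k"
    if "a \<in> Ob A" "b \<in> Ob A" "k \<in> Arr B" "src k = fob F a" "tgt k = fob F b" for a b k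
  proof -
    have "\<exists>f. f \<in> hom A a b \<and> farr F f = k" using full[of a b k] that by (auto simp: hom_iff)
    from someI_ex[OF this] show "lift a b k \<in> Arr A" "src (lift a b k) = a" "tgt (lift a b k) = b" "farr F (lift a b k) = k"
      by (auto simp: lift_def hom_iff)
  qed
  have faithful': "f = f'"
    if "farr F f = farr F f'" "f \<in> Arr A" "f' \<in> Arr A" "src f = src f'" "tgt f = tgt f'" for f f'
    using that faithful[of f "src f" "tgt f" f'] by (simp add: hom_iff)
  define G where "G = \<lparr>fob = g, farr = (\<lambda>h. lift (g (src h)) (g (tgt h)) (e' (tgt h) \<cdot>\<^bsub>B\<^esub> h \<cdot>\<^bsub>B\<^esub> e (src h)))\<rparr>"
  define \<eta> where "\<eta> a = lift a (g (fob F a)) (e' (fob F a))" for a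
  define \<eta>' where "\<eta>' a = lift (g (fob F a)) a (e (fob F a))" for a
  have [simp]: "farr G h \<in> Arr A" "src (farr G h) = g (src h)" "tgt (farr G h) = g (tgt h)"
    "farr F (farr G h) = e' (tgt h) \<cdot>\<^bsub>B\<^esub> h \<cdot>\<^bsub>B\<^esub> e (src h)" if "h \<in> Arr B" for h
    using that by (simp_all add: G_def lift)
  have [simp]: "fob G = g" by (simp add: G_def)
  have [simp]: "\<eta> a \<in> Arr A" "src (\<eta> a) = a" "tgt (\<eta> a) = g (fob F a)" "farr F (\<eta> a) = e' (fob F a)"
      "\<eta>' a \<in> Arr A" "src (\<eta>' a) = g (fob F a)" "tgt (\<eta>' a) = a" "farr F (\<eta>' a) = e (fob F a)"
    if "a \<in> Ob A" for a
    using that by (simp_all add: \<eta>_def \<eta>'_def lift)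
  have "functor_on B A G"
  proof unfold_locales
    fix a assume "a \<in> Ob B"
    then show "farr G (\<one>\<^bsub>B\<^esub> a) = \<one>\<^bsub>A\<^esub> (fob G a)"
      by (intro faithful') simp_all
  next
    fix f h assume "f \<in> Arr B" "h \<in> Arr B" "tgt f = src h"
    then show "farr G (h \<cdot>\<^bsub>B\<^esub> f) = farr G h \<cdot>\<^bsub>A\<^esub> farr G f"
      by (intro faithful') (simp_all add: farr_Comp)
  qed (simp_all add: hom_iff)
  moreover have "nat_iso A A id_fctr (comp_fctr G F) \<eta>"
  proof -
    have "inverse_arrows A (\<eta> a) (\<eta>' a)" if "a \<in> Ob A" for a
      using that by (auto simp: inverse_arrows_def hom_iff farr_Comp intro!: faithful')
    moreover have "\<eta> (tgt f) \<cdot>\<^bsub>A\<^esub> f = farr G (farr F f) \<cdot>\<^bsub>A\<^esub> \<eta> (src f)" if "f \<in> Arr A" for f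
      using that by (intro faithful') (simp_all add: farr_Comp)
    ultimately show ?thesis
      by (auto simp: nat_iso_def invertible_arrow_def id_fctr_def comp_fctr_def hom_iff)
  qed
  moreover have "nat_iso B B (comp_fctr F G) id_fctr e"
    using w by (auto simp: nat_iso_def id_fctr_def comp_fctr_def invertible_arrow_def)
  ultimately show ?thesis
    unfolding equivalence_of_categories_def using F by blast
qed

section \<open>Calculating with multimaps\<close>

lemma into_inputs_simps [simp]:
  "into_inputs C [] []"
  "into_inputs C (p # ps) (a # as) \<longleftrightarrow> p \<in> Arr C \<and> tgt p = a \<and> into_inputs C ps as"
  "\<not> into_inputs C [] (a # as)" "\<not> into_inputs C (p # ps) []"
  by (auto simp: into_inputs_def)

lemma into_inputs_iff:
  "into_inputs C ps as \<longleftrightarrow> length ps = length as \<and> (\<forall>n<length as. ps ! n \<in> Arr C \<and> tgt (ps ! n) = as ! n)"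
  by (auto simp: into_inputs_def list_all2_conv_all_nth)

lemma arity_cases:
  "length xs = Suc 0 \<longleftrightarrow> (\<exists>a. xs = [a])" "length xs = 2 \<longleftrightarrow> (\<exists>a b. xs = [a, b])"
  "length xs = 3 \<longleftrightarrow> (\<exists>a b c. xs = [a, b, c])" "length xs = 4 \<longleftrightarrow> (\<exists>a b c d. xs = [a, b, c, d])"
  by (auto simp: length_Suc_conv numeral_eq_Suc)

lemma mhom_iff: "f \<in> mhom C x as b \<longleftrightarrow> f \<in> Maps C \<and> mode f = x \<and> inputs f = as \<and> outcome f = b"
  by (simp add: mhom_def)

lemma to_multi_simps [simp]:
  "mode (to_multi p) = Tight" "inputs (to_multi p) = [src p]" "outcome (to_multi p) = tgt p"
  "to_arrow (to_multi p) = p" "mlbl (to_multi p) = lbl p"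
  by (simp_all add: to_multi_def to_arrow_def)

lemma to_multi_eq_iff [simp]: "to_multi p = to_multi q \<longleftrightarrow> p = q"
  by (metis to_multi_simps(4))

lemma mode_sub_simps [simp]:
  "mode_sub Loose i y = Loose" "mode_sub Tight (Suc 0) y = y"
  "mode_sub Tight 2 y = Tight" "mode_sub Tight 3 y = Tight"
  by (cases y; simp add: mode_sub_def)+

lemma list_update_middle:
  "n < length ys \<Longrightarrow> (xs @ ys @ zs)[length xs + n := p] = xs @ ys[n := p] @ zs"
  by (simp add: list_update_append)

context short_skew_multicategory
begin

lemma input_in_Ob [simp]: "f \<in> Maps C \<Longrightarrow> a \<in> set (inputs f) \<Longrightarrow> a \<in> Ob C"
  using inputs_Ob by blast

lemma outcome_in_Ob [simp]: "f \<in> Maps C \<Longrightarrow> outcome f \<in> Ob C"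
  by (rule output_Ob)

lemma into_inputs_Ids [simp]: "f \<in> Maps C \<Longrightarrow> into_inputs C (map \<one> (inputs f)) (inputs f)"
  by (simp add: into_inputs_iff)

lemma Act_simps [simp]:
  assumes "f \<in> Maps C" "into_inputs C ps (inputs f)" "q \<in> Arr C" "src q = outcome f"
  shows "Act C ps q f \<in> Maps C" "mode (Act C ps q f) = mode f"
    "inputs (Act C ps q f) = map src ps" "outcome (Act C ps q f) = tgt q"
  using Act_mhom[OF assms] by (simp_all add: mhom_iff)

lemma map_src_Ids [simp]: "f \<in> Maps C \<Longrightarrow> map (src \<circ> \<one>) (inputs f) = inputs f"
  by (rule nth_equalityI) simp_all

lemma post_simps [simp]:
  assumes "f \<in> Maps C" "q \<in> Arr C" "src q = outcome f"
  shows "post C q f \<in> Maps C" "mode (post C q f) = mode f"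
    "inputs (post C q f) = inputs f" "outcome (post C q f) = tgt q"
  using assms by (simp_all add: post_def)

lemma into_inputs_update:
  assumes "f \<in> Maps C" "p \<in> Arr C" "1 \<le> i" "i \<le> arity f" "tgt p = inputs f ! (i - 1)"
  shows "into_inputs C ((map \<one> (inputs f))[i - 1 := p]) (inputs f)"
  using assms by (auto simp: into_inputs_iff nth_list_update)

lemma pre_simps [simp]:
  assumes "f \<in> Maps C" "p \<in> Arr C" "1 \<le> i" "i \<le> arity f" "tgt p = inputs f ! (i - 1)"
  shows "pre C f i p \<in> Maps C" "mode (pre C f i p) = mode f"
    "inputs (pre C f i p) = (inputs f)[i - 1 := src p]" "outcome (pre C f i p) = outcome f"
  using assms into_inputs_update[OF assms] by (simp_all add: pre_def map_update)

lemma Sub_simps [simp]: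
  assumes "substitutable C f i g"
  shows "Sub C f i g \<in> Maps C" "mode (Sub C f i g) = mode_sub (mode f) i (mode g)"
    "inputs (Sub C f i g) = take (i - 1) (inputs f) @ inputs g @ drop i (inputs f)"
    "outcome (Sub C f i g) = outcome f"
  using Sub_mhom[OF assms] by (simp_all add: mhom_iff)

lemma J_simps [simp]:
  assumes "f \<in> Maps C" "mode f = Tight" "arity f = Suc 0 \<or> arity f = 2"
  shows "\<j> f \<in> Maps C" "mode (\<j> f) = Loose" "inputs (\<j> f) = inputs f" "outcome (\<j> f) = outcome f"
  using J_mhom[of f] assms by (auto simp: mhom_iff)

lemma to_multi_in_Maps [simp]: "p \<in> Arr C \<Longrightarrow> to_multi p \<in> Maps C"
  using unary_mhom[of "src p" "tgt p"] by (auto simp: mhom_def hom_def)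

lemma unary_is_arrow:
  assumes "f \<in> Maps C" "mode f = Tight" "arity f = Suc 0"
  obtains p where "p \<in> Arr C" "f = to_multi p"
proof -
  obtain a where a: "inputs f = [a]" using assms(3) by (auto simp: arity_cases)
  then have "f \<in> mhom C Tight [a] (outcome f)" using assms by (simp add: mhom_iff)
  moreover have "a \<in> Ob C" "outcome f \<in> Ob C" using assms a by auto
  ultimately show thesis using unary_mhom[of a "outcome f"] that by (auto simp: hom_def)
qed

lemma to_arrow_simps [simp]:
  assumes "f \<in> Maps C" "mode f = Tight" "arity f = Suc 0"
  shows "to_arrow f \<in> Arr C" "src (to_arrow f) = hd (inputs f)" "tgt (to_arrow f) = outcome f"
    "to_multi (to_arrow f) = f"
proof -
  obtain p where "p \<in> Arr C" "f = to_multi p" using unary_is_arrow[OF assms] .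
  then show "to_arrow f \<in> Arr C" "src (to_arrow f) = hd (inputs f)" "tgt (to_arrow f) = outcome f"
    "to_multi (to_arrow f) = f" by simp_all
qed

lemma Act_Act:
  "f \<in> Maps C \<Longrightarrow> into_inputs C ps (inputs f) \<Longrightarrow> into_inputs C ps' (map src ps) \<Longrightarrow>
    q \<in> Arr C \<Longrightarrow> src q = outcome f \<Longrightarrow> q' \<in> Arr C \<Longrightarrow> src q' = tgt q \<Longrightarrow>
    Act C ps' q' (Act C ps q f) = Act C (map2 (\<cdot>) ps ps') (q' \<cdot> q) f"
  by (simp add: Act_Comp)

lemma map2_Id_left: 
  "into_inputs C ps as \<Longrightarrow> map2 (\<cdot>) (map \<one> as) ps = ps"
  by (auto simp: into_inputs_iff intro!: nth_equalityI)

lemma map2_Id_right: 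
  "into_inputs C ps as \<Longrightarrow> map2 (\<cdot>) ps (map \<one> (map src ps)) = ps"
  by (auto simp: into_inputs_iff intro!: nth_equalityI)

lemma Act_Id' [simp]: "f \<in> Maps C \<Longrightarrow> outcome f = b \<Longrightarrow> Act C (map \<one> (inputs f)) (\<one> b) f = f"
  using Act_Id by blast

lemma post_Act:
  assumes "f \<in> Maps C" "into_inputs C ps (inputs f)" "q \<in> Arr C" "src q = outcome f"
    "q' \<in> Arr C" "src q' = tgt q"
  shows "post C q' (Act C ps q f) = Act C ps (q' \<cdot> q) f"
proof -
  have "into_inputs C (map \<one> (map src ps)) (map src ps)"
    using into_inputs_Ids[of "Act C ps q f"] assms by simp
  then show ?thesis
    using assms Act_Act[of f ps "map \<one> (map src ps)" q q'] map2_Id_right[OF assms(2)]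
    by (simp add: post_def)
qed

lemma Act_post:
  "f \<in> Maps C \<Longrightarrow> into_inputs C ps (inputs f) \<Longrightarrow> q \<in> Arr C \<Longrightarrow> src q = outcome f \<Longrightarrow>
    q' \<in> Arr C \<Longrightarrow> src q' = tgt q \<Longrightarrow> Act C ps q' (post C q f) = Act C ps (q' \<cdot> q) f"
  unfolding post_def by (subst Act_Act) (simp_all add: map2_Id_left)

lemma post_post:
  "f \<in> Maps C \<Longrightarrow> q \<in> Arr C \<Longrightarrow> src q = outcome f \<Longrightarrow> q' \<in> Arr C \<Longrightarrow> src q' = tgt q \<Longrightarrow>
    post C q' (post C q f) = post C (q' \<cdot> q) f"
  using post_Act[of f "map \<one> (inputs f)" q q'] by (simp add: post_def)

lemma post_Id [simp]: "f \<in> Maps C \<Longrightarrow> outcome f = b \<Longrightarrow> post C (\<one> b) f = f"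
  by (auto simp: post_def)

lemma pre_Id [simp]:
  "f \<in> Maps C \<Longrightarrow> 1 \<le> i \<Longrightarrow> i \<le> arity f \<Longrightarrow> inputs f ! (i - 1) = a \<Longrightarrow> pre C f i (\<one> a) = f"
  using list_update_id[of "map \<one> (inputs f)" "i - 1"] by (auto simp: pre_def)

lemma post_pre:
  assumes "f \<in> Maps C" "p \<in> Arr C" "1 \<le> i" "i \<le> arity f" "tgt p = inputs f ! (i - 1)"
    "q \<in> Arr C" "src q = outcome f"
  shows "post C q (pre C f i p) = pre C (post C q f) i p"
  using assms into_inputs_update[OF assms(1-5)] by (simp add: pre_def post_Act Act_post)

lemma post_to_multi [simp]:
  "p \<in> Arr C \<Longrightarrow> q \<in> Arr C \<Longrightarrow> src q = tgt p \<Longrightarrow> post C q (to_multi p) = to_multi (q \<cdot> p)"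
  using unary_Act[of p "\<one> (src p)" q] by (simp add: post_def)

lemma pre_to_multi [simp]:
  "p \<in> Arr C \<Longrightarrow> q \<in> Arr C \<Longrightarrow> tgt q = src p \<Longrightarrow> pre C (to_multi p) (Suc 0) q = to_multi (p \<cdot> q)"
  using unary_Act[of p q "\<one> (tgt p)"] by (simp add: pre_def)

lemma Act_to_multi:
  "r \<in> Arr C \<Longrightarrow> p \<in> Arr C \<Longrightarrow> q \<in> Arr C \<Longrightarrow> tgt p = src r \<Longrightarrow> src q = tgt r \<Longrightarrow>
      Act C [p] q (to_multi r) = to_multi (q \<cdot> r \<cdot> p)"
  by (rule unary_Act)

lemma Sub_Act:
  "substitutable C f i g \<Longrightarrow> into_inputs C rs (inputs f) \<Longrightarrow> rs ! (i - 1) = \<one> c \<Longrightarrow> outcome g = c \<Longrightarrow>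
    into_inputs C ps (inputs g) \<Longrightarrow> q \<in> Arr C \<Longrightarrow> src q = outcome f \<Longrightarrow>
    Sub C (Act C rs q f) i (Act C ps (\<one> c) g) = Act C (take (i - 1) rs @ ps @ drop i rs) q (Sub C f i g)"
  using Sub_nat by blast

lemma Sub_Act_left:
  assumes "substitutable C f i g" "into_inputs C rs (inputs f)" "rs ! (i - 1) = \<one> (outcome g)"
    "q \<in> Arr C" "src q = outcome f"
  shows "Sub C (Act C rs q f) i g = Act C (take (i - 1) rs @ map \<one> (inputs g) @ drop i rs) q (Sub C f i g)"
  using Sub_nat[OF assms(1-3) _ assms(4,5), of "map \<one> (inputs g)"] assms(1)
  by (simp add: substitutable_def)

lemma post_Sub:
  assumes "substitutable C f i g" "q \<in> Arr C" "src q = outcome f"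
  shows "post C q (Sub C f i g) = Sub C (post C q f) i g"
proof -
  have f: "f \<in> Maps C" "1 \<le> i" "i \<le> arity f" "inputs f ! (i - 1) = outcome g"
    using assms(1) by (auto simp: substitutable_def)
  have "Sub C (post C q f) i g =
    Act C (take (i - 1) (map \<one> (inputs f)) @ map \<one> (inputs g) @ drop i (map \<one> (inputs f))) q (Sub C f i g)"
    unfolding post_def by (rule Sub_Act_left) (use assms f in simp_all)
  also have "\<dots> = post C q (Sub C f i g)"
    using assms by (simp add: post_def take_map drop_map)
  finally show ?thesis ..
qed

lemma Sub_post:
  assumes "f \<in> Maps C" "g \<in> Maps C" "(mode f, arity f, mode g, arity g) \<in> sub_shapes"
      "1 \<le> i" "i \<le> arity f" "p \<in> Arr C" "src p = outcome g" "tgt p = inputs f ! (i - 1)"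
  shows "Sub C f i (post C p g) = Sub C (pre C f i p) i g"
  using Sub_dinat[OF assms] by simp

text \<open>
  Naturality of substitution in an input of the outer map that is not substituted for. The position of
  that input is unchanged if it lies before the substituted one, and is shifted by the arity of the
  inner map minus one if it lies after it.
\<close>

lemma pre_Sub_before:
  assumes s: "substitutable C f i g" and p: "p \<in> Arr C" "1 \<le> k" "k < i" "tgt p = inputs f ! (k - 1)"
  shows "pre C (Sub C f i g) k p = Sub C (pre C f k p) i g"
proof -
  have f: "f \<in> Maps C" "g \<in> Maps C" "1 \<le> i" "i \<le> arity f" "inputs f ! (i - 1) = outcome g"
    using s by (auto simp: substitutable_def)
  let ?xs = "map \<one> (inputs f)"
  have "Sub C (pre C f k p) i g = Act C (take (i - 1) (?xs[k - 1 := p]) @ map \<one> (inputs g) @ drop i (?xs[k - 1 := p]))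
      (\<one> (outcome f)) (Sub C f i g)"
    unfolding pre_def by (rule Sub_Act_left[OF s]) (use f p into_inputs_update[OF f(1) p(1,2)] in \<open>simp_all\<close>)
  moreover have "take (i - 1) (?xs[k - 1 := p]) @ map \<one> (inputs g) @ drop i (?xs[k - 1 := p])
      = (map \<one> (inputs (Sub C f i g)))[k - 1 := p]"
  proof -
    have "k - 1 < i - 1" using p by arith
    then show ?thesis using f p s
      by (simp add: take_update_swap drop_update_cancel list_update_append take_map drop_map)
  qed
  ultimately show ?thesis using s by (simp add: pre_def)
qed

lemma pre_Sub_after:
  assumes s: "substitutable C f i g" and p: "p \<in> Arr C" "i < k" "k \<le> arity f" "tgt p = inputs f ! (k - 1)"
  shows "pre C (Sub C f i g) (k + arity g - 1) p = Sub C (pre C f k p) i g"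
proof -
  have f: "f \<in> Maps C" "g \<in> Maps C" "1 \<le> i" "i \<le> arity f" "inputs f ! (i - 1) = outcome g"
    using s by (auto simp: substitutable_def)
  let ?xs = "map \<one> (inputs f)"
  have "Sub C (pre C f k p) i g = Act C (take (i - 1) (?xs[k - 1 := p]) @ map \<one> (inputs g) @ drop i (?xs[k - 1 := p]))
      (\<one> (outcome f)) (Sub C f i g)"
    unfolding pre_def by (rule Sub_Act_left[OF s]) (use f p into_inputs_update[OF f(1) p(1) _ p(3)] in \<open>simp_all\<close>)
  moreover have "take (i - 1) (?xs[k - 1 := p]) @ map \<one> (inputs g) @ drop i (?xs[k - 1 := p])
      = (map \<one> (inputs (Sub C f i g)))[k + arity g - 1 - 1 := p]"
  proof -
    have ij: "k + arity g - 1 - 1 = length (take (i - 1) ?xs @ map \<one> (inputs g)) + (k - 1 - i)" using f p by simp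
    have "drop i (?xs[k - 1 := p]) = (drop i ?xs)[k - 1 - i := p]"
      using f p by (simp add: drop_update_swap)
    then show ?thesis unfolding ij using s f p list_update_middle[of "k - 1 - i" "drop i ?xs" "take (i - 1) ?xs @ map \<one> (inputs g)" "[]"]
      by (simp add: take_map drop_map)
  qed
  ultimately show ?thesis using s by (simp add: pre_def)
qed

lemma pre_J_arrow:
  "p \<in> Arr C \<Longrightarrow> q \<in> Arr C \<Longrightarrow> tgt q = src p \<Longrightarrow> pre C (\<j> (to_multi p)) (Suc 0) q = \<j> (to_multi (p \<cdot> q))"
  using J_nat[of "to_multi p" "[q]" "\<one> (tgt p)"] by (simp add: pre_def Act_to_multi)

lemma circ_Sub: "\<not> (mode g = Tight \<and> arity g = 1) \<Longrightarrow> \<not> (mode f = Tight \<and> arity f = 1) \<Longrightarrow> 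
    f \<bullet>\<langle>i\<rangle> g = Sub C f i g"
  by (auto simp: circ_def)

lemma circ_to_multi_right: "f \<bullet>\<langle>i\<rangle> (to_multi p) = pre C f i p"
  by (simp add: circ_def)

text \<open>
  If both maps are unary, \<open>circ\<close> is given by precomposition, which agrees with postcomposition because
  both are composition of arrows.
\<close>

lemma circ_to_multi_left:
  assumes "p \<in> Arr C" "g \<in> Maps C" "src p = outcome g"
  shows "to_multi p \<bullet>\<langle>Suc 0\<rangle> g = post C p g"
proof (cases "mode g = Tight \<and> arity g = 1")
  case True
  then obtain q where "q \<in> Arr C" "g = to_multi q" using assms(2) unary_is_arrow by auto
  then show ?thesis using assms by (simp add: circ_def)
qed (auto simp: circ_def)

context
  fixes f assumes f: "f \<in> Maps C" "mode f = Tight" "arity f = 2"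
begin

lemma assoc_nested_22:
  assumes g: "g \<in> Maps C" "mode g = Tight" "arity g = 2"
    and h: "h \<in> Maps C" "mode h = Tight" "arity h = 2"
  shows "inputs f ! 0 = outcome g \<Longrightarrow> inputs g ! 0 = outcome h \<Longrightarrow>
      Sub C f (Suc 0) (Sub C g (Suc 0) h) = Sub C (Sub C f (Suc 0) g) (Suc 0) h"
    and "inputs f ! 0 = outcome g \<Longrightarrow> inputs g ! Suc 0 = outcome h \<Longrightarrow>
      Sub C f (Suc 0) (Sub C g 2 h) = Sub C (Sub C f (Suc 0) g) 2 h"
    and "inputs f ! Suc 0 = outcome g \<Longrightarrow> inputs g ! 0 = outcome h \<Longrightarrow>
      Sub C f 2 (Sub C g (Suc 0) h) = Sub C (Sub C f 2 g) 2 h"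
    and "inputs f ! Suc 0 = outcome g \<Longrightarrow> inputs g ! Suc 0 = outcome h \<Longrightarrow>
      Sub C f 2 (Sub C g 2 h) = Sub C (Sub C f 2 g) 3 h"
  using assoc_nested[OF f(1) g(1) h(1) f(2,3), of 1 1] assoc_nested[OF f(1) g(1) h(1) f(2,3), of 1 2]
    assoc_nested[OF f(1) g(1) h(1) f(2,3), of 2 1] assoc_nested[OF f(1) g(1) h(1) f(2,3), of 2 2] f g h
  by (simp_all add: circ_Sub substitutable_def sub_shapes_def flip: numeral_2_eq_2)

text \<open>
  If \<open>h\<close> is nullary, \<open>g \<circ>\<^sub>2 h\<close> is tight unary, so that its substitution into \<open>f\<close> is the functorial action of
  an arrow.
\<close>

lemma assoc_nested_20:
  assumes g: "g \<in> Maps C" "mode g = Tight" "arity g = 2"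
    and h: "h \<in> Maps C" "mode h = Loose" "inputs h = []"
  shows "inputs f ! 0 = outcome g \<Longrightarrow> inputs g ! 0 = outcome h \<Longrightarrow>
      Sub C f (Suc 0) (Sub C g (Suc 0) h) = Sub C (Sub C f (Suc 0) g) (Suc 0) h"
    and "inputs f ! 0 = outcome g \<Longrightarrow> inputs g ! Suc 0 = outcome h \<Longrightarrow>
      pre C f (Suc 0) (to_arrow (Sub C g 2 h)) = Sub C (Sub C f (Suc 0) g) 2 h"
    and "inputs f ! Suc 0 = outcome g \<Longrightarrow> inputs g ! 0 = outcome h \<Longrightarrow>
      Sub C f 2 (Sub C g (Suc 0) h) = Sub C (Sub C f 2 g) 2 h"
    and "inputs f ! Suc 0 = outcome g \<Longrightarrow> inputs g ! Suc 0 = outcome h \<Longrightarrow>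
      pre C f 2 (to_arrow (Sub C g 2 h)) = Sub C (Sub C f 2 g) 3 h"
  using assoc_nested[OF f(1) g(1) h(1) f(2,3), of 1 1] assoc_nested[OF f(1) g(1) h(1) f(2,3), of 1 2]
    assoc_nested[OF f(1) g(1) h(1) f(2,3), of 2 1] assoc_nested[OF f(1) g(1) h(1) f(2,3), of 2 2] f g h
  by (simp_all add: circ_def substitutable_def sub_shapes_def flip: numeral_2_eq_2)

lemma assoc_parallel_Sub:
  assumes g: "g \<in> Maps C" and h: "h \<in> Maps C" and inp: "inputs f = [outcome g, outcome h]"
  shows "mode g = Tight \<Longrightarrow> arity g = 2 \<Longrightarrow> mode h = Tight \<Longrightarrow> arity h = 2 \<Longrightarrow>
      Sub C (Sub C f (Suc 0) g) 3 h = Sub C (Sub C f 2 h) (Suc 0) g"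
    and "mode g = Tight \<Longrightarrow> arity g = 2 \<Longrightarrow> mode h = Loose \<Longrightarrow> inputs h = [] \<Longrightarrow>
      Sub C (Sub C f (Suc 0) g) 3 h = post C (to_arrow (Sub C f 2 h)) g"
    and "mode g = Loose \<Longrightarrow> inputs g = [] \<Longrightarrow> mode h = Tight \<Longrightarrow> arity h = 2 \<Longrightarrow>
      Sub C (Sub C f (Suc 0) g) (Suc 0) h = Sub C (Sub C f 2 h) (Suc 0) g"
    and "mode g = Loose \<Longrightarrow> inputs g = [] \<Longrightarrow> mode h = Loose \<Longrightarrow> inputs h = [] \<Longrightarrow>
      Sub C (Sub C f (Suc 0) g) (Suc 0) h = post C (to_arrow (Sub C f 2 h)) g"
  using assoc_parallel[OF f(1) g h f(2,3) _ inp] f g h inp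
  by (simp_all add: circ_def substitutable_def sub_shapes_def flip: numeral_2_eq_2)

lemma Sub2_J_arrow:
  "p \<in> Arr C \<Longrightarrow> tgt p = inputs f ! Suc 0 \<Longrightarrow> Sub C f 2 (\<j> (to_multi p)) = pre C f 2 p"
  using Sub2_J[of f "inputs f ! 0" "inputs f ! Suc 0" "outcome f" "to_multi p" "src p"] f
  by (auto simp: mhom_iff circ_def arity_cases)

lemma Sub1_J_arrow:
  "p \<in> Arr C \<Longrightarrow> tgt p = inputs f ! 0 \<Longrightarrow> Sub C f (Suc 0) (\<j> (to_multi p)) = \<j> (pre C f (Suc 0) p)"
  using Sub1_J[of f "inputs f ! 0" "inputs f ! Suc 0" "outcome f" "to_multi p" "src p"] f
  by (auto simp: mhom_iff circ_def arity_cases)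

lemma J_arrow_Sub:
  "p \<in> Arr C \<Longrightarrow> src p = outcome f \<Longrightarrow> Sub C (\<j> (to_multi p)) (Suc 0) f = \<j> (post C p f)"
  using J_Sub_binary[of "to_multi p" "src p" "tgt p" f "inputs f ! 0" "inputs f ! Suc 0"] f
  by (auto simp: mhom_iff circ_def arity_cases)

end

lemma post_J_arrow:
  "p \<in> Arr C \<Longrightarrow> q \<in> Arr C \<Longrightarrow> src q = tgt p \<Longrightarrow> post C q (\<j> (to_multi p)) = \<j> (to_multi (q \<cdot> p))"
  using post_J[of "to_multi q" "src q" "tgt q" "to_multi p" "src p"]
  by (auto simp: mhom_iff circ_def)

lemma J_arrow_nullary:
  "p \<in> Arr C \<Longrightarrow> v \<in> Maps C \<Longrightarrow> mode v = Loose \<Longrightarrow> inputs v = [] \<Longrightarrow> src p = outcome v \<Longrightarrow>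
    Sub C (\<j> (to_multi p)) (Suc 0) v = post C p v"
  using J_Sub_nullary[of "to_multi p" "src p" "tgt p" v]
  by (auto simp: mhom_iff circ_def)

end

section \<open>Universal maps\<close>

locale represented_multicategory = short_skew_multicategory C
  for C :: "('o, 'm) ssmulti" (structure) +
  fixes R :: "('o, 'm) lrep"
  assumes representation: "left_representation C R"
begin

abbreviation tens :: "'o \<Rightarrow> 'o \<Rightarrow> 'o" (infixl "\<odot>" 80) where "a \<odot> b \<equiv> K_tens R a b"
abbreviation tensA :: "('o, 'm) arrow \<Rightarrow> ('o, 'm) arrow \<Rightarrow> ('o, 'm) arrow" (infixl "\<odot>\<^sub>1" 80)
  where "p \<odot>\<^sub>1 q \<equiv> K_tensA C R p q"
abbreviation unit :: 'o ("I") where "I \<equiv> K_unit R"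
abbreviation \<upsilon> where "\<upsilon> \<equiv> \<u>\<^bsub>R\<^esub>"
abbreviation \<Theta> where "\<Theta> \<equiv> Theta R"

text \<open>
  Left bracketing matches the representability condition, which concerns substitution into the first
  input.
\<close>

definition \<Theta>3 where "\<Theta>3 a b c = Sub C (\<Theta> (a \<odot> b) c) 1 (\<Theta> a b)"
definition \<Theta>4 where "\<Theta>4 a b c d = Sub C (\<Theta> (a \<odot> b \<odot> c) d) 1 (\<Theta>3 a b c)"

lemma theta_simps [simp]:
  assumes "a \<in> Ob C" "b \<in> Ob C"
  shows "\<Theta> a b \<in> Maps C" "mode (\<Theta> a b) = Tight" "inputs (\<Theta> a b) = [a, b]" "outcome (\<Theta> a b) = a \<odot> b"
  using representation assms by (auto simp: left_representation_def mhom_iff K_tens_def)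

lemma tens_in_Ob [simp]: "a \<in> Ob C \<Longrightarrow> b \<in> Ob C \<Longrightarrow> a \<odot> b \<in> Ob C"
  using outcome_in_Ob[OF theta_simps(1)[of a b]] by simp

lemma u_simps [simp]: "\<upsilon> \<in> Maps C" "mode \<upsilon> = Loose" "inputs \<upsilon> = []" "outcome \<upsilon> = I"
  using representation by (auto simp: left_representation_def mhom_iff K_unit_def)

lemma unit_in_Ob [simp]: "I \<in> Ob C"
  using outcome_in_Ob[OF u_simps(1)] by simp

lemma subst_simps [simp]:
  "substitutable C f i g \<longleftrightarrow>
     f \<in> Maps C \<and> g \<in> Maps C \<and> (mode f, arity f, mode g, arity g) \<in> sub_shapes \<and>
     1 \<le> i \<and> i \<le> arity f \<and> inputs f ! (i - 1) = outcome g"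
  by (simp add: substitutable_def)

lemmas [simp] = sub_shapes_def

lemma theta3_simps [simp]:
  assumes "a \<in> Ob C" "b \<in> Ob C" "c \<in> Ob C"
  shows "\<Theta>3 a b c \<in> Maps C" "mode (\<Theta>3 a b c) = Tight" "inputs (\<Theta>3 a b c) = [a, b, c]"
    "outcome (\<Theta>3 a b c) = a \<odot> b \<odot> c"
  using assms by (simp_all add: \<Theta>3_def)

lemma theta4_simps [simp]:
  assumes "a \<in> Ob C" "b \<in> Ob C" "c \<in> Ob C" "d \<in> Ob C"
  shows "\<Theta>4 a b c d \<in> Maps C" "mode (\<Theta>4 a b c d) = Tight" "inputs (\<Theta>4 a b c d) = [a, b, c, d]"
    "outcome (\<Theta>4 a b c d) = a \<odot> b \<odot> c \<odot> d"
  using assms by (simp_all add: \<Theta>4_def)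

lemma theta4_alt:
  assumes "a \<in> Ob C" "b \<in> Ob C" "c \<in> Ob C" "d \<in> Ob C"
  shows "\<Theta>4 a b c d = Sub C (\<Theta>3 (a \<odot> b) c d) 1 (\<Theta> a b)"
  using assms assoc_nested_22(1)[of "\<Theta> (a \<odot> b \<odot> c) d" "\<Theta> (a \<odot> b) c" "\<Theta> a b"]
  by (simp add: \<Theta>4_def \<Theta>3_def)

text \<open>
  Representability, in the form from which factorisation and cancellation are read off.
\<close>

lemma theta_bij:
  assumes "a \<in> Ob C" "b \<in> Ob C" "set xs \<subseteq> Ob C" "length xs \<le> 2" "d \<in> Ob C"
  shows "bij_betw (\<lambda>f. f \<bullet>\<langle>1\<rangle> \<Theta> a b) (mhom C Tight (a \<odot> b # xs) d) (mhom C Tight (a # b # xs) d)"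
proof -
  have "length xs = 0 \<or> length xs = 1 \<or> length xs = 2" using assms(4) by arith
  then have "length xs + 1 \<in> {1, 2, 3}" by auto
  then show ?thesis using representation assms unfolding left_representation_def K_tens_def by blast
qed

lemma u_bij:
  assumes "set xs \<subseteq> Ob C" "length xs \<le> 2" "d \<in> Ob C"
  shows "bij_betw (\<lambda>f. f \<bullet>\<langle>1\<rangle> \<upsilon>) (mhom C Tight (I # xs) d) (mhom C Loose xs d)"
proof -
  have "length xs = 0 \<or> length xs = 1 \<or> length xs = 2" using assms(2) by arith
  then have "length xs \<in> {0, 1, 2}" by auto
  then show ?thesis using representation assms unfolding left_representation_def K_unit_def by blast
qed

lemma factor2:
  assumes "f \<in> Maps C" "mode f = Tight" "inputs f = [a, b]"
  obtains p where "p \<in> Arr C" "src p = a \<odot> b" "f = post C p (\<Theta> a b)"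
proof -
  have ab [simp]: "a \<in> Ob C" "b \<in> Ob C" using assms input_in_Ob by force+
  have "f \<in> (\<lambda>f. f \<bullet>\<langle>1\<rangle> \<Theta> a b) ` mhom C Tight [a \<odot> b] (outcome f)"
    using bij_betw_imp_surj_on[OF theta_bij[of a b "[]" "outcome f"]] assms by (simp add: mhom_iff)
  then obtain g where g: "g \<in> Maps C" "mode g = Tight" "inputs g = [a \<odot> b]" "outcome g = outcome f"
    "f = g \<bullet>\<langle>1\<rangle> \<Theta> a b" by (auto simp: mhom_iff)
  obtain p where p: "p \<in> Arr C" "g = to_multi p" using unary_is_arrow[of g] g(1-3) by auto
  show thesis using g(3,4,5) unfolding p(2) by (intro that[of p]) (simp_all add: p(1) circ_to_multi_left)
qed

lemma cancel2:
  assumes eq: "post C p (\<Theta> a b) = post C q (\<Theta> a b)" and ab: "a \<in> Ob C" "b \<in> Ob C"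
    and pq: "p \<in> Arr C" "src p = a \<odot> b" "q \<in> Arr C" "src q = a \<odot> b"
  shows "p = q"
proof -
  have "tgt p = tgt q" using arg_cong[OF eq, of outcome] ab pq by simp
  moreover have "inj_on (\<lambda>f. f \<bullet>\<langle>1\<rangle> \<Theta> a b) (mhom C Tight [a \<odot> b] (tgt p))"
    using theta_bij[of a b "[]" "tgt p"] ab pq by (intro bij_betw_imp_inj_on) simp
  ultimately have "to_multi p = to_multi q"
    using ab pq eq by (elim inj_onD) (simp_all add: mhom_iff circ_to_multi_left)
  then show ?thesis by simp
qed

lemma factor_theta:
  assumes "f \<in> Maps C" "mode f = Tight" "inputs f = a # b # xs" "length xs = 1 \<or> length xs = 2"
  obtains g where "g \<in> Maps C" "mode g = Tight" "inputs g = a \<odot> b # xs"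
    "f = Sub C g 1 (\<Theta> a b)"
proof -
  have ab: "a \<in> Ob C" "b \<in> Ob C" "set xs \<subseteq> Ob C" using assms inputs_Ob[of f] by simp_all
  have "f \<in> (\<lambda>f. f \<bullet>\<langle>1\<rangle> \<Theta> a b) ` mhom C Tight (a \<odot> b # xs) (outcome f)"
    using bij_betw_imp_surj_on[OF theta_bij[of a b xs "outcome f"]] assms ab by (auto simp: mhom_iff)
  then obtain g where g: "g \<in> Maps C" "mode g = Tight" "inputs g = a \<odot> b # xs" "outcome g = outcome f"
    "f = g \<bullet>\<langle>1\<rangle> \<Theta> a b" by (auto simp: mhom_iff)
  moreover have "f = Sub C g 1 (\<Theta> a b)"
    using g assms(4) ab by (subst g(5), subst circ_Sub) auto
  ultimately show thesis by (auto intro: that)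
qed

lemma cancel_theta:
  assumes eq: "Sub C f 1 (\<Theta> a b) = Sub C g 1 (\<Theta> a b)"
    and f: "f \<in> Maps C" "mode f = Tight" "inputs f = a \<odot> b # xs"
    and g: "g \<in> Maps C" "mode g = Tight" "inputs g = a \<odot> b # xs"
    and ab: "a \<in> Ob C" "b \<in> Ob C" "length xs = 1 \<or> length xs = 2"
  shows "f = g"
proof -
  have [simp]: "set xs \<subseteq> Ob C" using f inputs_Ob[of f] by simp
  have "outcome f = outcome g" using arg_cong[OF eq, of outcome] f g ab by auto
  moreover have "inj_on (\<lambda>f. f \<bullet>\<langle>1\<rangle> \<Theta> a b) (mhom C Tight (a \<odot> b # xs) (outcome f))"
    using theta_bij[of a b xs "outcome f"] ab f by (intro bij_betw_imp_inj_on) auto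
  moreover have "f \<bullet>\<langle>1\<rangle> \<Theta> a b = Sub C f 1 (\<Theta> a b)" "g \<bullet>\<langle>1\<rangle> \<Theta> a b = Sub C g 1 (\<Theta> a b)"
    using f g ab by (auto intro!: circ_Sub)
  ultimately show ?thesis
    using f g eq by (elim inj_onD) (simp_all add: mhom_iff)
qed

lemma factor3:
  assumes "f \<in> Maps C" "mode f = Tight" "inputs f = [a, b, c]"
  obtains p where "p \<in> Arr C" "src p = a \<odot> b \<odot> c" "f = post C p (\<Theta>3 a b c)"
proof -
  have [simp]: "a \<in> Ob C" "b \<in> Ob C" "c \<in> Ob C" using assms input_in_Ob by force+
  obtain g where g: "g \<in> Maps C" "mode g = Tight" "inputs g = [a \<odot> b, c]"
    "f = Sub C g 1 (\<Theta> a b)" by (rule factor_theta[OF assms]) simp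
  obtain p where "p \<in> Arr C" "src p = a \<odot> b \<odot> c" "g = post C p (\<Theta> (a \<odot> b) c)"
    using factor2[OF g(1-3)] .
  with g show thesis by (intro that[of p]) (simp_all add: \<Theta>3_def post_Sub)
qed

lemma factor4:
  assumes "f \<in> Maps C" "mode f = Tight" "inputs f = [a, b, c, d]"
  obtains p where "p \<in> Arr C" "src p = a \<odot> b \<odot> c \<odot> d" "f = post C p (\<Theta>4 a b c d)"
proof -
  have [simp]: "a \<in> Ob C" "b \<in> Ob C" "c \<in> Ob C" "d \<in> Ob C" using assms input_in_Ob by force+
  obtain g where g: "g \<in> Maps C" "mode g = Tight" "inputs g = [a \<odot> b, c, d]"
    "f = Sub C g 1 (\<Theta> a b)" by (rule factor_theta[OF assms]) simp
  obtain p where "p \<in> Arr C" "src p = a \<odot> b \<odot> c \<odot> d" "g = post C p (\<Theta>3 (a \<odot> b) c d)"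
    using factor3[OF g(1-3)] .
  with g show thesis by (intro that[of p]) (simp_all add: theta4_alt post_Sub)
qed

lemma cancel3:
  assumes eq: "post C p (\<Theta>3 a b c) = post C q (\<Theta>3 a b c)" and ab: "a \<in> Ob C" "b \<in> Ob C" "c \<in> Ob C"
    and pq: "p \<in> Arr C" "src p = a \<odot> b \<odot> c" "q \<in> Arr C" "src q = a \<odot> b \<odot> c"
  shows "p = q"
proof -
  have "post C p (\<Theta> (a \<odot> b) c) = post C q (\<Theta> (a \<odot> b) c)"
    by (rule cancel_theta[of _ a b _ "[c]"]) (use eq ab pq in \<open>simp_all add: \<Theta>3_def post_Sub\<close>)
  from cancel2[OF this] show ?thesis using ab pq by simp
qed

lemma cancel4:
  assumes eq: "post C p (\<Theta>4 a b c d) = post C q (\<Theta>4 a b c d)"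
    and ab: "a \<in> Ob C" "b \<in> Ob C" "c \<in> Ob C" "d \<in> Ob C"
    and pq: "p \<in> Arr C" "src p = a \<odot> b \<odot> c \<odot> d" "q \<in> Arr C" "src q = a \<odot> b \<odot> c \<odot> d"
  shows "p = q"
proof -
  have "post C p (\<Theta>3 (a \<odot> b) c d) = post C q (\<Theta>3 (a \<odot> b) c d)"
    by (rule cancel_theta[of _ a b _ "[c, d]"]) (use eq ab pq in \<open>simp_all add: theta4_alt post_Sub\<close>)
  from cancel3[OF this] show ?thesis using ab pq by simp
qed

text \<open>
  Every tight map is an arrow after one of the universal maps. Properties of tight maps that are stable
  under postcomposition need only be checked on the universal maps.
\<close>

lemma tight_cases:
  assumes f: "f \<in> Maps C" "mode f = Tight"
  obtains p where "p \<in> Arr C" "f = to_multi p"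
    | p a b where "a \<in> Ob C" "b \<in> Ob C" "p \<in> Arr C" "src p = a \<odot> b" "f = post C p (\<Theta> a b)"
    | p a b c where "a \<in> Ob C" "b \<in> Ob C" "c \<in> Ob C" "p \<in> Arr C" "src p = a \<odot> b \<odot> c" "f = post C p (\<Theta>3 a b c)"
    | p a b c d where "a \<in> Ob C" "b \<in> Ob C" "c \<in> Ob C" "d \<in> Ob C" "p \<in> Arr C" "src p = a \<odot> b \<odot> c \<odot> d" "f = post C p (\<Theta>4 a b c d)"
proof -
  have "arity f = Suc 0 \<or> arity f = 2 \<or> arity f = 3 \<or> arity f = 4"
    using tight_arity[OF f] by arith
  then consider "arity f = Suc 0" | a b where "inputs f = [a, b]" | a b c where "inputs f = [a, b, c]"
      | a b c d where "inputs f = [a, b, c, d]"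
    by (auto simp: arity_cases)
  then show thesis
  proof cases
    case 1 show thesis using unary_is_arrow[OF f 1] that(1) by metis
  next
    case (2 a b)
    have "a \<in> Ob C" "b \<in> Ob C" using f 2 input_in_Ob by force+
    then show thesis using factor2[OF f 2] that(2) by metis
  next
    case (3 a b c)
    have "a \<in> Ob C" "b \<in> Ob C" "c \<in> Ob C" using f 3 input_in_Ob by force+
    then show thesis using factor3[OF f 3] that(3) by metis
  next
    case (4 a b c d)
    have "a \<in> Ob C" "b \<in> Ob C" "c \<in> Ob C" "d \<in> Ob C" using f 4 input_in_Ob by force+
    then show thesis using factor4[OF f 4] that(4) by metis
  qed
qed

lemma factor_u:
  assumes "f \<in> Maps C" "mode f = Loose" "inputs f = []"
  obtains p where "p \<in> Arr C" "src p = I" "f = post C p \<upsilon>"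
proof -
  have "f \<in> (\<lambda>f. f \<bullet>\<langle>1\<rangle> \<upsilon>) ` mhom C Tight [I] (outcome f)"
    using bij_betw_imp_surj_on[OF u_bij[of "[]" "outcome f"]] assms by (simp add: mhom_iff)
  then obtain g where g: "g \<in> Maps C" "mode g = Tight" "inputs g = [I]" "outcome g = outcome f"
    "f = g \<bullet>\<langle>1\<rangle> \<upsilon>" by (auto simp: mhom_iff)
  obtain p where p: "p \<in> Arr C" "g = to_multi p" using unary_is_arrow[of g] g(1-3) by auto
  show thesis using g(3,4,5) unfolding p(2) by (intro that[of p]) (simp_all add: p(1) circ_to_multi_left)
qed

lemma cancel_u:
  assumes eq: "post C p \<upsilon> = post C q \<upsilon>"
    and pq: "p \<in> Arr C" "src p = I" "q \<in> Arr C" "src q = I"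
  shows "p = q"
proof -
  have "tgt p = tgt q" using arg_cong[OF eq, of outcome] pq by simp
  moreover have "inj_on (\<lambda>f. f \<bullet>\<langle>1\<rangle> \<upsilon>) (mhom C Tight [I] (tgt p))"
    using u_bij[of "[]" "tgt p"] pq by (intro bij_betw_imp_inj_on) simp
  ultimately have "to_multi p = to_multi q"
    using pq eq by (elim inj_onD) (simp_all add: mhom_iff circ_to_multi_left)
  then show ?thesis by simp
qed

lemma factor_Sub_u:
  assumes "f \<in> Maps C" "mode f = Loose" "arity f = 1 \<or> arity f = 2"
  obtains g where "g \<in> Maps C" "mode g = Tight" "inputs g = I # inputs f"
    "f = Sub C g 1 \<upsilon>"
proof -
  have "f \<in> (\<lambda>f. f \<bullet>\<langle>1\<rangle> \<upsilon>) ` mhom C Tight (I # inputs f) (outcome f)"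
    using bij_betw_imp_surj_on[OF u_bij[of "inputs f" "outcome f"]] assms inputs_Ob[of f] by (auto simp: mhom_iff)
  then obtain g where g: "g \<in> Maps C" "mode g = Tight" "inputs g = I # inputs f" "outcome g = outcome f"
    "f = g \<bullet>\<langle>1\<rangle> \<upsilon>" by (auto simp: mhom_iff)
  moreover have "f = Sub C g 1 \<upsilon>"
    using g assms(3) by (subst g(5), subst circ_Sub) auto
  ultimately show thesis by (auto intro: that)
qed

lemma cancel_Sub_u:
  assumes eq: "Sub C f 1 \<upsilon> = Sub C g 1 \<upsilon>"
    and f: "f \<in> Maps C" "mode f = Tight" "inputs f = I # xs"
    and g: "g \<in> Maps C" "mode g = Tight" "inputs g = I # xs"
    and ab: "length xs = 1 \<or> length xs = 2"
  shows "f = g"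
proof -
  have [simp]: "set xs \<subseteq> Ob C" using f inputs_Ob[of f] by simp
  have "outcome f = outcome g" using arg_cong[OF eq, of outcome] f g ab by auto
  moreover have "inj_on (\<lambda>f. f \<bullet>\<langle>1\<rangle> \<upsilon>) (mhom C Tight (I # xs) (outcome f))"
    using u_bij[of xs "outcome f"] ab f by (intro bij_betw_imp_inj_on) auto
  moreover have "f \<bullet>\<langle>1\<rangle> \<upsilon> = Sub C f 1 \<upsilon>" "g \<bullet>\<langle>1\<rangle> \<upsilon> = Sub C g 1 \<upsilon>"
    using f g ab by (auto intro!: circ_Sub)
  ultimately show ?thesis
    using f g eq by (elim inj_onD) (simp_all add: mhom_iff)
qed

lemma post_Comp:
  "f \<in> Maps C \<Longrightarrow> q \<in> Arr C \<Longrightarrow> src q = outcome f \<Longrightarrow> q' \<in> Arr C \<Longrightarrow> src q' = tgt q \<Longrightarrow>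
    post C (q' \<cdot> q) f = post C q' (post C q f)"
  by (simp add: post_post)

lemma pre_pre_theta:
  assumes "p \<in> Arr C" "q \<in> Arr C"
  shows "pre C (pre C (\<Theta> (tgt p) (tgt q)) (Suc 0) p) 2 q = Act C [p, q] (\<one> (tgt p \<odot> tgt q)) (\<Theta> (tgt p) (tgt q))"
  using assms by (simp add: pre_def Act_Act)

text \<open>
  The definite description defining the tensor product of arrows is resolved by cancelling \<open>\<theta>\<close>.
\<close>

lemma K_tensA_eqI:
  assumes "p \<in> Arr C" "q \<in> Arr C" "h \<in> Arr C" "src h = src p \<odot> src q" "tgt h = tgt p \<odot> tgt q"
    "post C h (\<Theta> (src p) (src q)) = Act C [p, q] (\<one> (tgt p \<odot> tgt q)) (\<Theta> (tgt p) (tgt q))"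
  shows "p \<odot>\<^sub>1 q = h"
  unfolding K_tensA_def
proof (rule the_equality)
  show "h \<in> hom C (K_tens R (src p) (src q)) (K_tens R (tgt p) (tgt q)) \<and> 
    to_multi h \<bullet>\<langle>1\<rangle> \<Theta> (src p) (src q) = (\<Theta> (tgt p) (tgt q) \<bullet>\<langle>1\<rangle> to_multi p) \<bullet>\<langle>2\<rangle> to_multi q"
    using assms by (simp add: hom_iff circ_to_multi_left circ_to_multi_right pre_pre_theta)
next
  fix k assume k: "k \<in> hom C (K_tens R (src p) (src q)) (K_tens R (tgt p) (tgt q)) \<and> 
    to_multi k \<bullet>\<langle>1\<rangle> \<Theta> (src p) (src q) = (\<Theta> (tgt p) (tgt q) \<bullet>\<langle>1\<rangle> to_multi p) \<bullet>\<langle>2\<rangle> to_multi q"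
  then have k': "k \<in> Arr C" "src k = src p \<odot> src q" "tgt k = tgt p \<odot> tgt q"
    by (simp_all add: hom_iff)
  show "k = h"
    by (rule cancel2[of k "src p" "src q" h])
      (use assms conjunct2[OF k] k' in \<open>simp_all add: hom_iff circ_to_multi_left circ_to_multi_right pre_pre_theta\<close>)
qed

lemma K_tensA_simps:
  assumes "p \<in> Arr C" "q \<in> Arr C"
  shows "p \<odot>\<^sub>1 q \<in> Arr C" "src (p \<odot>\<^sub>1 q) = src p \<odot> src q" "tgt (p \<odot>\<^sub>1 q) = tgt p \<odot> tgt q"
    "post C (p \<odot>\<^sub>1 q) (\<Theta> (src p) (src q)) = Act C [p, q] (\<one> (tgt p \<odot> tgt q)) (\<Theta> (tgt p) (tgt q))"
proof -
  let ?f = "Act C [p, q] (\<one> (tgt p \<odot> tgt q)) (\<Theta> (tgt p) (tgt q))"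
  have f: "?f \<in> Maps C" "mode ?f = Tight" "inputs ?f = [src p, src q]" using assms by simp_all
  obtain h where h: "h \<in> Arr C" "src h = src p \<odot> src q" "?f = post C h (\<Theta> (src p) (src q))"
    using factor2[OF f] .
  have tgt: "tgt h = tgt p \<odot> tgt q" using arg_cong[OF h(3), of outcome] h(1,2) assms by simp
  have "p \<odot>\<^sub>1 q = h" by (rule K_tensA_eqI[OF assms h(1,2) tgt h(3)[symmetric]])
  with h tgt show "p \<odot>\<^sub>1 q \<in> Arr C" "src (p \<odot>\<^sub>1 q) = src p \<odot> src q" "tgt (p \<odot>\<^sub>1 q) = tgt p \<odot> tgt q"
    "post C (p \<odot>\<^sub>1 q) (\<Theta> (src p) (src q)) = Act C [p, q] (\<one> (tgt p \<odot> tgt q)) (\<Theta> (tgt p) (tgt q))" by simp_all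
qed
declare K_tensA_simps(1-3) [simp]

lemma post_tensA_theta:
  assumes "p \<in> Arr C" "q \<in> Arr C" "src p = a" "src q = b"
  shows "post C (p \<odot>\<^sub>1 q) (\<Theta> a b) = Act C [p, q] (\<one> (tgt p \<odot> tgt q)) (\<Theta> (tgt p) (tgt q))"
  using K_tensA_simps(4)[OF assms(1,2)] assms(3,4) by simp

lemma post_tensA_left:
  "p \<in> Arr C \<Longrightarrow> src p = a \<Longrightarrow> b \<in> Ob C \<Longrightarrow> post C (p \<odot>\<^sub>1 \<one> b) (\<Theta> a b) = pre C (\<Theta> (tgt p) b) (Suc 0) p"
  by (simp add: post_tensA_theta pre_def)

lemma post_tensA_right:
  "p \<in> Arr C \<Longrightarrow> src p = b \<Longrightarrow> a \<in> Ob C \<Longrightarrow> post C (\<one> a \<odot>\<^sub>1 p) (\<Theta> a b) = pre C (\<Theta> a (tgt p)) 2 p"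
  by (simp add: post_tensA_theta pre_def)

text \<open>
  By dinaturality, an arrow acting on one tensor factor of a codomain can be moved inside a
  substitution and absorbed by the map substituted there. This rule and its mirror image evaluate
  composites of constraints on \<open>\<theta>3\<close> and \<open>\<theta>4\<close>.
\<close>

lemma post_tensA_Sub_left:
  assumes "p \<in> Arr C" "src p = outcome g" "b \<in> Ob C" "outcome g = a" "g \<in> Maps C"
    "mode g = Loose \<and> (inputs g = [] \<or> arity g = Suc 0) \<or> mode g = Tight \<and> (arity g = 2 \<or> arity g = 3)"
  shows "post C (p \<odot>\<^sub>1 \<one> b) (Sub C (\<Theta> a b) (Suc 0) g) = Sub C (\<Theta> (tgt p) b) (Suc 0) (post C p g)"
proof -
  have "(Tight, 2, mode g, arity g) \<in> sub_shapes" using assms(6) by auto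
  moreover have "a \<in> Ob C" using assms(4,5) by auto
  ultimately show ?thesis using assms(1-5) unfolding subst_simps
    by (subst post_Sub) (simp_all add: post_tensA_left Sub_post del: sub_shapes_def flip: numeral_2_eq_2)
qed

lemma post_tensA_Sub_right:
  assumes "p \<in> Arr C" "src p = outcome g" "a \<in> Ob C" "outcome g = b" "g \<in> Maps C"
    "mode g = Loose \<and> (inputs g = [] \<or> arity g = Suc 0) \<or> mode g = Tight \<and> (arity g = 2 \<or> arity g = 3)"
  shows "post C (\<one> a \<odot>\<^sub>1 p) (Sub C (\<Theta> a b) 2 g) = Sub C (\<Theta> a (tgt p)) 2 (post C p g)"
proof -
  have "(Tight, 2, mode g, arity g) \<in> sub_shapes" using assms(6) by auto
  moreover have "b \<in> Ob C" using assms(4,5) by auto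
  ultimately show ?thesis using assms(1-5) unfolding subst_simps
    by (subst post_Sub) (simp_all add: post_tensA_right Sub_post del: sub_shapes_def flip: numeral_2_eq_2)
qed

lemma K_tensA_Id: "a \<in> Ob C \<Longrightarrow> b \<in> Ob C \<Longrightarrow> \<one> a \<odot>\<^sub>1 \<one> b = \<one> (a \<odot> b)"
  using Act_Id[of "\<Theta> a b"] by (intro K_tensA_eqI) simp_all

lemma K_tensA_Comp:
  "p \<in> Arr C \<Longrightarrow> p' \<in> Arr C \<Longrightarrow> q \<in> Arr C \<Longrightarrow> q' \<in> Arr C \<Longrightarrow>
      tgt p = src p' \<Longrightarrow> tgt q = src q' \<Longrightarrow> (p' \<cdot> p) \<odot>\<^sub>1 (q' \<cdot> q) = (p' \<odot>\<^sub>1 q') \<cdot> (p \<odot>\<^sub>1 q)"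
proof (rule K_tensA_eqI)
  assume a: "p \<in> Arr C" "p' \<in> Arr C" "q \<in> Arr C" "q' \<in> Arr C" "tgt p = src p'" "tgt q = src q'"
  have "post C ((p' \<odot>\<^sub>1 q') \<cdot> (p \<odot>\<^sub>1 q)) (\<Theta> (src p) (src q)) = Act C [p, q] (p' \<odot>\<^sub>1 q') (\<Theta> (src p') (src q'))"
    using a by (simp add: post_Comp post_tensA_theta post_Act)
  also have "\<dots> = Act C [p, q] (\<one> (tgt p' \<odot> tgt q')) (post C (p' \<odot>\<^sub>1 q') (\<Theta> (src p') (src q')))"
    using a by (simp add: Act_post)
  also have "\<dots> = Act C [p' \<cdot> p, q' \<cdot> q] (\<one> (tgt p' \<odot> tgt q')) (\<Theta> (tgt p') (tgt q'))"
    using a by (simp add: post_tensA_theta Act_Act)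
  finally show "post C ((p' \<odot>\<^sub>1 q') \<cdot> (p \<odot>\<^sub>1 q)) (\<Theta> (src (p' \<cdot> p)) (src (q' \<cdot> q))) =
    Act C [p' \<cdot> p, q' \<cdot> q] (\<one> (tgt (p' \<cdot> p) \<odot> tgt (q' \<cdot> q))) (\<Theta> (tgt (p' \<cdot> p)) (tgt (q' \<cdot> q)))"
    using a by simp
qed simp_all

text \<open>
  Naturality of \<open>\<theta>3\<close>: the action on the first two inputs is carried through the substitution by
  dinaturality.
\<close>

lemma post_tensA_theta3:
  assumes "p \<in> Arr C" "q \<in> Arr C" "r \<in> Arr C" "src p = a" "src q = b" "src r = c"
  shows "post C (p \<odot>\<^sub>1 q \<odot>\<^sub>1 r) (\<Theta>3 a b c) =
    Act C [p, q, r] (\<one> (tgt p \<odot> tgt q \<odot> tgt r)) (\<Theta>3 (tgt p) (tgt q) (tgt r))"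
proof -
  have abc: "a \<in> Ob C" "b \<in> Ob C" "c \<in> Ob C" using assms by auto
  let ?a = "tgt p" and ?b = "tgt q" and ?c = "tgt r"
  let ?f = "Act C [\<one> (?a \<odot> ?b), r] (\<one> (?a \<odot> ?b \<odot> ?c)) (\<Theta> (?a \<odot> ?b) ?c)"
  have "post C (p \<odot>\<^sub>1 q \<odot>\<^sub>1 r) (\<Theta>3 a b c) = Sub C (Act C [p \<odot>\<^sub>1 q, r] (\<one> (?a \<odot> ?b \<odot> ?c)) (\<Theta> (?a \<odot> ?b) ?c)) 1 (\<Theta> a b)"
    using assms abc by (simp add: \<Theta>3_def post_Sub post_tensA_theta)
  also have "Act C [p \<odot>\<^sub>1 q, r] (\<one> (?a \<odot> ?b \<odot> ?c)) (\<Theta> (?a \<odot> ?b) ?c) = pre C ?f 1 (p \<odot>\<^sub>1 q)"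
    using assms abc by (simp add: pre_def Act_Act)
  also have "Sub C (pre C ?f 1 (p \<odot>\<^sub>1 q)) 1 (\<Theta> a b) = Sub C ?f 1 (Act C [p, q] (\<one> (?a \<odot> ?b)) (\<Theta> ?a ?b))"
    using assms abc by (subst Sub_post[symmetric]) (simp_all add: post_tensA_theta)
  also have "\<dots> = Act C [p, q, r] (\<one> (?a \<odot> ?b \<odot> ?c)) (\<Theta>3 ?a ?b ?c)"
    using assms abc by (simp add: \<Theta>3_def Sub_Act)
  finally show ?thesis .
qed

end

section \<open>The skew monoidal category of a left representation\<close>

context represented_multicategory
begin

lemma K_assoc_simps [simp]:
  assumes abc: "a \<in> Ob C" "b \<in> Ob C" "c \<in> Ob C"
  shows "K_assoc C R a b c \<in> Arr C" "src (K_assoc C R a b c) = a \<odot> b \<odot> c" "tgt (K_assoc C R a b c) = a \<odot> (b \<odot> c)"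
    and post_assoc: "post C (K_assoc C R a b c) (\<Theta>3 a b c) = Sub C (\<Theta> a (b \<odot> c)) 2 (\<Theta> b c)"
proof -
  let ?f = "Sub C (\<Theta> a (b \<odot> c)) 2 (\<Theta> b c)"
  have f: "?f \<in> Maps C" "mode ?f = Tight" "inputs ?f = [a, b, c]" using abc by simp_all
  obtain h where h: "h \<in> Arr C" "src h = a \<odot> b \<odot> c" "?f = post C h (\<Theta>3 a b c)"
    using factor3[OF f] .
  have tgt: "tgt h = a \<odot> (b \<odot> c)" using arg_cong[OF h(3), of outcome] h(1,2) abc by simp
  have circ: "(to_multi k \<bullet>\<langle>1\<rangle> \<Theta> (a \<odot> b) c) \<bullet>\<langle>1\<rangle> \<Theta> a b = \<Theta> a (b \<odot> c) \<bullet>\<langle>2\<rangle> \<Theta> b c \<longleftrightarrow>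
     post C k (\<Theta>3 a b c) = ?f" if "k \<in> Arr C" "src k = a \<odot> b \<odot> c" for k
    using abc that by (simp add: circ_to_multi_left circ_Sub \<Theta>3_def post_Sub)
  have "K_assoc C R a b c = h" unfolding K_assoc_def
  proof (rule the_equality)
    fix k assume k: "k \<in> hom C (a \<odot> b \<odot> c) (a \<odot> (b \<odot> c)) \<and>
      (to_multi k \<bullet>\<langle>1\<rangle> \<Theta> (a \<odot> b) c) \<bullet>\<langle>1\<rangle> \<Theta> a b = \<Theta> a (b \<odot> c) \<bullet>\<langle>2\<rangle> \<Theta> b c"
    then have k': "k \<in> Arr C" "src k = a \<odot> b \<odot> c" by (simp_all add: hom_iff)
    have "post C k (\<Theta>3 a b c) = post C h (\<Theta>3 a b c)" using conjunct2[OF k] circ[OF k'] h(3) by simp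
    from cancel3[OF this] show "k = h" using abc k' h(1,2) by simp
  qed (use h(1,2) tgt h(3)[symmetric] circ[OF h(1,2)] in \<open>simp add: hom_iff\<close>)
  with h tgt show "K_assoc C R a b c \<in> Arr C" "src (K_assoc C R a b c) = a \<odot> b \<odot> c"
    "tgt (K_assoc C R a b c) = a \<odot> (b \<odot> c)" "post C (K_assoc C R a b c) (\<Theta>3 a b c) = ?f" by simp_all
qed
declare post_assoc [simp del]

lemma factor_Loose1:
  assumes f: "f \<in> Maps C" "mode f = Loose" "inputs f = [a]"
  obtains p where "p \<in> Arr C" "src p = I \<odot> a" "f = post C p (Sub C (\<Theta> I a) 1 \<upsilon>)"
proof -
  have a: "a \<in> Ob C" using f input_in_Ob[of f a] by simp
  have "arity f = 1 \<or> arity f = 2" using f by simp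
  then obtain g where g: "g \<in> Maps C" "mode g = Tight" "inputs g = I # inputs f" "f = Sub C g 1 \<upsilon>"
    using factor_Sub_u[OF f(1,2)] by blast
  have "inputs g = [I, a]" using g(3) f(3) by simp
  then obtain p where p: "p \<in> Arr C" "src p = I \<odot> a" "g = post C p (\<Theta> I a)"
    using factor2[OF g(1,2)] by blast
  have "f = post C p (Sub C (\<Theta> I a) 1 \<upsilon>)" unfolding g(4) p(3) using p(1,2) a by (simp add: post_Sub)
  with p(1,2) show thesis by (rule that)
qed

lemma cancel_Loose1:
  assumes eq: "post C p (Sub C (\<Theta> I a) 1 \<upsilon>) = post C q (Sub C (\<Theta> I a) 1 \<upsilon>)" and a: "a \<in> Ob C"
    and pq: "p \<in> Arr C" "src p = I \<odot> a" "q \<in> Arr C" "src q = I \<odot> a"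
  shows "p = q"
proof -
  have "post C p (\<Theta> I a) = post C q (\<Theta> I a)"
    by (rule cancel_Sub_u[of _ _ "[a]"]) (use eq a pq in \<open>simp_all add: post_Sub\<close>)
  from cancel2[OF this] show ?thesis using a pq by simp
qed

lemma cancel_Loose2:
  assumes eq: "Sub C (post C p (\<Theta>3 I a b)) 1 \<upsilon> = Sub C (post C q (\<Theta>3 I a b)) 1 \<upsilon>" and a: "a \<in> Ob C" "b \<in> Ob C"
    and pq: "p \<in> Arr C" "src p = I \<odot> a \<odot> b" "q \<in> Arr C" "src q = I \<odot> a \<odot> b"
  shows "p = q"
proof -
  have "post C p (\<Theta>3 I a b) = post C q (\<Theta>3 I a b)"
    by (rule cancel_Sub_u[OF eq, of "[a, b]"]) (use a pq in simp_all)
  from cancel3[OF this] show ?thesis using a pq by simp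
qed

lemma K_lunit_simps [simp]:
  assumes a: "a \<in> Ob C"
  shows "K_lunit C R a \<in> Arr C" "src (K_lunit C R a) = I \<odot> a" "tgt (K_lunit C R a) = a"
    and post_lunit: "post C (K_lunit C R a) (Sub C (\<Theta> I a) 1 \<upsilon>) = \<j> (to_multi (\<one> a))"
proof -
  let ?f = "\<j> (to_multi (\<one> a))"
  have f: "?f \<in> Maps C" "mode ?f = Loose" "inputs ?f = [a]" using a by simp_all
  obtain h where h: "h \<in> Arr C" "src h = I \<odot> a" "?f = post C h (Sub C (\<Theta> I a) 1 \<upsilon>)"
    using factor_Loose1[OF f] .
  have tgt: "tgt h = a" using arg_cong[OF h(3), of outcome] h(1,2) a by simp
  have circ: "(to_multi k \<bullet>\<langle>1\<rangle> \<Theta> I a) \<bullet>\<langle>1\<rangle> \<upsilon> = post C k (Sub C (\<Theta> I a) 1 \<upsilon>)"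
    if "k \<in> Arr C" "src k = I \<odot> a" for k
    using a that by (simp add: circ_to_multi_left circ_Sub post_Sub)
  have "K_lunit C R a = h" unfolding K_lunit_def
  proof (rule the_equality)
    fix k assume k: "k \<in> hom C (I \<odot> a) a \<and> (to_multi k \<bullet>\<langle>1\<rangle> \<Theta> I a) \<bullet>\<langle>1\<rangle> \<upsilon> = ?f"
    then have k': "k \<in> Arr C" "src k = I \<odot> a" by (simp_all add: hom_iff)
    have "post C k (Sub C (\<Theta> I a) 1 \<upsilon>) = post C h (Sub C (\<Theta> I a) 1 \<upsilon>)"
      using conjunct2[OF k] circ[OF k'] h(3) by simp
    from cancel_Loose1[OF this] show "k = h" using a k' h(1,2) by simp
  qed (use h(1,2) tgt h(3)[symmetric] circ[OF h(1,2)] in \<open>simp add: hom_iff\<close>)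
  with h tgt show "K_lunit C R a \<in> Arr C" "src (K_lunit C R a) = I \<odot> a" "tgt (K_lunit C R a) = a"
    "post C (K_lunit C R a) (Sub C (\<Theta> I a) 1 \<upsilon>) = \<j> (to_multi (\<one> a))" by simp_all
qed
declare post_lunit [simp del]

lemma K_runit_simps [simp]:
  assumes a: "a \<in> Ob C"
  shows "K_runit C R a \<in> Arr C" "src (K_runit C R a) = a" "tgt (K_runit C R a) = a \<odot> I"
    and to_multi_runit: "to_multi (K_runit C R a) = Sub C (\<Theta> a I) 2 \<upsilon>"
  using a by (simp_all add: K_runit_def circ_Sub)
declare to_multi_runit [simp del]

lemma runit_eq: "a \<in> Ob C \<Longrightarrow> K_runit C R a = to_arrow (Sub C (\<Theta> a I) 2 \<upsilon>)"
  by (simp add: K_runit_def circ_Sub)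

lemma Sub_theta_right:
  assumes "p \<in> Arr C" "q \<in> Arr C" "r \<in> Arr C" "src p = a" "src q = b" "src r = c"
  shows "post C (p \<odot>\<^sub>1 (q \<odot>\<^sub>1 r)) (Sub C (\<Theta> a (b \<odot> c)) 2 (\<Theta> b c)) =
    Act C [p, q, r] (\<one> (tgt p \<odot> (tgt q \<odot> tgt r))) (Sub C (\<Theta> (tgt p) (tgt q \<odot> tgt r)) 2 (\<Theta> (tgt q) (tgt r)))"
proof -
  have abc: "a \<in> Ob C" "b \<in> Ob C" "c \<in> Ob C" using assms by auto
  let ?a = "tgt p" and ?b = "tgt q" and ?c = "tgt r"
  let ?f = "Act C [p, \<one> (?b \<odot> ?c)] (\<one> (?a \<odot> (?b \<odot> ?c))) (\<Theta> ?a (?b \<odot> ?c))"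
  have "post C (p \<odot>\<^sub>1 (q \<odot>\<^sub>1 r)) (Sub C (\<Theta> a (b \<odot> c)) 2 (\<Theta> b c)) =
    Sub C (Act C [p, q \<odot>\<^sub>1 r] (\<one> (?a \<odot> (?b \<odot> ?c))) (\<Theta> ?a (?b \<odot> ?c))) 2 (\<Theta> b c)"
    using assms abc by (simp add: post_Sub post_tensA_theta)
  also have "Act C [p, q \<odot>\<^sub>1 r] (\<one> (?a \<odot> (?b \<odot> ?c))) (\<Theta> ?a (?b \<odot> ?c)) = pre C ?f 2 (q \<odot>\<^sub>1 r)"
    using assms abc by (simp add: pre_def Act_Act)
  also have "Sub C (pre C ?f 2 (q \<odot>\<^sub>1 r)) 2 (\<Theta> b c) = Sub C ?f 2 (Act C [q, r] (\<one> (?b \<odot> ?c)) (\<Theta> ?b ?c))"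
    using assms abc by (subst Sub_post[symmetric]) (simp_all add: post_tensA_theta)
  also have "\<dots> = Act C [p, q, r] (\<one> (?a \<odot> (?b \<odot> ?c))) (Sub C (\<Theta> ?a (?b \<odot> ?c)) 2 (\<Theta> ?b ?c))"
    using assms abc by (simp add: Sub_Act)
  finally show ?thesis .
qed

lemma K_assoc_natural:
  assumes "p \<in> Arr C" "q \<in> Arr C" "r \<in> Arr C"
  shows "K_assoc C R (tgt p) (tgt q) (tgt r) \<cdot> (p \<odot>\<^sub>1 q \<odot>\<^sub>1 r) =
    (p \<odot>\<^sub>1 (q \<odot>\<^sub>1 r)) \<cdot> K_assoc C R (src p) (src q) (src r)"
proof (rule cancel3)
  let ?a = "tgt p" and ?b = "tgt q" and ?c = "tgt r" and ?f = "\<Theta>3 (src p) (src q) (src r)"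
  have "post C (K_assoc C R ?a ?b ?c \<cdot> (p \<odot>\<^sub>1 q \<odot>\<^sub>1 r)) ?f =
     Act C [p, q, r] (K_assoc C R ?a ?b ?c) (\<Theta>3 ?a ?b ?c)"
    using assms by (simp add: post_Comp post_tensA_theta3 post_Act)
  also have "\<dots> = Act C [p, q, r] (\<one> (?a \<odot> (?b \<odot> ?c))) (post C (K_assoc C R ?a ?b ?c) (\<Theta>3 ?a ?b ?c))"
    using assms by (simp add: Act_post)
  also have "\<dots> = post C ((p \<odot>\<^sub>1 (q \<odot>\<^sub>1 r)) \<cdot> K_assoc C R (src p) (src q) (src r)) ?f"
    using assms by (simp add: post_Comp post_assoc Sub_theta_right)
  finally show "post C (K_assoc C R ?a ?b ?c \<cdot> (p \<odot>\<^sub>1 q \<odot>\<^sub>1 r)) ?f =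
    post C ((p \<odot>\<^sub>1 (q \<odot>\<^sub>1 r)) \<cdot> K_assoc C R (src p) (src q) (src r)) ?f" .
qed (use assms in simp_all)

lemma K_lunit_natural:
  assumes "p \<in> Arr C"
  shows "K_lunit C R (tgt p) \<cdot> (\<one> I \<odot>\<^sub>1 p) = p \<cdot> K_lunit C R (src p)"
proof (rule cancel_Loose1)
  let ?b = "tgt p" and ?v = "Sub C (\<Theta> I (src p)) 1 \<upsilon>"
  have "post C (K_lunit C R ?b \<cdot> (\<one> I \<odot>\<^sub>1 p)) ?v = post C (K_lunit C R ?b) (Sub C (pre C (\<Theta> I ?b) 2 p) 1 \<upsilon>)"
    using assms by (simp add: post_Comp post_Sub post_tensA_right)
  also have "Sub C (pre C (\<Theta> I ?b) 2 p) 1 \<upsilon> = pre C (Sub C (\<Theta> I ?b) 1 \<upsilon>) 1 p"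
    using assms pre_Sub_after[of "\<Theta> I ?b" 1 \<upsilon> p 2] by simp
  also have "post C (K_lunit C R ?b) \<dots> = pre C (\<j> (to_multi (\<one> ?b))) 1 p"
    using assms post_lunit[of ?b] by (simp add: post_pre)
  also have "\<dots> = post C (p \<cdot> K_lunit C R (src p)) ?v"
    using assms post_lunit[of "src p"] by (simp add: post_Comp pre_J_arrow post_J_arrow)
  finally show "post C (K_lunit C R (tgt p) \<cdot> (\<one> I \<odot>\<^sub>1 p)) ?v = post C (p \<cdot> K_lunit C R (src p)) ?v" .
qed (use assms in simp_all)

lemma K_runit_natural:
  assumes "p \<in> Arr C"
  shows "K_runit C R (tgt p) \<cdot> p = (p \<odot>\<^sub>1 \<one> I) \<cdot> K_runit C R (src p)"
proof -
  have "to_multi (K_runit C R (tgt p) \<cdot> p) = pre C (Sub C (\<Theta> (tgt p) I) 2 \<upsilon>) 1 p"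
    using assms by (simp flip: to_multi_runit)
  also have "\<dots> = Sub C (pre C (\<Theta> (tgt p) I) 1 p) 2 \<upsilon>"
    using assms by (simp add: pre_Sub_before)
  also have "\<dots> = post C (p \<odot>\<^sub>1 \<one> I) (Sub C (\<Theta> (src p) I) 2 \<upsilon>)"
    using assms by (simp add: post_Sub post_tensA_left)
  also have "\<dots> = to_multi ((p \<odot>\<^sub>1 \<one> I) \<cdot> K_runit C R (src p))"
    using assms by (simp flip: to_multi_runit)
  finally show ?thesis by simp
qed

text \<open>
  Both sides become \<open>j \<theta>\<close> after precomposition with \<open>\<theta>3\<close> and then with \<open>u\<close>: the left side by axiom (B)
  and the rule \<open>(j h) \<circ> g = j (h \<circ> g)\<close>, the right side by axiom (A) and the compatibility
  of \<open>j\<close> with substitution into the first input.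
\<close>

lemma K_lunit_assoc:
  assumes a: "a \<in> Ob C" "b \<in> Ob C"
  shows "K_lunit C R (a \<odot> b) \<cdot> K_assoc C R I a b = K_lunit C R a \<odot>\<^sub>1 \<one> b"
proof (rule cancel_Loose2)
  have "Sub C (post C (K_lunit C R (a \<odot> b) \<cdot> K_assoc C R I a b) (\<Theta>3 I a b)) 1 \<upsilon> =
    post C (K_lunit C R (a \<odot> b)) (Sub C (Sub C (\<Theta> I (a \<odot> b)) 2 (\<Theta> a b)) 1 \<upsilon>)"
    using a by (simp add: post_Comp post_assoc post_Sub)
  also have "Sub C (Sub C (\<Theta> I (a \<odot> b)) 2 (\<Theta> a b)) 1 \<upsilon> = Sub C (Sub C (\<Theta> I (a \<odot> b)) 1 \<upsilon>) 1 (\<Theta> a b)"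
    using a by (simp add: assoc_parallel_Sub)
  also have "post C (K_lunit C R (a \<odot> b)) \<dots> = \<j> (\<Theta> a b)"
    using a post_lunit[of "a \<odot> b"] by (simp add: post_Sub J_arrow_Sub)
  also have "\<dots> = Sub C (\<Theta> a b) 1 (\<j> (to_multi (\<one> a)))"
    using a by (simp add: Sub1_J_arrow)
  also have "\<dots> = Sub C (\<Theta> a b) 1 (Sub C (post C (K_lunit C R a) (\<Theta> I a)) 1 \<upsilon>)"
    using a post_lunit[of a] by (simp add: post_Sub)
  also have "\<dots> = Sub C (Sub C (\<Theta> a b) 1 (post C (K_lunit C R a) (\<Theta> I a))) 1 \<upsilon>"
    using a by (simp add: assoc_nested_20)
  also have "\<dots> = Sub C (post C (K_lunit C R a \<odot>\<^sub>1 \<one> b) (\<Theta>3 I a b)) 1 \<upsilon>"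
    using a by (simp add: \<Theta>3_def post_tensA_Sub_left)
  finally show "Sub C (post C (K_lunit C R (a \<odot> b) \<cdot> K_assoc C R I a b) (\<Theta>3 I a b)) 1 \<upsilon> =
    Sub C (post C (K_lunit C R a \<odot>\<^sub>1 \<one> b) (\<Theta>3 I a b)) 1 \<upsilon>" .
qed (use a in simp_all)

text \<open>
  By axiom (B), \<open>\<rho>\<close> acts on a map as substitution of \<open>u\<close> for a new last input.
\<close>

lemma K_assoc_runit:
  assumes a: "a \<in> Ob C" "b \<in> Ob C"
  shows "K_assoc C R a b I \<cdot> K_runit C R (a \<odot> b) = \<one> a \<odot>\<^sub>1 K_runit C R b"
proof (rule cancel2)
  have "post C (K_assoc C R a b I \<cdot> K_runit C R (a \<odot> b)) (\<Theta> a b) = post C (K_assoc C R a b I) (Sub C (\<Theta>3 a b I) 3 \<upsilon>)"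
    using a assoc_parallel_Sub(2)[of "\<Theta> (a \<odot> b) I" "\<Theta> a b" \<upsilon>] by (simp add: post_Comp \<Theta>3_def flip: runit_eq)
  also have "\<dots> = Sub C (Sub C (\<Theta> a (b \<odot> I)) 2 (\<Theta> b I)) 3 \<upsilon>"
    using a by (simp add: post_Sub post_assoc)
  also have "\<dots> = pre C (\<Theta> a (b \<odot> I)) 2 (K_runit C R b)"
    using a by (simp add: runit_eq assoc_nested_20)
  finally show "post C (K_assoc C R a b I \<cdot> K_runit C R (a \<odot> b)) (\<Theta> a b) = post C (\<one> a \<odot>\<^sub>1 K_runit C R b) (\<Theta> a b)"
    using a by (simp add: post_tensA_right)
qed (use a in simp_all)

text \<open>
  On \<open>\<theta>\<close>, the arrows \<open>\<rho>\<close> and \<open>\<alpha>\<close> insert a unit \<open>u\<close> in front of the second input, and \<open>\<lambda>\<close> turns it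
  into \<open>j 1\<close>, whose substitution into a second input is trivial.
\<close>

lemma K_triangle:
  assumes a: "a \<in> Ob C" "b \<in> Ob C"
  shows "(\<one> a \<odot>\<^sub>1 K_lunit C R b) \<cdot> K_assoc C R a I b \<cdot> (K_runit C R a \<odot>\<^sub>1 \<one> b) = \<one> (a \<odot> b)"
proof (rule cancel2)
  have "post C (K_runit C R a \<odot>\<^sub>1 \<one> b) (\<Theta> a b) = Sub C (\<Theta>3 a I b) 2 \<upsilon>"
    using a by (simp add: post_tensA_left runit_eq assoc_nested_20 \<Theta>3_def)
  then have "post C (K_assoc C R a I b \<cdot> (K_runit C R a \<odot>\<^sub>1 \<one> b)) (\<Theta> a b) = Sub C (Sub C (\<Theta> a (I \<odot> b)) 2 (\<Theta> I b)) 2 \<upsilon>"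
    using a by (simp add: post_Comp post_Sub post_assoc)
  also have "\<dots> = Sub C (\<Theta> a (I \<odot> b)) 2 (Sub C (\<Theta> I b) 1 \<upsilon>)"
    using a by (simp add: assoc_nested_20)
  finally have "post C ((\<one> a \<odot>\<^sub>1 K_lunit C R b) \<cdot> K_assoc C R a I b \<cdot> (K_runit C R a \<odot>\<^sub>1 \<one> b)) (\<Theta> a b) =
      post C (\<one> a \<odot>\<^sub>1 K_lunit C R b) (Sub C (\<Theta> a (I \<odot> b)) 2 (Sub C (\<Theta> I b) 1 \<upsilon>))"
    using a by (simp add: post_Comp del: Comp_assoc')
  also have "\<dots> = post C (\<one> (a \<odot> b)) (\<Theta> a b)"
    using a post_lunit[of b] by (simp add: post_tensA_Sub_right Sub2_J_arrow)
  finally show "post C ((\<one> a \<odot>\<^sub>1 K_lunit C R b) \<cdot> K_assoc C R a I b \<cdot> (K_runit C R a \<odot>\<^sub>1 \<one> b)) (\<Theta> a b) =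
     post C (\<one> (a \<odot> b)) (\<Theta> a b)" .
qed (use a in simp_all)

lemma K_lunit_runit: "K_lunit C R I \<cdot> K_runit C R I = \<one> I"
proof (rule cancel_u)
  have "post C (K_lunit C R I \<cdot> K_runit C R I) \<upsilon> = post C (K_lunit C R I) (Sub C (Sub C (\<Theta> I I) 1 \<upsilon>) 1 \<upsilon>)"
    by (simp add: post_Comp assoc_parallel_Sub flip: runit_eq)
  also have "\<dots> = Sub C (\<j> (to_multi (\<one> I))) 1 \<upsilon>"
    using post_lunit[of I] by (simp add: post_Sub)
  finally show "post C (K_lunit C R I \<cdot> K_runit C R I) \<upsilon> = post C (\<one> I) \<upsilon>"
    by (simp add: J_arrow_nullary)
qed simp_all

text \<open>
  The composites of universal maps reached from \<open>\<theta>4\<close> by associativity arrows, each corresponding to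
  a bracketing of the four inputs.
\<close>

lemma post_assoc_tensA_theta4:
  assumes "a \<in> Ob C" "b \<in> Ob C" "c \<in> Ob C" "d \<in> Ob C"
  shows "post C (K_assoc C R a b c \<odot>\<^sub>1 \<one> d) (\<Theta>4 a b c d) = Sub C (\<Theta>3 a (b \<odot> c) d) 2 (\<Theta> b c)"
  using assms by (simp add: \<Theta>4_def post_tensA_Sub_left post_assoc assoc_nested_22 \<Theta>3_def[of a "b \<odot> c"])

lemma post_assoc_theta4:
  assumes "a \<in> Ob C" "b \<in> Ob C" "c \<in> Ob C" "d \<in> Ob C"
  shows "post C (K_assoc C R (a \<odot> b) c d) (\<Theta>4 a b c d) = Sub C (\<Theta>3 a b (c \<odot> d)) 3 (\<Theta> c d)"
  using assms by (simp add: theta4_alt post_Sub post_assoc assoc_parallel_Sub \<Theta>3_def[of a b])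

lemma post_assoc_theta4_middle:
  assumes "a \<in> Ob C" "b \<in> Ob C" "c \<in> Ob C" "d \<in> Ob C"
  shows "post C (K_assoc C R a (b \<odot> c) d) (Sub C (\<Theta>3 a (b \<odot> c) d) 2 (\<Theta> b c)) =
    Sub C (\<Theta> a (b \<odot> c \<odot> d)) 2 (\<Theta>3 b c d)"
  using assms by (simp add: post_Sub post_assoc assoc_nested_22 \<Theta>3_def[of b c d])

text \<open>
  Either side sends \<open>\<theta>4\<close> to the right-bracketed composite \<open>\<theta> \<circ>\<^sub>2 (\<theta> \<circ>\<^sub>2 \<theta>)\<close>.
\<close>

lemma K_pentagon:
  assumes a: "a \<in> Ob C" "b \<in> Ob C" "c \<in> Ob C" "d \<in> Ob C"
  shows "K_assoc C R a b (c \<odot> d) \<cdot> K_assoc C R (a \<odot> b) c d =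
    (\<one> a \<odot>\<^sub>1 K_assoc C R b c d) \<cdot> K_assoc C R a (b \<odot> c) d \<cdot> (K_assoc C R a b c \<odot>\<^sub>1 \<one> d)"
proof (rule cancel4)
  have "post C (K_assoc C R a b (c \<odot> d) \<cdot> K_assoc C R (a \<odot> b) c d) (\<Theta>4 a b c d) =
     Sub C (\<Theta> a (b \<odot> (c \<odot> d))) 2 (Sub C (\<Theta> b (c \<odot> d)) 2 (\<Theta> c d))"
    using a by (simp add: post_Comp post_assoc_theta4 post_Sub post_assoc assoc_nested_22)
  also have "\<dots> = post C ((\<one> a \<odot>\<^sub>1 K_assoc C R b c d) \<cdot> K_assoc C R a (b \<odot> c) d \<cdot> (K_assoc C R a b c \<odot>\<^sub>1 \<one> d)) (\<Theta>4 a b c d)"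
    using a by (simp add: post_Comp post_assoc_tensA_theta4 post_assoc_theta4_middle post_tensA_Sub_right post_assoc)
  finally show "post C (K_assoc C R a b (c \<odot> d) \<cdot> K_assoc C R (a \<odot> b) c d) (\<Theta>4 a b c d) =
     post C ((\<one> a \<odot>\<^sub>1 K_assoc C R b c d) \<cdot> K_assoc C R a (b \<odot> c) d \<cdot> (K_assoc C R a b c \<odot>\<^sub>1 \<one> d)) (\<Theta>4 a b c d)" .
qed (use a in simp_all)

lemma hom_K_skmon [simp]: "hom (K_skmon C R) a b = hom C a b"
  by (simp add: hom_def K_skmon_def)

lemma K_skmon_simps [simp]:
  "Ob (K_skmon C R) = Ob C" "Arr (K_skmon C R) = Arr C" "Id (K_skmon C R) = Id C" "Comp (K_skmon C R) = Comp C"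
  "Tens (K_skmon C R) = K_tens R" "TensA (K_skmon C R) = K_tensA C R" "Unit (K_skmon C R) = I"
  "Assoc (K_skmon C R) = K_assoc C R" "LUnit (K_skmon C R) = K_lunit C R" "RUnit (K_skmon C R) = K_runit C R"
  by (simp_all add: K_skmon_def)

lemma skew_monoidal_K_skmon: "skew_monoidal (K_skmon C R)"
  by unfold_locales
    (simp_all add: hom_iff K_tensA_Id K_tensA_Comp K_assoc_natural K_lunit_natural K_runit_natural
      K_pentagon K_lunit_assoc K_assoc_runit K_triangle K_lunit_runit)

end

section \<open>The braiding of a left representation\<close>

context short_braiding
begin

lemma Br32_simps [simp]:
  assumes "f \<in> Maps C" "mode f = Tight" "arity f = 3"
  shows "Br32 \<beta> f \<in> Maps C" "mode (Br32 \<beta> f) = Tight"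
    "inputs (Br32 \<beta> f) = [inputs f ! 0, inputs f ! 2, inputs f ! 1]" "outcome (Br32 \<beta> f) = outcome f"
proof -
  obtain a b c where abc: "inputs f = [a, b, c]" using assms(3) by (auto simp: arity_cases)
  then have "{a, b, c, outcome f} \<subseteq> Ob C" using assms by auto
  from bij_betw_apply[OF Br32_bij[OF this], of f]
  show "Br32 \<beta> f \<in> Maps C" "mode (Br32 \<beta> f) = Tight"
    "inputs (Br32 \<beta> f) = [inputs f ! 0, inputs f ! 2, inputs f ! 1]" "outcome (Br32 \<beta> f) = outcome f"
    using assms abc by (simp_all add: mhom_iff)
qed

lemma Br4_simps [simp]:
  assumes "f \<in> Maps C" "mode f = Tight" "arity f = 4"
  shows "Br42 \<beta> f \<in> Maps C" "mode (Br42 \<beta> f) = Tight"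
    "inputs (Br42 \<beta> f) = [inputs f ! 0, inputs f ! 2, inputs f ! 1, inputs f ! 3]" "outcome (Br42 \<beta> f) = outcome f"
    "Br43 \<beta> f \<in> Maps C" "mode (Br43 \<beta> f) = Tight"
    "inputs (Br43 \<beta> f) = [inputs f ! 0, inputs f ! 1, inputs f ! 3, inputs f ! 2]" "outcome (Br43 \<beta> f) = outcome f"
proof -
  obtain a b c d where abc: "inputs f = [a, b, c, d]" using assms(3) by (auto simp: arity_cases)
  then have ob: "{a, b, c, d, outcome f} \<subseteq> Ob C" using assms by auto
  from bij_betw_apply[OF Br42_bij[OF ob], of f]
  show "Br42 \<beta> f \<in> Maps C" "mode (Br42 \<beta> f) = Tight"
    "inputs (Br42 \<beta> f) = [inputs f ! 0, inputs f ! 2, inputs f ! 1, inputs f ! 3]" "outcome (Br42 \<beta> f) = outcome f"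
    using assms abc by (simp_all add: mhom_iff)
  from bij_betw_apply[OF Br43_bij[OF ob], of f]
  show "Br43 \<beta> f \<in> Maps C" "mode (Br43 \<beta> f) = Tight"
    "inputs (Br43 \<beta> f) = [inputs f ! 0, inputs f ! 1, inputs f ! 3, inputs f ! 2]" "outcome (Br43 \<beta> f) = outcome f"
    using assms abc by (simp_all add: mhom_iff)
qed

lemma Br32_Act:
  assumes "f \<in> Maps C" "mode f = Tight" "inputs f = [tgt p1, tgt p2, tgt p3]"
    "p1 \<in> Arr C" "p2 \<in> Arr C" "p3 \<in> Arr C" "q \<in> Arr C" "src q = outcome f"
  shows "Br32 \<beta> (Act C [p1, p2, p3] q f) = Act C [p1, p3, p2] q (Br32 \<beta> f)"
  using assms by (intro Br32_nat) (simp_all add: mhom_iff)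

lemma post_Br32:
  assumes "f \<in> Maps C" "mode f = Tight" "arity f = 3" "q \<in> Arr C" "src q = outcome f"
  shows "post C q (Br32 \<beta> f) = Br32 \<beta> (post C q f)"
proof -
  obtain a b c where abc: "inputs f = [a, b, c]" using assms(3) by (auto simp: arity_cases)
  then have "a \<in> Ob C" "b \<in> Ob C" "c \<in> Ob C" using assms(1) input_in_Ob by force+
  then show ?thesis using assms abc Br32_Act[of f "\<one> a" "\<one> b" "\<one> c" q] by (simp add: post_def)
qed

lemma post_Br4:
  assumes "f \<in> Maps C" "mode f = Tight" "arity f = 4" "q \<in> Arr C" "src q = outcome f"
  shows "post C q (Br42 \<beta> f) = Br42 \<beta> (post C q f)" "post C q (Br43 \<beta> f) = Br43 \<beta> (post C q f)"
proof -
  obtain a b c d where abc: "inputs f = [a, b, c, d]" using assms(3) by (auto simp: arity_cases)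
  then have "a \<in> Ob C" "b \<in> Ob C" "c \<in> Ob C" "d \<in> Ob C" using assms(1) input_in_Ob by force+
  then show "post C q (Br42 \<beta> f) = Br42 \<beta> (post C q f)" "post C q (Br43 \<beta> f) = Br43 \<beta> (post C q f)"
    using assms abc Br42_nat[of f a b c d "outcome f" "\<one> a" "\<one> b" "\<one> c" "\<one> d" q]
      Br43_nat[of f a b c d "outcome f" "\<one> a" "\<one> b" "\<one> c" "\<one> d" q]
    by (simp_all add: post_def mhom_iff)
qed

lemma Br32_inj:
  assumes "Br32 \<beta> f = Br32 \<beta> g" "f \<in> Maps C" "mode f = Tight" "arity f = 3"
    "g \<in> Maps C" "mode g = Tight" "arity g = 3"
  shows "f = g"
proof -
  obtain a b c where abc: "inputs f = [a, b, c]" using assms(4) by (auto simp: arity_cases)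
  obtain a' b' c' where abc': "inputs g = [a', b', c']" using assms(7) by (auto simp: arity_cases)
  have "outcome f = outcome g" "inputs g = [a, b, c]"
    using arg_cong[OF assms(1), of outcome] arg_cong[OF assms(1), of inputs] assms(2-7) abc abc' by simp_all
  then have "f \<in> mhom C Tight [a, b, c] (outcome f)" "g \<in> mhom C Tight [a, b, c] (outcome f)"
    using assms abc by (simp_all add: mhom_iff)
  moreover have "{a, b, c, outcome f} \<subseteq> Ob C" using assms(2) abc by auto
  ultimately show ?thesis using inj_onD[OF bij_betw_imp_inj_on[OF Br32_bij] assms(1)] by blast
qed

lemma Br32_surj:
  assumes "f \<in> Maps C" "mode f = Tight" "inputs f = [a, b, c]"
  obtains g where "g \<in> Maps C" "mode g = Tight" "inputs g = [a, c, b]" "f = Br32 \<beta> g"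
proof -
  have "{a, c, b, outcome f} \<subseteq> Ob C" using assms by auto
  from bij_betw_imp_surj_on[OF Br32_bij[OF this]]
  have "f \<in> Br32 \<beta> ` mhom C Tight [a, c, b] (outcome f)" using assms by (simp add: mhom_iff)
  then obtain g where g: "g \<in> mhom C Tight [a, c, b] (outcome f)" "f = Br32 \<beta> g" by blast
  from g(1) have "g \<in> Maps C" "mode g = Tight" "inputs g = [a, c, b]" by (simp_all only: mhom_iff)
  then show thesis using g(2) by (rule that)
qed

lemma Sub_Br32_left:
  assumes "g \<in> Maps C" "mode g = Tight" "arity g = 3" "f \<in> Maps C" "mode f = Tight" "arity f = 2"
  shows "inputs g ! 0 = outcome f \<Longrightarrow> Sub C (Br32 \<beta> g) (Suc 0) f = Br43 \<beta> (Sub C g (Suc 0) f)"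
    "inputs g ! 1 = outcome f \<Longrightarrow> Sub C (Br32 \<beta> g) 3 f = Br42 \<beta> (Br43 \<beta> (Sub C g 2 f))"
    "inputs g ! 2 = outcome f \<Longrightarrow> Sub C (Br32 \<beta> g) 2 f = Br43 \<beta> (Br42 \<beta> (Sub C g 3 f))"
proof -
  obtain a b c where abc: "inputs g = [a, b, c]" using assms(3) by (auto simp: arity_cases)
  obtain x y where xy: "inputs f = [x, y]" using assms(6) by (auto simp: arity_cases)
  show "Sub C (Br32 \<beta> g) (Suc 0) f = Br43 \<beta> (Sub C g (Suc 0) f)" if "inputs g ! 0 = outcome f"
    using Br_Sub_3_2_1[of g a b c "outcome g" f x y] assms abc xy that by (simp add: mhom_iff circ_Sub)
  show "Sub C (Br32 \<beta> g) 3 f = Br42 \<beta> (Br43 \<beta> (Sub C g 2 f))" if "inputs g ! 1 = outcome f"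
    using Br_Sub_3_2_2[of g a b c "outcome g" f x y] assms abc xy that by (simp add: mhom_iff circ_Sub)
  show "Sub C (Br32 \<beta> g) 2 f = Br43 \<beta> (Br42 \<beta> (Sub C g 3 f))" if "inputs g ! 2 = outcome f"
    using Br_Sub_3_2_3[of g a b c "outcome g" f x y] assms abc xy that by (simp add: mhom_iff circ_Sub)
qed

lemma Sub_Br32_right:
  assumes "g \<in> Maps C" "mode g = Tight" "arity g = 2" "f \<in> Maps C" "mode f = Tight" "arity f = 3"
  shows "inputs g ! 0 = outcome f \<Longrightarrow> Sub C g (Suc 0) (Br32 \<beta> f) = Br42 \<beta> (Sub C g (Suc 0) f)"
    "inputs g ! 1 = outcome f \<Longrightarrow> Sub C g 2 (Br32 \<beta> f) = Br43 \<beta> (Sub C g 2 f)"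
proof -
  obtain a b where ab: "inputs g = [a, b]" using assms(3) by (auto simp: arity_cases)
  obtain x y z where xyz: "inputs f = [x, y, z]" using assms(6) by (auto simp: arity_cases)
  show "Sub C g (Suc 0) (Br32 \<beta> f) = Br42 \<beta> (Sub C g (Suc 0) f)" if "inputs g ! 0 = outcome f"
    using Br_Sub_2_3_1[of g a b "outcome g" f x y z] assms ab xyz that by (simp add: mhom_iff circ_Sub)
  show "Sub C g 2 (Br32 \<beta> f) = Br43 \<beta> (Sub C g 2 f)" if "inputs g ! 1 = outcome f"
    using Br_Sub_2_3_2[of g a b "outcome g" f x y z] assms ab xyz that by (simp add: mhom_iff circ_Sub)
qed

end

locale represented_braided_multicategory = represented_multicategory C R + short_braiding C \<beta>
  for C :: "('o, 'm) ssmulti" (structure) and R \<beta>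
begin

abbreviation s where "s \<equiv> K_braid C R \<beta>"

lemma K_braid_eqI:
  assumes abc: "x \<in> Ob C" "a \<in> Ob C" "b \<in> Ob C"
    and h: "h \<in> Arr C" "src h = x \<odot> a \<odot> b" "post C h (\<Theta>3 x a b) = Br32 \<beta> (\<Theta>3 x b a)"
  shows "s x a b = h"
  unfolding K_braid_def
proof (rule the_equality)
  have circ: "to_multi k \<bullet>\<langle>1\<rangle> (\<Theta> (x \<odot> a) b \<bullet>\<langle>1\<rangle> \<Theta> x a) = post C k (\<Theta>3 x a b)" if "k \<in> Arr C" "src k = x \<odot> a \<odot> b" for k
    using abc that by (simp add: circ_to_multi_left circ_Sub \<Theta>3_def)
  have circ': "\<Theta> (x \<odot> b) a \<bullet>\<langle>1\<rangle> \<Theta> x b = \<Theta>3 x b a"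
    using abc by (simp add: circ_Sub \<Theta>3_def)
  have "tgt h = x \<odot> b \<odot> a" using arg_cong[OF h(3), of outcome] h(1,2) abc by simp
  then show "h \<in> hom C (x \<odot> a \<odot> b) (x \<odot> b \<odot> a) \<and>
        to_multi h \<bullet>\<langle>1\<rangle> (\<Theta> (x \<odot> a) b \<bullet>\<langle>1\<rangle> \<Theta> x a) = Br32 \<beta> (\<Theta> (x \<odot> b) a \<bullet>\<langle>1\<rangle> \<Theta> x b)"
    using h circ circ' by (simp add: hom_iff)
  fix k assume k: "k \<in> hom C (x \<odot> a \<odot> b) (x \<odot> b \<odot> a) \<and>
        to_multi k \<bullet>\<langle>1\<rangle> (\<Theta> (x \<odot> a) b \<bullet>\<langle>1\<rangle> \<Theta> x a) = Br32 \<beta> (\<Theta> (x \<odot> b) a \<bullet>\<langle>1\<rangle> \<Theta> x b)"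
  then have k': "k \<in> Arr C" "src k = x \<odot> a \<odot> b" by (simp_all add: hom_iff)
  have "post C k (\<Theta>3 x a b) = post C h (\<Theta>3 x a b)" using conjunct2[OF k] circ[OF k'] circ' h(3) by simp
  from cancel3[OF this] show "k = h" using abc k' h(1,2) by simp
qed

lemma K_braid_simps [simp]:
  assumes abc: "x \<in> Ob C" "a \<in> Ob C" "b \<in> Ob C"
  shows "s x a b \<in> Arr C" "src (s x a b) = x \<odot> a \<odot> b" "tgt (s x a b) = x \<odot> b \<odot> a"
    and post_braid: "post C (s x a b) (\<Theta>3 x a b) = Br32 \<beta> (\<Theta>3 x b a)"
proof -
  let ?f = "Br32 \<beta> (\<Theta>3 x b a)"
  have f: "?f \<in> Maps C" "mode ?f = Tight" "inputs ?f = [x, a, b]" using abc by simp_all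
  obtain h where h: "h \<in> Arr C" "src h = x \<odot> a \<odot> b" "?f = post C h (\<Theta>3 x a b)"
    using factor3[OF f] .
  have tgt: "tgt h = x \<odot> b \<odot> a" using arg_cong[OF h(3), of outcome] h(1,2) abc by simp
  have "s x a b = h" using K_braid_eqI[OF abc h(1,2) h(3)[symmetric]] .
  with h tgt show "s x a b \<in> Arr C" "src (s x a b) = x \<odot> a \<odot> b" "tgt (s x a b) = x \<odot> b \<odot> a"
    "post C (s x a b) (\<Theta>3 x a b) = ?f" by simp_all
qed
declare post_braid [simp del]

text \<open>
  The inverse is the arrow that represents the preimage of \<open>\<theta>3\<close> under \<open>\<beta>\<^sup>3\<^sub>2\<close>.
\<close>

lemma K_braid_invertible:
  assumes abc: "x \<in> Ob C" "a \<in> Ob C" "b \<in> Ob C"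
  shows "invertible_arrow C (s x a b)"
proof -
  have f: "\<Theta>3 x a b \<in> Maps C" "mode (\<Theta>3 x a b) = Tight" "inputs (\<Theta>3 x a b) = [x, a, b]" using abc by simp_all
  obtain g where g: "g \<in> Maps C" "mode g = Tight" "inputs g = [x, b, a]" "\<Theta>3 x a b = Br32 \<beta> g"
    using Br32_surj[OF f] .
  obtain t where t: "t \<in> Arr C" "src t = x \<odot> b \<odot> a" "g = post C t (\<Theta>3 x b a)"
    using factor3[OF g(1-3)] .
  have eq: "\<Theta>3 x a b = Br32 \<beta> (post C t (\<Theta>3 x b a))" using g(4) t(3) by simp
  have [simp]: "tgt t = x \<odot> a \<odot> b" using arg_cong[OF eq, of outcome] t(1,2) abc by simp
  have "post C (t \<cdot> s x a b) (\<Theta>3 x a b) = post C (\<one> (x \<odot> a \<odot> b)) (\<Theta>3 x a b)"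
    using abc t(1,2) eq[symmetric] by (simp add: post_Comp post_braid post_Br32)
  from cancel3[OF this] have ts: "t \<cdot> s x a b = \<one> (x \<odot> a \<odot> b)" using abc t(1,2) by simp
  have "Br32 \<beta> (post C (s x a b \<cdot> t) (\<Theta>3 x b a)) = Br32 \<beta> (post C (\<one> (x \<odot> b \<odot> a)) (\<Theta>3 x b a))"
    using abc t(1,2) eq[symmetric] by (simp add: post_Comp post_braid flip: post_Br32)
  from Br32_inj[OF this] have "post C (s x a b \<cdot> t) (\<Theta>3 x b a) = post C (\<one> (x \<odot> b \<odot> a)) (\<Theta>3 x b a)"
    using abc t(1,2) by simp
  from cancel3[OF this] have "s x a b \<cdot> t = \<one> (x \<odot> b \<odot> a)" using abc t(1,2) by simp
  with ts abc t(1,2) show ?thesis by (auto simp: invertible_arrow_def inverse_arrows_def hom_iff intro!: exI[of _ t])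
qed

lemma K_braid_natural:
  assumes "f \<in> Arr C" "g \<in> Arr C" "h \<in> Arr C"
  shows "s (tgt f) (tgt g) (tgt h) \<cdot> (f \<odot>\<^sub>1 g \<odot>\<^sub>1 h) = (f \<odot>\<^sub>1 h \<odot>\<^sub>1 g) \<cdot> s (src f) (src g) (src h)"
proof (rule cancel3)
  let ?x = "tgt f" and ?a = "tgt g" and ?b = "tgt h" and ?f = "\<Theta>3 (src f) (src g) (src h)"
  have "post C (s ?x ?a ?b \<cdot> (f \<odot>\<^sub>1 g \<odot>\<^sub>1 h)) ?f = Act C [f, g, h] (s ?x ?a ?b) (\<Theta>3 ?x ?a ?b)"
    using assms by (simp add: post_Comp post_tensA_theta3 post_Act)
  also have "\<dots> = Act C [f, g, h] (\<one> (?x \<odot> ?b \<odot> ?a)) (Br32 \<beta> (\<Theta>3 ?x ?b ?a))"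
    using assms by (simp add: Act_post flip: post_braid)
  also have "\<dots> = Br32 \<beta> (post C (f \<odot>\<^sub>1 h \<odot>\<^sub>1 g) (\<Theta>3 (src f) (src h) (src g)))"
    using assms by (simp add: post_tensA_theta3 Br32_Act)
  also have "\<dots> = post C ((f \<odot>\<^sub>1 h \<odot>\<^sub>1 g) \<cdot> s (src f) (src g) (src h)) ?f"
    using assms by (simp add: post_Comp post_braid post_Br32)
  finally show "post C (s ?x ?a ?b \<cdot> (f \<odot>\<^sub>1 g \<odot>\<^sub>1 h)) ?f = post C ((f \<odot>\<^sub>1 h \<odot>\<^sub>1 g) \<cdot> s (src f) (src g) (src h)) ?f" .
qed (use assms in simp_all)

context
  fixes x a b c assumes ob: "x \<in> Ob C" "a \<in> Ob C" "b \<in> Ob C" "c \<in> Ob C"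
begin

lemma post_braid_theta4: "post C (s (x \<odot> a) b c) (\<Theta>4 x a b c) = Br43 \<beta> (\<Theta>4 x a c b)"
  using ob by (simp add: theta4_alt post_Sub post_braid Sub_Br32_left)

lemma post_braid_tensA_theta4: "post C (s x a b \<odot>\<^sub>1 \<one> c) (\<Theta>4 x a b c) = Br42 \<beta> (\<Theta>4 x b a c)"
  using ob by (simp add: \<Theta>4_def post_tensA_Sub_left post_braid Sub_Br32_right)

end

context
  fixes x a b c assumes ob [simp]: "x \<in> Ob C" "a \<in> Ob C" "b \<in> Ob C" "c \<in> Ob C"
begin

lemma K_braid_braid: "s (x \<odot> c) a b \<cdot> (s x a c \<odot>\<^sub>1 \<one> b) \<cdot> s (x \<odot> a) b c = (s x b c \<odot>\<^sub>1 \<one> a) \<cdot> s (x \<odot> b) a c \<cdot> (s x a b \<odot>\<^sub>1 \<one> c)"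
  by (rule cancel4[of _ x a b c])
    (simp_all add: post_Comp post_braid_theta4 post_braid_tensA_theta4 post_Br4 Br_braid)

lemma K_braid_assoc_1: "s x a (b \<odot> c) \<cdot> K_assoc C R (x \<odot> a) b c =
   (K_assoc C R x b c \<odot>\<^sub>1 \<one> a) \<cdot> s (x \<odot> b) a c \<cdot> (s x a b \<odot>\<^sub>1 \<one> c)"
proof (rule cancel4[of _ x a b c])
  have "post C (s x a (b \<odot> c) \<cdot> K_assoc C R (x \<odot> a) b c) (\<Theta>4 x a b c) = Br42 \<beta> (Br43 \<beta> (Sub C (\<Theta>3 x (b \<odot> c) a) 2 (\<Theta> b c)))"
    by (simp add: post_Comp post_assoc_theta4 post_Sub post_braid Sub_Br32_left)
  then show "post C (s x a (b \<odot> c) \<cdot> K_assoc C R (x \<odot> a) b c) (\<Theta>4 x a b c) =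
     post C ((K_assoc C R x b c \<odot>\<^sub>1 \<one> a) \<cdot> s (x \<odot> b) a c \<cdot> (s x a b \<odot>\<^sub>1 \<one> c)) (\<Theta>4 x a b c)"
    by (simp add: post_Comp post_braid_tensA_theta4 post_braid_theta4 post_Br4 post_assoc_tensA_theta4)
qed simp_all

lemma K_braid_assoc_2: "s x (a \<odot> b) c \<cdot> (K_assoc C R x a b \<odot>\<^sub>1 \<one> c) =
   K_assoc C R (x \<odot> c) a b \<cdot> (s x a c \<odot>\<^sub>1 \<one> b) \<cdot> s (x \<odot> a) b c"
proof (rule cancel4[of _ x a b c])
  have "post C (s x (a \<odot> b) c \<cdot> (K_assoc C R x a b \<odot>\<^sub>1 \<one> c)) (\<Theta>4 x a b c) = Br43 \<beta> (Br42 \<beta> (Sub C (\<Theta>3 x c (a \<odot> b)) 3 (\<Theta> a b)))"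
    by (simp add: post_Comp post_assoc_tensA_theta4 post_Sub post_braid Sub_Br32_left)
  then show "post C (s x (a \<odot> b) c \<cdot> (K_assoc C R x a b \<odot>\<^sub>1 \<one> c)) (\<Theta>4 x a b c) =
     post C (K_assoc C R (x \<odot> c) a b \<cdot> (s x a c \<odot>\<^sub>1 \<one> b) \<cdot> s (x \<odot> a) b c) (\<Theta>4 x a b c)"
    by (simp add: post_Comp post_braid_tensA_theta4 post_braid_theta4 post_Br4 post_assoc_theta4)
qed simp_all

lemma K_braid_assoc_3: "(\<one> x \<odot>\<^sub>1 s a b c) \<cdot> K_assoc C R x (a \<odot> b) c \<cdot> (K_assoc C R x a b \<odot>\<^sub>1 \<one> c) =
   K_assoc C R x (a \<odot> c) b \<cdot> (K_assoc C R x a c \<odot>\<^sub>1 \<one> b) \<cdot> s (x \<odot> a) b c"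
proof (rule cancel4[of _ x a b c])
  have "post C ((\<one> x \<odot>\<^sub>1 s a b c) \<cdot> K_assoc C R x (a \<odot> b) c \<cdot> (K_assoc C R x a b \<odot>\<^sub>1 \<one> c)) (\<Theta>4 x a b c) =
    Br43 \<beta> (Sub C (\<Theta> x (a \<odot> c \<odot> b)) 2 (\<Theta>3 a c b))"
    by (simp add: post_Comp post_assoc_tensA_theta4 post_assoc_theta4_middle post_tensA_Sub_right post_braid Sub_Br32_right)
  then show "post C ((\<one> x \<odot>\<^sub>1 s a b c) \<cdot> K_assoc C R x (a \<odot> b) c \<cdot> (K_assoc C R x a b \<odot>\<^sub>1 \<one> c)) (\<Theta>4 x a b c) =
    post C (K_assoc C R x (a \<odot> c) b \<cdot> (K_assoc C R x a c \<odot>\<^sub>1 \<one> b) \<cdot> s (x \<odot> a) b c) (\<Theta>4 x a b c)"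
    by (simp add: post_Comp post_braid_theta4 post_Br4 post_assoc_tensA_theta4 post_assoc_theta4_middle)
qed simp_all

end

lemma invertible_K_skmon [simp]: "invertible_arrow (K_skmon C R) f = invertible_arrow C f"
  by (simp add: invertible_arrow_def inverse_arrows_def)

lemma skew_braiding_K_braid: "skew_braiding (K_skmon C R) s"
proof -
  interpret K: skew_monoidal "K_skmon C R" by (rule skew_monoidal_K_skmon)
  show ?thesis
    by unfold_locales
     (simp_all add: hom_iff K_braid_invertible K_braid_natural K_braid_braid K_braid_assoc_1 K_braid_assoc_2 K_braid_assoc_3)
qed

lemma skew_symmetric_K_braid:
  assumes "short_symmetric C \<beta>"
  shows "skew_symmetric (K_skmon C R) s"
proof -
  have "s x b a \<cdot> s x a b = \<one> (x \<odot> a \<odot> b)" if "x \<in> Ob C" "a \<in> Ob C" "b \<in> Ob C" for x a b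
  proof (rule cancel3[of _ x a b])
    have "Br32 \<beta> (Br32 \<beta> (\<Theta>3 x a b)) = \<Theta>3 x a b" using assms that by (simp add: short_symmetric_def)
    then show "post C (s x b a \<cdot> s x a b) (\<Theta>3 x a b) = post C (\<one> (x \<odot> a \<odot> b)) (\<Theta>3 x a b)"
      using that by (simp add: post_Comp post_braid post_Br32)
  qed (use that in simp_all)
  then show ?thesis by (simp add: skew_symmetric_def inverse_arrows_def hom_iff)
qed

end

section \<open>The lax monoidal functor of a multifunctor\<close>

context functor_on
begin

lemma farr_simps [simp]:
  "f \<in> Arr A \<Longrightarrow> farr F f \<in> Arr B" "f \<in> Arr A \<Longrightarrow> src (farr F f) = fob F (src f)"
  "f \<in> Arr A \<Longrightarrow> tgt (farr F f) = fob F (tgt f)"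
  using farr_hom[of f] by (simp_all add: hom_iff)

lemmas [simp] = fob_Ob farr_Id

end

context multifunctor
begin

lemma fmulti_simps [simp]:
  assumes "f \<in> Maps C"
  shows "fmulti F f \<in> Maps D" "mode (fmulti F f) = mode f"
    "inputs (fmulti F f) = map (fob F) (inputs f)" "outcome (fmulti F f) = fob F (outcome f)"
  using fmulti_mhom[OF assms] by (simp_all add: mhom_iff)

lemma fmulti_post:
  assumes "f \<in> Maps C" "q \<in> Arr C" "src q = outcome f"
  shows "fmulti F (post C q f) = post D (farr F q) (fmulti F f)"
proof -
  have "map (farr F) (map \<one>\<^bsub>C\<^esub> (inputs f)) = map \<one>\<^bsub>D\<^esub> (inputs (fmulti F f))"
    using assms by (simp add: C.inputs_Ob[THEN subsetD])
  moreover have "fmulti F (post C q f) = Act D (map (farr F) (map \<one>\<^bsub>C\<^esub> (inputs f))) (farr F q) (fmulti F f)"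
    unfolding post_def by (rule fmulti_nat) (use assms in simp_all)
  ultimately show ?thesis by (simp only: post_def)
qed

end

text \<open>
  Arbitrary representations at source and target are allowed. The identity multifunctor between two
  representations of the same multicategory then compares the two skew monoidal structures.
\<close>

locale represented_multifunctor = multifunctor C D F +
    C: represented_multicategory C R + D: represented_multicategory D S
  for C D :: "('o, 'm) ssmulti" and F :: "('o, 'm) mmor" and R S
begin

no_notation C.tens (infixl "\<odot>" 80) and D.tens (infixl "\<odot>" 80)
  and C.tensA (infixl "\<odot>\<^sub>1" 80) and D.tensA (infixl "\<odot>\<^sub>1" 80)
  and C.unit ("I") and D.unit ("I")
notation C.tens (infixl "\<otimes>" 80) and D.tens (infixl "\<otimes>''" 80)
  and D.tensA (infixl "\<star>''" 80)

abbreviation K where "K \<equiv> K_lax C R D S F"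

lemma K_lax_fctr [simp]: "fob K = fob F" "farr K = farr F"
  by (simp_all add: K_lax_def)

lemma K_lax2_eqI:
  assumes ab: "a \<in> Ob C" "b \<in> Ob C" and h: "h \<in> Arr D" "src h = fob F a \<otimes>' fob F b"
    "post D h (D.\<Theta> (fob F a) (fob F b)) = fmulti F (C.\<Theta> a b)"
  shows "lax2 K a b = h"
proof -
  have circ: "to_multi k \<bullet>\<^bsub>D\<^esub>\<langle>1\<rangle> D.\<Theta> (fob F a) (fob F b) = post D k (D.\<Theta> (fob F a) (fob F b))"
    if "k \<in> Arr D" "src k = fob F a \<otimes>' fob F b" for k
    using ab that by (simp add: D.circ_to_multi_left)
  have tgt: "tgt h = fob F (a \<otimes> b)" using arg_cong[OF h(3), of outcome] h(1,2) ab by simp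
  have "(THE k. k \<in> hom D (fob F a \<otimes>' fob F b) (fob F (a \<otimes> b)) \<and>
      to_multi k \<bullet>\<^bsub>D\<^esub>\<langle>1\<rangle> D.\<Theta> (fob F a) (fob F b) = fmulti F (C.\<Theta> a b)) = h"
  proof (rule the_equality)
    fix k assume k: "k \<in> hom D (fob F a \<otimes>' fob F b) (fob F (a \<otimes> b)) \<and>
      to_multi k \<bullet>\<^bsub>D\<^esub>\<langle>1\<rangle> D.\<Theta> (fob F a) (fob F b) = fmulti F (C.\<Theta> a b)"
    then have k': "k \<in> Arr D" "src k = fob F a \<otimes>' fob F b" by (simp_all add: hom_iff)
    have "post D k (D.\<Theta> (fob F a) (fob F b)) = post D h (D.\<Theta> (fob F a) (fob F b))"
      using conjunct2[OF k] circ[OF k'] h(3) by simp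
    from D.cancel2[OF this] show "k = h" using ab k' h(1,2) by simp
  qed (use h tgt circ[OF h(1,2)] in \<open>simp add: hom_iff\<close>)
  then show ?thesis using ab by (simp add: K_lax_def)
qed

lemma K_lax2_simps [simp]:
  assumes ab: "a \<in> Ob C" "b \<in> Ob C"
  shows "lax2 K a b \<in> Arr D" "src (lax2 K a b) = fob F a \<otimes>' fob F b" "tgt (lax2 K a b) = fob F (a \<otimes> b)"
    and post_lax2: "post D (lax2 K a b) (D.\<Theta> (fob F a) (fob F b)) = fmulti F (C.\<Theta> a b)"
proof -
  let ?f = "fmulti F (C.\<Theta> a b)"
  have f: "?f \<in> Maps D" "mode ?f = Tight" "inputs ?f = [fob F a, fob F b]" using ab by simp_all
  obtain h where h: "h \<in> Arr D" "src h = fob F a \<otimes>' fob F b" "?f = post D h (D.\<Theta> (fob F a) (fob F b))"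
    using D.factor2[OF f] .
  have tgt: "tgt h = fob F (a \<otimes> b)" using arg_cong[OF h(3), of outcome] h(1,2) ab by simp
  have "lax2 K a b = h" using K_lax2_eqI[OF ab h(1,2) h(3)[symmetric]] .
  with h tgt show "lax2 K a b \<in> Arr D" "src (lax2 K a b) = fob F a \<otimes>' fob F b" "tgt (lax2 K a b) = fob F (a \<otimes> b)"
    "post D (lax2 K a b) (D.\<Theta> (fob F a) (fob F b)) = fmulti F (C.\<Theta> a b)" by simp_all
qed
declare post_lax2 [simp del]

lemma K_lax0_eqI:
  assumes h: "h \<in> Arr D" "src h = D.unit" "post D h D.\<upsilon> = fmulti F C.\<upsilon>"
  shows "lax0 K = h"
proof -
  have circ: "to_multi k \<bullet>\<^bsub>D\<^esub>\<langle>1\<rangle> D.\<upsilon> = post D k D.\<upsilon>"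
    if "k \<in> Arr D" "src k = D.unit" for k
    using that by (simp add: D.circ_to_multi_left)
  have tgt: "tgt h = fob F C.unit" using arg_cong[OF h(3), of outcome] h(1,2) by simp
  have "(THE k. k \<in> hom D D.unit (fob F C.unit) \<and> to_multi k \<bullet>\<^bsub>D\<^esub>\<langle>1\<rangle> D.\<upsilon> = fmulti F C.\<upsilon>) = h"
  proof (rule the_equality)
    fix k assume k: "k \<in> hom D D.unit (fob F C.unit) \<and> to_multi k \<bullet>\<^bsub>D\<^esub>\<langle>1\<rangle> D.\<upsilon> = fmulti F C.\<upsilon>"
    then have k': "k \<in> Arr D" "src k = D.unit" by (simp_all add: hom_iff)
    have "post D k D.\<upsilon> = post D h D.\<upsilon>" using conjunct2[OF k] circ[OF k'] h(3) by simp
    from D.cancel_u[OF this] show "k = h" using k' h(1,2) by simp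
  qed (use h tgt circ[OF h(1,2)] in \<open>simp add: hom_iff\<close>)
  then show ?thesis by (simp add: K_lax_def)
qed

lemma K_lax0_simps [simp]:
  shows "lax0 K \<in> Arr D" "src (lax0 K) = D.unit" "tgt (lax0 K) = fob F C.unit"
    and post_lax0: "post D (lax0 K) D.\<upsilon> = fmulti F C.\<upsilon>"
proof -
  let ?f = "fmulti F C.\<upsilon>"
  have f: "?f \<in> Maps D" "mode ?f = Loose" "inputs ?f = []" by simp_all
  obtain h where h: "h \<in> Arr D" "src h = D.unit" "?f = post D h D.\<upsilon>"
    using D.factor_u[OF f] .
  have tgt: "tgt h = fob F C.unit" using arg_cong[OF h(3), of outcome] h(1,2) by simp
  have "lax0 K = h" using K_lax0_eqI[OF h(1,2) h(3)[symmetric]] .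
  with h tgt show "lax0 K \<in> Arr D" "src (lax0 K) = D.unit" "tgt (lax0 K) = fob F C.unit"
    "post D (lax0 K) D.\<upsilon> = fmulti F C.\<upsilon>" by simp_all
qed
declare post_lax0 [simp del]

lemma K_lax2_natural:
  assumes "f \<in> Arr C" "g \<in> Arr C"
  shows "lax2 K (tgt f) (tgt g) \<cdot>\<^bsub>D\<^esub> (farr F f \<star>' farr F g) = farr F (K_tensA C R f g) \<cdot>\<^bsub>D\<^esub> lax2 K (src f) (src g)"
proof (rule D.cancel2)
  let ?\<theta> = "D.\<Theta> (fob F (src f)) (fob F (src g))" and ?a = "tgt f" and ?b = "tgt g"
  have "post D (lax2 K ?a ?b \<cdot>\<^bsub>D\<^esub> (farr F f \<star>' farr F g)) ?\<theta> = Act D [farr F f, farr F g] (lax2 K ?a ?b) (D.\<Theta> (fob F ?a) (fob F ?b))"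
    using assms by (simp add: D.post_Comp D.post_tensA_theta D.post_Act)
  also have "\<dots> = Act D [farr F f, farr F g] (\<one>\<^bsub>D\<^esub> (fob F (?a \<otimes> ?b))) (fmulti F (C.\<Theta> ?a ?b))"
    using assms by (simp add: D.Act_post flip: post_lax2)
  also have "\<dots> = fmulti F (Act C [f, g] (\<one>\<^bsub>C\<^esub> (?a \<otimes> ?b)) (C.\<Theta> ?a ?b))"
    using assms by (simp add: fmulti_nat)
  also have "\<dots> = post D (farr F (K_tensA C R f g) \<cdot>\<^bsub>D\<^esub> lax2 K (src f) (src g)) ?\<theta>"
    using assms by (simp add: D.post_Comp post_lax2 fmulti_post flip: C.post_tensA_theta)
  finally show "post D (lax2 K ?a ?b \<cdot>\<^bsub>D\<^esub> (farr F f \<star>' farr F g)) ?\<theta> =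
    post D (farr F (K_tensA C R f g) \<cdot>\<^bsub>D\<^esub> lax2 K (src f) (src g)) ?\<theta>" .
qed (use assms in simp_all)

lemma post_lax2_tensA:
  assumes "a \<in> Ob C" "b \<in> Ob C" "c \<in> Ob C"
  shows "post D (lax2 K (a \<otimes> b) c) (post D (lax2 K a b \<star>' \<one>\<^bsub>D\<^esub> (fob F c)) (D.\<Theta>3 (fob F a) (fob F b) (fob F c))) =
    fmulti F (C.\<Theta>3 a b c)"
  using assms
  by (simp add: D.\<Theta>3_def C.\<Theta>3_def D.post_tensA_Sub_left post_lax2, simp add: D.post_Sub post_lax2 fmulti_Sub)

lemma post_farr_lax2_tensA:
  assumes "a \<in> Ob C" "b \<in> Ob C" "c \<in> Ob C" "p \<in> Arr C" "src p = a \<otimes> b \<otimes> c"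
  shows "post D (farr F p \<cdot>\<^bsub>D\<^esub> lax2 K (a \<otimes> b) c \<cdot>\<^bsub>D\<^esub> (lax2 K a b \<star>' \<one>\<^bsub>D\<^esub> (fob F c))) (D.\<Theta>3 (fob F a) (fob F b) (fob F c)) =
    fmulti F (post C p (C.\<Theta>3 a b c))"
  using assms by (simp add: D.post_Comp post_lax2_tensA fmulti_post)

text \<open>
  Both sides evaluate on \<open>\<theta>3\<close> to the image of \<open>\<theta> \<circ>\<^sub>2 \<theta>\<close>.
\<close>

lemma K_lax_assoc:
  assumes ob: "a \<in> Ob C" "b \<in> Ob C" "c \<in> Ob C"
  shows "farr F (K_assoc C R a b c) \<cdot>\<^bsub>D\<^esub> lax2 K (a \<otimes> b) c \<cdot>\<^bsub>D\<^esub> (lax2 K a b \<star>' \<one>\<^bsub>D\<^esub> (fob F c)) =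
      lax2 K a (b \<otimes> c) \<cdot>\<^bsub>D\<^esub> (\<one>\<^bsub>D\<^esub> (fob F a) \<star>' lax2 K b c) \<cdot>\<^bsub>D\<^esub> K_assoc D S (fob F a) (fob F b) (fob F c)"
proof (rule D.cancel3)
  let ?\<theta> = "D.\<Theta>3 (fob F a) (fob F b) (fob F c)"
  have "post D (lax2 K a (b \<otimes> c) \<cdot>\<^bsub>D\<^esub> (\<one>\<^bsub>D\<^esub> (fob F a) \<star>' lax2 K b c) \<cdot>\<^bsub>D\<^esub> K_assoc D S (fob F a) (fob F b) (fob F c)) ?\<theta> =
    fmulti F (Sub C (C.\<Theta> a (b \<otimes> c)) 2 (C.\<Theta> b c))"
    using ob by (simp add: D.post_Comp D.post_assoc D.post_tensA_Sub_right post_lax2, simp add: D.post_Sub post_lax2 fmulti_Sub)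
  then show "post D (farr F (K_assoc C R a b c) \<cdot>\<^bsub>D\<^esub> lax2 K (a \<otimes> b) c \<cdot>\<^bsub>D\<^esub> (lax2 K a b \<star>' \<one>\<^bsub>D\<^esub> (fob F c))) ?\<theta> =
    post D (lax2 K a (b \<otimes> c) \<cdot>\<^bsub>D\<^esub> (\<one>\<^bsub>D\<^esub> (fob F a) \<star>' lax2 K b c) \<cdot>\<^bsub>D\<^esub> K_assoc D S (fob F a) (fob F b) (fob F c)) ?\<theta>"
    using ob by (simp add: post_farr_lax2_tensA C.post_assoc)
qed (use ob in simp_all)

lemma K_lax_lunit:
  assumes a: "a \<in> Ob C"
  shows "farr F (K_lunit C R a) \<cdot>\<^bsub>D\<^esub> lax2 K C.unit a \<cdot>\<^bsub>D\<^esub> (lax0 K \<star>' \<one>\<^bsub>D\<^esub> (fob F a)) = K_lunit D S (fob F a)"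
proof (rule D.cancel_Loose1)
  let ?v = "Sub D (D.\<Theta> D.unit (fob F a)) 1 D.\<upsilon>"
  have "post D (farr F (K_lunit C R a) \<cdot>\<^bsub>D\<^esub> lax2 K C.unit a \<cdot>\<^bsub>D\<^esub> (lax0 K \<star>' \<one>\<^bsub>D\<^esub> (fob F a))) ?v =
    post D (farr F (K_lunit C R a)) (fmulti F (Sub C (C.\<Theta> C.unit a) 1 C.\<upsilon>))"
    using a by (simp add: D.post_Comp D.post_tensA_Sub_left post_lax0, simp add: D.post_Sub post_lax2 fmulti_Sub)
  also have "\<dots> = fmulti F (post C (K_lunit C R a) (Sub C (C.\<Theta> C.unit a) 1 C.\<upsilon>))"
    using a by (simp add: fmulti_post)
  also have "\<dots> = post D (K_lunit D S (fob F a)) ?v"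
    using a by (simp add: C.post_lunit[simplified] D.post_lunit[simplified] fmulti_J fmulti_unary)
  finally show "post D (farr F (K_lunit C R a) \<cdot>\<^bsub>D\<^esub> lax2 K C.unit a \<cdot>\<^bsub>D\<^esub> (lax0 K \<star>' \<one>\<^bsub>D\<^esub> (fob F a))) ?v =
    post D (K_lunit D S (fob F a)) ?v" .
qed (use a in simp_all)

lemma K_lax_runit:
  assumes a: "a \<in> Ob C"
  shows "lax2 K a C.unit \<cdot>\<^bsub>D\<^esub> (\<one>\<^bsub>D\<^esub> (fob F a) \<star>' lax0 K) \<cdot>\<^bsub>D\<^esub> K_runit D S (fob F a) = farr F (K_runit C R a)"
proof -
  have "to_multi (lax2 K a C.unit \<cdot>\<^bsub>D\<^esub> (\<one>\<^bsub>D\<^esub> (fob F a) \<star>' lax0 K) \<cdot>\<^bsub>D\<^esub> K_runit D S (fob F a)) =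
    post D (lax2 K a C.unit) (post D (\<one>\<^bsub>D\<^esub> (fob F a) \<star>' lax0 K) (to_multi (K_runit D S (fob F a))))"
    using a by simp
  also have "\<dots> = fmulti F (Sub C (C.\<Theta> a C.unit) 2 C.\<upsilon>)"
    using a by (simp add: D.to_multi_runit D.post_tensA_Sub_right post_lax0 del: D.post_to_multi,
      simp add: D.post_Sub post_lax2 fmulti_Sub)
  also have "\<dots> = to_multi (farr F (K_runit C R a))"
    using a by (simp add: fmulti_unary flip: C.to_multi_runit)
  finally show ?thesis by simp
qed

lemma lax_monoidal_K: "lax_monoidal (K_skmon C R) (K_skmon D S) K"
proof -
  interpret M: skew_monoidal "K_skmon C R" by (rule C.skew_monoidal_K_skmon)
  interpret N: skew_monoidal "K_skmon D S" by (rule D.skew_monoidal_K_skmon)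
  show ?thesis
    by unfold_locales
     (simp_all add: hom_iff farr_Comp K_lax2_natural K_lax_assoc K_lax_lunit K_lax_runit)
qed

lemma K_extensional: "mmor_extensional C F \<Longrightarrow> laxmor_extensional (K_skmon C R) K"
  by (simp add: mmor_extensional_def laxmor_extensional_def fctr_extensional_def) (simp add: K_lax_def)

end

lemma braided_lax_monoidal_K:
  assumes X: "represented_braided_multicategory C R \<beta>" and Y: "represented_braided_multicategory D S \<gamma>"
    and F: "braided_multifunctor (C, \<beta>) (D, \<gamma>) F"
  shows "braided_lax_monoidal (K_skmon C R, K_braid C R \<beta>) (K_skmon D S, K_braid D S \<gamma>) (K_lax C R D S F)"
proof -
  interpret C: represented_braided_multicategory C R \<beta> by fact
  interpret D: represented_braided_multicategory D S \<gamma> by fact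
  interpret multifunctor C D F using F by (simp add: braided_multifunctor_def)
  interpret represented_multifunctor C D F R S ..
  have "farr F (C.s x a b) \<cdot>\<^bsub>D\<^esub> lax2 K (K_tens R x a) b \<cdot>\<^bsub>D\<^esub> K_tensA D S (lax2 K x a) (\<one>\<^bsub>D\<^esub> (fob F b)) =
         lax2 K (K_tens R x b) a \<cdot>\<^bsub>D\<^esub> K_tensA D S (lax2 K x b) (\<one>\<^bsub>D\<^esub> (fob F a)) \<cdot>\<^bsub>D\<^esub> D.s (fob F x) (fob F a) (fob F b)"
    (is "?l = ?r") if ob: "x \<in> Ob C" "a \<in> Ob C" "b \<in> Ob C" for x a b
  proof (rule D.cancel3)
    let ?\<theta> = "D.\<Theta>3 (fob F x) (fob F a) (fob F b)"
    have "post D ?l ?\<theta> = fmulti F (Br32 \<beta> (C.\<Theta>3 x b a))"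
      using ob by (simp add: post_farr_lax2_tensA C.post_braid)
    also have "\<dots> = Br32 \<gamma> (fmulti F (C.\<Theta>3 x b a))"
      using F ob by (simp add: braided_multifunctor_def)
    also have "\<dots> = post D ?r ?\<theta>"
      using ob by (simp add: D.post_Comp D.post_braid D.post_Br32 post_lax2_tensA)
    finally show "post D ?l ?\<theta> = post D ?r ?\<theta>" .
  qed (use ob in simp_all)
  then show ?thesis by (simp add: braided_lax_monoidal_def lax_monoidal_K)
qed

section \<open>Composition of braided lax monoidal functors\<close>

context skew_monoidal
begin

lemmas [simp] = Tens_Ob Unit_Ob TensA_Id

lemma TensA_simps [simp]:
  "f \<in> Arr M \<Longrightarrow> g \<in> Arr M \<Longrightarrow> f \<star> g \<in> Arr M"
  "f \<in> Arr M \<Longrightarrow> g \<in> Arr M \<Longrightarrow> src (f \<star> g) = src f \<otimes> src g"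
  "f \<in> Arr M \<Longrightarrow> g \<in> Arr M \<Longrightarrow> tgt (f \<star> g) = tgt f \<otimes> tgt g"
  using TensA_hom[of f g] by (simp_all add: hom_iff)

lemma Assoc_simps [simp]:
  assumes "a \<in> Ob M" "b \<in> Ob M" "c \<in> Ob M"
  shows "\<alpha> a b c \<in> Arr M" "src (\<alpha> a b c) = a \<otimes> b \<otimes> c" "tgt (\<alpha> a b c) = a \<otimes> (b \<otimes> c)"
  using Assoc_hom[OF assms] by (simp_all add: hom_iff)

lemma Unit_simps [simp]:
  assumes "a \<in> Ob M"
  shows "\<l> a \<in> Arr M" "src (\<l> a) = \<I> \<otimes> a" "tgt (\<l> a) = a"
    "\<r> a \<in> Arr M" "src (\<r> a) = a" "tgt (\<r> a) = a \<otimes> \<I>"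
  using LUnit_hom[OF assms] RUnit_hom[OF assms] by (simp_all add: hom_iff)

lemma TensA_Comp_left:
  "f \<in> Arr M \<Longrightarrow> g \<in> Arr M \<Longrightarrow> tgt f = src g \<Longrightarrow> b \<in> Ob M \<Longrightarrow> (g \<cdot> f) \<star> \<one> b = (g \<star> \<one> b) \<cdot> (f \<star> \<one> b)"
  using TensA_Comp[of f g "\<one> b" "\<one> b"] by simp

lemma TensA_Comp_right:
  "f \<in> Arr M \<Longrightarrow> g \<in> Arr M \<Longrightarrow> tgt f = src g \<Longrightarrow> b \<in> Ob M \<Longrightarrow> \<one> b \<star> (g \<cdot> f) = (\<one> b \<star> g) \<cdot> (\<one> b \<star> f)"
  using TensA_Comp[of "\<one> b" "\<one> b" f g] by simp

end

context skew_braiding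
begin

lemma s_simps [simp]:
  assumes "x \<in> Ob M" "a \<in> Ob M" "b \<in> Ob M"
  shows "s x a b \<in> Arr M" "src (s x a b) = x \<otimes> a \<otimes> b" "tgt (s x a b) = x \<otimes> b \<otimes> a"
  using s_hom[OF assms] by (simp_all add: hom_iff)

end

context lax_monoidal
begin

lemma lax0_simps [simp]: "lax0 F \<in> Arr N" "src (lax0 F) = \<I>\<^bsub>N\<^esub>" "tgt (lax0 F) = fob F \<I>\<^bsub>M\<^esub>"
  using lax0_hom by (simp_all add: hom_iff)

lemma lax2_simps [simp]:
  assumes "a \<in> Ob M" "b \<in> Ob M"
  shows "lax2 F a b \<in> Arr N" "src (lax2 F a b) = fob F a \<otimes>\<^bsub>N\<^esub> fob F b" "tgt (lax2 F a b) = fob F (a \<otimes>\<^bsub>M\<^esub> b)"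
  using lax2_hom[OF assms] by (simp_all add: hom_iff)

end

lemma lax_monoidal_id:
  assumes "skew_monoidal M" shows "lax_monoidal M M (id_laxmor M)"
proof -
  interpret skew_monoidal M by fact
  show ?thesis
    by unfold_locales (simp_all add: id_laxmor_def hom_iff)
qed

locale lax_monoidal_pair = F: lax_monoidal M N F + G: lax_monoidal N P G for M N P F G
begin

abbreviation GF where "GF \<equiv> comp_laxmor M P G F"

sublocale composite: functor_on M P GF
  by unfold_locales (simp_all add: comp_laxmor_def hom_iff F.farr_Comp G.farr_Comp)

lemma G_lax2_natural:
  assumes "f \<in> Arr N" "g \<in> Arr N" "k \<in> Arr P" "tgt k = fob G (src f) \<otimes>\<^bsub>P\<^esub> fob G (src g)"
  shows "lax2 G (tgt f) (tgt g) \<cdot>\<^bsub>P\<^esub> (farr G f \<star>\<^bsub>P\<^esub> farr G g) \<cdot>\<^bsub>P\<^esub> k =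
     farr G (f \<star>\<^bsub>N\<^esub> g) \<cdot>\<^bsub>P\<^esub> lax2 G (src f) (src g) \<cdot>\<^bsub>P\<^esub> k"
  using assms G.lax2_nat[of f g] by (simp flip: G.N.Comp_assoc')

lemma comp_laxmor_simps [simp]:
  "a \<in> Ob M \<Longrightarrow> fob GF a = fob G (fob F a)"
  "f \<in> Arr M \<Longrightarrow> farr GF f = farr G (farr F f)"
  "lax0 GF = farr G (lax0 F) \<cdot>\<^bsub>P\<^esub> lax0 G"
  "a \<in> Ob M \<Longrightarrow> b \<in> Ob M \<Longrightarrow> lax2 GF a b = farr G (lax2 F a b) \<cdot>\<^bsub>P\<^esub> lax2 G (fob F a) (fob F b)"
  by (simp_all add: comp_laxmor_def)

text \<open>
  The part of the coherence conditions that concerns the outer functor alone is isolated by moving the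
  comparison maps of \<open>G\<close> to the right.
\<close>

lemma comp_lax2_tensA_left:
  assumes ob: "a \<in> Ob M" "b \<in> Ob M" "c \<in> Ob M"
    and p: "p \<in> Arr N" "src p = fob F (a \<otimes>\<^bsub>M\<^esub> b \<otimes>\<^bsub>M\<^esub> c)"
  shows "farr G p \<cdot>\<^bsub>P\<^esub> (farr G (lax2 F (a \<otimes>\<^bsub>M\<^esub> b) c) \<cdot>\<^bsub>P\<^esub> lax2 G (fob F (a \<otimes>\<^bsub>M\<^esub> b)) (fob F c)) \<cdot>\<^bsub>P\<^esub>
      ((farr G (lax2 F a b) \<cdot>\<^bsub>P\<^esub> lax2 G (fob F a) (fob F b)) \<star>\<^bsub>P\<^esub> \<one>\<^bsub>P\<^esub> (fob G (fob F c))) =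
    farr G (p \<cdot>\<^bsub>N\<^esub> lax2 F (a \<otimes>\<^bsub>M\<^esub> b) c \<cdot>\<^bsub>N\<^esub> (lax2 F a b \<star>\<^bsub>N\<^esub> \<one>\<^bsub>N\<^esub> (fob F c))) \<cdot>\<^bsub>P\<^esub>
      lax2 G (fob F a \<otimes>\<^bsub>N\<^esub> fob F b) (fob F c) \<cdot>\<^bsub>P\<^esub> (lax2 G (fob F a) (fob F b) \<star>\<^bsub>P\<^esub> \<one>\<^bsub>P\<^esub> (fob G (fob F c)))"
  using assms G_lax2_natural[of "lax2 F a b" "\<one>\<^bsub>N\<^esub> (fob F c)" "lax2 G (fob F a) (fob F b) \<star>\<^bsub>P\<^esub> \<one>\<^bsub>P\<^esub> (fob G (fob F c))"]
  by (simp add: G.N.TensA_Comp_left G.farr_Comp)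

lemma lax_monoidal_comp: "lax_monoidal M P GF"
proof unfold_locales
  fix f g assume fg: "f \<in> Arr M" "g \<in> Arr M"
  have "farr G (lax2 F (tgt f) (tgt g)) \<cdot>\<^bsub>P\<^esub> lax2 G (fob F (tgt f)) (fob F (tgt g)) \<cdot>\<^bsub>P\<^esub> (farr G (farr F f) \<star>\<^bsub>P\<^esub> farr G (farr F g)) =
    farr G (lax2 F (tgt f) (tgt g) \<cdot>\<^bsub>N\<^esub> (farr F f \<star>\<^bsub>N\<^esub> farr F g)) \<cdot>\<^bsub>P\<^esub> lax2 G (fob F (src f)) (fob F (src g))"
    using fg G.lax2_nat[of "farr F f" "farr F g"] by (simp add: G.farr_Comp)
  then show "lax2 GF (tgt f) (tgt g) \<cdot>\<^bsub>P\<^esub> (farr GF f \<star>\<^bsub>P\<^esub> farr GF g) =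
    farr GF (f \<star>\<^bsub>M\<^esub> g) \<cdot>\<^bsub>P\<^esub> lax2 GF (src f) (src g)"
    using fg F.lax2_nat[of f g] by (simp add: G.farr_Comp)
next
  fix a b c assume ob: "a \<in> Ob M" "b \<in> Ob M" "c \<in> Ob M"
  let ?a = "fob F a" and ?b = "fob F b" and ?c = "fob F c"
  have "farr G (lax2 F a (b \<otimes>\<^bsub>M\<^esub> c) \<cdot>\<^bsub>N\<^esub> (\<one>\<^bsub>N\<^esub> ?a \<star>\<^bsub>N\<^esub> lax2 F b c) \<cdot>\<^bsub>N\<^esub> \<alpha>\<^bsub>N\<^esub> ?a ?b ?c) \<cdot>\<^bsub>P\<^esub>
      lax2 G (?a \<otimes>\<^bsub>N\<^esub> ?b) ?c \<cdot>\<^bsub>P\<^esub> (lax2 G ?a ?b \<star>\<^bsub>P\<^esub> \<one>\<^bsub>P\<^esub> (fob G ?c)) =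
    farr G (lax2 F a (b \<otimes>\<^bsub>M\<^esub> c)) \<cdot>\<^bsub>P\<^esub> farr G (\<one>\<^bsub>N\<^esub> ?a \<star>\<^bsub>N\<^esub> lax2 F b c) \<cdot>\<^bsub>P\<^esub>
      (lax2 G ?a (?b \<otimes>\<^bsub>N\<^esub> ?c) \<cdot>\<^bsub>P\<^esub> (\<one>\<^bsub>P\<^esub> (fob G ?a) \<star>\<^bsub>P\<^esub> lax2 G ?b ?c) \<cdot>\<^bsub>P\<^esub> \<alpha>\<^bsub>P\<^esub> (fob G ?a) (fob G ?b) (fob G ?c))"
    using ob G.lax_Assoc[of ?a ?b ?c] by (simp add: G.farr_Comp)
  also have "\<dots> = farr G (lax2 F a (b \<otimes>\<^bsub>M\<^esub> c)) \<cdot>\<^bsub>P\<^esub> lax2 G ?a (fob F (b \<otimes>\<^bsub>M\<^esub> c)) \<cdot>\<^bsub>P\<^esub>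
      (\<one>\<^bsub>P\<^esub> (fob G ?a) \<star>\<^bsub>P\<^esub> farr G (lax2 F b c)) \<cdot>\<^bsub>P\<^esub> (\<one>\<^bsub>P\<^esub> (fob G ?a) \<star>\<^bsub>P\<^esub> lax2 G ?b ?c) \<cdot>\<^bsub>P\<^esub> \<alpha>\<^bsub>P\<^esub> (fob G ?a) (fob G ?b) (fob G ?c)"
    using ob G_lax2_natural[of "\<one>\<^bsub>N\<^esub> ?a" "lax2 F b c" "(\<one>\<^bsub>P\<^esub> (fob G ?a) \<star>\<^bsub>P\<^esub> lax2 G ?b ?c) \<cdot>\<^bsub>P\<^esub> \<alpha>\<^bsub>P\<^esub> (fob G ?a) (fob G ?b) (fob G ?c)"]
    by simp
  finally show "farr GF (\<alpha>\<^bsub>M\<^esub> a b c) \<cdot>\<^bsub>P\<^esub> lax2 GF (a \<otimes>\<^bsub>M\<^esub> b) c \<cdot>\<^bsub>P\<^esub>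
       (lax2 GF a b \<star>\<^bsub>P\<^esub> \<one>\<^bsub>P\<^esub> (fob GF c)) =
    lax2 GF a (b \<otimes>\<^bsub>M\<^esub> c) \<cdot>\<^bsub>P\<^esub> (\<one>\<^bsub>P\<^esub> (fob GF a) \<star>\<^bsub>P\<^esub> lax2 GF b c) \<cdot>\<^bsub>P\<^esub>
       \<alpha>\<^bsub>P\<^esub> (fob GF a) (fob GF b) (fob GF c)"
    using ob F.lax_Assoc[of a b c] comp_lax2_tensA_left[of a b c "farr F (\<alpha>\<^bsub>M\<^esub> a b c)"]
    by (simp add: G.N.TensA_Comp_right)
next
  fix a assume a: "a \<in> Ob M"
  let ?a = "fob F a"
  have "farr G (farr F (\<l>\<^bsub>M\<^esub> a)) \<cdot>\<^bsub>P\<^esub> farr G (lax2 F \<I>\<^bsub>M\<^esub> a) \<cdot>\<^bsub>P\<^esub> lax2 G (fob F \<I>\<^bsub>M\<^esub>) ?a \<cdot>\<^bsub>P\<^esub>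
      (farr G (lax0 F) \<star>\<^bsub>P\<^esub> \<one>\<^bsub>P\<^esub> (fob G ?a)) \<cdot>\<^bsub>P\<^esub> (lax0 G \<star>\<^bsub>P\<^esub> \<one>\<^bsub>P\<^esub> (fob G ?a)) =
    farr G (farr F (\<l>\<^bsub>M\<^esub> a) \<cdot>\<^bsub>N\<^esub> lax2 F \<I>\<^bsub>M\<^esub> a \<cdot>\<^bsub>N\<^esub> (lax0 F \<star>\<^bsub>N\<^esub> \<one>\<^bsub>N\<^esub> ?a)) \<cdot>\<^bsub>P\<^esub> lax2 G \<I>\<^bsub>N\<^esub> ?a \<cdot>\<^bsub>P\<^esub> (lax0 G \<star>\<^bsub>P\<^esub> \<one>\<^bsub>P\<^esub> (fob G ?a))"
    using a G_lax2_natural[of "lax0 F" "\<one>\<^bsub>N\<^esub> ?a" "lax0 G \<star>\<^bsub>P\<^esub> \<one>\<^bsub>P\<^esub> (fob G ?a)"] by (simp add: G.farr_Comp)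
  also have "\<dots> = \<l>\<^bsub>P\<^esub> (fob G ?a)"
    using a F.lax_LUnit[of a] G.lax_LUnit[of ?a] by simp
  finally show "farr GF (\<l>\<^bsub>M\<^esub> a) \<cdot>\<^bsub>P\<^esub> lax2 GF \<I>\<^bsub>M\<^esub> a \<cdot>\<^bsub>P\<^esub>
      (lax0 GF \<star>\<^bsub>P\<^esub> \<one>\<^bsub>P\<^esub> (fob GF a)) = \<l>\<^bsub>P\<^esub> (fob GF a)"
    using a by (simp add: G.N.TensA_Comp_left)
next
  fix a assume a: "a \<in> Ob M"
  let ?a = "fob F a"
  have "farr G (lax2 F a \<I>\<^bsub>M\<^esub>) \<cdot>\<^bsub>P\<^esub> lax2 G ?a (fob F \<I>\<^bsub>M\<^esub>) \<cdot>\<^bsub>P\<^esub>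
      (\<one>\<^bsub>P\<^esub> (fob G ?a) \<star>\<^bsub>P\<^esub> farr G (lax0 F)) \<cdot>\<^bsub>P\<^esub> (\<one>\<^bsub>P\<^esub> (fob G ?a) \<star>\<^bsub>P\<^esub> lax0 G) \<cdot>\<^bsub>P\<^esub> \<r>\<^bsub>P\<^esub> (fob G ?a) =
    farr G (lax2 F a \<I>\<^bsub>M\<^esub>) \<cdot>\<^bsub>P\<^esub> farr G (\<one>\<^bsub>N\<^esub> ?a \<star>\<^bsub>N\<^esub> lax0 F) \<cdot>\<^bsub>P\<^esub> (lax2 G ?a \<I>\<^bsub>N\<^esub> \<cdot>\<^bsub>P\<^esub> (\<one>\<^bsub>P\<^esub> (fob G ?a) \<star>\<^bsub>P\<^esub> lax0 G) \<cdot>\<^bsub>P\<^esub> \<r>\<^bsub>P\<^esub> (fob G ?a))"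
    using a G_lax2_natural[of "\<one>\<^bsub>N\<^esub> ?a" "lax0 F" "(\<one>\<^bsub>P\<^esub> (fob G ?a) \<star>\<^bsub>P\<^esub> lax0 G) \<cdot>\<^bsub>P\<^esub> \<r>\<^bsub>P\<^esub> (fob G ?a)"] by simp
  also have "\<dots> = farr G (lax2 F a \<I>\<^bsub>M\<^esub> \<cdot>\<^bsub>N\<^esub> (\<one>\<^bsub>N\<^esub> ?a \<star>\<^bsub>N\<^esub> lax0 F) \<cdot>\<^bsub>N\<^esub> \<r>\<^bsub>N\<^esub> ?a)"
    using a by (simp add: G.lax_RUnit G.farr_Comp)
  also have "\<dots> = farr G (farr F (\<r>\<^bsub>M\<^esub> a))"
    using a F.lax_RUnit[of a] by simp
  finally show "lax2 GF a \<I>\<^bsub>M\<^esub> \<cdot>\<^bsub>P\<^esub>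
      (\<one>\<^bsub>P\<^esub> (fob GF a) \<star>\<^bsub>P\<^esub> lax0 GF) \<cdot>\<^bsub>P\<^esub> \<r>\<^bsub>P\<^esub> (fob GF a) =
      farr GF (\<r>\<^bsub>M\<^esub> a)"
    using a by (simp add: G.N.TensA_Comp_right)
qed (simp_all add: hom_iff)

end

lemma braided_lax_monoidal_id:
  assumes "skew_braiding M s"
  shows "braided_lax_monoidal (M, s) (M, s) (id_laxmor M)"
proof -
  interpret skew_braiding M s by fact
  show ?thesis
    using lax_monoidal_id[OF skew_monoidal_axioms] by (simp add: braided_lax_monoidal_def id_laxmor_def)
qed

lemma braided_lax_monoidal_comp:
  assumes F: "braided_lax_monoidal (M, s) (N, t) F" and G: "braided_lax_monoidal (N, t) (P, w) G"
    and s: "skew_braiding M s" and t: "skew_braiding N t" and w: "skew_braiding P w"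
  shows "braided_lax_monoidal (M, s) (P, w) (comp_laxmor M P G F)"
proof -
  interpret M: skew_braiding M s by fact
  interpret N: skew_braiding N t by fact
  interpret P: skew_braiding P w by fact
  interpret F: lax_monoidal M N F using F by (simp add: braided_lax_monoidal_def)
  interpret G: lax_monoidal N P G using G by (simp add: braided_lax_monoidal_def)
  interpret lax_monoidal_pair M N P F G ..
  have "farr G (farr F (s x a b)) \<cdot>\<^bsub>P\<^esub> (farr G (lax2 F (x \<otimes>\<^bsub>M\<^esub> a) b) \<cdot>\<^bsub>P\<^esub> lax2 G (fob F (x \<otimes>\<^bsub>M\<^esub> a)) (fob F b)) \<cdot>\<^bsub>P\<^esub>
      ((farr G (lax2 F x a) \<cdot>\<^bsub>P\<^esub> lax2 G (fob F x) (fob F a)) \<star>\<^bsub>P\<^esub> \<one>\<^bsub>P\<^esub> (fob G (fob F b))) =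
    (farr G (lax2 F (x \<otimes>\<^bsub>M\<^esub> b) a) \<cdot>\<^bsub>P\<^esub> lax2 G (fob F (x \<otimes>\<^bsub>M\<^esub> b)) (fob F a)) \<cdot>\<^bsub>P\<^esub>
      ((farr G (lax2 F x b) \<cdot>\<^bsub>P\<^esub> lax2 G (fob F x) (fob F b)) \<star>\<^bsub>P\<^esub> \<one>\<^bsub>P\<^esub> (fob G (fob F a))) \<cdot>\<^bsub>P\<^esub>
      w (fob G (fob F x)) (fob G (fob F a)) (fob G (fob F b))"
    if ob: "x \<in> Ob M" "a \<in> Ob M" "b \<in> Ob M" for x a b
  proof -
    let ?x = "fob F x" and ?a = "fob F a" and ?b = "fob F b"
    have Fs: "farr F (s x a b) \<cdot>\<^bsub>N\<^esub> lax2 F (x \<otimes>\<^bsub>M\<^esub> a) b \<cdot>\<^bsub>N\<^esub> (lax2 F x a \<star>\<^bsub>N\<^esub> \<one>\<^bsub>N\<^esub> ?b) =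
      lax2 F (x \<otimes>\<^bsub>M\<^esub> b) a \<cdot>\<^bsub>N\<^esub> (lax2 F x b \<star>\<^bsub>N\<^esub> \<one>\<^bsub>N\<^esub> ?a) \<cdot>\<^bsub>N\<^esub> t ?x ?a ?b"
      using F ob by (simp add: braided_lax_monoidal_def)
    have Gt: "farr G (t ?x ?a ?b) \<cdot>\<^bsub>P\<^esub> lax2 G (?x \<otimes>\<^bsub>N\<^esub> ?a) ?b \<cdot>\<^bsub>P\<^esub> (lax2 G ?x ?a \<star>\<^bsub>P\<^esub> \<one>\<^bsub>P\<^esub> (fob G ?b)) =
      lax2 G (?x \<otimes>\<^bsub>N\<^esub> ?b) ?a \<cdot>\<^bsub>P\<^esub> (lax2 G ?x ?b \<star>\<^bsub>P\<^esub> \<one>\<^bsub>P\<^esub> (fob G ?a)) \<cdot>\<^bsub>P\<^esub> w (fob G ?x) (fob G ?a) (fob G ?b)"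
      using G ob by (simp add: braided_lax_monoidal_def)
    show ?thesis
      using ob Fs Gt comp_lax2_tensA_left[of x a b "farr F (s x a b)"]
       G_lax2_natural[of "lax2 F x b" "\<one>\<^bsub>N\<^esub> ?a" "(lax2 G ?x ?b \<star>\<^bsub>P\<^esub> \<one>\<^bsub>P\<^esub> (fob G ?a)) \<cdot>\<^bsub>P\<^esub> w (fob G ?x) (fob G ?a) (fob G ?b)"]
      by (simp add: G.farr_Comp P.TensA_Comp_left)
  qed
  then show ?thesis
    using lax_monoidal_comp by (simp add: braided_lax_monoidal_def)
qed

section \<open>The categories of braided objects and the functor between them\<close>

lemma BrdSkMon_simps:
  "(M, s) \<in> Ob BrdSkMon \<longleftrightarrow> skew_braiding M s"
  "Arrow X Y F \<in> Arr BrdSkMon \<longleftrightarrow> X \<in> Ob BrdSkMon \<and> Y \<in> Ob BrdSkMon \<and>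
      braided_lax_monoidal X Y F \<and> laxmor_extensional (fst X) F"
  "Id BrdSkMon X = Arrow X X (id_laxmor (fst X))"
  "Comp BrdSkMon g f = Arrow (src f) (tgt g) (comp_laxmor (fst (src f)) (fst (tgt g)) (lbl g) (lbl f))"
  by (auto simp: BrdSkMon_def skew_braiding_def)

lemma laxmor_eqI:
  fixes F G :: "('o, 'm) laxmor"
  assumes "laxmor_extensional M F" "laxmor_extensional M G"
    and "\<And>a. a \<in> Ob M \<Longrightarrow> fob F a = fob G a" "\<And>f. f \<in> Arr M \<Longrightarrow> farr F f = farr G f"
    and "lax0 F = lax0 G" "\<And>a b. a \<in> Ob M \<Longrightarrow> b \<in> Ob M \<Longrightarrow> lax2 F a b = lax2 G a b"
  shows "F = G"
proof -
  have "fob F = fob G" "farr F = farr G"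
    using assms by (auto simp: laxmor_extensional_def fctr_extensional_def intro: extensionalityI)
  moreover have "lax2 F a b = lax2 G a b" for a b
    using assms by (cases "a \<in> Ob M \<and> b \<in> Ob M") (auto simp: laxmor_extensional_def)
  ultimately show ?thesis using assms(5) by (auto intro!: laxmor.equality ext)
qed

lemma laxmor_extensional_id_comp:
  "laxmor_extensional M (id_laxmor M)" "laxmor_extensional M (comp_laxmor M P G F)"
  by (auto simp: laxmor_extensional_def fctr_extensional_def id_laxmor_def comp_laxmor_def)

lemma comp_laxmor_id:
  assumes F: "lax_monoidal M N F" "laxmor_extensional M F"
  shows "comp_laxmor M N (id_laxmor N) F = F" "comp_laxmor M N F (id_laxmor M) = F"
proof -
  interpret lax_monoidal M N F by fact
  show "comp_laxmor M N (id_laxmor N) F = F"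
    by (rule laxmor_eqI[OF laxmor_extensional_id_comp(2) F(2)])
      (simp_all add: comp_laxmor_def id_laxmor_def)
  show "comp_laxmor M N F (id_laxmor M) = F"
    by (rule laxmor_eqI[OF laxmor_extensional_id_comp(2) F(2)])
      (simp_all add: comp_laxmor_def id_laxmor_def)
qed

lemma comp_laxmor_assoc:
  assumes "lax_monoidal M N F" "lax_monoidal N P G" "lax_monoidal P Q H"
  shows "comp_laxmor M Q (comp_laxmor N Q H G) F = comp_laxmor M Q H (comp_laxmor M P G F)"
proof -
  interpret F: lax_monoidal M N F by fact
  interpret G: lax_monoidal N P G by fact
  interpret H: lax_monoidal P Q H by fact
  show ?thesis
    by (rule laxmor_eqI[OF laxmor_extensional_id_comp(2) laxmor_extensional_id_comp(2)])
      (simp_all add: comp_laxmor_def H.farr_Comp)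
qed

lemma BrdSkMon_ArrD:
  assumes "f \<in> Arr BrdSkMon"
  shows "skew_braiding (fst (src f)) (snd (src f))" "skew_braiding (fst (tgt f)) (snd (tgt f))"
    "src f \<in> Ob BrdSkMon" "tgt f \<in> Ob BrdSkMon"
    "braided_lax_monoidal (src f) (tgt f) (lbl f)" "laxmor_extensional (fst (src f)) (lbl f)"
    "lax_monoidal (fst (src f)) (fst (tgt f)) (lbl f)"
  using assms by (cases f; auto simp: BrdSkMon_simps(2) braided_lax_monoidal_def simp flip: BrdSkMon_simps(1))+

lemma category_BrdSkMon: "category (BrdSkMon :: (('o, 'm) br_skmon, ('o, 'm) laxmor) category)"
proof
  fix X :: "('o, 'm) br_skmon" assume "X \<in> Ob BrdSkMon"
  then show "\<one>\<^bsub>BrdSkMon\<^esub> X \<in> hom BrdSkMon X X"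
    by (cases X) (simp add: hom_iff BrdSkMon_simps(2,3) laxmor_extensional_id_comp braided_lax_monoidal_id
      flip: BrdSkMon_simps(1))
next
  fix f g :: "(('o, 'm) br_skmon, ('o, 'm) laxmor) arrow"
  assume fg: "f \<in> Arr BrdSkMon" "g \<in> Arr BrdSkMon" "tgt f = src g"
  note f = BrdSkMon_ArrD[OF fg(1)] and g = BrdSkMon_ArrD[OF fg(2)]
  have "braided_lax_monoidal (src f) (tgt g) (comp_laxmor (fst (src f)) (fst (tgt g)) (lbl g) (lbl f))"
    using braided_lax_monoidal_comp[of "fst (src f)" "snd (src f)" "fst (tgt f)" "snd (tgt f)" "lbl f"
      "fst (tgt g)" "snd (tgt g)" "lbl g"] f g fg(3) by simp
  then show "g \<cdot>\<^bsub>BrdSkMon\<^esub> f \<in> hom BrdSkMon (src f) (tgt g)"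
    using f(3) g(4) by (simp add: hom_iff BrdSkMon_simps(2,4) laxmor_extensional_id_comp)
next
  fix f :: "(('o, 'm) br_skmon, ('o, 'm) laxmor) arrow"
  assume "f \<in> Arr BrdSkMon"
  note f = BrdSkMon_ArrD[OF this]
  show "\<one>\<^bsub>BrdSkMon\<^esub> (tgt f) \<cdot>\<^bsub>BrdSkMon\<^esub> f = f" "f \<cdot>\<^bsub>BrdSkMon\<^esub> \<one>\<^bsub>BrdSkMon\<^esub> (src f) = f"
    using f by (simp_all add: BrdSkMon_simps(3,4) comp_laxmor_id)
next
  fix f g h :: "(('o, 'm) br_skmon, ('o, 'm) laxmor) arrow"
  assume fg: "f \<in> Arr BrdSkMon" "g \<in> Arr BrdSkMon" "h \<in> Arr BrdSkMon" "tgt f = src g" "tgt g = src h"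
  then show "(h \<cdot>\<^bsub>BrdSkMon\<^esub> g) \<cdot>\<^bsub>BrdSkMon\<^esub> f = h \<cdot>\<^bsub>BrdSkMon\<^esub> (g \<cdot>\<^bsub>BrdSkMon\<^esub> f)"
    using comp_laxmor_assoc[OF BrdSkMon_ArrD(7)[OF fg(1)], of "fst (tgt g)" "lbl g" "fst (tgt h)" "lbl h"]
      BrdSkMon_ArrD(7)[OF fg(2)] BrdSkMon_ArrD(7)[OF fg(3)] by (simp add: BrdSkMon_simps(4))
qed (auto dest: BrdSkMon_ArrD)

lemma mmor_eqI:
  fixes F G :: "('o, 'm) mmor"
  assumes "mmor_extensional C F" "mmor_extensional C G"
    and "\<And>a. a \<in> Ob C \<Longrightarrow> fob F a = fob G a" "\<And>f. f \<in> Arr C \<Longrightarrow> farr F f = farr G f"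
    and "\<And>f. f \<in> Maps C \<Longrightarrow> fmulti F f = fmulti G f"
  shows "F = G"
proof -
  have "fob F = fob G" "farr F = farr G" "fmulti F = fmulti G"
    using assms by (auto simp: mmor_extensional_def fctr_extensional_def intro: extensionalityI)
  then show ?thesis by (auto intro!: mmor.equality)
qed

lemma mmor_extensional_id_comp:
  "mmor_extensional C (id_mmor C)" "mmor_extensional C (comp_mmor C G F)"
  by (auto simp: mmor_extensional_def fctr_extensional_def id_mmor_def comp_mmor_def)

lemma multifunctor_id:
  assumes "short_skew_multicategory C" shows "multifunctor C C (id_mmor C)"
proof -
  interpret short_skew_multicategory C by fact
  have [simp]: "map (\<lambda>a. if a \<in> Ob C then a else undefined) (inputs f) = inputs f" if "f \<in> Maps C" for f
    using inputs_Ob[OF that] by (intro map_idI) auto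
  have [simp]: "map (\<lambda>p. if p \<in> Arr C then p else undefined) ps = ps" if "into_inputs C ps as" for ps as
    using that by (intro map_idI) (auto simp: into_inputs_iff in_set_conv_nth)
  show ?thesis
    by unfold_locales
      (auto simp: id_mmor_def hom_iff mhom_iff restrict_def substitutable_def)
qed

context multifunctor
begin

lemma substitutable_fmulti: "substitutable C f i g \<Longrightarrow> substitutable D (fmulti F f) i (fmulti F g)"
  by (auto simp: substitutable_def nth_map[of "i - Suc 0" "inputs f"])

lemma into_inputs_farr: "into_inputs C ps as \<Longrightarrow> into_inputs D (map (farr F) ps) (map (fob F) as)"
  by (auto simp: into_inputs_iff)

end

lemma multifunctor_comp:
  assumes "multifunctor C D F" "multifunctor D E G"
  shows "multifunctor C E (comp_mmor C G F)"
proof -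
  interpret F: multifunctor C D F by fact
  interpret G: multifunctor D E G by fact
  have [simp]: "map (restrict (fob G \<circ> fob F) (Ob C)) (inputs f) = map (fob G \<circ> fob F) (inputs f)" if "f \<in> Maps C" for f
    using F.C.inputs_Ob[OF that] by auto
  have [simp]: "map (restrict (farr G \<circ> farr F) (Arr C)) ps = map (farr G \<circ> farr F) ps" if "into_inputs C ps as" for ps as
    using that by (auto simp: into_inputs_iff in_set_conv_nth)
  show ?thesis
  proof
    fix f ps q assume "f \<in> Maps C" "into_inputs C ps (inputs f)" "q \<in> Arr C" "src q = outcome f"
    then show "fmulti (comp_mmor C G F) (Act C ps q f) =
       Act E (map (farr (comp_mmor C G F)) ps) (farr (comp_mmor C G F) q) (fmulti (comp_mmor C G F) f)"
      using G.fmulti_nat[of "fmulti F f" "map (farr F) ps" "farr F q"] F.into_inputs_farr[of ps "inputs f"]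
      by (simp add: comp_mmor_def F.fmulti_nat)
  next
    fix f i g assume s: "substitutable C f i g"
    then have "f \<in> Maps C" "g \<in> Maps C" by (simp_all add: substitutable_def)
    with s show "fmulti (comp_mmor C G F) (Sub C f i g) =
       Sub E (fmulti (comp_mmor C G F) f) i (fmulti (comp_mmor C G F) g)"
      by (simp add: comp_mmor_def F.fmulti_Sub G.fmulti_Sub F.substitutable_fmulti)
  qed (simp_all add: comp_mmor_def hom_iff mhom_iff F.farr_Comp G.farr_Comp F.fmulti_unary G.fmulti_unary
      F.fmulti_J G.fmulti_J)
qed

lemma braided_multifunctor_id:
  assumes "short_braiding C \<beta>" shows "braided_multifunctor (C, \<beta>) (C, \<beta>) (id_mmor C)"
proof -
  interpret short_braiding C \<beta> by fact
  show ?thesis using multifunctor_id[OF short_skew_multicategory_axioms]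
    by (simp add: braided_multifunctor_def id_mmor_def)
qed

lemma braided_multifunctor_comp:
  assumes F: "braided_multifunctor (C, \<beta>) (D, \<gamma>) F" and G: "braided_multifunctor (D, \<gamma>) (E, \<delta>) G"
    and "short_braiding C \<beta>"
  shows "braided_multifunctor (C, \<beta>) (E, \<delta>) (comp_mmor C G F)"
proof -
  interpret F: multifunctor C D F using F by (simp add: braided_multifunctor_def)
  interpret G: multifunctor D E G using G by (simp add: braided_multifunctor_def)
  interpret C: short_braiding C \<beta> by fact
  show ?thesis
    using F G multifunctor_comp[OF F.multifunctor_axioms G.multifunctor_axioms]
    by (simp add: braided_multifunctor_def comp_mmor_def)
qed

lemma comp_mmor_id:
  assumes F: "multifunctor C D F" "mmor_extensional C F"
  shows "comp_mmor C (id_mmor D) F = F" "comp_mmor C F (id_mmor C) = F"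
proof -
  interpret multifunctor C D F by fact
  show "comp_mmor C (id_mmor D) F = F"
    by (rule mmor_eqI[OF mmor_extensional_id_comp(2) F(2)])
      (simp_all add: comp_mmor_def id_mmor_def)
  show "comp_mmor C F (id_mmor C) = F"
    by (rule mmor_eqI[OF mmor_extensional_id_comp(2) F(2)])
      (simp_all add: comp_mmor_def id_mmor_def)
qed

lemma comp_mmor_assoc:
  assumes "multifunctor C D F"
  shows "comp_mmor C (comp_mmor D H G) F = comp_mmor C H (comp_mmor C G F)"
proof -
  interpret multifunctor C D F by fact
  show ?thesis
    by (rule mmor_eqI[OF mmor_extensional_id_comp(2) mmor_extensional_id_comp(2)])
      (simp_all add: comp_mmor_def)
qed

lemma BrdShSkMulti_simps:
  "(C, \<beta>) \<in> Ob BrdShSkMulti_lr \<longleftrightarrow> left_representable C \<and> short_braiding C \<beta>"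
  "Arrow X Y F \<in> Arr BrdShSkMulti_lr \<longleftrightarrow> X \<in> Ob BrdShSkMulti_lr \<and> Y \<in> Ob BrdShSkMulti_lr \<and>
      braided_multifunctor X Y F \<and> mmor_extensional (fst X) F"
  "Id BrdShSkMulti_lr X = Arrow X X (id_mmor (fst X))"
  "Comp BrdShSkMulti_lr g f = Arrow (src f) (tgt g) (comp_mmor (fst (src f)) (lbl g) (lbl f))"
  by (auto simp: BrdShSkMulti_lr_def short_braiding_def)

lemma BrdShSkMulti_ArrD:
  assumes "f \<in> Arr BrdShSkMulti_lr"
  shows "short_braiding (fst (src f)) (snd (src f))" "short_braiding (fst (tgt f)) (snd (tgt f))"
    "src f \<in> Ob BrdShSkMulti_lr" "tgt f \<in> Ob BrdShSkMulti_lr"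
    "braided_multifunctor (src f) (tgt f) (lbl f)" "mmor_extensional (fst (src f)) (lbl f)"
    "multifunctor (fst (src f)) (fst (tgt f)) (lbl f)"
proof -
  obtain C \<beta> where X: "src f = (C, \<beta>)" by (cases "src f")
  obtain D \<gamma> where Y: "tgt f = (D, \<gamma>)" by (cases "tgt f")
  have "f = Arrow (C, \<beta>) (D, \<gamma>) (lbl f)" using X Y by (cases f) simp
  then have *: "Arrow (C, \<beta>) (D, \<gamma>) (lbl f) \<in> Arr BrdShSkMulti_lr" using assms by simp
  show "short_braiding (fst (src f)) (snd (src f))" "short_braiding (fst (tgt f)) (snd (tgt f))"
    "src f \<in> Ob BrdShSkMulti_lr" "tgt f \<in> Ob BrdShSkMulti_lr"
    "braided_multifunctor (src f) (tgt f) (lbl f)" "mmor_extensional (fst (src f)) (lbl f)"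
    "multifunctor (fst (src f)) (fst (tgt f)) (lbl f)"
    using * by (simp_all add: X Y BrdShSkMulti_simps(1,2) braided_multifunctor_def)
qed

lemma category_BrdShSkMulti: "category (BrdShSkMulti_lr :: (('o, 'm) br_ssmulti, ('o, 'm) mmor) category)"
proof
  fix X :: "('o, 'm) br_ssmulti" assume "X \<in> Ob BrdShSkMulti_lr"
  then show "\<one>\<^bsub>BrdShSkMulti_lr\<^esub> X \<in> hom BrdShSkMulti_lr X X"
    by (cases X) (simp add: hom_iff BrdShSkMulti_simps mmor_extensional_id_comp braided_multifunctor_id)
next
  fix f g :: "(('o, 'm) br_ssmulti, ('o, 'm) mmor) arrow"
  assume fg: "f \<in> Arr BrdShSkMulti_lr" "g \<in> Arr BrdShSkMulti_lr" "tgt f = src g"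
  note f = BrdShSkMulti_ArrD[OF fg(1)] and g = BrdShSkMulti_ArrD[OF fg(2)]
  have "braided_multifunctor (src f) (tgt g) (comp_mmor (fst (src f)) (lbl g) (lbl f))"
    using braided_multifunctor_comp[of "fst (src f)" "snd (src f)" "fst (tgt f)" "snd (tgt f)" "lbl f"
      "fst (tgt g)" "snd (tgt g)" "lbl g"] f g fg(3) by simp
  then show "g \<cdot>\<^bsub>BrdShSkMulti_lr\<^esub> f \<in> hom BrdShSkMulti_lr (src f) (tgt g)"
    using f(3) g(4) by (simp add: hom_iff BrdShSkMulti_simps(2,4) mmor_extensional_id_comp)
next
  fix f :: "(('o, 'm) br_ssmulti, ('o, 'm) mmor) arrow"
  assume "f \<in> Arr BrdShSkMulti_lr"
  note f = BrdShSkMulti_ArrD[OF this]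
  show "\<one>\<^bsub>BrdShSkMulti_lr\<^esub> (tgt f) \<cdot>\<^bsub>BrdShSkMulti_lr\<^esub> f = f" "f \<cdot>\<^bsub>BrdShSkMulti_lr\<^esub> \<one>\<^bsub>BrdShSkMulti_lr\<^esub> (src f) = f"
    using f comp_mmor_id[OF f(7,6)] by (simp_all add: BrdShSkMulti_simps(3,4))
next
  fix f g h :: "(('o, 'm) br_ssmulti, ('o, 'm) mmor) arrow"
  assume fg: "f \<in> Arr BrdShSkMulti_lr" "g \<in> Arr BrdShSkMulti_lr" "h \<in> Arr BrdShSkMulti_lr" "tgt f = src g" "tgt g = src h"
  then show "(h \<cdot>\<^bsub>BrdShSkMulti_lr\<^esub> g) \<cdot>\<^bsub>BrdShSkMulti_lr\<^esub> f = h \<cdot>\<^bsub>BrdShSkMulti_lr\<^esub> (g \<cdot>\<^bsub>BrdShSkMulti_lr\<^esub> f)"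
    using comp_mmor_assoc[OF BrdShSkMulti_ArrD(7)[OF fg(1)], of "lbl h" "lbl g"] by (simp add: BrdShSkMulti_simps(4))
qed (auto dest: BrdShSkMulti_ArrD)

lemma K_lax_id:
  assumes "represented_multicategory C R"
  shows "K_lax C R C R (id_mmor C) = id_laxmor (K_skmon C R)"
proof -
  interpret C: represented_multicategory C R by fact
  interpret multifunctor C C "id_mmor C" by (rule multifunctor_id) unfold_locales
  interpret represented_multifunctor C C "id_mmor C" R R ..
  show ?thesis
  proof (rule laxmor_eqI[OF K_extensional laxmor_extensional_id_comp(1)])
    have "lax0 K = \<one>\<^bsub>C\<^esub> C.unit" by (rule K_lax0_eqI) (simp_all add: id_mmor_def)
    then show "lax0 K = lax0 (id_laxmor (K_skmon C R))" by (simp add: id_laxmor_def)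
  next
    fix a b assume "a \<in> Ob (K_skmon C R)" "b \<in> Ob (K_skmon C R)"
    then have ab: "a \<in> Ob C" "b \<in> Ob C" by simp_all
    have "lax2 K a b = \<one>\<^bsub>C\<^esub> (K_tens R a b)" by (rule K_lax2_eqI) (simp_all add: ab id_mmor_def)
    then show "lax2 K a b = lax2 (id_laxmor (K_skmon C R)) a b" using ab by (simp add: id_laxmor_def)
  qed (simp_all add: mmor_extensional_id_comp, simp_all add: id_mmor_def id_laxmor_def)
qed

text \<open>
  The comparison maps of the composite have the universal property that defines those of
  \<open>K (G \<circ> F)\<close>.
\<close>

lemma K_lax_comp:
  assumes R: "represented_multicategory C R" and S: "represented_multicategory D S" and T: "represented_multicategory E T"
    and F: "multifunctor C D F" and G: "multifunctor D E G"
  shows "K_lax C R E T (comp_mmor C G F) = comp_laxmor (K_skmon C R) (K_skmon E T) (K_lax D S E T G) (K_lax C R D S F)"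
proof -
  interpret C: represented_multicategory C R by fact
  interpret D: represented_multicategory D S by fact
  interpret E: represented_multicategory E T by fact
  interpret F: multifunctor C D F by fact
  interpret G: multifunctor D E G by fact
  interpret F: represented_multifunctor C D F R S ..
  interpret G: represented_multifunctor D E G S T ..
  interpret GF: multifunctor C E "comp_mmor C G F" by (rule multifunctor_comp[OF F G])
  interpret GF: represented_multifunctor C E "comp_mmor C G F" R T ..
  have [simp]: "fob (comp_mmor C G F) a = fob G (fob F a)" if "a \<in> Ob C" for a using that by (simp add: comp_mmor_def)
  have [simp]: "fmulti (comp_mmor C G F) f = fmulti G (fmulti F f)" if "f \<in> Maps C" for f using that by (simp add: comp_mmor_def)
  show ?thesis
  proof (rule laxmor_eqI[OF GF.K_extensional laxmor_extensional_id_comp(2)])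
    have "lax0 GF.K = farr G (lax0 F.K) \<cdot>\<^bsub>E\<^esub> lax0 G.K"
      by (rule GF.K_lax0_eqI) (simp_all add: E.post_Comp G.post_lax0 F.post_lax0 flip: G.fmulti_post)
    then show "lax0 GF.K = lax0 (comp_laxmor (K_skmon C R) (K_skmon E T) G.K F.K)"
      by (simp add: comp_laxmor_def)
  next
    fix a b assume "a \<in> Ob (K_skmon C R)" "b \<in> Ob (K_skmon C R)"
    then have ab: "a \<in> Ob C" "b \<in> Ob C" by simp_all
    have "lax2 GF.K a b = farr G (lax2 F.K a b) \<cdot>\<^bsub>E\<^esub> lax2 G.K (fob F a) (fob F b)"
      by (rule GF.K_lax2_eqI) (simp_all add: ab E.post_Comp G.post_lax2 F.post_lax2 flip: G.fmulti_post)
    then show "lax2 GF.K a b = lax2 (comp_laxmor (K_skmon C R) (K_skmon E T) G.K F.K) a b"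
      using ab by (simp add: comp_laxmor_def)
  qed (simp_all add: mmor_extensional_id_comp, simp_all add: comp_mmor_def comp_laxmor_def)
qed

lemma BrdShSkMulti_represented:
  assumes "choice_of_representations ch" "X \<in> Ob BrdShSkMulti_lr"
  shows "represented_braided_multicategory (fst X) (ch (fst X)) (snd X)"
proof -
  obtain C \<beta> where X: "X = (C, \<beta>)" by (cases X)
  then have C: "left_representable C" "short_braiding C \<beta>" using assms(2) by (simp_all add: BrdShSkMulti_simps)
  interpret short_braiding C \<beta> by fact
  have "left_representation C (ch C)"
    using assms(1) C(1) short_skew_multicategory_axioms by (simp add: choice_of_representations_def)
  then show ?thesis using X by simp unfold_locales
qed

lemma functor_K_brd:
  fixes ch :: "('o, 'm) ssmulti \<Rightarrow> ('o, 'm) lrep"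
  assumes ch: "choice_of_representations ch"
  shows "functor_on BrdShSkMulti_lr BrdSkMon (K_brd ch)"
proof -
  note rep = BrdShSkMulti_represented[OF ch]
  interpret A: category BrdShSkMulti_lr by (rule category_BrdShSkMulti)
  interpret B: category BrdSkMon by (rule category_BrdSkMon)
  have ob: "K_ob ch X \<in> Ob BrdSkMon" if "X \<in> Ob BrdShSkMulti_lr" for X :: "('o, 'm) br_ssmulti"
    using represented_braided_multicategory.skew_braiding_K_braid[OF rep[OF that]]
    by (simp add: K_ob_def BrdSkMon_simps)
  show ?thesis
  proof
    fix f :: "(('o, 'm) br_ssmulti, ('o, 'm) mmor) arrow" assume f: "f \<in> Arr BrdShSkMulti_lr"
    note fD = BrdShSkMulti_ArrD[OF f]
    interpret C: represented_braided_multicategory "fst (src f)" "ch (fst (src f))" "snd (src f)" using rep[OF fD(3)] .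
    interpret D: represented_braided_multicategory "fst (tgt f)" "ch (fst (tgt f))" "snd (tgt f)" using rep[OF fD(4)] .
    interpret multifunctor "fst (src f)" "fst (tgt f)" "lbl f" using fD(7) .
    interpret represented_multifunctor "fst (src f)" "fst (tgt f)" "lbl f" "ch (fst (src f))" "ch (fst (tgt f))" ..
    have "braided_lax_monoidal (K_ob ch (src f)) (K_ob ch (tgt f)) K"
      using braided_lax_monoidal_K[OF rep[OF fD(3)] rep[OF fD(4)], of "lbl f"] fD(5) by (simp add: K_ob_def)
    then show "farr (K_brd ch) f \<in> hom BrdSkMon (fob (K_brd ch) (src f)) (fob (K_brd ch) (tgt f))"
      using ob[OF fD(3)] ob[OF fD(4)] K_extensional[OF fD(6)]
      by (simp add: hom_iff K_brd_def BrdSkMon_simps(2)) (simp add: K_ob_def)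
  next
    fix X :: "('o, 'm) br_ssmulti" assume "X \<in> Ob BrdShSkMulti_lr"
    from rep[OF this] interpret C: represented_braided_multicategory "fst X" "ch (fst X)" "snd X" .
    show "farr (K_brd ch) (\<one>\<^bsub>BrdShSkMulti_lr\<^esub> X) = \<one>\<^bsub>BrdSkMon\<^esub> (fob (K_brd ch) X)"
      using K_lax_id[OF C.represented_multicategory_axioms]
      by (simp add: K_brd_def BrdShSkMulti_simps(3) BrdSkMon_simps(3) K_ob_def)
  next
    fix f g :: "(('o, 'm) br_ssmulti, ('o, 'm) mmor) arrow"
    assume fg: "f \<in> Arr BrdShSkMulti_lr" "g \<in> Arr BrdShSkMulti_lr" "tgt f = src g"
    note f = BrdShSkMulti_ArrD[OF fg(1)] and g = BrdShSkMulti_ArrD[OF fg(2)]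
    have *: "represented_multicategory (fst X) (ch (fst X))" if "X \<in> Ob BrdShSkMulti_lr" for X :: "('o, 'm) br_ssmulti"
      using rep[OF that] by (simp add: represented_braided_multicategory_def)
    show "farr (K_brd ch) (g \<cdot>\<^bsub>BrdShSkMulti_lr\<^esub> f) = farr (K_brd ch) g \<cdot>\<^bsub>BrdSkMon\<^esub> farr (K_brd ch) f"
      using K_lax_comp[OF *[OF f(3)] *[OF f(4)] *[OF g(4)] f(7), of "lbl g"] g(7) fg(3)
      by (simp add: K_brd_def BrdShSkMulti_simps(4) BrdSkMon_simps(4) K_ob_def)
  qed (simp add: K_brd_def ob)
qed

section \<open>Invertibility of the constraints\<close>

context skew_monoidal
begin

lemma invertible_TensA:
  assumes "invertible_arrow M f" "invertible_arrow M g"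
  shows "invertible_arrow M (f \<star> g)"
proof -
  obtain f' g' where i: "inverse_arrows M f f'" "inverse_arrows M g g'"
    using assms by (auto simp: invertible_arrow_def)
  note f = inverse_arrowsD[OF i(1)] and g = inverse_arrowsD[OF i(2)]
  have "inverse_arrows M (f \<star> g) (f' \<star> g')"
    using f g by (simp add: inverse_arrows_def hom_iff flip: TensA_Comp)
  then show ?thesis by (auto simp: invertible_arrow_def)
qed

end

context skew_braiding
begin

context
  assumes LUnit_inv: "\<And>a. a \<in> Ob M \<Longrightarrow> invertible_arrow M (\<l> a)"
begin

text \<open>
  The equation \<open>\<lambda> \<cdot> \<alpha> = \<lambda> \<star> 1\<close> settles the associativity arrows whose first object is the unit.
\<close>

lemma Assoc_Unit_invertible:
  assumes [simp]: "a \<in> Ob M" "b \<in> Ob M"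
  shows "invertible_arrow M (\<alpha> \<I> a b)"
  by (rule invertible_cancel_left[of "\<l> (a \<otimes> b)"]) (simp_all add: LUnit_Assoc LUnit_inv invertible_TensA)

text \<open>
  The axiom \<open>s_Assoc_1\<close> at the unit expresses \<open>\<alpha>\<close> with first object \<open>\<I> \<otimes> a\<close> through invertible arrows;
  naturality along the isomorphism \<open>\<l> a\<close> replaces \<open>\<I> \<otimes> a\<close> by \<open>a\<close>.
\<close>

lemma Assoc_invertible:
  assumes [simp]: "a \<in> Ob M" "b \<in> Ob M" "c \<in> Ob M"
  shows "invertible_arrow M (\<alpha> a b c)"
proof -
  have "invertible_arrow M (s \<I> a (b \<otimes> c) \<cdot> \<alpha> (\<I> \<otimes> a) b c)"
    by (simp add: s_Assoc_1 invertible_Comp invertible_TensA s_invertible Assoc_Unit_invertible)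
  then have "invertible_arrow M (\<alpha> (\<I> \<otimes> a) b c)"
    by (rule invertible_cancel_left) (simp_all add: s_invertible)
  then have "invertible_arrow M (\<alpha> a b c \<cdot> (\<l> a \<star> \<one> b \<star> \<one> c))"
    using Assoc_nat[of "\<l> a" "\<one> b" "\<one> c"] by (simp add: invertible_Comp invertible_TensA LUnit_inv)
  then show ?thesis
    by (rule invertible_cancel_right) (simp_all add: invertible_TensA LUnit_inv)
qed

text \<open>
  The triangle equation makes \<open>\<r> a \<star> \<one> \<I>\<close> invertible, and by naturality of \<open>\<l>\<close> also
  \<open>\<one> \<I> \<star> \<r> a \<star> \<one> \<I>\<close>. Naturality of \<open>s\<close> moves \<open>\<r> a\<close> to the last of these three positions, where the
  units in front of it are removed by naturality of \<open>\<l>\<close>.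
\<close>

lemma RUnit_invertible:
  assumes [simp]: "a \<in> Ob M"
  shows "invertible_arrow M (\<r> a)"
proof -
  have "invertible_arrow M (((\<one> a \<star> \<l> \<I>) \<cdot> \<alpha> a \<I> \<I>) \<cdot> (\<r> a \<star> \<one> \<I>))"
    using triangle[of a \<I>] by simp
  then have "invertible_arrow M (\<r> a \<star> \<one> \<I>)"
    by (rule invertible_cancel_left) (simp_all add: invertible_Comp invertible_TensA LUnit_inv Assoc_invertible)
  from invertible_Comp[OF _ this, of "\<l> a \<star> \<one> \<I>"]
  have "invertible_arrow M ((\<r> a \<star> \<one> \<I>) \<cdot> (\<l> a \<star> \<one> \<I>))"
    by (simp add: invertible_TensA LUnit_inv)
  moreover have "(\<l> (a \<otimes> \<I>) \<star> \<one> \<I>) \<cdot> ((\<one> \<I> \<star> \<r> a) \<star> \<one> \<I>) = (\<r> a \<star> \<one> \<I>) \<cdot> (\<l> a \<star> \<one> \<I>)"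
    using LUnit_nat[of "\<r> a"] by (simp flip: TensA_Comp_left)
  ultimately have "invertible_arrow M ((\<l> (a \<otimes> \<I>) \<star> \<one> \<I>) \<cdot> ((\<one> \<I> \<star> \<r> a) \<star> \<one> \<I>))"
    by simp
  then have "invertible_arrow M ((\<one> \<I> \<star> \<r> a) \<star> \<one> \<I>)"
    by (rule invertible_cancel_left) (simp_all add: invertible_TensA LUnit_inv)
  then have "invertible_arrow M (s \<I> (a \<otimes> \<I>) \<I> \<cdot> ((\<one> \<I> \<star> \<r> a) \<star> \<one> \<I>))"
    by (intro invertible_Comp) (simp_all add: s_invertible)
  then have "invertible_arrow M ((\<one> (\<I> \<otimes> \<I>) \<star> \<r> a) \<cdot> s \<I> a \<I>)"
    using s_nat[of "\<one> \<I>" "\<r> a" "\<one> \<I>"] by simp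
  then have "invertible_arrow M (\<one> (\<I> \<otimes> \<I>) \<star> \<r> a)"
    by (rule invertible_cancel_right) (simp_all add: s_invertible)
  then have "invertible_arrow M ((\<l> \<I> \<star> \<one> (a \<otimes> \<I>)) \<cdot> (\<one> (\<I> \<otimes> \<I>) \<star> \<r> a))"
    by (intro invertible_Comp) (simp_all add: invertible_TensA LUnit_inv)
  then have "invertible_arrow M ((\<one> \<I> \<star> \<r> a) \<cdot> (\<l> \<I> \<star> \<one> a))"
    by (simp flip: TensA_Comp)
  then have "invertible_arrow M (\<one> \<I> \<star> \<r> a)"
    by (rule invertible_cancel_right) (simp_all add: invertible_TensA LUnit_inv)
  then have "invertible_arrow M (\<l> (a \<otimes> \<I>) \<cdot> (\<one> \<I> \<star> \<r> a))"
    by (intro invertible_Comp) (simp_all add: LUnit_inv)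
  then have "invertible_arrow M (\<r> a \<cdot> \<l> a)"
    using LUnit_nat[of "\<r> a"] by simp
  then show ?thesis
    by (rule invertible_cancel_right) (simp_all add: LUnit_inv)
qed

lemma invertible_constraints_if_LUnit: "invertible_constraints M"
  by (simp add: invertible_constraints_def LUnit_inv Assoc_invertible RUnit_invertible)

end

end

context short_skew_multicategory
begin

text \<open>
  The loose maps of arity one and two are exactly the images of tight ones under \<open>j\<close>.
\<close>

lemma tight_eq_looseD:
  assumes "tight_eq_loose C"
  shows "f \<in> Maps C \<Longrightarrow> mode f = Tight \<Longrightarrow> arity f = Suc 0 \<or> arity f = 2 \<Longrightarrow> \<j> f = as_loose f"
    and "g \<in> Maps C \<Longrightarrow> mode g = Loose \<Longrightarrow> arity g = Suc 0 \<or> arity g = 2 \<Longrightarrow>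
      \<exists>f. f \<in> Maps C \<and> mode f = Tight \<and> inputs f = inputs g \<and> g = \<j> f"
proof -
  have a: "mhom C Loose (inputs f) (outcome f) = as_loose ` mhom C Tight (inputs f) (outcome f) \<and>
        (\<forall>h \<in> mhom C Tight (inputs f) (outcome f). J C h = as_loose h)" if "arity f = Suc 0 \<or> arity f = 2" for f
    using assms that unfolding tight_eq_loose_def by auto
  show "\<j> f = as_loose f" if "f \<in> Maps C" "mode f = Tight" "arity f = Suc 0 \<or> arity f = 2"
    using a[OF that(3)] that(1,2) by (simp add: mhom_iff)
  show "\<exists>f. f \<in> Maps C \<and> mode f = Tight \<and> inputs f = inputs g \<and> g = \<j> f"
    if "g \<in> Maps C" "mode g = Loose" "arity g = Suc 0 \<or> arity g = 2"
  proof -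
    have "g \<in> as_loose ` mhom C Tight (inputs g) (outcome g)"
      using a[OF that(3)] that(1,2) by (auto simp: mhom_iff)
    then obtain f where f: "f \<in> mhom C Tight (inputs g) (outcome g)" "g = as_loose f" by blast
    moreover have "\<j> f = as_loose f" using a[OF that(3)] f(1) by blast
    ultimately show ?thesis unfolding mhom_iff by metis
  qed
qed

lemma as_loose_inj:
  "as_loose f = as_loose g \<Longrightarrow> mode f = Tight \<Longrightarrow> mode g = Tight \<Longrightarrow> f = g"
  by (cases f; cases g) (simp add: as_loose_def)

lemma J_inj:
  assumes "tight_eq_loose C" "\<j> f = \<j> g" "f \<in> Maps C" "mode f = Tight" "arity f = Suc 0 \<or> arity f = 2"
    "g \<in> Maps C" "mode g = Tight" "arity g = Suc 0 \<or> arity g = 2"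
  shows "f = g"
  using assms tight_eq_looseD(1)[OF assms(1)] as_loose_inj by metis

lemma loose_unary_is_J:
  assumes "tight_eq_loose C" "g \<in> Maps C" "mode g = Loose" "arity g = Suc 0"
  obtains p where "p \<in> Arr C" "g = \<j> (to_multi p)"
proof -
  obtain f where f: "f \<in> Maps C" "mode f = Tight" "inputs f = inputs g" "g = \<j> f"
    using tight_eq_looseD(2)[OF assms(1-3)] assms(4) by blast
  have "arity f = Suc 0" using f(3) assms(4) by simp
  from unary_is_arrow[OF f(1,2) this] show thesis using f(4) that by metis
qed

end

context represented_multicategory
begin

text \<open>
  The inverse of \<open>\<lambda>\<close> is the arrow underlying the loose unary map \<open>\<theta> \<circ>\<^sub>1 u\<close>.
\<close>

lemma K_lunit_inverse:
  assumes tl: "tight_eq_loose C" and a: "a \<in> Ob C"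
  obtains e where "inverse_arrows C (K_lunit C R a) e" "Sub C (\<Theta> I a) 1 \<upsilon> = \<j> (to_multi e)"
proof -
  let ?v = "Sub C (\<Theta> I a) 1 \<upsilon>"
  have v: "?v \<in> Maps C" "mode ?v = Loose" "arity ?v = Suc 0" using a by simp_all
  obtain e where e: "e \<in> Arr C" "?v = \<j> (to_multi e)" using loose_unary_is_J[OF tl v] .
  have src: "src e = a" using arg_cong[OF e(2), of inputs] e(1) a by simp
  have tgt: "tgt e = I \<odot> a" using arg_cong[OF e(2), of outcome] e(1) a by simp
  have "\<j> (to_multi (K_lunit C R a \<cdot> e)) = \<j> (to_multi (\<one> a))"
    using post_lunit[OF a] e src tgt a by (simp add: post_J_arrow)
  from J_inj[OF tl this] have le: "K_lunit C R a \<cdot> e = \<one> a" using e(1) src tgt a by simp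
  have "post C (e \<cdot> K_lunit C R a) ?v = post C (\<one> (I \<odot> a)) ?v"
    using post_lunit[OF a] e src tgt a le by (simp add: post_Comp post_J_arrow)
  from cancel_Loose1[OF this a] have "e \<cdot> K_lunit C R a = \<one> (I \<odot> a)" using e(1) src tgt a by simp
  with le have "inverse_arrows C (K_lunit C R a) e" using e(1) src tgt a by (simp add: inverse_arrows_def hom_iff)
  then show thesis using e(2) by (rule that)
qed

end

context represented_braided_multicategory
begin

lemma invertible_constraints_K:
  assumes "tight_eq_loose C"
  shows "invertible_constraints (K_skmon C R)"
proof -
  interpret K: skew_braiding "K_skmon C R" s by (rule skew_braiding_K_braid)
  show ?thesis
  proof (rule K.invertible_constraints_if_LUnit)
    fix a assume "a \<in> Ob (K_skmon C R)"
    then have a: "a \<in> Ob C" by simp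
    obtain e where "inverse_arrows C (K_lunit C R a) e" using K_lunit_inverse[OF assms a] .
    then show "invertible_arrow (K_skmon C R) (LUnit (K_skmon C R) a)"
      by (auto simp: invertible_arrow_def[of C])
  qed
qed

end

section \<open>Faithfulness\<close>

text \<open>
  The universal maps and postcomposition generate all multimaps, and the lax structure of \<open>K F\<close> records
  the values of \<open>F\<close> on \<open>\<theta>\<close> and \<open>u\<close>.
\<close>

lemma fmulti_eqI:
  assumes F: "represented_multifunctor C D F R S" and G: "represented_multifunctor C D G R S"
    and K: "K_lax C R D S F = K_lax C R D S G" and f: "f \<in> Maps C"
  shows "fmulti F f = fmulti G f"
proof -
  interpret F: represented_multifunctor C D F R S by fact
  interpret G: represented_multifunctor C D G R S by fact
  have fctr [simp]: "fob F = fob G" "farr F = farr G"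
    using arg_cong[OF K, of fob] arg_cong[OF K, of farr] by simp_all
  have theta: "fmulti F (F.C.\<Theta> a b) = fmulti G (F.C.\<Theta> a b)" if "a \<in> Ob C" "b \<in> Ob C" for a b
    using F.post_lax2[OF that] G.post_lax2[OF that] K by simp
  have u: "fmulti F F.C.\<upsilon> = fmulti G F.C.\<upsilon>"
    using F.post_lax0 G.post_lax0 K by simp
  have theta3: "fmulti F (F.C.\<Theta>3 a b c) = fmulti G (F.C.\<Theta>3 a b c)" if "a \<in> Ob C" "b \<in> Ob C" "c \<in> Ob C" for a b c
    using that by (simp add: F.C.\<Theta>3_def F.fmulti_Sub G.fmulti_Sub theta)
  have theta4: "fmulti F (F.C.\<Theta>4 a b c d) = fmulti G (F.C.\<Theta>4 a b c d)"
    if "a \<in> Ob C" "b \<in> Ob C" "c \<in> Ob C" "d \<in> Ob C" for a b c d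
    using that by (simp add: F.C.\<Theta>4_def F.fmulti_Sub G.fmulti_Sub theta theta3)
  have tight: "fmulti F f = fmulti G f" if f: "f \<in> Maps C" "mode f = Tight" for f
    using f by (cases rule: F.C.tight_cases)
      (simp_all add: F.fmulti_unary G.fmulti_unary F.fmulti_post G.fmulti_post theta theta3 theta4)
  show ?thesis
  proof (cases "mode f")
    case Tight
    with f show ?thesis by (rule tight)
  next
    case Loose
    show ?thesis
    proof (cases "inputs f = []")
      case True
      obtain p where "p \<in> Arr C" "src p = K_unit R" "f = post C p F.C.\<upsilon>"
        using F.C.factor_u[OF f Loose True] .
      then show ?thesis by (simp add: F.fmulti_post G.fmulti_post u)
    next
      case False
      then have "arity f \<noteq> 0" by simp
      then have ar: "arity f = 1 \<or> arity f = 2"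
        using F.C.loose_arity[OF f Loose] by arith
      obtain g where g: "g \<in> Maps C" "mode g = Tight" "inputs g = K_unit R # inputs f" "f = Sub C g 1 F.C.\<upsilon>"
        using F.C.factor_Sub_u[OF f Loose ar] .
      have "substitutable C g 1 F.C.\<upsilon>" using g(1-3) ar by auto
      then show ?thesis
        unfolding g(4) using tight[OF g(1,2)] u by (simp add: F.fmulti_Sub G.fmulti_Sub del: F.C.subst_simps)
    qed
  qed
qed

section \<open>Fullness\<close>

context short_skew_multicategory
begin

text \<open>
  The action on \<open>g \<circ>\<^sub>1 t'\<close> is reduced to the action on \<open>g\<close>, which has one input fewer, whenever the
  action of \<open>x\<close> and \<open>y\<close> on \<open>t'\<close> is represented by an arrow \<open>w\<close>. It applies to the universal maps of the
  source and equally to their images in the target.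
\<close>

lemma Act_Sub_first:
  assumes g: "g \<in> Maps C" "mode g = Tight" "inputs g = outcome t' # bs" "length bs = 1 \<or> length bs = 2"
    and t: "t \<in> Maps C" "mode t = Tight" "arity t = 2" and t': "t' \<in> Maps C" "mode t' = Tight" "arity t' = 2"
    and w: "w \<in> Arr C" "src w = outcome t" "tgt w = outcome t'"
    and xy: "into_inputs C [x, y] (inputs t')" "post C w t = Act C [x, y] (\<one> (outcome t')) t'"
    and zs: "into_inputs C zs bs" and q: "q \<in> Arr C" "src q = outcome g"
  shows "Act C (x # y # zs) q (Sub C g (Suc 0) t') = Sub C (Act C (w # zs) q g) (Suc 0) t"
proof -
  have o: "outcome t' \<in> Ob C" using t' by simp
  have sh: "(Tight, Suc (length bs), Tight, 2) \<in> sub_shapes" using g(4) by (auto simp: sub_shapes_def)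
  have bs: "length bs = length zs" using zs by (simp add: into_inputs_iff)
  let ?g = "Act C (\<one> (outcome t') # zs) q g"
  have "Act C (x # y # zs) q (Sub C g (Suc 0) t') = Sub C ?g (Suc 0) (Act C [x, y] (\<one> (outcome t')) t')"
    using Sub_nat[of g "Suc 0" t' "\<one> (outcome t') # zs" "[x, y]" q] assms sh o
    by (simp add: substitutable_def)
  also have "\<dots> = Sub C (pre C ?g (Suc 0) w) (Suc 0) t"
    unfolding xy(2)[symmetric] using assms sh o bs by (intro Sub_post) simp_all
  also have "pre C ?g (Suc 0) w = Act C (w # zs) q g"
  proof -
    have "map2 (\<cdot>) zs (map (\<lambda>z. \<one> (src z)) zs) = zs"
      using zs by (auto simp: into_inputs_iff intro!: nth_equalityI)
    moreover have "into_inputs C (map (\<lambda>z. \<one> (src z)) zs) (map src zs)"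
      using zs by (auto simp: into_inputs_iff)
    ultimately show ?thesis
      using assms o by (simp add: pre_def Act_Act o_def)
  qed
  finally show ?thesis .
qed

end

locale lax_lift = C: represented_multicategory C R + D: represented_multicategory D S +
    lax_monoidal "K_skmon C R" "K_skmon D S" \<phi>
  for C D :: "('o, 'm) ssmulti" and R S \<phi> +
  assumes tight_loose_C: "tight_eq_loose C" and tight_loose_D: "tight_eq_loose D"
begin

no_notation C.tens (infixl "\<odot>" 80) and D.tens (infixl "\<odot>" 80)
  and C.tensA (infixl "\<odot>\<^sub>1" 80) and D.tensA (infixl "\<odot>\<^sub>1" 80)
  and C.unit ("I") and D.unit ("I")
notation C.tens (infixl "\<otimes>" 80) and D.tens (infixl "\<otimes>''" 80)
  and C.tensA (infixl "\<star>" 80) and D.tensA (infixl "\<star>''" 80)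
  and C.unit ("I")

abbreviation p1 where "p1 \<equiv> farr \<phi>"
abbreviation p0 where "p0 \<equiv> fob \<phi>"

lemma phi_simps [simp]:
  "a \<in> Ob C \<Longrightarrow> p0 a \<in> Ob D"
  "f \<in> Arr C \<Longrightarrow> p1 f \<in> Arr D" "f \<in> Arr C \<Longrightarrow> src (p1 f) = p0 (src f)" "f \<in> Arr C \<Longrightarrow> tgt (p1 f) = p0 (tgt f)"
  "a \<in> Ob C \<Longrightarrow> p1 (\<one>\<^bsub>C\<^esub> a) = \<one>\<^bsub>D\<^esub> (p0 a)"
  "lax0 \<phi> \<in> Arr D" "src (lax0 \<phi>) = D.unit" "tgt (lax0 \<phi>) = p0 I"
  "a \<in> Ob C \<Longrightarrow> b \<in> Ob C \<Longrightarrow> lax2 \<phi> a b \<in> Arr D"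
  "a \<in> Ob C \<Longrightarrow> b \<in> Ob C \<Longrightarrow> src (lax2 \<phi> a b) = p0 a \<otimes>' p0 b"
  "a \<in> Ob C \<Longrightarrow> b \<in> Ob C \<Longrightarrow> tgt (lax2 \<phi> a b) = p0 (a \<otimes> b)"
  using fob_Ob farr_simps farr_Id lax0_simps lax2_simps by simp_all

lemma p1_Comp: "f \<in> Arr C \<Longrightarrow> g \<in> Arr C \<Longrightarrow> tgt f = src g \<Longrightarrow> p1 (g \<cdot>\<^bsub>C\<^esub> f) = p1 g \<cdot>\<^bsub>D\<^esub> p1 f"
  using farr_Comp[of f g] by simp

lemma into_inputs_p1: "into_inputs C ps as \<Longrightarrow> into_inputs D (map p1 ps) (map p0 as)"
  by (auto simp: into_inputs_iff)

text \<open>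
  The prescribed images of the universal maps under the multifunctor to be constructed.
\<close>

definition \<Phi>2 where "\<Phi>2 a b = post D (lax2 \<phi> a b) (D.\<Theta> (p0 a) (p0 b))"
definition \<Phi>0 where "\<Phi>0 = post D (lax0 \<phi>) D.\<upsilon>"
definition \<Phi>3 where "\<Phi>3 a b c = Sub D (\<Phi>2 (a \<otimes> b) c) 1 (\<Phi>2 a b)"
definition \<Phi>4 where "\<Phi>4 a b c d = Sub D (\<Phi>2 (a \<otimes> b \<otimes> c) d) 1 (\<Phi>3 a b c)"

lemma Phi_simps [simp]:
  "\<Phi>0 \<in> Maps D" "mode \<Phi>0 = Loose" "inputs \<Phi>0 = []" "outcome \<Phi>0 = p0 I"
  "a \<in> Ob C \<Longrightarrow> b \<in> Ob C \<Longrightarrow> \<Phi>2 a b \<in> Maps D"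
  "a \<in> Ob C \<Longrightarrow> b \<in> Ob C \<Longrightarrow> mode (\<Phi>2 a b) = Tight"
  "a \<in> Ob C \<Longrightarrow> b \<in> Ob C \<Longrightarrow> inputs (\<Phi>2 a b) = [p0 a, p0 b]"
  "a \<in> Ob C \<Longrightarrow> b \<in> Ob C \<Longrightarrow> outcome (\<Phi>2 a b) = p0 (a \<otimes> b)"
  by (simp_all add: \<Phi>0_def \<Phi>2_def)

lemma Phi3_simps [simp]:
  assumes "a \<in> Ob C" "b \<in> Ob C" "c \<in> Ob C"
  shows "\<Phi>3 a b c \<in> Maps D" "mode (\<Phi>3 a b c) = Tight" "inputs (\<Phi>3 a b c) = [p0 a, p0 b, p0 c]"
    "outcome (\<Phi>3 a b c) = p0 (a \<otimes> b \<otimes> c)"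
  using assms by (simp_all add: \<Phi>3_def)

lemma Phi4_simps [simp]:
  assumes "a \<in> Ob C" "b \<in> Ob C" "c \<in> Ob C" "d \<in> Ob C"
  shows "\<Phi>4 a b c d \<in> Maps D" "mode (\<Phi>4 a b c d) = Tight" "inputs (\<Phi>4 a b c d) = [p0 a, p0 b, p0 c, p0 d]"
    "outcome (\<Phi>4 a b c d) = p0 (a \<otimes> b \<otimes> c \<otimes> d)"
  using assms by (simp_all add: \<Phi>4_def)

lemma Phi4_alt:
  assumes "a \<in> Ob C" "b \<in> Ob C" "c \<in> Ob C" "d \<in> Ob C"
  shows "\<Phi>4 a b c d = Sub D (\<Phi>3 (a \<otimes> b) c d) 1 (\<Phi>2 a b)"
  using assms D.assoc_nested_22(1)[of "\<Phi>2 (a \<otimes> b \<otimes> c) d" "\<Phi>2 (a \<otimes> b) c" "\<Phi>2 a b"]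
  by (simp add: \<Phi>4_def \<Phi>3_def)

lemma Phi2_natural:
  assumes "f \<in> Arr C" "g \<in> Arr C"
  shows "post D (p1 (f \<star> g)) (\<Phi>2 (src f) (src g)) = Act D [p1 f, p1 g] (\<one>\<^bsub>D\<^esub> (p0 (tgt f \<otimes> tgt g))) (\<Phi>2 (tgt f) (tgt g))"
proof -
  have "p1 (f \<star> g) \<cdot>\<^bsub>D\<^esub> lax2 \<phi> (src f) (src g) = lax2 \<phi> (tgt f) (tgt g) \<cdot>\<^bsub>D\<^esub> (p1 f \<star>' p1 g)"
    using lax2_nat[of f g] assms by simp
  then have "post D (p1 (f \<star> g)) (\<Phi>2 (src f) (src g)) = post D (lax2 \<phi> (tgt f) (tgt g) \<cdot>\<^bsub>D\<^esub> (p1 f \<star>' p1 g)) (D.\<Theta> (p0 (src f)) (p0 (src g)))"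
    using assms by (simp add: \<Phi>2_def D.post_post)
  also have "\<dots> = Act D [p1 f, p1 g] (\<one>\<^bsub>D\<^esub> (p0 (tgt f \<otimes> tgt g))) (\<Phi>2 (tgt f) (tgt g))"
    using assms by (simp add: \<Phi>2_def D.post_Comp D.post_tensA_theta D.post_Act D.Act_post)
  finally show ?thesis .
qed

text \<open>
  The compatibility of \<open>\<phi>\<close> with \<open>\<alpha>\<close>, in terms of multimaps.
\<close>

lemma Phi3_assoc:
  assumes ob: "a \<in> Ob C" "b \<in> Ob C" "c \<in> Ob C"
  shows "post D (p1 (K_assoc C R a b c)) (\<Phi>3 a b c) = Sub D (\<Phi>2 a (b \<otimes> c)) 2 (\<Phi>2 b c)"
proof -
  let ?\<theta> = "D.\<Theta>3 (p0 a) (p0 b) (p0 c)"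
  have "\<Phi>3 a b c = post D (lax2 \<phi> (a \<otimes> b) c \<cdot>\<^bsub>D\<^esub> (lax2 \<phi> a b \<star>' \<one>\<^bsub>D\<^esub> (p0 c))) ?\<theta>"
    using ob by (simp add: \<Phi>3_def \<Phi>2_def D.post_Comp D.\<Theta>3_def D.post_tensA_Sub_left, simp add: D.post_Sub)
  then have "post D (p1 (K_assoc C R a b c)) (\<Phi>3 a b c) =
    post D (p1 (K_assoc C R a b c) \<cdot>\<^bsub>D\<^esub> lax2 \<phi> (a \<otimes> b) c \<cdot>\<^bsub>D\<^esub> (lax2 \<phi> a b \<star>' \<one>\<^bsub>D\<^esub> (p0 c))) ?\<theta>"
    using ob by (simp add: D.post_post)
  also have "\<dots> = post D (lax2 \<phi> a (b \<otimes> c) \<cdot>\<^bsub>D\<^esub> (\<one>\<^bsub>D\<^esub> (p0 a) \<star>' lax2 \<phi> b c) \<cdot>\<^bsub>D\<^esub> K_assoc D S (p0 a) (p0 b) (p0 c)) ?\<theta>"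
    using lax_Assoc[of a b c] ob by simp
  also have "\<dots> = Sub D (\<Phi>2 a (b \<otimes> c)) 2 (\<Phi>2 b c)"
    using ob by (simp add: D.post_Comp D.post_assoc D.post_tensA_Sub_right \<Phi>2_def, simp add: D.post_Sub)
  finally show ?thesis .
qed

text \<open>
  The compatibility of \<open>\<phi>\<close> with \<open>\<lambda>\<close>. As every loose unary map of \<open>D\<close> comes from an arrow, it suffices to
  cancel the isomorphism \<open>\<phi> \<lambda>\<close>.
\<close>

lemma Phi_lunit:
  assumes b: "b \<in> Ob C" and e: "inverse_arrows C (K_lunit C R b) e"
  shows "Sub D (\<Phi>2 I b) 1 \<Phi>0 = J D (to_multi (p1 e))"
proof -
  note [simp] = C.inverse_arrowsD(1-4)[OF e]
  let ?W = "Sub D (\<Phi>2 I b) 1 \<Phi>0" and ?l = "K_lunit C R b"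
  have W: "?W \<in> Maps D" "mode ?W = Loose" "arity ?W = Suc 0" using b by simp_all
  obtain w where w: "w \<in> Arr D" "?W = J D (to_multi w)" using D.loose_unary_is_J[OF tight_loose_D W] .
  have [simp]: "src w = p0 b" using arg_cong[OF w(2), of inputs] w(1) b by simp
  have [simp]: "tgt w = p0 (I \<otimes> b)" using arg_cong[OF w(2), of outcome] w(1) b by simp
  have "?W = post D (lax2 \<phi> I b \<cdot>\<^bsub>D\<^esub> (lax0 \<phi> \<star>' \<one>\<^bsub>D\<^esub> (p0 b))) (Sub D (D.\<Theta> D.unit (p0 b)) 1 D.\<upsilon>)"
    using b by (simp add: \<Phi>0_def \<Phi>2_def D.post_Comp D.post_tensA_Sub_left, simp add: D.post_Sub)
  then have "post D (p1 ?l) ?W = post D (p1 ?l \<cdot>\<^bsub>D\<^esub> lax2 \<phi> I b \<cdot>\<^bsub>D\<^esub> (lax0 \<phi> \<star>' \<one>\<^bsub>D\<^esub> (p0 b))) (Sub D (D.\<Theta> D.unit (p0 b)) 1 D.\<upsilon>)"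
    using b by (simp add: D.post_post)
  also have "\<dots> = J D (to_multi (\<one>\<^bsub>D\<^esub> (p0 b)))"
    using lax_LUnit[of b] b D.post_lunit[of "p0 b"] by simp
  finally have "J D (to_multi (p1 ?l \<cdot>\<^bsub>D\<^esub> w)) = J D (to_multi (\<one>\<^bsub>D\<^esub> (p0 b)))"
    using w b by (simp add: D.post_J_arrow)
  from D.J_inj[OF tight_loose_D this] have "p1 ?l \<cdot>\<^bsub>D\<^esub> w = \<one>\<^bsub>D\<^esub> (p0 b)" using w(1) b by simp
  then have "p1 e \<cdot>\<^bsub>D\<^esub> p1 ?l \<cdot>\<^bsub>D\<^esub> w = p1 e" using b by simp
  moreover have "p1 e \<cdot>\<^bsub>D\<^esub> p1 ?l = \<one>\<^bsub>D\<^esub> (p0 (I \<otimes> b))"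
    using p1_Comp[of ?l e] C.inverse_arrowsD(5)[OF e] b by simp
  then have "(p1 e \<cdot>\<^bsub>D\<^esub> p1 ?l) \<cdot>\<^bsub>D\<^esub> w = w" using w(1) by simp
  ultimately have "w = p1 e" using w(1) b by simp
  with w(2) show ?thesis by simp
qed

lemma Phi_runit:
  assumes a: "a \<in> Ob C"
  shows "Sub D (\<Phi>2 a I) 2 \<Phi>0 = to_multi (p1 (K_runit C R a))"
proof -
  have "to_multi (p1 (K_runit C R a)) = to_multi (lax2 \<phi> a I \<cdot>\<^bsub>D\<^esub> (\<one>\<^bsub>D\<^esub> (p0 a) \<star>' lax0 \<phi>) \<cdot>\<^bsub>D\<^esub> K_runit D S (p0 a))"
    using lax_RUnit[of a] a by simp
  also have "\<dots> = post D (lax2 \<phi> a I) (post D (\<one>\<^bsub>D\<^esub> (p0 a) \<star>' lax0 \<phi>) (to_multi (K_runit D S (p0 a))))"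
    using a by simp
  also have "\<dots> = Sub D (\<Phi>2 a I) 2 \<Phi>0"
    using a by (simp add: D.to_multi_runit D.post_tensA_Sub_right \<Phi>0_def \<Phi>2_def del: D.post_to_multi, simp add: D.post_Sub)
  finally show ?thesis ..
qed

text \<open>
  The unique arrow \<open>p\<close> with \<open>f = p \<circ> \<theta>n\<close>, or with \<open>f = p \<circ> u\<close>.
\<close>

definition factor_arrow where
  "factor_arrow f = (THE p. p \<in> Arr C \<and>
     (case inputs f of [] \<Rightarrow> src p = I \<and> f = post C p C.\<upsilon> | [a] \<Rightarrow> f = to_multi p
      | [a, b] \<Rightarrow> src p = a \<otimes> b \<and> f = post C p (C.\<Theta> a b)
      | [a, b, c] \<Rightarrow> src p = a \<otimes> b \<otimes> c \<and> f = post C p (C.\<Theta>3 a b c)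
      | a # b # c # d # _ \<Rightarrow> src p = a \<otimes> b \<otimes> c \<otimes> d \<and> f = post C p (C.\<Theta>4 a b c d)))"

definition lift_arr where
  "lift_arr f = post D (p1 (factor_arrow f)) (case inputs f of [] \<Rightarrow> \<Phi>0 | [a] \<Rightarrow> to_multi (\<one>\<^bsub>D\<^esub> (p0 a))
      | [a, b] \<Rightarrow> \<Phi>2 a b | [a, b, c] \<Rightarrow> \<Phi>3 a b c | a # b # c # d # _ \<Rightarrow> \<Phi>4 a b c d)"

text \<open>
  Since \<open>j\<close> only changes the mode of a map, a loose map of arity one or two is sent to the loose copy of
  the image of its tight counterpart.
\<close>

definition lift_map where
  "lift_map f = (if mode f = Tight \<or> inputs f = [] then lift_arr f
     else as_loose (lift_arr (Multimap Tight (inputs f) (outcome f) (mlbl f))))"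

lemma lift_arrow [simp]:
  assumes p: "p \<in> Arr C" shows "lift_map (to_multi p) = to_multi (p1 p)"
proof -
  have "factor_arrow (to_multi p) = p" unfolding factor_arrow_def by (rule the_equality) (use p in auto)
  then show ?thesis using p by (simp add: lift_map_def lift_arr_def)
qed

lemma lift_theta:
  assumes ab: "a \<in> Ob C" "b \<in> Ob C" and p: "p \<in> Arr C" "src p = a \<otimes> b"
  shows "lift_map (post C p (C.\<Theta> a b)) = post D (p1 p) (\<Phi>2 a b)"
proof -
  have "factor_arrow (post C p (C.\<Theta> a b)) = p" unfolding factor_arrow_def
    by (rule the_equality) (use ab p C.cancel2[of p a b, symmetric] in auto)
  then show ?thesis using ab p by (simp add: lift_map_def lift_arr_def)
qed

lemma lift_theta3:
  assumes ab: "a \<in> Ob C" "b \<in> Ob C" "c \<in> Ob C" and p: "p \<in> Arr C" "src p = a \<otimes> b \<otimes> c"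
  shows "lift_map (post C p (C.\<Theta>3 a b c)) = post D (p1 p) (\<Phi>3 a b c)"
proof -
  have "factor_arrow (post C p (C.\<Theta>3 a b c)) = p" unfolding factor_arrow_def
    by (rule the_equality) (use ab p C.cancel3[of p a b c, symmetric] in auto)
  then show ?thesis using ab p by (simp add: lift_map_def lift_arr_def)
qed

lemma lift_theta4:
  assumes ab: "a \<in> Ob C" "b \<in> Ob C" "c \<in> Ob C" "d \<in> Ob C" and p: "p \<in> Arr C" "src p = a \<otimes> b \<otimes> c \<otimes> d"
  shows "lift_map (post C p (C.\<Theta>4 a b c d)) = post D (p1 p) (\<Phi>4 a b c d)"
proof -
  have "factor_arrow (post C p (C.\<Theta>4 a b c d)) = p" unfolding factor_arrow_def
    by (rule the_equality) (use ab p C.cancel4[of p a b c d, symmetric] in auto)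
  then show ?thesis using ab p by (simp add: lift_map_def lift_arr_def)
qed

lemma lift_u:
  assumes p: "p \<in> Arr C" "src p = I"
  shows "lift_map (post C p C.\<upsilon>) = post D (p1 p) \<Phi>0"
proof -
  have "factor_arrow (post C p C.\<upsilon>) = p" unfolding factor_arrow_def
    by (rule the_equality) (use p C.cancel_u[of p, symmetric] in auto)
  then show ?thesis using p by (simp add: lift_map_def lift_arr_def)
qed

lemma lift_tight_simps [simp]:
  assumes f: "f \<in> Maps C" "mode f = Tight"
  shows "lift_map f \<in> Maps D" "mode (lift_map f) = Tight" "inputs (lift_map f) = map p0 (inputs f)" "outcome (lift_map f) = p0 (outcome f)"
proof -
  from f have "lift_map f \<in> Maps D \<and> mode (lift_map f) = Tight \<and> inputs (lift_map f) = map p0 (inputs f) \<and> outcome (lift_map f) = p0 (outcome f)"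
    by (cases rule: C.tight_cases) (simp_all add: lift_theta lift_theta3 lift_theta4)
  then show "lift_map f \<in> Maps D" "mode (lift_map f) = Tight" "inputs (lift_map f) = map p0 (inputs f)" "outcome (lift_map f) = p0 (outcome f)"
    by auto
qed

lemma lift_J:
  assumes "f \<in> Maps C" "mode f = Tight" "arity f = Suc 0 \<or> arity f = 2"
  shows "lift_map (J C f) = J D (lift_map f)"
proof -
  have "J C f = as_loose f" by (rule C.tight_eq_looseD(1)[OF tight_loose_C assms])
  moreover have "J D (lift_map f) = as_loose (lift_map f)"
    by (rule D.tight_eq_looseD(1)[OF tight_loose_D]) (use assms in simp_all)
  moreover have "lift_map (as_loose f) = as_loose (lift_map f)"
    using assms by (cases f) (auto simp: lift_map_def as_loose_def)
  ultimately show ?thesis by simp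
qed

lemma loose_cases:
  assumes "f \<in> Maps C" "mode f = Loose"
  obtains p where "p \<in> Arr C" "src p = I" "f = post C p C.\<upsilon>"
    | p where "p \<in> Arr C" "f = J C (to_multi p)"
    | g where "g \<in> Maps C" "mode g = Tight" "arity g = 2" "f = J C g"
proof -
  have "arity f = 0 \<or> arity f = Suc 0 \<or> arity f = 2" using C.loose_arity[OF assms] by arith
  then consider "inputs f = []" | "arity f = Suc 0" | "arity f = 2" by auto
  then show thesis
  proof cases
    case 1 show thesis using C.factor_u[OF assms 1] that(1) by metis
  next
    case 2 show thesis using C.loose_unary_is_J[OF tight_loose_C assms 2] that(2) by metis
  next
    case 3 then show thesis using C.tight_eq_looseD(2)[OF tight_loose_C assms] that(3) by metis
  qed
qed

lemma lift_loose_simps [simp]: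
  assumes f: "f \<in> Maps C" "mode f = Loose"
  shows "lift_map f \<in> Maps D" "mode (lift_map f) = Loose" "inputs (lift_map f) = map p0 (inputs f)" "outcome (lift_map f) = p0 (outcome f)"
proof -
  from f have "lift_map f \<in> Maps D \<and> mode (lift_map f) = Loose \<and> inputs (lift_map f) = map p0 (inputs f) \<and> outcome (lift_map f) = p0 (outcome f)"
  proof (cases rule: loose_cases)
    case (1 p) then show ?thesis by (simp add: lift_u)
  next
    case (2 p) then show ?thesis by (simp add: lift_J)
  next
    case (3 g) then show ?thesis by (simp add: lift_J)
  qed
  then show "lift_map f \<in> Maps D" "mode (lift_map f) = Loose" "inputs (lift_map f) = map p0 (inputs f)" "outcome (lift_map f) = p0 (outcome f)"
    by auto
qed

end

context lax_lift
begin

lemma lift_simps [simp]: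
  assumes "f \<in> Maps C"
  shows "lift_map f \<in> Maps D" "mode (lift_map f) = mode f" "inputs (lift_map f) = map p0 (inputs f)" "outcome (lift_map f) = p0 (outcome f)"
  using assms lift_tight_simps[of f] lift_loose_simps[of f] by (cases "mode f"; simp)+

lemma lift_Theta [simp]: "a \<in> Ob C \<Longrightarrow> b \<in> Ob C \<Longrightarrow> lift_map (C.\<Theta> a b) = \<Phi>2 a b"
  using lift_theta[of a b "\<one>\<^bsub>C\<^esub> (a \<otimes> b)"] by simp

lemma lift_u_Id [simp]: "lift_map C.\<upsilon> = \<Phi>0"
  using lift_u[of "\<one>\<^bsub>C\<^esub> I"] by simp

lemma lift_Theta3 [simp]: "a \<in> Ob C \<Longrightarrow> b \<in> Ob C \<Longrightarrow> c \<in> Ob C \<Longrightarrow> lift_map (C.\<Theta>3 a b c) = \<Phi>3 a b c"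
  using lift_theta3[of a b c "\<one>\<^bsub>C\<^esub> (a \<otimes> b \<otimes> c)"] by simp

lemma lift_post_tight:
  assumes f: "f \<in> Maps C" "mode f = Tight" and q: "q \<in> Arr C" "src q = outcome f"
  shows "lift_map (post C q f) = post D (p1 q) (lift_map f)"
  using f
proof (cases rule: C.tight_cases)
  case (1 p) then show ?thesis using q by (simp add: p1_Comp)
next
  case (2 p a b) then show ?thesis using q by (simp add: lift_theta C.post_post D.post_post p1_Comp)
next
  case (3 p a b c) then show ?thesis using q by (simp add: lift_theta3 C.post_post D.post_post p1_Comp)
next
  case (4 p a b c d) then show ?thesis using q by (simp add: lift_theta4 C.post_post D.post_post p1_Comp)
qed

text \<open>
  The maps \<open>\<Phi>n\<close> are built by the same substitutions as the maps \<open>\<theta>n\<close>.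
\<close>

lemma lift_Sub_theta:
  assumes g: "g \<in> Maps C" "mode g = Tight" "inputs g = a \<otimes> b # xs" "length xs = 1 \<or> length xs = 2"
    and ab: "a \<in> Ob C" "b \<in> Ob C"
  shows "lift_map (Sub C g (Suc 0) (C.\<Theta> a b)) = Sub D (lift_map g) (Suc 0) (\<Phi>2 a b)"
proof -
  consider c where "xs = [c]" | c d where "xs = [c, d]" using g(4) by (auto simp: arity_cases)
  then show ?thesis
  proof cases
    case (1 c)
    then have inp: "inputs g = [a \<otimes> b, c]" using g by simp
    have "c \<in> Ob C" using C.input_in_Ob[OF g(1), of c] inp by simp
    moreover obtain p where "p \<in> Arr C" "src p = a \<otimes> b \<otimes> c" "g = post C p (C.\<Theta> (a \<otimes> b) c)"
      using C.factor2[OF g(1,2) inp] .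
    ultimately show ?thesis using ab lift_theta3[of a b c p]
      by (simp add: lift_theta C.\<Theta>3_def \<Phi>3_def C.post_Sub D.post_Sub)
  next
    case (2 c d)
    then have inp: "inputs g = [a \<otimes> b, c, d]" using g by simp
    have "c \<in> Ob C" "d \<in> Ob C" using C.input_in_Ob[OF g(1), of c] C.input_in_Ob[OF g(1), of d] inp by simp_all
    moreover obtain p where "p \<in> Arr C" "src p = a \<otimes> b \<otimes> c \<otimes> d" "g = post C p (C.\<Theta>3 (a \<otimes> b) c d)"
      using C.factor3[OF g(1,2) inp] .
    ultimately show ?thesis using ab lift_theta4[of a b c d p]
      by (simp add: lift_theta3 C.theta4_alt Phi4_alt C.post_Sub D.post_Sub)
  qed
qed

lemma lift_Act2:
  assumes f: "f \<in> Maps C" "mode f = Tight" "inputs f = [a, b]" and xy: "into_inputs C [x, y] [a, b]"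
    and q: "q \<in> Arr C" "src q = outcome f"
  shows "lift_map (Act C [x, y] q f) = Act D [p1 x, p1 y] (p1 q) (lift_map f)"
proof -
  have [simp]: "x \<in> Arr C" "y \<in> Arr C" "a = tgt x" "b = tgt y" using xy by auto
  obtain p where p: "p \<in> Arr C" "src p = a \<otimes> b" "f = post C p (C.\<Theta> a b)" using C.factor2[OF f(1-3)] .
  have [simp]: "src q = tgt p" using q p by simp
  have "Act C [x, y] q f = Act C [x, y] (q \<cdot>\<^bsub>C\<^esub> p) (C.\<Theta> a b)"
    unfolding p(3) using p(1,2) q(1) by (simp add: C.Act_post)
  also have "\<dots> = post C (q \<cdot>\<^bsub>C\<^esub> p) (post C (x \<star> y) (C.\<Theta> (src x) (src y)))"
    using p(1,2) q(1) by (simp add: C.post_tensA_theta C.post_Act)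
  finally have "lift_map (Act C [x, y] q f) = post D (p1 (q \<cdot>\<^bsub>C\<^esub> p)) (post D (p1 (x \<star> y)) (\<Phi>2 (src x) (src y)))"
    using p(1,2) q(1) by (simp add: lift_post_tight)
  also have "\<dots> = Act D [p1 x, p1 y] (p1 q) (post D (p1 p) (\<Phi>2 a b))"
    using p(1,2) q(1) by (simp add: Phi2_natural D.post_Act D.Act_post p1_Comp)
  finally show ?thesis unfolding p(3) using p(1,2) by (simp add: lift_theta)
qed

text \<open>
  The inductive step on the arity for compatibility with the functorial action.
\<close>

lemma lift_Act_first:
  assumes g: "g \<in> Maps C" "mode g = Tight" "inputs g = a \<otimes> b # bs" "length bs = 1 \<or> length bs = 2"
    and xy: "x \<in> Arr C" "y \<in> Arr C" "tgt x = a" "tgt y = b" and zs: "into_inputs C zs bs"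
    and q: "q \<in> Arr C" "src q = outcome g"
    and IH: "lift_map (Act C ((x \<star> y) # zs) q g) = Act D (p1 (x \<star> y) # map p1 zs) (p1 q) (lift_map g)"
  shows "lift_map (Act C (x # y # zs) q (Sub C g 1 (C.\<Theta> a b))) =
    Act D (p1 x # p1 y # map p1 zs) (p1 q) (lift_map (Sub C g 1 (C.\<Theta> a b)))"
proof -
  have ab: "a \<in> Ob C" "b \<in> Ob C" using xy by auto
  let ?t = "C.\<Theta> (src x) (src y)" and ?w = "x \<star> y"
  have len: "length zs = length bs" using zs by (simp add: into_inputs_iff)
  have "lift_map (Act C (x # y # zs) q (Sub C g (Suc 0) (C.\<Theta> a b))) = lift_map (Sub C (Act C (?w # zs) q g) (Suc 0) ?t)"
    by (subst C.Act_Sub_first[of g "C.\<Theta> a b" bs ?t ?w x y zs q])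
      (use g xy zs q ab in \<open>simp_all add: C.post_tensA_theta\<close>)
  also have "\<dots> = Sub D (lift_map (Act C (?w # zs) q g)) (Suc 0) (\<Phi>2 (src x) (src y))"
    using g xy zs q ab len by (intro lift_Sub_theta[of _ _ _ "map src zs"]) simp_all
  also have "\<dots> = Sub D (Act D (p1 ?w # map p1 zs) (p1 q) (lift_map g)) (Suc 0) (\<Phi>2 (src x) (src y))"
    by (simp only: IH)
  also have "\<dots> = Act D (p1 x # p1 y # map p1 zs) (p1 q) (Sub D (lift_map g) (Suc 0) (\<Phi>2 a b))"
    by (rule D.Act_Sub_first[symmetric, where bs = "map p0 bs"])
      (use g xy zs q ab len in \<open>simp_all add: Phi2_natural into_inputs_p1\<close>)
  also have "Sub D (lift_map g) (Suc 0) (\<Phi>2 a b) = lift_map (Sub C g 1 (C.\<Theta> a b))"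
    using lift_Sub_theta[OF g ab] by simp
  finally show ?thesis by simp
qed

lemma lift_Act3:
  assumes f: "f \<in> Maps C" "mode f = Tight" "inputs f = [a, b, c]" and xy: "into_inputs C [x, y, z] [a, b, c]"
    and q: "q \<in> Arr C" "src q = outcome f"
  shows "lift_map (Act C [x, y, z] q f) = Act D [p1 x, p1 y, p1 z] (p1 q) (lift_map f)"
proof -
  have len: "length [c] = 1 \<or> length [c] = 2" by simp
  have ab: "a \<in> Ob C" "b \<in> Ob C" using f C.input_in_Ob by force+
  obtain g where g: "g \<in> Maps C" "mode g = Tight" "inputs g = [a \<otimes> b, c]" "f = Sub C g 1 (C.\<Theta> a b)"
    using C.factor_theta[OF f(1-3) len] .
  have o: "src q = outcome g" using q g ab by simp
  have "lift_map (Act C [x \<star> y, z] q g) = Act D [p1 (x \<star> y), p1 z] (p1 q) (lift_map g)"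
    using g xy q(1) o by (intro lift_Act2) auto
  then show ?thesis unfolding g(4) using lift_Act_first[OF g(1-3) len, of x y "[z]" q] xy q(1) o by simp
qed

lemma lift_Act4:
  assumes f: "f \<in> Maps C" "mode f = Tight" "inputs f = [a, b, c, d]" and xy: "into_inputs C [x, y, z, w] [a, b, c, d]"
    and q: "q \<in> Arr C" "src q = outcome f"
  shows "lift_map (Act C [x, y, z, w] q f) = Act D [p1 x, p1 y, p1 z, p1 w] (p1 q) (lift_map f)"
proof -
  have len: "length [c, d] = 1 \<or> length [c, d] = 2" by simp
  have ab: "a \<in> Ob C" "b \<in> Ob C" using f C.input_in_Ob by force+
  obtain g where g: "g \<in> Maps C" "mode g = Tight" "inputs g = [a \<otimes> b, c, d]" "f = Sub C g 1 (C.\<Theta> a b)"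
    using C.factor_theta[OF f(1-3) len] .
  have o: "src q = outcome g" using q g ab by simp
  have "lift_map (Act C [x \<star> y, z, w] q g) = Act D [p1 (x \<star> y), p1 z, p1 w] (p1 q) (lift_map g)"
    using g xy q(1) o by (intro lift_Act3) auto
  then show ?thesis unfolding g(4) using lift_Act_first[OF g(1-3) len, of x y "[z, w]" q] xy q(1) o by simp
qed

lemma lift_Act_tight:
  assumes f: "f \<in> Maps C" "mode f = Tight" and ps: "into_inputs C ps (inputs f)" and q: "q \<in> Arr C" "src q = outcome f"
  shows "lift_map (Act C ps q f) = Act D (map p1 ps) (p1 q) (lift_map f)"
proof -
  have "arity f = Suc 0 \<or> arity f = 2 \<or> arity f = 3 \<or> arity f = 4"
    using C.tight_arity[OF f] by arith
  moreover have len: "length ps = arity f" using ps by (simp add: into_inputs_iff)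
  ultimately consider a x where "inputs f = [a]" "ps = [x]" | a b x y where "inputs f = [a, b]" "ps = [x, y]"
    | a b c x y z where "inputs f = [a, b, c]" "ps = [x, y, z]"
    | a b c d x y z w where "inputs f = [a, b, c, d]" "ps = [x, y, z, w]"
    by (elim disjE) (simp_all add: arity_cases, blast+)
  then show ?thesis
  proof cases
    case 1
    have "arity f = Suc 0" using 1 by simp
    then obtain p where "p \<in> Arr C" "f = to_multi p" using C.unary_is_arrow[OF f] by metis
    then show ?thesis using 1 ps q by (simp add: C.Act_to_multi D.Act_to_multi p1_Comp)
  qed (use lift_Act2[OF f _ _ q] lift_Act3[OF f _ _ q] lift_Act4[OF f _ _ q] ps in simp_all)
qed

lemma lift_Act:
  assumes f: "f \<in> Maps C" and ps: "into_inputs C ps (inputs f)" and q: "q \<in> Arr C" "src q = outcome f"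
  shows "lift_map (Act C ps q f) = Act D (map p1 ps) (p1 q) (lift_map f)"
proof (cases "mode f")
  case Tight with lift_Act_tight[OF f _ ps q] show ?thesis by simp
next
  case Loose
  have J: ?thesis if g: "g \<in> Maps C" "mode g = Tight" "arity g = Suc 0 \<or> arity g = 2" "f = J C g" for g
  proof -
    have ps': "into_inputs C ps (inputs g)" "src q = outcome g" using ps q g by auto
    have "lift_map (Act C ps q f) = J D (lift_map (Act C ps q g))"
      unfolding g(4) using g(1-3) ps' q(1) C.J_nat[of g ps q] lift_J[of "Act C ps q g"] by (auto simp: into_inputs_iff)
    also have "\<dots> = J D (Act D (map p1 ps) (p1 q) (lift_map g))"
      using lift_Act_tight[OF g(1,2) ps'(1) q(1) ps'(2)] by simp
    also have "\<dots> = Act D (map p1 ps) (p1 q) (J D (lift_map g))"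
      by (rule D.J_nat) (use g(1-3) ps' q(1) into_inputs_p1[OF ps'(1)] in auto)
    also have "J D (lift_map g) = lift_map f" unfolding g(4) using lift_J[OF g(1-3)] by simp
    finally show ?thesis .
  qed
  from f Loose show ?thesis
  proof (cases rule: loose_cases)
    case (1 p)
    then have "ps = []" using ps by (simp add: into_inputs_iff)
    moreover have "Act C [] q f = post C q f" "Act D [] (p1 q) (lift_map f) = post D (p1 q) (lift_map f)"
      using 1 by (simp_all add: post_def)
    ultimately show ?thesis using 1 q by (simp add: lift_u C.post_post D.post_post p1_Comp)
  next
    case (2 p) then show ?thesis using J[of "to_multi p"] by simp
  next
    case (3 g) then show ?thesis using J[of g] by simp
  qed
qed

lemma lift_post:
  assumes "f \<in> Maps C" "q \<in> Arr C" "src q = outcome f"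
  shows "lift_map (post C q f) = post D (p1 q) (lift_map f)"
proof -
  have "map p1 (map \<one>\<^bsub>C\<^esub> (inputs f)) = map \<one>\<^bsub>D\<^esub> (inputs (lift_map f))"
    using assms by (simp add: C.inputs_Ob[THEN subsetD])
  moreover have "lift_map (post C q f) = Act D (map p1 (map \<one>\<^bsub>C\<^esub> (inputs f))) (p1 q) (lift_map f)"
    unfolding post_def by (rule lift_Act) (use assms in simp_all)
  ultimately show ?thesis by (simp only: post_def)
qed

lemma lift_pre:
  assumes "f \<in> Maps C" "p \<in> Arr C" "1 \<le> i" "i \<le> arity f" "tgt p = inputs f ! (i - 1)"
  shows "lift_map (pre C f i p) = pre D (lift_map f) i (p1 p)"
proof -
  have "map p1 (map \<one>\<^bsub>C\<^esub> (inputs f)) = map \<one>\<^bsub>D\<^esub> (inputs (lift_map f))"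
    using assms by (simp add: C.inputs_Ob[THEN subsetD])
  then have "map p1 ((map \<one>\<^bsub>C\<^esub> (inputs f))[i - 1 := p]) = (map \<one>\<^bsub>D\<^esub> (inputs (lift_map f)))[i - 1 := p1 p]"
    by (simp only: map_update)
  moreover have "lift_map (pre C f i p) = Act D (map p1 ((map \<one>\<^bsub>C\<^esub> (inputs f))[i - 1 := p])) (p1 (\<one>\<^bsub>C\<^esub> (outcome f))) (lift_map f)"
    unfolding pre_def by (rule lift_Act) (use assms C.into_inputs_update[OF assms] in simp_all)
  ultimately show ?thesis using assms by (simp add: pre_def)
qed

lemma lift_Sub_x2_1:
  assumes f: "f \<in> Maps C" "mode f = Tight" "arity f = 2 \<or> arity f = 3"
    and g: "g \<in> Maps C" "mode g = Tight" "arity g = 2" and fg: "inputs f ! 0 = outcome g"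
  shows "lift_map (Sub C f (Suc 0) g) = Sub D (lift_map f) (Suc 0) (lift_map g)"
proof -
  obtain c xs where inp: "inputs f = c # xs" "length xs = 1 \<or> length xs = 2"
    using f(3) by (auto simp: arity_cases)
  obtain a b where inpg: "inputs g = [a, b]" using g(3) by (auto simp: arity_cases)
  have ab: "a \<in> Ob C" "b \<in> Ob C" using g inpg C.input_in_Ob by force+
  obtain p where p: "p \<in> Arr C" "src p = a \<otimes> b" "g = post C p (C.\<Theta> a b)" using C.factor2[OF g(1,2) inpg] .
  have tgt: "tgt p = c" using fg inp p ab by simp
  have "Sub C f (Suc 0) g = Sub C (pre C f (Suc 0) p) (Suc 0) (C.\<Theta> a b)"
    unfolding p(3) by (rule C.Sub_post) (use f inp ab p(1,2) tgt in auto)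
  then have "lift_map (Sub C f (Suc 0) g) = Sub D (lift_map (pre C f (Suc 0) p)) (Suc 0) (\<Phi>2 a b)"
    using lift_Sub_theta[of "pre C f (Suc 0) p" a b xs] f inp ab p(1,2) tgt by simp
  also have "\<dots> = Sub D (pre D (lift_map f) (Suc 0) (p1 p)) (Suc 0) (\<Phi>2 a b)"
    using lift_pre[of f p 1] f inp p(1) tgt by simp
  also have "\<dots> = Sub D (lift_map f) (Suc 0) (post D (p1 p) (\<Phi>2 a b))"
    by (rule D.Sub_post[symmetric]) (use f inp ab p(1,2) tgt in auto)
  also have "post D (p1 p) (\<Phi>2 a b) = lift_map g" unfolding p(3) using ab p(1,2) by (simp add: lift_theta)
  finally show ?thesis .
qed

text \<open>
  The only case that needs the compatibility of \<open>\<phi>\<close> with \<open>\<alpha>\<close>: with both maps in factored form, the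
  composite is \<open>p \<circ> (\<theta> \<circ>\<^sub>2 \<theta>) = p \<circ> \<alpha> \<circ> \<theta>3\<close>.
\<close>

lemma lift_Sub_22_2:
  assumes f: "f \<in> Maps C" "mode f = Tight" "arity f = 2"
    and g: "g \<in> Maps C" "mode g = Tight" "arity g = 2" and fg: "inputs f ! 1 = outcome g"
  shows "lift_map (Sub C f 2 g) = Sub D (lift_map f) 2 (lift_map g)"
proof -
  obtain x c where inp: "inputs f = [x, c]" using f(3) by (auto simp: arity_cases)
  obtain a b where inpg: "inputs g = [a, b]" using g(3) by (auto simp: arity_cases)
  have ob: "a \<in> Ob C" "b \<in> Ob C" using g inpg C.input_in_Ob by force+
  have obx: "x \<in> Ob C" using f inp C.input_in_Ob by force
  obtain q where q: "q \<in> Arr C" "src q = a \<otimes> b" "g = post C q (C.\<Theta> a b)" using C.factor2[OF g(1,2) inpg] .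
  have tgt: "tgt q = c" using fg inp q ob by simp
  let ?f = "pre C f 2 q"
  have f': "?f \<in> Maps C" "mode ?f = Tight" "inputs ?f = [x, a \<otimes> b]" using f inp q(1,2) tgt by simp_all
  obtain p where p: "p \<in> Arr C" "src p = x \<otimes> (a \<otimes> b)" "?f = post C p (C.\<Theta> x (a \<otimes> b))" using C.factor2[OF f'] .
  have "Sub C f 2 g = Sub C ?f 2 (C.\<Theta> a b)"
    unfolding q(3) by (rule C.Sub_post) (use f inp ob q(1,2) tgt in auto)
  also have "\<dots> = post C p (post C (K_assoc C R x a b) (C.\<Theta>3 x a b))"
    unfolding p(3) using p(1,2) ob obx by (simp add: C.post_assoc C.post_Sub)
  finally have "lift_map (Sub C f 2 g) = post D (p1 p) (post D (p1 (K_assoc C R x a b)) (\<Phi>3 x a b))"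
    using p(1,2) ob obx by (simp add: lift_post)
  also have "\<dots> = Sub D (lift_map ?f) 2 (\<Phi>2 a b)"
    unfolding p(3) using p(1,2) ob obx by (simp add: Phi3_assoc lift_theta D.post_Sub)
  also have "lift_map ?f = pre D (lift_map f) 2 (p1 q)"
    using lift_pre[of f q 2] f inp q(1) tgt by simp
  also have "Sub D (pre D (lift_map f) 2 (p1 q)) 2 (\<Phi>2 a b) = Sub D (lift_map f) 2 (post D (p1 q) (\<Phi>2 a b))"
    by (rule D.Sub_post[symmetric]) (use f inp ob q(1,2) tgt in auto)
  also have "post D (p1 q) (\<Phi>2 a b) = lift_map g" unfolding q(3) using ob q(1,2) by (simp add: lift_theta)
  finally show ?thesis .
qed

text \<open>
  A ternary map is a binary map with \<open>\<theta>\<close> substituted into its first input, so that (A) and (B) reduce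
  substitutions that involve it to substitutions between binary, unary and nullary maps.
\<close>

lemma factor_ternary:
  assumes f: "f \<in> Maps C" "mode f = Tight" "arity f = 3"
  obtains a b c g where "a \<in> Ob C" "b \<in> Ob C" "inputs f = [a, b, c]"
    "g \<in> Maps C" "mode g = Tight" "inputs g = [a \<otimes> b, c]" "f = Sub C g (Suc 0) (C.\<Theta> a b)" "outcome f = outcome g"
proof -
  obtain a b c where inp: "inputs f = [a, b, c]" using f(3) by (auto simp: arity_cases)
  have len: "length [c] = 1 \<or> length [c] = 2" by simp
  have ab: "a \<in> Ob C" "b \<in> Ob C" using f inp C.input_in_Ob by force+
  obtain g where g: "g \<in> Maps C" "mode g = Tight" "inputs g = [a \<otimes> b, c]" "f = Sub C g 1 (C.\<Theta> a b)"
    using C.factor_theta[OF f(1,2) inp len] .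
  have "outcome f = outcome g" using g ab by simp
  with ab inp g show thesis unfolding One_nat_def by (rule that)
qed

context
  fixes a b c f g assumes abc: "a \<in> Ob C" "b \<in> Ob C"
    and g: "g \<in> Maps C" "mode g = Tight" "inputs g = [a \<otimes> b, c]" and f: "f = Sub C g (Suc 0) (C.\<Theta> a b)"
begin

lemma lift_ternary: "lift_map f = Sub D (lift_map g) (Suc 0) (\<Phi>2 a b)"
  unfolding f using lift_Sub_theta[of g a b "[c]"] abc g by simp

lemma lift_Sub_23_1_aux:
  assumes h: "h \<in> Maps C" "mode h = Tight" "arity h = 2" "inputs h ! 0 = outcome g"
  shows "lift_map (Sub C h (Suc 0) f) = Sub D (lift_map h) (Suc 0) (lift_map f)"
proof -
  obtain y z where inp: "inputs h = [y, z]" using h(3) by (auto simp: arity_cases)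
  have "lift_map (Sub C h (Suc 0) f) = lift_map (Sub C (Sub C h (Suc 0) g) (Suc 0) (C.\<Theta> a b))"
    unfolding f using h g abc by (simp add: C.assoc_nested_22)
  also have "\<dots> = Sub D (lift_map (Sub C h (Suc 0) g)) (Suc 0) (\<Phi>2 a b)"
    using h g abc inp by (intro lift_Sub_theta[of _ a b "[c, z]"]) simp_all
  also have "\<dots> = Sub D (Sub D (lift_map h) (Suc 0) (lift_map g)) (Suc 0) (\<Phi>2 a b)"
    using h g by (simp add: lift_Sub_x2_1)
  also have "\<dots> = Sub D (lift_map h) (Suc 0) (lift_map f)"
    unfolding lift_ternary using h g abc inp by (simp add: D.assoc_nested_22)
  finally show ?thesis .
qed

end

lemma lift_Sub_23_1:
  assumes h: "h \<in> Maps C" "mode h = Tight" "arity h = 2" and f: "f \<in> Maps C" "mode f = Tight" "arity f = 3"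
    and hf: "inputs h ! 0 = outcome f"
  shows "lift_map (Sub C h (Suc 0) f) = Sub D (lift_map h) (Suc 0) (lift_map f)"
proof -
  obtain a b c g where a: "a \<in> Ob C" "b \<in> Ob C" "inputs f = [a, b, c]"
    "g \<in> Maps C" "mode g = Tight" "inputs g = [a \<otimes> b, c]" "f = Sub C g (Suc 0) (C.\<Theta> a b)" "outcome f = outcome g"
    using factor_ternary[OF f] .
  show ?thesis by (rule lift_Sub_23_1_aux[OF a(1,2,4-7) h]) (use hf a(8) in simp)
qed

lemma lift_Sub_32:
  assumes f: "f \<in> Maps C" "mode f = Tight" "arity f = 3" and h: "h \<in> Maps C" "mode h = Tight" "arity h = 2"
  shows "inputs f ! 1 = outcome h \<Longrightarrow> lift_map (Sub C f 2 h) = Sub D (lift_map f) 2 (lift_map h)"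
    and "inputs f ! 2 = outcome h \<Longrightarrow> lift_map (Sub C f 3 h) = Sub D (lift_map f) 3 (lift_map h)"
proof -
  obtain a b c g where a: "a \<in> Ob C" "b \<in> Ob C" "inputs f = [a, b, c]"
    "g \<in> Maps C" "mode g = Tight" "inputs g = [a \<otimes> b, c]" "f = Sub C g (Suc 0) (C.\<Theta> a b)" "outcome f = outcome g"
    using factor_ternary[OF f] .
  have Ff: "lift_map f = Sub D (lift_map g) (Suc 0) (\<Phi>2 a b)" by (rule lift_ternary[OF a(1,2,4-7)])
  show "lift_map (Sub C f 2 h) = Sub D (lift_map f) 2 (lift_map h)" if "inputs f ! 1 = outcome h"
  proof -
    have o: "outcome h = b" using that a(3) by simp
    have "lift_map (Sub C f 2 h) = lift_map (Sub C g (Suc 0) (Sub C (C.\<Theta> a b) 2 h))"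
      unfolding a(7) using a(1,2,4-6) h o by (simp add: C.assoc_nested_22)
    also have "\<dots> = Sub D (lift_map g) (Suc 0) (Sub D (\<Phi>2 a b) 2 (lift_map h))"
      using a(1,2,4-6) h o by (simp add: lift_Sub_23_1 lift_Sub_22_2)
    also have "\<dots> = Sub D (lift_map f) 2 (lift_map h)"
      unfolding Ff using a(1,2,4-6) h o by (simp add: D.assoc_nested_22)
    finally show ?thesis .
  qed
  show "lift_map (Sub C f 3 h) = Sub D (lift_map f) 3 (lift_map h)" if "inputs f ! 2 = outcome h"
  proof -
    have o: "outcome h = c" using that a(3) by simp
    obtain y z where inp: "inputs h = [y, z]" using h(3) by (auto simp: arity_cases)
    have "lift_map (Sub C f 3 h) = lift_map (Sub C (Sub C g 2 h) (Suc 0) (C.\<Theta> a b))"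
      unfolding a(7) using a(1,2,4-6) h o by (simp add: C.assoc_parallel_Sub)
    also have "\<dots> = Sub D (lift_map (Sub C g 2 h)) (Suc 0) (\<Phi>2 a b)"
      using a(1,2,4-6) h o inp by (intro lift_Sub_theta[of _ a b "[y, z]"]) simp_all
    also have "\<dots> = Sub D (Sub D (lift_map g) 2 (lift_map h)) (Suc 0) (\<Phi>2 a b)"
      using a(1,2,4-6) h o by (simp add: lift_Sub_22_2)
    also have "\<dots> = Sub D (lift_map f) 3 (lift_map h)"
      unfolding Ff using a(1,2,4-6) h o by (simp add: D.assoc_parallel_Sub)
    finally show ?thesis .
  qed
qed

lemma lift_Sub_23_2:
  assumes h: "h \<in> Maps C" "mode h = Tight" "arity h = 2" and f: "f \<in> Maps C" "mode f = Tight" "arity f = 3"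
    and hf: "inputs h ! 1 = outcome f"
  shows "lift_map (Sub C h 2 f) = Sub D (lift_map h) 2 (lift_map f)"
proof -
  obtain a b c g where a: "a \<in> Ob C" "b \<in> Ob C" "inputs f = [a, b, c]"
    "g \<in> Maps C" "mode g = Tight" "inputs g = [a \<otimes> b, c]" "f = Sub C g (Suc 0) (C.\<Theta> a b)" "outcome f = outcome g"
    using factor_ternary[OF f] .
  have Ff: "lift_map f = Sub D (lift_map g) (Suc 0) (\<Phi>2 a b)" by (rule lift_ternary[OF a(1,2,4-7)])
  obtain y z where inp: "inputs h = [y, z]" using h(3) by (auto simp: arity_cases)
  have o: "outcome g = z" using hf a(8) inp by simp
  have "lift_map (Sub C h 2 f) = lift_map (Sub C (Sub C h 2 g) 2 (C.\<Theta> a b))"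
    unfolding a(7) using a(1,2,4-6) h o inp by (simp add: C.assoc_nested_22)
  also have "\<dots> = Sub D (Sub D (lift_map h) 2 (lift_map g)) 2 (\<Phi>2 a b)"
    using a(1,2,4-6) h o inp by (simp add: lift_Sub_32 lift_Sub_22_2)
  also have "\<dots> = Sub D (lift_map h) 2 (lift_map f)"
    unfolding Ff using a(1,2,4-6) h o inp by (simp add: D.assoc_nested_22)
  finally show ?thesis .
qed

lemma lift_Sub_loose_right:
  assumes f: "f \<in> Maps C" "mode f = Tight" "arity f = 2" and g: "g \<in> Maps C" "mode g = Loose" "arity g = Suc 0"
  shows "inputs f ! 0 = outcome g \<Longrightarrow> lift_map (Sub C f (Suc 0) g) = Sub D (lift_map f) (Suc 0) (lift_map g)"
    and "inputs f ! 1 = outcome g \<Longrightarrow> lift_map (Sub C f 2 g) = Sub D (lift_map f) 2 (lift_map g)"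
proof -
  obtain p where p: "p \<in> Arr C" "g = J C (to_multi p)" using C.loose_unary_is_J[OF tight_loose_C g] .
  obtain a b where inp: "inputs f = [a, b]" using f(3) by (auto simp: arity_cases)
  show "lift_map (Sub C f (Suc 0) g) = Sub D (lift_map f) (Suc 0) (lift_map g)" if "inputs f ! 0 = outcome g"
  proof -
    have [simp]: "tgt p = a" using that p inp by simp
    show ?thesis unfolding p(2) using f p(1) inp lift_pre[of f p 1] by (simp add: C.Sub1_J_arrow D.Sub1_J_arrow lift_J)
  qed
  show "lift_map (Sub C f 2 g) = Sub D (lift_map f) 2 (lift_map g)" if "inputs f ! 1 = outcome g"
  proof -
    have [simp]: "tgt p = b" using that p inp by simp
    show ?thesis unfolding p(2) using f p(1) inp lift_pre[of f p 2] by (simp add: C.Sub2_J_arrow D.Sub2_J_arrow lift_J)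
  qed
qed

lemma lift_Sub_loose_left:
  assumes f: "f \<in> Maps C" "mode f = Loose" "arity f = Suc 0" and fg: "inputs f ! 0 = outcome g" and g: "g \<in> Maps C"
    "mode g = Tight \<and> arity g = 2 \<or> mode g = Loose \<and> inputs g = []"
  shows "lift_map (Sub C f (Suc 0) g) = Sub D (lift_map f) (Suc 0) (lift_map g)"
proof -
  obtain p where p: "p \<in> Arr C" "f = J C (to_multi p)" using C.loose_unary_is_J[OF tight_loose_C f] .
  have [simp]: "src p = outcome g" using fg p by simp
  show ?thesis unfolding p(2) using g p(1)
    by (auto simp: C.J_arrow_Sub D.J_arrow_Sub lift_J lift_post C.J_arrow_nullary D.J_arrow_nullary)
qed

text \<open>
  A nullary map is an arrow after \<open>u\<close>, which reduces this to \<open>\<theta> \<circ>\<^sub>1 u\<close> and \<open>\<theta> \<circ>\<^sub>2 u\<close>; these are governed by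
  \<open>\<lambda>\<close> and \<open>\<rho>\<close>.
\<close>

lemma lift_Sub_20:
  assumes f: "f \<in> Maps C" "mode f = Tight" "arity f = 2" and v: "v \<in> Maps C" "mode v = Loose" "inputs v = []"
  shows "inputs f ! 0 = outcome v \<Longrightarrow> lift_map (Sub C f (Suc 0) v) = Sub D (lift_map f) (Suc 0) (lift_map v)"
    and "inputs f ! 1 = outcome v \<Longrightarrow> lift_map (Sub C f 2 v) = Sub D (lift_map f) 2 (lift_map v)"
proof -
  obtain p where p: "p \<in> Arr C" "src p = I" "v = post C p C.\<upsilon>" using C.factor_u[OF v] .
  obtain a b where inp: "inputs f = [a, b]" using f(3) by (auto simp: arity_cases)
  have ob: "a \<in> Ob C" "b \<in> Ob C" using f inp C.input_in_Ob by force+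
  have Fv: "lift_map v = post D (p1 p) \<Phi>0" unfolding p(3) using p(1,2) by (simp add: lift_u)
  show "lift_map (Sub C f (Suc 0) v) = Sub D (lift_map f) (Suc 0) (lift_map v)" if "inputs f ! 0 = outcome v"
  proof -
    have [simp]: "tgt p = a" using that p inp by simp
    let ?f = "pre C f 1 p"
    have f': "?f \<in> Maps C" "mode ?f = Tight" "inputs ?f = [I, b]" using f inp p(1,2) by simp_all
    obtain q where q: "q \<in> Arr C" "src q = I \<otimes> b" "?f = post C q (C.\<Theta> I b)" using C.factor2[OF f'] .
    obtain e where e: "inverse_arrows C (K_lunit C R b) e" "Sub C (C.\<Theta> I b) 1 C.\<upsilon> = J C (to_multi e)"
      using C.K_lunit_inverse[OF tight_loose_C ob(2)] .
    note [simp] = C.inverse_arrowsD(1-4)[OF e(1)]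
    have "Sub C f (Suc 0) v = Sub C ?f (Suc 0) C.\<upsilon>"
      unfolding p(3) One_nat_def by (rule C.Sub_post) (use f inp ob p(1,2) in auto)
    also have "\<dots> = post C q (J C (to_multi e))"
      unfolding q(3) using q(1,2) ob e(2) by (simp flip: C.post_Sub)
    finally have "lift_map (Sub C f (Suc 0) v) = post D (p1 q) (J D (to_multi (p1 e)))"
      using q(1,2) ob by (simp add: C.post_J_arrow lift_J D.post_J_arrow p1_Comp)
    also have "\<dots> = Sub D (lift_map ?f) (Suc 0) \<Phi>0"
      unfolding q(3) using q(1,2) ob Phi_lunit[OF ob(2) e(1)] by (simp add: lift_theta flip: D.post_Sub)
    also have "lift_map ?f = pre D (lift_map f) (Suc 0) (p1 p)"
      using lift_pre[of f p 1] f inp p(1) by simp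
    also have "Sub D \<dots> (Suc 0) \<Phi>0 = Sub D (lift_map f) (Suc 0) (lift_map v)"
      unfolding Fv by (rule D.Sub_post[symmetric]) (use f inp ob p(1,2) in auto)
    finally show ?thesis .
  qed
  show "lift_map (Sub C f 2 v) = Sub D (lift_map f) 2 (lift_map v)" if "inputs f ! 1 = outcome v"
  proof -
    have [simp]: "tgt p = b" using that p inp by simp
    let ?f = "pre C f 2 p"
    have f': "?f \<in> Maps C" "mode ?f = Tight" "inputs ?f = [a, I]" using f inp p(1,2) by simp_all
    obtain q where q: "q \<in> Arr C" "src q = a \<otimes> I" "?f = post C q (C.\<Theta> a I)" using C.factor2[OF f'] .
    have "Sub C f 2 v = Sub C ?f 2 C.\<upsilon>"
      unfolding p(3) by (rule C.Sub_post) (use f inp ob p(1,2) in auto)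
    also have "\<dots> = post C q (to_multi (K_runit C R a))"
      unfolding q(3) using q(1,2) ob by (simp add: C.to_multi_runit C.post_Sub)
    finally have "lift_map (Sub C f 2 v) = post D (p1 q) (to_multi (p1 (K_runit C R a)))"
      using q(1,2) ob by (simp add: p1_Comp)
    also have "\<dots> = Sub D (lift_map ?f) 2 \<Phi>0"
      unfolding q(3) using q(1,2) ob by (simp add: lift_theta Phi_runit[symmetric] D.post_Sub)
    also have "lift_map ?f = pre D (lift_map f) 2 (p1 p)"
      using lift_pre[of f p 2] f inp p(1) by simp
    also have "Sub D \<dots> 2 \<Phi>0 = Sub D (lift_map f) 2 (lift_map v)"
      unfolding Fv by (rule D.Sub_post[symmetric]) (use f inp ob p(1,2) in auto)
    finally show ?thesis .
  qed
qed

lemma lift_Sub_30: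
  assumes f: "f \<in> Maps C" "mode f = Tight" "arity f = 3" and v: "v \<in> Maps C" "mode v = Loose" "inputs v = []"
  shows "inputs f ! 0 = outcome v \<Longrightarrow> lift_map (Sub C f (Suc 0) v) = Sub D (lift_map f) (Suc 0) (lift_map v)"
    and "inputs f ! 1 = outcome v \<Longrightarrow> lift_map (Sub C f 2 v) = Sub D (lift_map f) 2 (lift_map v)"
    and "inputs f ! 2 = outcome v \<Longrightarrow> lift_map (Sub C f 3 v) = Sub D (lift_map f) 3 (lift_map v)"
proof -
  obtain a b c g where a: "a \<in> Ob C" "b \<in> Ob C" "inputs f = [a, b, c]"
    "g \<in> Maps C" "mode g = Tight" "inputs g = [a \<otimes> b, c]" "f = Sub C g (Suc 0) (C.\<Theta> a b)" "outcome f = outcome g"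
    using factor_ternary[OF f] .
  note [simp] = a(1,2,4-6) v
  have Ff: "lift_map f = Sub D (lift_map g) (Suc 0) (\<Phi>2 a b)" by (rule lift_ternary[OF a(1,2,4-7)])
  have arrow: "lift_map h = to_multi (p1 (to_arrow h))" if "h \<in> Maps C" "mode h = Tight" "arity h = Suc 0" for h
    using lift_arrow[of "to_arrow h"] C.to_arrow_simps[OF that] by simp
  show "lift_map (Sub C f (Suc 0) v) = Sub D (lift_map f) (Suc 0) (lift_map v)" if "inputs f ! 0 = outcome v"
  proof -
    have [simp]: "outcome v = a" using that a(3) by simp
    have "lift_map (Sub C f (Suc 0) v) = lift_map (Sub C g (Suc 0) (Sub C (C.\<Theta> a b) (Suc 0) v))"
      unfolding a(7) by (simp add: C.assoc_nested_20)
    also have "\<dots> = Sub D (lift_map g) (Suc 0) (Sub D (\<Phi>2 a b) (Suc 0) (lift_map v))"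
      by (simp add: lift_Sub_loose_right lift_Sub_20)
    also have "\<dots> = Sub D (lift_map f) (Suc 0) (lift_map v)" unfolding Ff by (simp add: D.assoc_nested_20)
    finally show ?thesis .
  qed
  show "lift_map (Sub C f 2 v) = Sub D (lift_map f) 2 (lift_map v)" if "inputs f ! 1 = outcome v"
  proof -
    have [simp]: "outcome v = b" using that a(3) by simp
    let ?h = "Sub C (C.\<Theta> a b) 2 v"
    have h: "lift_map ?h = to_multi (p1 (to_arrow ?h))" by (rule arrow) simp_all
    have "lift_map (Sub C f 2 v) = lift_map (pre C g (Suc 0) (to_arrow ?h))"
      unfolding a(7) by (simp add: C.assoc_nested_20)
    also have "\<dots> = pre D (lift_map g) (Suc 0) (p1 (to_arrow ?h))"
      using lift_pre[of g "to_arrow ?h" 1] by simp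
    also have "p1 (to_arrow ?h) = to_arrow (Sub D (\<Phi>2 a b) 2 (lift_map v))"
      using arg_cong[OF h, of to_arrow] by (simp add: lift_Sub_20)
    also have "pre D (lift_map g) (Suc 0) \<dots> = Sub D (lift_map f) 2 (lift_map v)" unfolding Ff by (simp add: D.assoc_nested_20)
    finally show ?thesis .
  qed
  show "lift_map (Sub C f 3 v) = Sub D (lift_map f) 3 (lift_map v)" if "inputs f ! 2 = outcome v"
  proof -
    have [simp]: "outcome v = c" using that a(3) by simp
    let ?h = "Sub C g 2 v"
    have h: "lift_map ?h = to_multi (p1 (to_arrow ?h))" by (rule arrow) simp_all
    have "lift_map (Sub C f 3 v) = lift_map (post C (to_arrow ?h) (C.\<Theta> a b))"
      unfolding a(7) by (simp add: C.assoc_parallel_Sub)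
    also have "\<dots> = post D (p1 (to_arrow ?h)) (\<Phi>2 a b)"
      by (simp add: lift_post)
    also have "p1 (to_arrow ?h) = to_arrow (Sub D (lift_map g) 2 (lift_map v))"
      using arg_cong[OF h, of to_arrow] by (simp add: lift_Sub_20)
    also have "post D \<dots> (\<Phi>2 a b) = Sub D (lift_map f) 3 (lift_map v)" unfolding Ff by (simp add: D.assoc_parallel_Sub)
    finally show ?thesis .
  qed
qed

lemma lift_Sub:
  assumes "substitutable C f i g"
  shows "lift_map (Sub C f i g) = Sub D (lift_map f) i (lift_map g)"
proof -
  have *: "f \<in> Maps C" "g \<in> Maps C" "inputs f ! (i - 1) = outcome g" using assms by simp_all
  have "i = Suc 0 \<and> arity f \<noteq> 0 \<or> i = 2 \<and> (arity f = 2 \<or> arity f = 3) \<or> i = 3 \<and> arity f = 3"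
    using assms by auto
  then show ?thesis
    using assms *
    by (elim disjE conjE; simp)
     (auto simp: lift_Sub_x2_1 lift_Sub_22_2 lift_Sub_23_1 lift_Sub_32 lift_Sub_23_2 lift_Sub_loose_right lift_Sub_loose_left
       lift_Sub_20 lift_Sub_30)
qed

definition lift :: "('o, 'm) mmor" where
  "lift = \<lparr>fob = p0, farr = p1, fmulti = restrict lift_map (Maps C)\<rparr>"

lemma multifunctor_lift: "multifunctor C D lift"
proof
  fix f i g assume s: "substitutable C f i g"
  then have "Sub C f i g \<in> Maps C" "f \<in> Maps C" "g \<in> Maps C" by simp_all
  with lift_Sub[OF s] show "fmulti lift (Sub C f i g) = Sub D (fmulti lift f) i (fmulti lift g)"
    by (simp add: lift_def)
qed (auto simp: lift_def hom_iff mhom_iff p1_Comp lift_Act lift_J)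

lemma K_lax_lift:
  assumes "laxmor_extensional (K_skmon C R) \<phi>"
  shows "K_lax C R D S lift = \<phi>" "mmor_extensional C lift"
proof -
  show ext: "mmor_extensional C lift"
    using assms by (simp add: mmor_extensional_def lift_def laxmor_extensional_def fctr_extensional_def)
  interpret F: multifunctor C D lift by (rule multifunctor_lift)
  interpret F: represented_multifunctor C D lift R S ..
  show "F.K = \<phi>"
  proof (rule laxmor_eqI[OF F.K_extensional[OF ext] assms])
    show "lax0 F.K = lax0 \<phi>" by (rule F.K_lax0_eqI) (simp_all add: lift_def \<Phi>0_def)
    show "lax2 F.K a b = lax2 \<phi> a b" if "a \<in> Ob (K_skmon C R)" "b \<in> Ob (K_skmon C R)" for a b
      by (rule F.K_lax2_eqI) (use that in \<open>simp_all add: lift_def \<Phi>2_def\<close>)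
  qed (simp_all, simp_all add: lift_def)
qed

end

text \<open>
  A ternary map is an arrow after \<open>\<theta>3\<close>, on which \<open>\<beta>\<^sup>3\<^sub>2\<close> is given by \<open>s\<close>. A quaternary map is obtained both
  by substituting \<open>\<theta>3\<close> into a binary map and by substituting \<open>\<theta>\<close> into a ternary one, so that
  \<open>\<beta>\<^sup>4\<^sub>2\<close> and \<open>\<beta>\<^sup>4\<^sub>3\<close> are determined by \<open>\<beta>\<^sup>3\<^sub>2\<close>.
\<close>

lemma full_K:
  assumes X: "represented_braided_multicategory C R \<beta>" and Y: "represented_braided_multicategory D S \<gamma>"
    and tl: "tight_eq_loose C" "tight_eq_loose D"
    and \<phi>: "braided_lax_monoidal (K_skmon C R, K_braid C R \<beta>) (K_skmon D S, K_braid D S \<gamma>) \<phi>"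
      "laxmor_extensional (K_skmon C R) \<phi>"
  obtains F where "braided_multifunctor (C, \<beta>) (D, \<gamma>) F" "mmor_extensional C F" "K_lax C R D S F = \<phi>"
proof -
  interpret C: represented_braided_multicategory C R \<beta> by fact
  interpret D: represented_braided_multicategory D S \<gamma> by fact
  interpret lax_monoidal "K_skmon C R" "K_skmon D S" \<phi> using \<phi>(1) by (simp add: braided_lax_monoidal_def)
  interpret lax_lift C D R S \<phi> by unfold_locales (fact tl)+
  have Phi3: "\<Phi>3 a b c = post D (lax2 \<phi> (K_tens R a b) c \<cdot>\<^bsub>D\<^esub> K_tensA D S (lax2 \<phi> a b) (\<one>\<^bsub>D\<^esub> (p0 c))) (D.\<Theta>3 (p0 a) (p0 b) (p0 c))"
    if "a \<in> Ob C" "b \<in> Ob C" "c \<in> Ob C" for a b c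
    using that by (simp add: \<Phi>3_def \<Phi>2_def D.post_Comp D.\<Theta>3_def D.post_tensA_Sub_left, simp add: D.post_Sub)
  have Phi3_braid: "post D (p1 (C.s x a b)) (\<Phi>3 x a b) = Br32 \<gamma> (\<Phi>3 x b a)"
    if ob: "x \<in> Ob C" "a \<in> Ob C" "b \<in> Ob C" for x a b
  proof -
    have "post D (p1 (C.s x a b)) (\<Phi>3 x a b) = post D (p1 (C.s x a b) \<cdot>\<^bsub>D\<^esub> lax2 \<phi> (K_tens R x a) b \<cdot>\<^bsub>D\<^esub> K_tensA D S (lax2 \<phi> x a) (\<one>\<^bsub>D\<^esub> (p0 b))) (D.\<Theta>3 (p0 x) (p0 a) (p0 b))"
      using ob by (simp add: Phi3 D.post_post)
    also have "p1 (C.s x a b) \<cdot>\<^bsub>D\<^esub> lax2 \<phi> (K_tens R x a) b \<cdot>\<^bsub>D\<^esub> K_tensA D S (lax2 \<phi> x a) (\<one>\<^bsub>D\<^esub> (p0 b)) =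
      lax2 \<phi> (K_tens R x b) a \<cdot>\<^bsub>D\<^esub> K_tensA D S (lax2 \<phi> x b) (\<one>\<^bsub>D\<^esub> (p0 a)) \<cdot>\<^bsub>D\<^esub> D.s (p0 x) (p0 a) (p0 b)"
      using \<phi>(1) ob by (simp add: braided_lax_monoidal_def)
    also have "post D \<dots> (D.\<Theta>3 (p0 x) (p0 a) (p0 b)) = Br32 \<gamma> (\<Phi>3 x b a)"
      using ob by (simp add: D.post_Comp D.post_braid Phi3 D.post_Br32)
    finally show ?thesis .
  qed
  have b32: "lift_map (Br32 \<beta> f) = Br32 \<gamma> (lift_map f)" if f: "f \<in> Maps C" "mode f = Tight" "arity f = 3" for f
  proof -
    obtain x b a where inp: "inputs f = [x, b, a]" using f(3) by (auto simp: arity_cases)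
    have ob: "x \<in> Ob C" "b \<in> Ob C" "a \<in> Ob C" using f inp C.input_in_Ob by force+
    obtain p where p: "p \<in> Arr C" "src p = K_tens R (K_tens R x b) a" "f = post C p (C.\<Theta>3 x b a)"
      using C.factor3[OF f(1,2) inp] .
    have "Br32 \<beta> f = post C p (post C (C.s x a b) (C.\<Theta>3 x a b))"
      unfolding p(3) using p(1,2) ob by (simp add: C.post_braid C.post_Br32)
    then have "lift_map (Br32 \<beta> f) = post D (p1 p) (post D (p1 (C.s x a b)) (\<Phi>3 x a b))"
      using p(1,2) ob by (simp add: lift_post)
    also have "\<dots> = Br32 \<gamma> (lift_map f)"
      unfolding p(3) using p(1,2) ob by (simp add: Phi3_braid lift_post D.post_Br32)
    finally show ?thesis .
  qed
  have b4: "lift_map (Br42 \<beta> f) = Br42 \<gamma> (lift_map f)" "lift_map (Br43 \<beta> f) = Br43 \<gamma> (lift_map f)"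
    if f: "f \<in> Maps C" "mode f = Tight" "arity f = 4" for f
  proof -
    obtain a b c d where inp: "inputs f = [a, b, c, d]" using f(3) by (auto simp: arity_cases)
    have ob: "a \<in> Ob C" "b \<in> Ob C" "c \<in> Ob C" "d \<in> Ob C" using f inp C.input_in_Ob by force+
    obtain p where p: "p \<in> Arr C" "src p = K_tens R (K_tens R (K_tens R a b) c) d" "f = post C p (C.\<Theta>4 a b c d)"
      using C.factor4[OF f(1,2) inp] .
    \<comment> \<open>split as a binary map with \<open>\<theta>3\<close> substituted, to reach \<open>\<beta>\<^sup>4\<^sub>2\<close>\<close>
    have "f = Sub C (post C p (C.\<Theta> (K_tens R (K_tens R a b) c) d)) (Suc 0) (C.\<Theta>3 a b c)"
      unfolding p(3) using p(1,2) ob by (simp add: C.\<Theta>4_def C.post_Sub)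
    then show "lift_map (Br42 \<beta> f) = Br42 \<gamma> (lift_map f)"
      using p(1,2) ob by (simp add: lift_Sub_23_1 b32 lift_post flip: C.Sub_Br32_right D.Sub_Br32_right)
    \<comment> \<open>split as a ternary map with \<open>\<theta>\<close> substituted, to reach \<open>\<beta>\<^sup>4\<^sub>3\<close>\<close>
    have "f = Sub C (post C p (C.\<Theta>3 (K_tens R a b) c d)) (Suc 0) (C.\<Theta> a b)"
      unfolding p(3) using p(1,2) ob by (simp add: C.theta4_alt C.post_Sub)
    then show "lift_map (Br43 \<beta> f) = Br43 \<gamma> (lift_map f)"
      using p(1,2) ob by (simp add: lift_Sub_x2_1 b32 lift_post flip: C.Sub_Br32_left D.Sub_Br32_left)
  qed
  have "braided_multifunctor (C, \<beta>) (D, \<gamma>) lift"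
    using multifunctor_lift by (simp add: braided_multifunctor_def) (simp add: lift_def b32 b4)
  with K_lax_lift[OF \<phi>(2)] show thesis by (intro that)
qed

section \<open>The short multicategory of a braided monoidal category\<close>

lemma arity_le4_cases:
  assumes "length xs \<le> 4"
  obtains "xs = []" | a where "xs = [a]" | a b where "xs = [a, b]" | a b c where "xs = [a, b, c]"
    | a b c d where "xs = [a, b, c, d]"
proof -
  have "length xs = 0 \<or> length xs = Suc 0 \<or> length xs = 2 \<or> length xs = 3 \<or> length xs = 4" using assms by arith
  then show thesis using that by (auto simp: arity_cases)
qed

text \<open>
  A nullary map is an arrow out of the unit, whereas a unary map is just an arrow: the unit occurs in the
  empty tensor product only.
\<close>

definition tens_list where
  "tens_list M as = (case as of [] \<Rightarrow> Unit M | a # bs \<Rightarrow> foldl (Tens M) a bs)"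

definition tens_arr where
  "tens_arr M ps = (case ps of [] \<Rightarrow> Id M (Unit M) | p # qs \<Rightarrow> foldl (TensA M) p qs)"

lemma tens_list_simps [simp]:
  "tens_list M [] = Unit M" "tens_list M (a # bs) = foldl (Tens M) a bs"
  by (simp_all add: tens_list_def)

lemma tens_arr_simps [simp]:
  "tens_arr M [] = Id M (Unit M)" "tens_arr M (p # qs) = foldl (TensA M) p qs"
  by (simp_all add: tens_arr_def)

lemma tens_list_snoc: "xs \<noteq> [] \<Longrightarrow> tens_list M (xs @ [c]) = Tens M (tens_list M xs) c"
  by (cases xs) simp_all

text \<open>
  A multimap of the short multicategory of \<open>M\<close> carries the label of an arrow of \<open>M\<close> out of the
  left-bracketed tensor product of its inputs. On unary maps this is the identification of tight unary
  maps with arrows, and it does not see the mode.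
\<close>

definition arrow_of where
  "arrow_of M f = Arrow (tens_list M (inputs f)) (outcome f) (mlbl f)"

definition multi where
  "multi x as p = Multimap x as (tgt p) (lbl p)"

lemma arrow_of_simps [simp]: "src (arrow_of M f) = tens_list M (inputs f)" "tgt (arrow_of M f) = outcome f"
  by (simp_all add: arrow_of_def)

lemma multi_simps [simp]: "mode (multi x as p) = x" "inputs (multi x as p) = as" "outcome (multi x as p) = tgt p"
  by (simp_all add: multi_def)

lemma arrow_of_multi [simp]: "src p = tens_list M as \<Longrightarrow> arrow_of M (multi x as p) = p"
  by (cases p) (simp add: arrow_of_def multi_def)

lemma multi_arrow_of: "mode f = x \<Longrightarrow> inputs f = as \<Longrightarrow> multi x as (arrow_of M f) = f"
  by (cases f) (simp add: arrow_of_def multi_def)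

lemma multimap_eqI: "mode f = mode g \<Longrightarrow> inputs f = inputs g \<Longrightarrow> arrow_of M f = arrow_of M g \<Longrightarrow> f = g"
  by (cases f; cases g) (simp add: arrow_of_def)

lemma as_loose_simps [simp]:
  "mode (as_loose f) = Loose" "inputs (as_loose f) = inputs f" "outcome (as_loose f) = outcome f" "arrow_of M (as_loose f) = arrow_of M f"
  by (simp_all add: as_loose_def arrow_of_def)

lemma arrow_of_to_multi [simp]: "arrow_of M (to_multi p) = p"
  by (cases p) (simp add: arrow_of_def to_multi_def)

lemma to_arrow_eq_arrow_of: "arity f = Suc 0 \<Longrightarrow> to_arrow f = arrow_of M f"
  by (auto simp: arrow_of_def to_arrow_def arity_cases)

text \<open>
  By \<open>invertible_constraints_if_LUnit\<close> this is another description of braided monoidal categories.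
\<close>

locale left_normal_braided = skew_braiding M s
  for M :: "('o, 'm) skmon" (structure) and s +
  assumes LUnit_inv: "a \<in> Ob M \<Longrightarrow> invertible_arrow M (\<l> a)"
begin

definition linv where "linv a = (SOME e. inverse_arrows M (\<l> a) e)"

lemma inverse_linv: "a \<in> Ob M \<Longrightarrow> inverse_arrows M (\<l> a) (linv a)"
  using LUnit_inv unfolding linv_def invertible_arrow_def by (rule someI_ex)

lemma linv_simps [simp]:
  assumes "a \<in> Ob M"
  shows "linv a \<in> Arr M" "src (linv a) = a" "tgt (linv a) = \<I> \<otimes> a" "linv a \<cdot> \<l> a = \<one> (\<I> \<otimes> a)" "\<l> a \<cdot> linv a = \<one> a"
  using inverse_arrowsD[OF inverse_linv[OF assms]] assms by simp_all

lemma LUnit_cancel: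
  assumes "\<l> a \<cdot> p = \<l> a \<cdot> q" "a \<in> Ob M" "p \<in> Arr M" "q \<in> Arr M" "tgt p = \<I> \<otimes> a" "tgt q = \<I> \<otimes> a"
  shows "p = q"
proof -
  have "p = (linv a \<cdot> \<l> a) \<cdot> p" using assms(2-) by (simp del: Comp_assoc')
  also have "\<dots> = linv a \<cdot> \<l> a \<cdot> p" by (rule Comp_assoc) (use assms(2-) in simp_all)
  also have "\<dots> = linv a \<cdot> \<l> a \<cdot> q" by (simp only: assms(1))
  also have "\<dots> = (linv a \<cdot> \<l> a) \<cdot> q" by (rule Comp_assoc[symmetric]) (use assms(2-) in simp_all)
  also have "\<dots> = q" using assms(2-) by (simp del: Comp_assoc')
  finally show ?thesis .
qed

lemma linv_natural: "f \<in> Arr M \<Longrightarrow> linv (tgt f) \<cdot> f = (\<one> \<I> \<star> f) \<cdot> linv (src f)"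
proof (rule LUnit_cancel[of "tgt f"])
  assume f: "f \<in> Arr M"
  have "\<l> (tgt f) \<cdot> (\<one> \<I> \<star> f) \<cdot> linv (src f) = (\<l> (tgt f) \<cdot> (\<one> \<I> \<star> f)) \<cdot> linv (src f)" using f by simp
  also have "\<dots> = f" unfolding LUnit_nat[OF f] using f by simp
  finally show "\<l> (tgt f) \<cdot> linv (tgt f) \<cdot> f = \<l> (tgt f) \<cdot> (\<one> \<I> \<star> f) \<cdot> linv (src f)"
    using f by (simp flip: Comp_assoc')
qed simp_all

text \<open>
  The unit axioms of \<open>M\<close> rewritten in terms of the inverse of \<open>\<l>\<close>, which is how \<open>\<l>\<close> enters substitution.
\<close>

lemma Assoc_linv: 
  assumes [simp]: "a \<in> Ob M" "b \<in> Ob M" shows "\<alpha> \<I> a b \<cdot> (linv a \<star> \<one> b) = linv (a \<otimes> b)"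
proof (rule LUnit_cancel[of "a \<otimes> b"])
  have "\<l> (a \<otimes> b) \<cdot> \<alpha> \<I> a b \<cdot> (linv a \<star> \<one> b) = (\<l> (a \<otimes> b) \<cdot> \<alpha> \<I> a b) \<cdot> (linv a \<star> \<one> b)" by simp
  also have "\<dots> = \<one> (a \<otimes> b)" by (simp add: LUnit_Assoc flip: TensA_Comp_left)
  finally show "\<l> (a \<otimes> b) \<cdot> \<alpha> \<I> a b \<cdot> (linv a \<star> \<one> b) = \<l> (a \<otimes> b) \<cdot> linv (a \<otimes> b)" by simp
qed simp_all

lemma Assoc_RUnit_left:
  assumes [simp]: "a \<in> Ob M" "b \<in> Ob M" shows "\<alpha> a \<I> b \<cdot> (\<r> a \<star> \<one> b) = \<one> a \<star> linv b"
proof -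
  have "(\<one> a \<star> linv b) \<cdot> (\<one> a \<star> \<l> b) \<cdot> \<alpha> a \<I> b \<cdot> (\<r> a \<star> \<one> b) = \<one> a \<star> linv b"
    by (simp add: triangle)
  moreover have "((\<one> a \<star> linv b) \<cdot> (\<one> a \<star> \<l> b)) \<cdot> \<alpha> a \<I> b \<cdot> (\<r> a \<star> \<one> b) = \<alpha> a \<I> b \<cdot> (\<r> a \<star> \<one> b)"
    by (simp del: Comp_assoc' flip: TensA_Comp_right)
  ultimately show ?thesis by simp
qed

lemma linv_Unit: "linv \<I> = \<r> \<I>"
  by (rule LUnit_cancel[of \<I>]) (simp_all add: LUnit_RUnit)

lemma foldl_Tens_Ob [simp]: "a \<in> Ob M \<Longrightarrow> set bs \<subseteq> Ob M \<Longrightarrow> foldl (\<otimes>) a bs \<in> Ob M"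
  by (induction bs arbitrary: a) simp_all

lemma tens_list_Ob: "set as \<subseteq> Ob M \<Longrightarrow> tens_list M as \<in> Ob M"
  by (cases as) simp_all

lemma into_inputs_arrows: "into_inputs M ps as \<longleftrightarrow> set ps \<subseteq> Arr M \<and> as = map tgt ps"
proof (induction ps arbitrary: as)
  case (Cons p ps) then show ?case by (cases as) auto
qed (case_tac as; simp)

lemma foldl_TensA:
  "p \<in> Arr M \<Longrightarrow> set ps \<subseteq> Arr M \<Longrightarrow> foldl (\<star>) p ps \<in> Arr M \<and>
    src (foldl (\<star>) p ps) = foldl (\<otimes>) (src p) (map src ps) \<and> tgt (foldl (\<star>) p ps) = foldl (\<otimes>) (tgt p) (map tgt ps)"
  by (induction ps arbitrary: p) simp_all

lemma foldl_TensA_Comp: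
  "p \<in> Arr M \<Longrightarrow> p' \<in> Arr M \<Longrightarrow> src p = tgt p' \<Longrightarrow> set ps \<subseteq> Arr M \<Longrightarrow> set ps' \<subseteq> Arr M \<Longrightarrow> map src ps = map tgt ps' \<Longrightarrow>
    foldl (\<star>) (p \<cdot> p') (map2 (\<cdot>) ps ps') = foldl (\<star>) p ps \<cdot> foldl (\<star>) p' ps'"
proof (induction ps arbitrary: p p' ps')
  case (Cons q ps)
  then obtain q' qs where "ps' = q' # qs" by (cases ps') auto
  with Cons show ?case by (simp add: TensA_Comp)
qed simp

lemma foldl_TensA_Id: "a \<in> Ob M \<Longrightarrow> set as \<subseteq> Ob M \<Longrightarrow> foldl (\<star>) (\<one> a) (map \<one> as) = \<one> (foldl (\<otimes>) a as)"
  by (induction as arbitrary: a) simp_all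

lemma tens_arr_hom:
  assumes "into_inputs M ps as"
  shows "tens_arr M ps \<in> Arr M" "src (tens_arr M ps) = tens_list M (map src ps)"
    and tens_arr_tgt: "tgt (tens_arr M ps) = tens_list M as"
proof -
  have "tens_arr M ps \<in> Arr M \<and> src (tens_arr M ps) = tens_list M (map src ps) \<and> tgt (tens_arr M ps) = tens_list M as"
    using assms foldl_TensA by (cases ps) (auto simp: into_inputs_arrows)
  then show "tens_arr M ps \<in> Arr M" "src (tens_arr M ps) = tens_list M (map src ps)"
    "tgt (tens_arr M ps) = tens_list M as" by auto
qed

lemma tens_arr_Comp:
  assumes "into_inputs M ps as" "into_inputs M ps' (map src ps)"
  shows "tens_arr M (map2 (\<cdot>) ps ps') = tens_arr M ps \<cdot> tens_arr M ps'"
proof (cases ps)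
  case Nil then show ?thesis using assms by (simp add: into_inputs_arrows)
next
  case (Cons p qs)
  then obtain p' qs' where "ps' = p' # qs'" using assms(2) by (cases ps') auto
  then show ?thesis using Cons assms foldl_TensA_Comp[of p p' qs qs'] by (auto simp: into_inputs_arrows)
qed

lemma tens_arr_Id: "set as \<subseteq> Ob M \<Longrightarrow> tens_arr M (map \<one> as) = \<one> (tens_list M as)"
  by (cases as) (simp_all add: foldl_TensA_Id)

definition pMaps where
  "pMaps = {f. arrow_of M f \<in> Arr M \<and> set (inputs f) \<subseteq> Ob M \<and>
     (mode f = Tight \<and> 1 \<le> arity f \<and> arity f \<le> 4 \<or> mode f = Loose \<and> arity f \<le> 2)}"

definition pAct where
  "pAct ps q f = multi (mode f) (map src ps) (q \<cdot> arrow_of M f \<cdot> tens_arr M ps)"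

text \<open>
  The arrows \<open>(inputs g) \<otimes> b \<rightarrow> outcome g \<otimes> b\<close> and \<open>a \<otimes> (inputs g) \<rightarrow> a \<otimes> outcome g\<close> that a map
  \<open>g\<close> induces when it is substituted into the first or the second input of a binary map. The source is
  bracketed to the left, which is why \<open>\<alpha>\<close> has to be inserted in the second case.
\<close>

definition arg1 where
  "arg1 g b = (if inputs g = [] then (arrow_of M g \<star> \<one> b) \<cdot> linv b else arrow_of M g \<star> \<one> b)"

definition arg2 where
  "arg2 a g = (case inputs g of [] \<Rightarrow> (\<one> a \<star> arrow_of M g) \<cdot> \<r> a | [x] \<Rightarrow> \<one> a \<star> arrow_of M g
     | [x, y] \<Rightarrow> (\<one> a \<star> arrow_of M g) \<cdot> \<alpha> a x y
     | x # y # z # _ \<Rightarrow> (\<one> a \<star> arrow_of M g) \<cdot> \<alpha> a (x \<otimes> y) z \<cdot> (\<alpha> a x y \<star> \<one> z))"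

text \<open>
  The arrow to be precomposed for a substitution at position \<open>i\<close> of a map with inputs \<open>as\<close>. A ternary
  map is treated as a binary one with first input \<open>a \<otimes> b\<close>.
\<close>

definition argument where
  "argument as (i::nat) g = (case as of [a] \<Rightarrow> arrow_of M g
     | [a, b] \<Rightarrow> if i = 1 then arg1 g b else arg2 a g
     | a # b # c # _ \<Rightarrow> if i = 1 then arg1 g b \<star> \<one> c else if i = 2 then arg2 a g \<star> \<one> c else arg2 (a \<otimes> b) g)"

definition pSub where
  "pSub f i g = multi (mode_sub (mode f) i (mode g)) (take (i - 1) (inputs f) @ inputs g @ drop i (inputs f))
     (arrow_of M f \<cdot> argument (inputs f) i g)"

definition PM :: "('o, 'm) ssmulti" where
  "PM = \<lparr>Ob = Ob M, Arr = Arr M, Id = Id M, Comp = Comp M, Maps = pMaps, Act = pAct, Sub = pSub, J = as_loose\<rparr>"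

lemma PM_simps [simp]:
  "Ob PM = Ob M" "Arr PM = Arr M" "Id PM = Id M" "Comp PM = Comp M" "Maps PM = pMaps" "Act PM = pAct" "Sub PM = pSub"
  "J PM = as_loose" "hom PM = hom M" "into_inputs PM = into_inputs M"
  by (simp_all add: PM_def hom_def into_inputs_def fun_eq_iff)

lemma pMapsD [simp]:
  assumes "f \<in> pMaps"
  shows "arrow_of M f \<in> Arr M" "set (inputs f) \<subseteq> Ob M" "outcome f \<in> Ob M"
  using assms tgt_Ob[of "arrow_of M f"] by (simp_all add: pMaps_def)

lemma pMaps_Ob: "f \<in> pMaps \<Longrightarrow> a \<in> set (inputs f) \<Longrightarrow> a \<in> Ob M"
  using pMapsD(2) by blast

lemma multi_pMaps:
  "p \<in> Arr M \<Longrightarrow> src p = tens_list M as \<Longrightarrow> set as \<subseteq> Ob M \<Longrightarrow>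
   x = Tight \<and> 1 \<le> length as \<and> length as \<le> 4 \<or> x = Loose \<and> length as \<le> 2 \<Longrightarrow> multi x as p \<in> pMaps"
  by (simp add: pMaps_def del: pMapsD)

lemma pAct_simps:
  assumes "f \<in> pMaps" "into_inputs M ps (inputs f)" "q \<in> Arr M" "src q = outcome f"
  shows "pAct ps q f \<in> pMaps" "mode (pAct ps q f) = mode f" "inputs (pAct ps q f) = map src ps"
    "outcome (pAct ps q f) = tgt q" "arrow_of M (pAct ps q f) = q \<cdot> arrow_of M f \<cdot> tens_arr M ps"
proof -
  have [simp]: "tgt (tens_arr M ps) = tens_list M (inputs f)" by (rule tens_arr_tgt[OF assms(2)])
  have [simp]: "tens_arr M ps \<in> Arr M" "src (tens_arr M ps) = tens_list M (map src ps)"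
    using tens_arr_hom[OF assms(2)] by simp_all
  have len: "length ps = arity f" using assms(2) by (simp add: into_inputs_iff)
  have "set (map src ps) \<subseteq> Ob M" using assms(2) by (auto simp: into_inputs_iff in_set_conv_nth)
  then show "pAct ps q f \<in> pMaps" using assms len unfolding pAct_def
    by (intro multi_pMaps) (auto simp: pMaps_def simp del: pMapsD)
  show "mode (pAct ps q f) = mode f" "inputs (pAct ps q f) = map src ps"
    "outcome (pAct ps q f) = tgt q" "arrow_of M (pAct ps q f) = q \<cdot> arrow_of M f \<cdot> tens_arr M ps"
    using assms by (simp_all add: pAct_def)
qed

lemma arg1_simps [simp]:
  assumes "g \<in> pMaps" "b \<in> Ob M"
  shows "arg1 g b \<in> Arr M" "src (arg1 g b) = tens_list M (inputs g @ [b])" "tgt (arg1 g b) = outcome g \<otimes> b"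
proof -
  have "arrow_of M g \<in> Arr M" "set (inputs g) \<subseteq> Ob M" using assms by simp_all
  then show "arg1 g b \<in> Arr M" "src (arg1 g b) = tens_list M (inputs g @ [b])" "tgt (arg1 g b) = outcome g \<otimes> b"
    using assms(2) by (cases "inputs g"; simp add: arg1_def)+
qed

lemma arg2_simps [simp]:
  assumes "g \<in> pMaps" "a \<in> Ob M" "arity g \<le> 3"
  shows "arg2 a g \<in> Arr M" "src (arg2 a g) = tens_list M (a # inputs g)" "tgt (arg2 a g) = a \<otimes> outcome g"
proof -
  have g: "arrow_of M g \<in> Arr M" "set (inputs g) \<subseteq> Ob M" using assms by simp_all
  have "arity g \<le> 4" using assms(3) by simp
  then have "arg2 a g \<in> Arr M \<and> src (arg2 a g) = tens_list M (a # inputs g) \<and> tgt (arg2 a g) = a \<otimes> outcome g"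
    by (cases rule: arity_le4_cases) (use assms g in \<open>simp_all add: arg2_def\<close>)
  then show "arg2 a g \<in> Arr M" "src (arg2 a g) = tens_list M (a # inputs g)" "tgt (arg2 a g) = a \<otimes> outcome g"
    by auto
qed

text \<open>
  Besides the shapes in which substitution is part of the structure this covers those in which one of the
  maps is tight unary. There the formula \<open>pSub\<close> gives the functorial action, so that it computes all
  instances of \<open>circ\<close> in the axioms.
\<close>

definition pShape where
  "pShape f (i::nat) g \<longleftrightarrow> f \<in> pMaps \<and> g \<in> pMaps \<and> arity g \<le> 3 \<and>
     (inputs f = [outcome g] \<and> i = 1 \<or> (\<exists>b. inputs f = [outcome g, b]) \<and> i = 1 \<or> (\<exists>a. inputs f = [a, outcome g]) \<and> i = 2 \<or>
      (\<exists>b c. inputs f = [outcome g, b, c]) \<and> i = 1 \<or> (\<exists>a c. inputs f = [a, outcome g, c]) \<and> i = 2 \<or>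
      (\<exists>a b. inputs f = [a, b, outcome g]) \<and> i = 3)"

lemma pShape_substitutable:
  assumes "f \<in> pMaps" "g \<in> pMaps" "(mode f, arity f, mode g, arity g) \<in> sub_shapes"
    "1 \<le> i" "i \<le> arity f" "inputs f ! (i - 1) = outcome g"
  shows "pShape f i g"
proof -
  have ar: "arity f \<le> 4" "arity f = 1 \<or> arity f = 2 \<or> arity f = 3" "arity g \<le> 3"
    using assms(3) by (auto simp: sub_shapes_def)
  have i: "i = 1 \<or> i = 2 \<and> arity f \<noteq> 1 \<or> i = 3 \<and> arity f = 3" using ar(2) assms(4,5) by arith
  from ar(1) show ?thesis
    by (cases rule: arity_le4_cases) (use assms ar i in \<open>auto simp: pShape_def\<close>)
qed

lemma argument_simps:
  assumes "pShape f i g"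
  shows "argument (inputs f) i g \<in> Arr M" "tgt (argument (inputs f) i g) = tens_list M (inputs f)"
    "src (argument (inputs f) i g) = tens_list M (take (i - 1) (inputs f) @ inputs g @ drop i (inputs f))"
proof -
  have f: "f \<in> pMaps" "g \<in> pMaps" "arity g \<le> 3" "set (inputs f) \<subseteq> Ob M" using assms pMapsD(2) by (auto simp: pShape_def)
  have snoc: "tens_list M (xs @ [b, c]) = tens_list M (xs @ [b]) \<otimes> c" for xs b c
    using tens_list_snoc[of "xs @ [b]" M c] by simp
  have "argument (inputs f) i g \<in> Arr M \<and> tgt (argument (inputs f) i g) = tens_list M (inputs f) \<and>
    src (argument (inputs f) i g) = tens_list M (take (i - 1) (inputs f) @ inputs g @ drop i (inputs f))"
    using assms f unfolding pShape_def
    by (elim conjE disjE exE) (simp_all add: argument_def snoc del: tens_list_simps(2), simp_all)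
  then show "argument (inputs f) i g \<in> Arr M" "tgt (argument (inputs f) i g) = tens_list M (inputs f)"
    "src (argument (inputs f) i g) = tens_list M (take (i - 1) (inputs f) @ inputs g @ drop i (inputs f))" by auto
qed

lemma pSub_simps:
  assumes "pShape f i g"
  shows "mode (pSub f i g) = mode_sub (mode f) i (mode g)"
    "inputs (pSub f i g) = take (i - 1) (inputs f) @ inputs g @ drop i (inputs f)"
    "outcome (pSub f i g) = outcome f" "arrow_of M (pSub f i g) = arrow_of M f \<cdot> argument (inputs f) i g"
proof -
  have f: "f \<in> pMaps" using assms by (auto simp: pShape_def)
  show "mode (pSub f i g) = mode_sub (mode f) i (mode g)"
    "inputs (pSub f i g) = take (i - 1) (inputs f) @ inputs g @ drop i (inputs f)"
    "outcome (pSub f i g) = outcome f" "arrow_of M (pSub f i g) = arrow_of M f \<cdot> argument (inputs f) i g"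
    using f argument_simps[OF assms] by (simp_all add: pSub_def)
qed

lemma pSub_pMaps:
  assumes "pShape f i g" "mode_sub (mode f) i (mode g) = Loose \<Longrightarrow> arity f + arity g \<le> 3"
    "mode_sub (mode f) i (mode g) = Tight \<Longrightarrow> 2 \<le> arity f + arity g \<and> arity f + arity g \<le> 5"
  shows "pSub f i g \<in> pMaps"
proof -
  have f: "f \<in> pMaps" "arrow_of M f \<in> Arr M" "set (inputs f) \<subseteq> Ob M" "set (inputs g) \<subseteq> Ob M"
    using assms pMapsD(1,2) by (auto simp: pShape_def)
  have i: "1 \<le> i" "i \<le> arity f" using assms(1) by (auto simp: pShape_def)
  have "set (take (i - 1) (inputs f) @ inputs g @ drop i (inputs f)) \<subseteq> Ob M"
    unfolding set_append using f(3,4) set_take_subset[of "i - 1" "inputs f"] set_drop_subset[of i "inputs f"] by blast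
  moreover have "length (take (i - 1) (inputs f) @ inputs g @ drop i (inputs f)) = arity f + arity g - 1"
    using i by simp
  ultimately show ?thesis using f assms(2,3) argument_simps[OF assms(1)] unfolding pSub_def
    by (intro multi_pMaps; cases "mode_sub (mode f) i (mode g)") auto
qed

lemma pre_PM:
  assumes f: "f \<in> pMaps" "arity f \<le> 3" and g: "g \<in> pMaps" "mode g = Tight" "arity g = 1"
    and i: "1 \<le> i" "i \<le> arity f" "inputs f ! (i - 1) = outcome g"
  shows "pre PM f i (to_arrow g) = pSub f i g" "pShape f i g"
proof -
  obtain x where x: "inputs g = [x]" using g(3) by (auto simp: arity_cases)
  have [simp]: "arrow_of M g \<in> Arr M" "arrow_of M f \<in> Arr M" "set (inputs f) \<subseteq> Ob M" "x \<in> Ob M" "outcome f \<in> Ob M" "outcome g \<in> Ob M"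
    using f(1) g(1) pMaps_Ob[OF g(1)] x by simp_all
  have [simp]: "to_arrow g = arrow_of M g" using g(3) to_arrow_eq_arrow_of by simp
  have "arity f \<le> 4" using f(2) by simp
  then have sh: "pShape f i g"
    by (cases rule: arity_le4_cases) (use f g i x in \<open>auto simp: pShape_def le_Suc_eq numeral_3_eq_3 numeral_2_eq_2\<close>)
  then show "pShape f i g" .
  have "mode_sub (mode f) i Tight = mode f" by (cases "mode f") (simp_all add: mode_sub_def)
  moreover have "(map \<one> (inputs f))[i - 1 := arrow_of M g] \<noteq> []" using i by auto
  moreover have "into_inputs M ((map \<one> (inputs f))[i - 1 := arrow_of M g]) (inputs f)"
    using i pMaps_Ob[OF f(1)] by (auto simp: into_inputs_iff nth_list_update)
  moreover have "argument (inputs f) i g = tens_arr M ((map \<one> (inputs f))[i - 1 := arrow_of M g])"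
    using sh f x pMaps_Ob[OF f(1)] unfolding pShape_def
    by (elim conjE disjE exE) (simp_all add: argument_def arg1_def arg2_def)
  moreover have "map src ((map \<one> (inputs f))[i - 1 := arrow_of M g]) = take (i - 1) (inputs f) @ inputs g @ drop i (inputs f)"
    using sh f x pMaps_Ob[OF f(1)] unfolding pShape_def by (elim conjE disjE exE) simp_all
  ultimately show "pre PM f i (to_arrow g) = pSub f i g"
    using g f tens_arr_hom[of "(map \<one> (inputs f))[i - 1 := arrow_of M g]" "inputs f"] tens_arr_tgt[of "(map \<one> (inputs f))[i - 1 := arrow_of M g]" "inputs f"]
    by (simp add: pre_def pAct_def pSub_def)
qed

lemma post_PM:
  assumes f: "f \<in> pMaps" "mode f = Tight" "inputs f = [outcome g]" and g: "g \<in> pMaps" "arity g \<le> 3"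
  shows "post PM (to_arrow f) g = pSub f 1 g" "pShape f 1 g"
proof -
  have [simp]: "to_arrow f = arrow_of M f" using f(3) to_arrow_eq_arrow_of[of f] by simp
  have "map (src \<circ> \<one>) (inputs g) = inputs g" using pMaps_Ob[OF g(1)] by (intro map_idI) simp
  then show "post PM (to_arrow f) g = pSub f 1 g"
    using f g tens_list_Ob[of "inputs g"] by (simp add: post_def pAct_def pSub_def tens_arr_Id argument_def)
  show "pShape f 1 g" using f g by (auto simp: pShape_def)
qed

lemma circ_PM:
  assumes "pShape f i g" "f \<in> pMaps" "g \<in> pMaps"
  shows "f \<bullet>\<^bsub>PM\<^esub>\<langle>i\<rangle> g = pSub f i g"
proof -
  have i: "1 \<le> i" "i \<le> arity f" "inputs f ! (i - 1) = outcome g" "arity f \<le> 3" "arity g \<le> 3"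
    using assms(1) by (auto simp: pShape_def)
  show ?thesis
  proof (cases "mode g = Tight \<and> arity g = 1")
    case True then show ?thesis using pre_PM(1)[OF assms(2) i(4) assms(3)] i by (simp add: circ_def)
  next
    case False
    then show ?thesis using assms i post_PM(1)[OF assms(2)] by (auto simp: circ_def arity_cases)
  qed
qed

end

context left_normal_braided
begin

lemma post_pMaps:
  assumes "g \<in> pMaps" "p \<in> Arr M" "src p = outcome g"
  shows "post PM p g \<in> pMaps" "mode (post PM p g) = mode g" "inputs (post PM p g) = inputs g"
    "outcome (post PM p g) = tgt p" "arrow_of M (post PM p g) = p \<cdot> arrow_of M g"
proof -
  have ids: "into_inputs M (map \<one> (inputs g)) (inputs g)" "map (src \<circ> \<one>) (inputs g) = inputs g"
    using pMaps_Ob[OF assms(1)] by (auto simp: into_inputs_iff intro: map_idI)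
  show "post PM p g \<in> pMaps" "mode (post PM p g) = mode g" "inputs (post PM p g) = inputs g"
    "outcome (post PM p g) = tgt p" "arrow_of M (post PM p g) = p \<cdot> arrow_of M g"
    using assms pAct_simps[OF assms(1) ids(1) assms(2,3)] ids(2)
    by (simp_all add: post_def tens_arr_Id)
qed

lemma TensA_exchange:
  assumes "r \<in> Arr M" "t \<in> Arr M" "u \<in> Arr M" "tgt t = src u"
  shows "(r \<star> \<one> (tgt u)) \<cdot> (\<one> (src r) \<star> (u \<cdot> t)) = (\<one> (tgt r) \<star> u) \<cdot> (r \<star> t)"
    "(\<one> (tgt u) \<star> r) \<cdot> ((u \<cdot> t) \<star> \<one> (src r)) = (u \<star> \<one> (tgt r)) \<cdot> (t \<star> r)"
  using assms by (simp_all flip: TensA_Comp)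

lemma tens_arr_snoc: "ps \<noteq> [] \<Longrightarrow> tens_arr M (ps @ [r]) = tens_arr M ps \<star> r"
  by (cases ps) simp_all

lemma arg1_natural:
  assumes g: "g \<in> pMaps" and ps: "into_inputs M ps (inputs g)" and r: "r \<in> Arr M"
  shows "(\<one> (outcome g) \<star> r) \<cdot> arg1 (pAct ps (\<one> (outcome g)) g) (src r) = arg1 g (tgt r) \<cdot> tens_arr M (ps @ [r])"
proof -
  have o: "outcome g \<in> Ob M" "arrow_of M g \<in> Arr M" using g by simp_all
  note act = pAct_simps[OF g ps Id_Arr[OF o(1)] src_Id[OF o(1)]]
  note T = tens_arr_hom[OF ps] tens_arr_tgt[OF ps]
  show ?thesis
  proof (cases "inputs g = []")
    case True
    then have [simp]: "ps = []" using ps by (cases ps) simp_all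
    have "(\<one> (outcome g) \<star> r) \<cdot> (arrow_of M g \<star> \<one> (src r)) \<cdot> linv (src r) = ((\<one> (outcome g) \<star> r) \<cdot> (arrow_of M g \<star> \<one> (src r))) \<cdot> linv (src r)"
      using True o r by simp
    also have "\<dots> = ((arrow_of M g \<star> \<one> (tgt r)) \<cdot> (\<one> \<I> \<star> r)) \<cdot> linv (src r)"
      using True o r by (simp flip: TensA_Comp)
    also have "\<dots> = (arrow_of M g \<star> \<one> (tgt r)) \<cdot> linv (tgt r) \<cdot> r"
      using True o r by (simp add: linv_natural)
    finally show ?thesis using True o r act by (simp add: arg1_def)
  next
    case False
    then have "ps \<noteq> []" using ps by (cases ps; cases "inputs g") simp_all
    then show ?thesis using False o r T act TensA_exchange(2)[of r "tens_arr M ps" "arrow_of M g"]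
      by (simp add: arg1_def tens_arr_snoc)
  qed
qed

text \<open>
  Naturality of the inserted constraints \<open>\<r>\<close> and \<open>\<alpha>\<close>, according to the arity of \<open>g\<close>.
\<close>

lemma arg2_natural:
  assumes g: "g \<in> pMaps" "arity g \<le> 3" and ps: "into_inputs M ps (inputs g)" and r: "r \<in> Arr M"
  shows "(r \<star> \<one> (outcome g)) \<cdot> arg2 (src r) (pAct ps (\<one> (outcome g)) g) = arg2 (tgt r) g \<cdot> tens_arr M (r # ps)"
proof -
  have o: "outcome g \<in> Ob M" "arrow_of M g \<in> Arr M" using g by simp_all
  note act = pAct_simps[OF g(1) ps Id_Arr[OF o(1)] src_Id[OF o(1)]]
  note T = tens_arr_hom[OF ps] tens_arr_tgt[OF ps]
  have ex: "(r \<star> \<one> (outcome g)) \<cdot> (\<one> (src r) \<star> (arrow_of M g \<cdot> tens_arr M ps)) = (\<one> (tgt r) \<star> arrow_of M g) \<cdot> (r \<star> tens_arr M ps)"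
    using TensA_exchange(1)[of r "tens_arr M ps" "arrow_of M g"] o r T by simp
  have "arity g \<le> 4" using g(2) by simp
  then show ?thesis
  proof (cases rule: arity_le4_cases)
    case 1
    then have [simp]: "ps = []" using ps by (cases ps) simp_all
    have "((r \<star> \<one> (outcome g)) \<cdot> (\<one> (src r) \<star> arrow_of M g)) \<cdot> \<r> (src r) = ((\<one> (tgt r) \<star> arrow_of M g) \<cdot> (r \<star> \<one> \<I>)) \<cdot> \<r> (src r)"
      using ex 1 o by simp
    also have "\<dots> = (\<one> (tgt r) \<star> arrow_of M g) \<cdot> \<r> (tgt r) \<cdot> r" using 1 o r by (simp add: RUnit_nat)
    finally show ?thesis using 1 o r act by (simp add: arg2_def)
  next
    case (2 x)
    then show ?thesis using o r act ex ps by (cases ps) (auto simp: arg2_def into_inputs_arrows)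
  next
    case (3 x y)
    then obtain p q where pq: "ps = [p, q]" "p \<in> Arr M" "q \<in> Arr M" "tgt p = x" "tgt q = y"
      using ps by (auto simp: into_inputs_arrows)
    have "((r \<star> \<one> (outcome g)) \<cdot> (\<one> (src r) \<star> (arrow_of M g \<cdot> (p \<star> q)))) \<cdot> \<alpha> (src r) (src p) (src q) =
      ((\<one> (tgt r) \<star> arrow_of M g) \<cdot> (r \<star> (p \<star> q))) \<cdot> \<alpha> (src r) (src p) (src q)"
      using ex pq by simp
    also have "\<dots> = (\<one> (tgt r) \<star> arrow_of M g) \<cdot> \<alpha> (tgt r) x y \<cdot> (r \<star> p \<star> q)"
      using 3 pq o r Assoc_nat[of r p q] by simp
    finally show ?thesis using 3 o r act pq tgt_Ob[of p] tgt_Ob[of q] by (simp add: arg2_def)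
  next
    case (4 x y z)
    then obtain p q w where pq: "ps = [p, q, w]" "p \<in> Arr M" "q \<in> Arr M" "w \<in> Arr M" "tgt p = x" "tgt q = y" "tgt w = z"
      using ps by (auto simp: into_inputs_arrows)
    have xyz: "x \<in> Ob M" "y \<in> Ob M" "z \<in> Ob M" using pMaps_Ob[OF g(1)] 4 by simp_all
    let ?r = "src r" and ?p = "src p" and ?q = "src q" and ?w = "src w"
    have "((r \<star> \<one> (outcome g)) \<cdot> (\<one> ?r \<star> (arrow_of M g \<cdot> (p \<star> q \<star> w)))) \<cdot> \<alpha> ?r (?p \<otimes> ?q) ?w \<cdot> (\<alpha> ?r ?p ?q \<star> \<one> ?w) =
      ((\<one> (tgt r) \<star> arrow_of M g) \<cdot> (r \<star> (p \<star> q \<star> w))) \<cdot> \<alpha> ?r (?p \<otimes> ?q) ?w \<cdot> (\<alpha> ?r ?p ?q \<star> \<one> ?w)"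
      using ex pq by simp
    also have "\<dots> = (\<one> (tgt r) \<star> arrow_of M g) \<cdot> ((r \<star> (p \<star> q \<star> w)) \<cdot> \<alpha> ?r (?p \<otimes> ?q) ?w) \<cdot> (\<alpha> ?r ?p ?q \<star> \<one> ?w)"
      using 4 pq xyz o r by simp
    also have "(r \<star> (p \<star> q \<star> w)) \<cdot> \<alpha> ?r (?p \<otimes> ?q) ?w = \<alpha> (tgt r) (x \<otimes> y) z \<cdot> (r \<star> (p \<star> q) \<star> w)"
      using Assoc_nat[of r "p \<star> q" w] pq xyz r by simp
    also have "(\<one> (tgt r) \<star> arrow_of M g) \<cdot> (\<alpha> (tgt r) (x \<otimes> y) z \<cdot> (r \<star> (p \<star> q) \<star> w)) \<cdot> (\<alpha> ?r ?p ?q \<star> \<one> ?w) =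
      (\<one> (tgt r) \<star> arrow_of M g) \<cdot> \<alpha> (tgt r) (x \<otimes> y) z \<cdot> (((r \<star> (p \<star> q)) \<cdot> \<alpha> ?r ?p ?q) \<star> w)"
      using 4 pq xyz o r TensA_Comp[of "\<alpha> ?r ?p ?q" "r \<star> (p \<star> q)" "\<one> ?w" w] by simp
    also have "((r \<star> (p \<star> q)) \<cdot> \<alpha> ?r ?p ?q) \<star> w = (\<alpha> (tgt r) x y \<star> \<one> z) \<cdot> (r \<star> p \<star> q \<star> w)"
      using 4 pq xyz o r Assoc_nat[of r p q] TensA_Comp[of "r \<star> p \<star> q" "\<alpha> (tgt r) x y" w "\<one> z"] by simp
    finally show ?thesis using 4 o r act pq tgt_Ob[of p] tgt_Ob[of q] tgt_Ob[of w] by (simp add: arg2_def)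
  next
    case 5 then show ?thesis using g(2) by simp
  qed
qed

lemma arg_post:
  assumes g: "g \<in> pMaps" and p: "p \<in> Arr M" "src p = outcome g"
  shows "b \<in> Ob M \<Longrightarrow> arg1 (post PM p g) b = (p \<star> \<one> b) \<cdot> arg1 g b"
    and "a \<in> Ob M \<Longrightarrow> arity g \<le> 3 \<Longrightarrow> arg2 a (post PM p g) = (\<one> a \<star> p) \<cdot> arg2 a g"
proof -
  note post = post_pMaps[OF g p]
  have o: "arrow_of M g \<in> Arr M" "set (inputs g) \<subseteq> Ob M" using g by simp_all
  show "arg1 (post PM p g) b = (p \<star> \<one> b) \<cdot> arg1 g b" if "b \<in> Ob M"
    using o p post that by (cases "inputs g") (simp_all add: arg1_def TensA_Comp_left)
  show "arg2 a (post PM p g) = (\<one> a \<star> p) \<cdot> arg2 a g" if a: "a \<in> Ob M" and ar: "arity g \<le> 3"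
  proof -
    have "arity g \<le> 4" using ar by simp
    then show ?thesis
      by (cases rule: arity_le4_cases) (use o p post a ar in \<open>simp_all add: arg2_def TensA_Comp_right\<close>)
  qed
qed

lemma argument_natural:
  assumes sh: "pShape f i g" and rs: "into_inputs M rs (inputs f)" "rs ! (i - 1) = \<one> (outcome g)"
    and ps: "into_inputs M ps (inputs g)"
  shows "tens_arr M rs \<cdot> argument (map src rs) i (pAct ps (\<one> (outcome g)) g) =
    argument (inputs f) i g \<cdot> tens_arr M (take (i - 1) rs @ ps @ drop i rs)"
proof -
  have fg: "f \<in> pMaps" "g \<in> pMaps" "arity g \<le> 3" using sh by (auto simp: pShape_def)
  have o: "outcome g \<in> Ob M" "arrow_of M g \<in> Arr M" using fg by simp_all
  have ob: "\<And>a. a \<in> set (inputs f) \<Longrightarrow> a \<in> Ob M" using pMaps_Ob[OF fg(1)] .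
  let ?g = "pAct ps (\<one> (outcome g)) g"
  note act = pAct_simps[OF fg(2) ps Id_Arr[OF o(1)] src_Id[OF o(1)]]
  note T = tens_arr_hom[OF ps] tens_arr_tgt[OF ps]
  have len: "length (inputs ?g) \<le> 3" using act(3) fg(3) ps by (simp add: into_inputs_iff)
  note g' = act(1) len
  have n1: "(\<one> (outcome g) \<star> r) \<cdot> arg1 ?g (src r) = arg1 g (tgt r) \<cdot> tens_arr M (ps @ [r])" if "r \<in> Arr M" for r
    using arg1_natural[OF fg(2) ps that] .
  have n2: "(r \<star> \<one> (outcome g)) \<cdot> arg2 (src r) ?g = arg2 (tgt r) g \<cdot> tens_arr M (r # ps)" if "r \<in> Arr M" for r
    using arg2_natural[OF fg(2,3) ps that] .
  have snoc: "tens_arr M (ps @ [r, r']) = tens_arr M (ps @ [r]) \<star> r'" for r r'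
    using tens_arr_snoc[of "ps @ [r]" r'] by simp
  have rps: "into_inputs M (r # ps) (tgt r # inputs g)" "into_inputs M (ps @ [r]) (inputs g @ [tgt r])" if "r \<in> Arr M" for r
    using that ps by (auto simp: into_inputs_arrows)
  note T' = tens_arr_hom[OF rps(1)] tens_arr_tgt[OF rps(1)] tens_arr_hom[OF rps(2)] tens_arr_tgt[OF rps(2)]
  note A = arg1_simps[OF act(1)] arg2_simps[OF act(1) _ len] arg1_simps[OF fg(2)] arg2_simps[OF fg(2) _ fg(3)]
  consider "inputs f = [outcome g]" "i = 1" "rs = [\<one> (outcome g)]"
    | b r where "inputs f = [outcome g, b]" "i = 1" "rs = [\<one> (outcome g), r]" "r \<in> Arr M" "tgt r = b"
    | a r where "inputs f = [a, outcome g]" "i = 2" "rs = [r, \<one> (outcome g)]" "r \<in> Arr M" "tgt r = a"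
    | b c r t where "inputs f = [outcome g, b, c]" "i = 1" "rs = [\<one> (outcome g), r, t]" "r \<in> Arr M" "tgt r = b" "t \<in> Arr M" "tgt t = c"
    | a c r t where "inputs f = [a, outcome g, c]" "i = 2" "rs = [r, \<one> (outcome g), t]" "r \<in> Arr M" "tgt r = a" "t \<in> Arr M" "tgt t = c"
    | a b r t where "inputs f = [a, b, outcome g]" "i = 3" "rs = [r, t, \<one> (outcome g)]" "r \<in> Arr M" "tgt r = a" "t \<in> Arr M" "tgt t = b"
    using sh rs unfolding pShape_def by (elim conjE disjE exE) (auto simp: into_inputs_arrows map_eq_Cons_conv)
  then show ?thesis
  proof cases
    case 1 then show ?thesis using o T act by (simp add: argument_def)
  next
    case (2 b r) then show ?thesis using n1[of r] by (simp add: argument_def)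
  next
    case (3 a r) then show ?thesis using n2[of r] by (simp add: argument_def)
  next
    case (4 b c r t)
    have "(\<one> (outcome g) \<star> r \<star> t) \<cdot> (arg1 ?g (src r) \<star> \<one> (src t)) = ((\<one> (outcome g) \<star> r) \<cdot> arg1 ?g (src r)) \<star> t"
      using 4 o A act TensA_Comp[of "arg1 ?g (src r)" "\<one> (outcome g) \<star> r" "\<one> (src t)" t] by simp
    also have "\<dots> = (arg1 g b \<star> \<one> c) \<cdot> (tens_arr M (ps @ [r]) \<star> t)"
      using 4 o A T' n1[of r] TensA_Comp[of "tens_arr M (ps @ [r])" "arg1 g b" t "\<one> c"] by (auto simp del: tens_list_simps(2))
    finally show ?thesis using 4 by (simp add: argument_def snoc)
  next
    case (5 a c r t)
    have "(r \<star> \<one> (outcome g) \<star> t) \<cdot> (arg2 (src r) ?g \<star> \<one> (src t)) = ((r \<star> \<one> (outcome g)) \<cdot> arg2 (src r) ?g) \<star> t"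
      using 5 o A act TensA_Comp[of "arg2 (src r) ?g" "r \<star> \<one> (outcome g)" "\<one> (src t)" t] by simp
    also have "\<dots> = (arg2 a g \<star> \<one> c) \<cdot> (tens_arr M (r # ps) \<star> t)"
      using 5 o A T' n2[of r] TensA_Comp[of "tens_arr M (r # ps)" "arg2 a g" t "\<one> c"]
      by (auto simp del: tens_list_simps(2) tens_arr_simps(2))
    finally show ?thesis using 5 by (simp add: argument_def)
  next
    case (6 a b r t) then show ?thesis using n2[of "r \<star> t"] by (simp add: argument_def)
  qed
qed

lemma argument_dinatural:
  assumes f: "pShape f i (post PM p g)" and g: "g \<in> pMaps" and p: "p \<in> Arr M" "src p = outcome g"
  shows "argument (inputs f) i (post PM p g) =
    tens_arr M ((map \<one> (inputs f))[i - 1 := p]) \<cdot> argument ((inputs f)[i - 1 := outcome g]) i g"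
proof -
  note post = post_pMaps[OF g p]
  have fg: "f \<in> pMaps" "arity g \<le> 3" using f post(3) by (auto simp: pShape_def)
  have o: "outcome g \<in> Ob M" "arrow_of M g \<in> Arr M" using g by simp_all
  have ob: "\<And>a. a \<in> set (inputs f) \<Longrightarrow> a \<in> Ob M" using pMaps_Ob[OF fg(1)] .
  note A = arg1_simps[OF g] arg2_simps[OF g _ fg(2)]
  show ?thesis
    using f ob p o fg(2) unfolding pShape_def
    by (elim conjE disjE exE)
      (simp_all add: argument_def post arg_post[OF g p] TensA_Comp_left A del: tens_list_simps(2))
qed

end

context left_normal_braided
begin

lemma pShapeI:
  assumes "f \<in> pMaps" "g \<in> pMaps" "arity g \<le> 3" "arity f \<le> 3" "1 \<le> i" "i \<le> arity f" "inputs f ! (i - 1) = outcome g"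
  shows "pShape f i g"
proof -
  have i: "i = 1 \<or> i = 2 \<or> i = 3" using assms by arith
  have "arity f \<le> 4" using assms(4) by simp
  then show ?thesis
    by (cases rule: arity_le4_cases) (use assms i in \<open>auto simp: pShape_def\<close>)
qed

lemma argument_concrete:
  "argument [a] i g = arrow_of M g"
  "argument [a, b] (Suc 0) g = arg1 g b" "argument [a, b] 2 g = arg2 a g"
  "argument [a, b, c] (Suc 0) g = arg1 g b \<star> \<one> c" "argument [a, b, c] 2 g = arg2 a g \<star> \<one> c"
  "argument [a, b, c] 3 g = arg2 (a \<otimes> b) g"
  by (simp_all add: argument_def)

lemma arg1_pSub:
  assumes g: "pShape g j h" "inputs (pSub g j h) \<noteq> []" and b: "b \<in> Ob M"
  shows "arg1 (pSub g j h) b = (arrow_of M g \<star> \<one> b) \<cdot> (argument (inputs g) j h \<star> \<one> b)"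
proof -
  have "g \<in> pMaps" using g by (simp add: pShape_def)
  then show ?thesis
    using g b argument_simps[OF g(1)] pSub_simps(4)[OF g(1)] by (simp add: arg1_def TensA_Comp_left)
qed

text \<open>
  This is the triangle equation if \<open>h\<close> is nullary, and naturality of \<open>\<alpha>\<close> if \<open>h\<close> is binary.
\<close>

lemma arg2_pSub_1:
  assumes g: "g \<in> pMaps" "inputs g = [outcome h, y]" and h: "h \<in> pMaps" "inputs h = [] \<or> arity h = 2" and a: "a \<in> Ob M"
  shows "arg2 a (pSub g 1 h) = (\<one> a \<star> arrow_of M g) \<cdot> \<alpha> a (outcome h) y \<cdot> (arg2 a h \<star> \<one> y)"
proof -
  have sh: "pShape g 1 h" using g h by (auto simp: pShape_def)
  have ob: "y \<in> Ob M" "outcome h \<in> Ob M" "arrow_of M g \<in> Arr M" "arrow_of M h \<in> Arr M" using g h pMaps_Ob[OF g(1)] by simp_all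
  let ?x = "outcome h"
  from h(2) show ?thesis
  proof
    assume i: "inputs h = []"
    have "(\<one> a \<star> arrow_of M g) \<cdot> (\<one> a \<star> (arrow_of M h \<star> \<one> y)) \<cdot> (\<one> a \<star> linv y) =
      (\<one> a \<star> arrow_of M g) \<cdot> ((\<one> a \<star> (arrow_of M h \<star> \<one> y)) \<cdot> \<alpha> a \<I> y) \<cdot> (\<r> a \<star> \<one> y)"
      using ob a i by (simp add: Assoc_RUnit_left)
    also have "(\<one> a \<star> (arrow_of M h \<star> \<one> y)) \<cdot> \<alpha> a \<I> y = \<alpha> a ?x y \<cdot> (\<one> a \<star> arrow_of M h \<star> \<one> y)"
      using ob a i Assoc_nat[of "\<one> a" "arrow_of M h" "\<one> y"] by simp
    finally show ?thesis
      using ob a g i pSub_simps[OF sh] by (simp add: arg2_def argument_concrete arg1_def TensA_Comp_right TensA_Comp_left)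
  next
    assume "arity h = 2"
    then obtain p q where i: "inputs h = [p, q]" by (auto simp: arity_cases)
    have pq: "p \<in> Ob M" "q \<in> Ob M" using pMaps_Ob[OF h(1)] i by simp_all
    have "(\<one> a \<star> arrow_of M g) \<cdot> ((\<one> a \<star> (arrow_of M h \<star> \<one> y)) \<cdot> \<alpha> a (p \<otimes> q) y) \<cdot> (\<alpha> a p q \<star> \<one> y) =
      (\<one> a \<star> arrow_of M g) \<cdot> (\<alpha> a ?x y \<cdot> (\<one> a \<star> arrow_of M h \<star> \<one> y)) \<cdot> (\<alpha> a p q \<star> \<one> y)"
      using ob pq a i Assoc_nat[of "\<one> a" "arrow_of M h" "\<one> y"] by simp
    then show ?thesis
      using ob pq a g i pSub_simps[OF sh] by (simp add: arg2_def argument_concrete arg1_def TensA_Comp_right TensA_Comp_left)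
  qed
qed

text \<open>
  This is the equation for \<open>\<alpha>\<close> and \<open>\<r>\<close> if \<open>h\<close> is nullary, and the pentagon if \<open>h\<close> is binary.
\<close>

lemma arg2_pSub_2:
  assumes g: "g \<in> pMaps" "inputs g = [x, outcome h]" and h: "h \<in> pMaps" "inputs h = [] \<or> arity h = 2" and a: "a \<in> Ob M"
  shows "arg2 a (pSub g 2 h) = (\<one> a \<star> arrow_of M g) \<cdot> \<alpha> a x (outcome h) \<cdot> arg2 (a \<otimes> x) h"
proof -
  have sh: "pShape g 2 h" using g h by (auto simp: pShape_def)
  have ob: "x \<in> Ob M" "outcome h \<in> Ob M" "arrow_of M g \<in> Arr M" "arrow_of M h \<in> Arr M" using g h pMaps_Ob[OF g(1)] by simp_all
  let ?y = "outcome h"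
  have nat: "\<alpha> a x ?y \<cdot> (\<one> (a \<otimes> x) \<star> arrow_of M h) = (\<one> a \<star> (\<one> x \<star> arrow_of M h)) \<cdot> \<alpha> a x (tens_list M (inputs h))"
    using Assoc_nat[of "\<one> a" "\<one> x" "arrow_of M h"] ob a by simp
  from h(2) show ?thesis
  proof
    assume i: "inputs h = []"
    have "(\<one> a \<star> arrow_of M g) \<cdot> (\<alpha> a x ?y \<cdot> (\<one> (a \<otimes> x) \<star> arrow_of M h)) \<cdot> \<r> (a \<otimes> x) =
      (\<one> a \<star> arrow_of M g) \<cdot> (\<one> a \<star> (\<one> x \<star> arrow_of M h)) \<cdot> (\<one> a \<star> \<r> x)"
      unfolding nat using ob a i by (simp add: Assoc_RUnit)
    then show ?thesis
      using ob a g i pSub_simps[OF sh] by (simp add: arg2_def argument_concrete TensA_Comp_right)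
  next
    assume "arity h = 2"
    then obtain p q where i: "inputs h = [p, q]" by (auto simp: arity_cases)
    have pq: "p \<in> Ob M" "q \<in> Ob M" using pMaps_Ob[OF h(1)] i by simp_all
    have "(\<one> a \<star> arrow_of M g) \<cdot> (\<alpha> a x ?y \<cdot> (\<one> (a \<otimes> x) \<star> arrow_of M h)) \<cdot> \<alpha> (a \<otimes> x) p q =
      (\<one> a \<star> arrow_of M g) \<cdot> (\<one> a \<star> (\<one> x \<star> arrow_of M h)) \<cdot> (\<one> a \<star> \<alpha> x p q) \<cdot> \<alpha> a (x \<otimes> p) q \<cdot> (\<alpha> a x p \<star> \<one> q)"
      unfolding nat using ob a pq i by (simp add: pentagon)
    then show ?thesis
      using ob pq a g i pSub_simps[OF sh] by (simp add: arg2_def argument_concrete TensA_Comp_right)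
  qed
qed

lemma pSub_nested:
  assumes f: "f \<in> pMaps" "mode f = Tight" "inputs f = [a, b]"
    and g: "g \<in> pMaps" "mode g = Tight" "inputs g = [x, y]"
    and h: "h \<in> pMaps" "mode h = Tight \<and> arity h = 2 \<or> mode h = Loose \<and> inputs h = []"
    and i: "i = 1 \<and> a = outcome g \<or> i = 2 \<and> b = outcome g"
    and j: "j = 1 \<and> x = outcome h \<or> j = 2 \<and> y = outcome h"
  shows "f \<bullet>\<^bsub>PM\<^esub>\<langle>i\<rangle> (g \<bullet>\<^bsub>PM\<^esub>\<langle>j\<rangle> h) = (f \<bullet>\<^bsub>PM\<^esub>\<langle>i\<rangle> g) \<bullet>\<^bsub>PM\<^esub>\<langle>j + i - 1\<rangle> h"
proof -
  have ob: "a \<in> Ob M" "b \<in> Ob M" "x \<in> Ob M" "y \<in> Ob M" "arrow_of M f \<in> Arr M" "arrow_of M g \<in> Arr M" "arrow_of M h \<in> Arr M"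
    using f g h pMaps_Ob[OF f(1)] pMaps_Ob[OF g(1)] by simp_all
  have ah: "arity h \<le> 3" "inputs h = [] \<or> arity h = 2" using h(2) by auto
  have gh: "pShape g j h" using g h(1) ah j by (intro pShapeI) auto
  have fg: "pShape f i g" using f g i by (intro pShapeI) auto
  have gh': "pSub g j h \<in> pMaps"
    by (rule pSub_pMaps[OF gh]) (use g h j in \<open>auto simp: mode_sub_def\<close>)
  have fg': "pSub f i g \<in> pMaps"
    by (rule pSub_pMaps[OF fg]) (use f g i in \<open>auto simp: mode_sub_def\<close>)
  have f_gh: "pShape f i (pSub g j h)"
    using f gh' i j ah g pSub_simps[OF gh] by (intro pShapeI) auto
  have fg_h: "pShape (pSub f i g) (j + i - 1) h"
    using fg' h(1) ah i j f g pSub_simps[OF fg] by (intro pShapeI) auto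
  have "pSub f i (pSub g j h) = pSub (pSub f i g) (j + i - 1) h"
  proof (rule multimap_eqI[of _ _ M])
    show "mode (pSub f i (pSub g j h)) = mode (pSub (pSub f i g) (j + i - 1) h)"
      unfolding pSub_simps(1)[OF f_gh] pSub_simps(1)[OF fg_h] pSub_simps(1)[OF gh] pSub_simps(1)[OF fg]
      using i j f(2) g(2) by (auto simp flip: numeral_2_eq_2)
    show "inputs (pSub f i (pSub g j h)) = inputs (pSub (pSub f i g) (j + i - 1) h)"
      unfolding pSub_simps(2)[OF f_gh] pSub_simps(2)[OF fg_h] pSub_simps(2)[OF gh] pSub_simps(2)[OF fg]
      using i j f(3) g(3) by auto
    have ne: "inputs (pSub g j h) \<noteq> []" using j g(3) by (auto simp: pSub_simps[OF gh])
    note A = arg1_simps[OF h(1)] arg2_simps[OF h(1) _ ah(1)]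
    have nd: "arg1 g b = arrow_of M g \<star> \<one> b" "arg2 a g = (\<one> a \<star> arrow_of M g) \<cdot> \<alpha> a x y"
      using g(3) by (simp_all add: arg1_def arg2_def)
    show "arrow_of M (pSub f i (pSub g j h)) = arrow_of M (pSub (pSub f i g) (j + i - 1) h)"
      unfolding pSub_simps(4)[OF f_gh] pSub_simps(4)[OF fg_h] pSub_simps(4)[OF fg] pSub_simps(2)[OF fg]
      using i j
      by (elim disjE conjE) (use f g ob A nd arg1_pSub[OF gh ne] arg2_pSub_1[OF g(1) _ h(1) ah(2)] arg2_pSub_2[OF g(1) _ h(1) ah(2)]
        in \<open>simp_all add: argument_concrete flip: numeral_2_eq_2\<close>)
  qed
  then show ?thesis
    unfolding circ_PM[OF gh g(1) h(1)] circ_PM[OF fg f(1) g(1)] circ_PM[OF f_gh f(1) gh'] circ_PM[OF fg_h fg' h(1)] .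
qed

text \<open>
  Both sides apply \<open>g\<close> and \<open>h\<close> to different tensor factors. If \<open>g\<close> is nullary the bracketings are
  compared by the equation for \<open>\<alpha>\<close> and \<open>\<l>\<close>, and by the equality of \<open>\<r> \<I>\<close> with the inverse of \<open>\<l> \<I>\<close>
  if \<open>h\<close> is nullary too.
\<close>

lemma pSub_parallel:
  assumes f: "f \<in> pMaps" "mode f = Tight" "inputs f = [outcome g, outcome h]"
    and g: "g \<in> pMaps" "mode g = Tight \<and> arity g = 2 \<or> mode g = Loose \<and> inputs g = []"
    and h: "h \<in> pMaps" "mode h = Tight \<and> arity h = 2 \<or> mode h = Loose \<and> inputs h = []"
  shows "(f \<bullet>\<^bsub>PM\<^esub>\<langle>1\<rangle> g) \<bullet>\<^bsub>PM\<^esub>\<langle>arity g + 1\<rangle> h = (f \<bullet>\<^bsub>PM\<^esub>\<langle>2\<rangle> h) \<bullet>\<^bsub>PM\<^esub>\<langle>1\<rangle> g"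
proof -
  have ob: "outcome g \<in> Ob M" "outcome h \<in> Ob M" "arrow_of M f \<in> Arr M" "arrow_of M g \<in> Arr M" "arrow_of M h \<in> Arr M"
    using f g h by simp_all
  let ?a = "outcome g" and ?b = "outcome h"
  have ag: "arity g = 2 \<or> inputs g = []" and ah: "arity h = 2 \<or> inputs h = []" using g(2) h(2) by auto
  have fg: "pShape f 1 g" using f g(1) ag by (intro pShapeI) auto
  have fh: "pShape f 2 h" using f h(1) ah by (intro pShapeI) auto
  have fg': "pSub f 1 g \<in> pMaps" by (rule pSub_pMaps[OF fg]) (use f g in auto)
  have fh': "pSub f 2 h \<in> pMaps" by (rule pSub_pMaps[OF fh]) (use f h in auto)
  have fg_h: "pShape (pSub f 1 g) (arity g + 1) h"
    using fg' h(1) ah ag f(3) pSub_simps[OF fg] by (intro pShapeI) (auto simp: arity_cases)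
  have fh_g: "pShape (pSub f 2 h) 1 g"
    using fh' g(1) ah ag f(3) pSub_simps[OF fh] by (intro pShapeI) (auto simp: arity_cases)
  have "pSub (pSub f 1 g) (arity g + 1) h = pSub (pSub f 2 h) 1 g"
  proof (rule multimap_eqI[of _ _ M])
    show "mode (pSub (pSub f 1 g) (arity g + 1) h) = mode (pSub (pSub f 2 h) 1 g)"
      unfolding pSub_simps(1)[OF fg] pSub_simps(1)[OF fh] pSub_simps(1)[OF fg_h] pSub_simps(1)[OF fh_g]
      using f(2) g(2) h(2) by auto
    show "inputs (pSub (pSub f 1 g) (arity g + 1) h) = inputs (pSub (pSub f 2 h) 1 g)"
      unfolding pSub_simps(2)[OF fg] pSub_simps(2)[OF fh] pSub_simps(2)[OF fg_h] pSub_simps(2)[OF fh_g]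
      using f(3) ag by auto
    have xch: "(arrow_of M g \<star> \<one> ?b) \<cdot> (\<one> (tens_list M (inputs g)) \<star> arrow_of M h) = (\<one> ?a \<star> arrow_of M h) \<cdot> (arrow_of M g \<star> \<one> (tens_list M (inputs h)))"
      using ob tens_list_Ob[OF pMapsD(2)[OF g(1)]] tens_list_Ob[OF pMapsD(2)[OF h(1)]] by (simp flip: TensA_Comp)
    have "argument [?a, ?b] 1 g \<cdot> argument (inputs g @ [?b]) (arity g + 1) h =
      argument [?a, ?b] 2 h \<cdot> argument (?a # inputs h) 1 g"
      using ag
    proof
      assume "arity g = 2"
      then obtain x y where i: "inputs g = [x, y]" by (auto simp: arity_cases)
      have xy: "x \<in> Ob M" "y \<in> Ob M" using pMaps_Ob[OF g(1)] i by simp_all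
      from ah show ?thesis
      proof
        assume "arity h = 2"
        then obtain p q where k: "inputs h = [p, q]" by (auto simp: arity_cases)
        have pq: "p \<in> Ob M" "q \<in> Ob M" using pMaps_Ob[OF h(1)] k by simp_all
        have "((arrow_of M g \<star> \<one> ?b) \<cdot> (\<one> (x \<otimes> y) \<star> arrow_of M h)) \<cdot> \<alpha> (x \<otimes> y) p q =
          (\<one> ?a \<star> arrow_of M h) \<cdot> \<alpha> ?a p q \<cdot> (arrow_of M g \<star> \<one> p \<star> \<one> q)"
          using xch Assoc_nat[of "arrow_of M g" "\<one> p" "\<one> q"] ob xy pq i k by simp
        then show ?thesis using ob xy pq i k by (simp add: argument_concrete arg1_def arg2_def flip: numeral_3_eq_3)
      next
        assume k: "inputs h = []"
        have "((arrow_of M g \<star> \<one> ?b) \<cdot> (\<one> (x \<otimes> y) \<star> arrow_of M h)) \<cdot> \<r> (x \<otimes> y) = (\<one> ?a \<star> arrow_of M h) \<cdot> \<r> ?a \<cdot> arrow_of M g"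
          using xch RUnit_nat[of "arrow_of M g"] ob xy i k by simp
        then show ?thesis using ob xy i k by (simp add: argument_concrete arg1_def arg2_def flip: numeral_3_eq_3)
      qed
    next
      assume i: "inputs g = []"
      have g1: "linv ?b \<cdot> arrow_of M h = (\<one> \<I> \<star> arrow_of M h) \<cdot> linv (tens_list M (inputs h))"
        using linv_natural[of "arrow_of M h"] ob by simp
      have "(arrow_of M g \<star> \<one> ?b) \<cdot> linv ?b \<cdot> arrow_of M h = ((arrow_of M g \<star> \<one> ?b) \<cdot> (\<one> \<I> \<star> arrow_of M h)) \<cdot> linv (tens_list M (inputs h))"
        unfolding g1 using ob i tens_list_Ob[of "inputs h"] h(1) by simp
      also have "\<dots> = (\<one> ?a \<star> arrow_of M h) \<cdot> (arrow_of M g \<star> \<one> (tens_list M (inputs h))) \<cdot> linv (tens_list M (inputs h))"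
        using xch ob i tens_list_Ob[of "inputs h"] h(1) by simp
      finally have eq: "(arrow_of M g \<star> \<one> ?b) \<cdot> linv ?b \<cdot> arrow_of M h =
        (\<one> ?a \<star> arrow_of M h) \<cdot> (arrow_of M g \<star> \<one> (tens_list M (inputs h))) \<cdot> linv (tens_list M (inputs h))" .
      from ah show ?thesis
      proof
        assume "arity h = 2"
        then obtain p q where k: "inputs h = [p, q]" by (auto simp: arity_cases)
        have pq: "p \<in> Ob M" "q \<in> Ob M" using pMaps_Ob[OF h(1)] k by simp_all
        have "(\<one> ?a \<star> arrow_of M h) \<cdot> (arrow_of M g \<star> \<one> (p \<otimes> q)) \<cdot> \<alpha> \<I> p q \<cdot> (linv p \<star> \<one> q) =
            (\<one> ?a \<star> arrow_of M h) \<cdot> ((arrow_of M g \<star> \<one> (p \<otimes> q)) \<cdot> \<alpha> \<I> p q) \<cdot> (linv p \<star> \<one> q)"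
          using ob pq i k by simp
        also have "(arrow_of M g \<star> \<one> (p \<otimes> q)) \<cdot> \<alpha> \<I> p q = \<alpha> ?a p q \<cdot> (arrow_of M g \<star> \<one> p \<star> \<one> q)"
          using Assoc_nat[of "arrow_of M g" "\<one> p" "\<one> q"] ob pq i by simp
        finally show ?thesis using eq ob pq i k
          by (simp add: argument_concrete arg1_def arg2_def TensA_Comp_left Assoc_linv)
      next
        assume k: "inputs h = []"
        have "(arrow_of M g \<star> \<one> \<I>) \<cdot> linv \<I> = \<r> ?a \<cdot> arrow_of M g"
          using RUnit_nat[of "arrow_of M g"] ob i by (simp add: linv_Unit)
        then show ?thesis using eq ob i k
          by (simp add: argument_concrete arg1_def arg2_def)
      qed
    qed
    then show "arrow_of M (pSub (pSub f 1 g) (arity g + 1) h) = arrow_of M (pSub (pSub f 2 h) 1 g)"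
      unfolding pSub_simps(4)[OF fg] pSub_simps(4)[OF fh] pSub_simps(4)[OF fg_h] pSub_simps(4)[OF fh_g] pSub_simps(2)[OF fg] pSub_simps(2)[OF fh]
      using argument_simps[OF fg] argument_simps[OF fh] argument_simps[OF fg_h, unfolded pSub_simps(2)[OF fg]]
        argument_simps[OF fh_g, unfolded pSub_simps(2)[OF fh]] f ob
      by simp
  qed
  then show ?thesis
    unfolding circ_PM[OF fg f(1) g(1)] circ_PM[OF fh f(1) h(1)] circ_PM[OF fg_h fg' h(1)] circ_PM[OF fh_g fh' g(1)] .
qed

lemma argument_as_loose: "argument as i (as_loose g) = argument as i g"
  by (simp add: argument_def arg1_def arg2_def split: list.splits)

lemma as_loose_pMaps: "f \<in> pMaps \<Longrightarrow> arity f \<le> 2 \<Longrightarrow> as_loose f \<in> pMaps"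
  by (simp add: pMaps_def del: pMapsD)

lemma as_loose_multi: "as_loose (multi x as p) = multi Loose as p"
  by (simp add: as_loose_def multi_def)

lemma category_PM: "category PM"
  by unfold_locales (simp_all add: hom_iff)

lemma short_skew_multicategory_PM: "short_skew_multicategory PM"
proof -
  interpret category PM by (rule category_PM)
  have sub: "pShape f i g" if "substitutable PM f i g" for f i g
    using that by (intro pShape_substitutable) (simp_all add: substitutable_def)
  have subM: "pSub f i g \<in> pMaps" if "substitutable PM f i g" for f i g
    using that by (intro pSub_pMaps[OF sub[OF that]]) (auto simp: substitutable_def sub_shapes_def mode_sub_def split: if_splits)
  have tight2: "\<exists>x y. inputs f = [x, y]" if "arity f = 2" for f :: "('o, 'm) multimap"
    using that by (auto simp: arity_cases)
  show ?thesis
  proof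
    fix f ps q assume "f \<in> Maps PM" "into_inputs PM ps (inputs f)" "q \<in> Arr PM" "src q = outcome f"
    then show "Act PM ps q f \<in> mhom PM (mode f) (map src ps) (tgt q)"
      using pAct_simps[of f ps q] by (simp add: mhom_iff)
  next
    fix f assume f: "f \<in> Maps PM"
    then have "post PM (\<one> (outcome f)) f = f"
      using post_pMaps[of f "\<one> (outcome f)"] by (intro multimap_eqI[of _ _ M]) simp_all
    then show "Act PM (map \<one>\<^bsub>PM\<^esub> (inputs f)) (\<one>\<^bsub>PM\<^esub> (outcome f)) f = f" by (simp add: post_def)
  next
    fix f ps ps' q q'
    assume a: "f \<in> Maps PM" "into_inputs PM ps (inputs f)" "into_inputs PM ps' (map src ps)" "q \<in> Arr PM"
      "src q = outcome f" "q' \<in> Arr PM" "src q' = tgt q"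
    have pp: "into_inputs M (map2 (\<cdot>) ps ps') (inputs f)" "map src (map2 (\<cdot>) ps ps') = map src ps'"
      using a(2,3) by (auto simp: into_inputs_iff intro!: nth_equalityI)
    show "Act PM (map2 (\<cdot>\<^bsub>PM\<^esub>) ps ps') (q' \<cdot>\<^bsub>PM\<^esub> q) f = Act PM ps' q' (Act PM ps q f)"
      using a pp pAct_simps[of f ps q] pAct_simps[of "pAct ps q f" ps' q'] pAct_simps[of f "map2 (\<cdot>) ps ps'" "q' \<cdot> q"]
       tens_arr_hom[of ps "inputs f"] tens_arr_tgt[of ps "inputs f"] tens_arr_hom[of ps' "map src ps"] tens_arr_tgt[of ps' "map src ps"]
      by (intro multimap_eqI[of _ _ M]) (simp_all add: tens_arr_Comp)
  next
    fix a b assume ab: "a \<in> Ob PM" "b \<in> Ob PM"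
    show "mhom PM Tight [a] b = to_multi ` hom PM a b"
    proof (intro equalityI subsetI)
      fix f assume f: "f \<in> mhom PM Tight [a] b"
      then have "arrow_of M f \<in> hom M a b" by (simp add: mhom_iff hom_iff)
      moreover have "f = to_multi (arrow_of M f)" using f by (intro multimap_eqI[of _ _ M]) (simp_all add: mhom_iff)
      ultimately show "f \<in> to_multi ` hom PM a b" by simp
    qed (use ab in \<open>auto simp: mhom_iff hom_iff pMaps_def simp del: pMapsD\<close>)
  next
    fix r p q assume "r \<in> Arr PM" "p \<in> Arr PM" "q \<in> Arr PM" "tgt p = src r" "src q = tgt r"
    then show "Act PM [p] q (to_multi r) = to_multi (q \<cdot>\<^bsub>PM\<^esub> r \<cdot>\<^bsub>PM\<^esub> p)"
      by (intro multimap_eqI[of _ _ M]) (simp_all add: pAct_def)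
  next
    fix f assume "f \<in> Maps PM" "mode f = Tight" "arity f \<in> {1, 2}"
    then show "J PM f \<in> mhom PM Loose (inputs f) (outcome f)"
      using as_loose_pMaps[of f] by (auto simp: mhom_iff)
  next
    fix f ps q show "J PM (Act PM ps q f) = Act PM ps q (J PM f)"
      by (simp add: pAct_def as_loose_multi)
  next
    fix f i g assume s: "substitutable PM f i g"
    show "Sub PM f i g \<in> mhom PM (mode_sub (mode f) i (mode g)) (take (i - 1) (inputs f) @ inputs g @ drop i (inputs f)) (outcome f)"
      using subM[OF s] pSub_simps[OF sub[OF s]] by (simp add: mhom_iff)
  next
    fix f i g rs ps q
    assume s: "substitutable PM f i g" and rs: "into_inputs PM rs (inputs f)" "rs ! (i - 1) = \<one>\<^bsub>PM\<^esub> (outcome g)"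
      and ps: "into_inputs PM ps (inputs g)" and q: "q \<in> Arr PM" "src q = outcome f"
    have fg: "f \<in> pMaps" "g \<in> pMaps" "1 \<le> i" "i \<le> arity f" "arity g \<le> 3" "arity f \<le> 3" "inputs f ! (i - 1) = outcome g"
      using s by (auto simp: substitutable_def sub_shapes_def)
    have rs': "into_inputs M rs (inputs f)" "rs ! (i - 1) = \<one> (outcome g)" and ps': "into_inputs M ps (inputs g)"
      and q': "q \<in> Arr M" using rs ps q by simp_all
    let ?f = "pAct rs q f" and ?g = "pAct ps (\<one> (outcome g)) g"
    have o: "outcome g \<in> Ob M" "arrow_of M f \<in> Arr M" using fg by simp_all
    note af = pAct_simps[OF fg(1) rs'(1) q' q(2)] and ag = pAct_simps[OF fg(2) ps' Id_Arr[unfolded PM_simps, OF o(1)] src_Id[unfolded PM_simps, OF o(1)]]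
    note Trs = tens_arr_hom[OF rs'(1)] tens_arr_tgt[OF rs'(1)]
    have len: "length rs = arity f" "length ps = arity g" using rs ps by (simp_all add: into_inputs_iff)
    have nth: "map src rs ! (i - 1) = outcome g" using rs'(2) len fg(3,4) o by simp
    have fg': "pShape ?f i ?g" using af ag fg len nth o by (intro pShapeI) simp_all
    let ?qs = "take (i - 1) rs @ ps @ drop i rs"
    have qs: "into_inputs M ?qs (inputs (pSub f i g))"
      using rs ps pSub_simps(2)[OF sub[OF s]] by (simp add: into_inputs_def list_all2_appendI)
    have qsrc: "map src ?qs = inputs (pSub ?f i ?g)"
      using pSub_simps(2)[OF fg'] af ag by (simp add: take_map drop_map)
    have Q: "src q = outcome (pSub f i g)" using q(2) pSub_simps(3)[OF sub[OF s]] by simp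
    note aq = pAct_simps[OF subM[OF s, unfolded PM_simps] qs q' Q]
    show "Sub PM (Act PM rs q f) i (Act PM ps (\<one>\<^bsub>PM\<^esub> (outcome g)) g) = Act PM ?qs q (Sub PM f i g)"
      unfolding PM_simps
    proof (rule multimap_eqI[of _ _ M])
      show "mode (pSub ?f i ?g) = mode (pAct ?qs q (pSub f i g))"
        using af ag aq pSub_simps[OF fg'] pSub_simps[OF sub[OF s]] by simp
      show "inputs (pSub ?f i ?g) = inputs (pAct ?qs q (pSub f i g))"
        using aq(3) qsrc by simp
      have "arrow_of M (pSub ?f i ?g) = (q \<cdot> arrow_of M f) \<cdot> tens_arr M rs \<cdot> argument (map src rs) i ?g"
        using pSub_simps(4)[OF fg'] af argument_simps[OF fg'] Trs q o by simp
      also have "\<dots> = (q \<cdot> arrow_of M f) \<cdot> argument (inputs f) i g \<cdot> tens_arr M ?qs"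
        using argument_natural[OF sub[OF s] rs' ps'] by simp
      also have "\<dots> = arrow_of M (pAct ?qs q (pSub f i g))"
        using aq(5) pSub_simps[OF sub[OF s]] argument_simps[OF sub[OF s]] q o tens_arr_hom[OF qs] tens_arr_tgt[OF qs] by simp
      finally show "arrow_of M (pSub ?f i ?g) = arrow_of M (pAct ?qs q (pSub f i g))" .
    qed
  next
    fix f g i p
    assume a: "f \<in> Maps PM" "g \<in> Maps PM" "(mode f, arity f, mode g, arity g) \<in> sub_shapes" "1 \<le> i" "i \<le> arity f"
      "p \<in> Arr PM" "src p = outcome g" "tgt p = inputs f ! (i - 1)"
    have len: "arity f \<le> 3" "arity g \<le> 3" using a(3) by (auto simp: sub_shapes_def)
    let ?ps = "(map \<one> (inputs f))[i - 1 := p]"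
    have ps: "into_inputs M ?ps (inputs f)"
      using a pMaps_Ob[of f] by (auto simp: into_inputs_iff nth_list_update)
    have psrc: "map src ?ps = (inputs f)[i - 1 := outcome g]"
      using a pMaps_Ob[of f] by (auto simp: map_update intro!: arg_cong[of _ _ "\<lambda>xs. xs[_ := _]"] map_idI)
    have o: "outcome f \<in> Ob M" "arrow_of M f \<in> Arr M" using a by simp_all
    have fM: "f \<in> pMaps" and gM: "g \<in> pMaps" and pM: "p \<in> Arr M" using a by simp_all
    note af = pAct_simps[OF fM ps Id_Arr[unfolded PM_simps, OF o(1)] src_Id[unfolded PM_simps, OF o(1)]]
    note ag = post_pMaps[OF gM pM a(7)]
    have s1: "pShape (pAct ?ps (\<one> (outcome f)) f) i g"
      using af gM len a psrc by (intro pShapeI) simp_all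
    have s2: "pShape f i (post PM p g)" using ag fM len a by (intro pShapeI) simp_all
    show "Sub PM (pre PM f i p) i g = Sub PM f i (post PM p g)"
      unfolding pre_def PM_simps
    proof (rule multimap_eqI[of _ _ M])
      show "mode (pSub (pAct ?ps (\<one> (outcome f)) f) i g) = mode (pSub f i (post PM p g))"
        using af ag pSub_simps[OF s1] pSub_simps[OF s2] by simp
      show "inputs (pSub (pAct ?ps (\<one> (outcome f)) f) i g) = inputs (pSub f i (post PM p g))"
        using af ag pSub_simps[OF s1] pSub_simps[OF s2] psrc a by (simp add: take_update_cancel drop_update_cancel)
      show "arrow_of M (pSub (pAct ?ps (\<one> (outcome f)) f) i g) = arrow_of M (pSub f i (post PM p g))"
        using af pSub_simps[OF s1] pSub_simps[OF s2] psrc argument_dinatural[OF s2 gM pM a(7)] argument_simps[OF s1]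
          tens_arr_hom[OF ps] tens_arr_tgt[OF ps] o
        by simp
    qed
  next
    fix f g h i j
    assume a: "f \<in> Maps PM" "g \<in> Maps PM" "h \<in> Maps PM" "mode f = Tight" "arity f = 2"
      "(mode g, arity g, mode h, arity h) \<in> {(Tight, 2, Tight, 2), (Tight, 2, Loose, 0)}"
      "i \<in> {1..2}" "j \<in> {1..arity g}" "inputs f ! (i - 1) = outcome g" "inputs g ! (j - 1) = outcome h"
    obtain a1 b1 where f: "inputs f = [a1, b1]" using tight2[OF a(5)] by blast
    have ag: "arity g = 2" using a(6) by auto
    then obtain x y where g: "inputs g = [x, y]" using tight2 by blast
    have i: "i = 1 \<or> i = 2" and j: "j = 1 \<or> j = 2" using a(7,8) ag by auto
    show "f \<bullet>\<^bsub>PM\<^esub>\<langle>i\<rangle> (g \<bullet>\<^bsub>PM\<^esub>\<langle>j\<rangle> h) = (f \<bullet>\<^bsub>PM\<^esub>\<langle>i\<rangle> g) \<bullet>\<^bsub>PM\<^esub>\<langle>j + i - 1\<rangle> h"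
      by (rule pSub_nested[of f a1 b1 g x y]) (use a f g i j in auto)
  next
    fix f g h
    assume a: "f \<in> Maps PM" "g \<in> Maps PM" "h \<in> Maps PM" "mode f = Tight" "arity f = 2"
      "(mode g, arity g, mode h, arity h) \<in> {(Tight, 2, Tight, 2), (Tight, 2, Loose, 0), (Loose, 0, Tight, 2), (Loose, 0, Loose, 0)}"
      "inputs f = [outcome g, outcome h]"
    show "(f \<bullet>\<^bsub>PM\<^esub>\<langle>1\<rangle> g) \<bullet>\<^bsub>PM\<^esub>\<langle>arity g + 1\<rangle> h = (f \<bullet>\<^bsub>PM\<^esub>\<langle>2\<rangle> h) \<bullet>\<^bsub>PM\<^esub>\<langle>1\<rangle> g"
      by (rule pSub_parallel) (use a in auto)
  next
    fix g h a b c a' assume g: "g \<in> mhom PM Tight [a, b] c" and h: "h \<in> mhom PM Tight [a'] b"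
    have s: "pShape g 2 h" using g h by (intro pShapeI) (simp_all add: mhom_iff)
    show "g \<bullet>\<^bsub>PM\<^esub>\<langle>2\<rangle> (J PM h) = g \<bullet>\<^bsub>PM\<^esub>\<langle>2\<rangle> h"
      using g h circ_PM[OF s] by (simp add: mhom_iff circ_def[of PM g 2 "as_loose h"] argument_as_loose pSub_def)
  next
    fix g h a b c a' assume g: "g \<in> mhom PM Tight [a, b] c" and h: "h \<in> mhom PM Tight [a'] a"
    have s: "pShape g 1 h" using g h by (intro pShapeI) (simp_all add: mhom_iff)
    show "g \<bullet>\<^bsub>PM\<^esub>\<langle>1\<rangle> (J PM h) = J PM (g \<bullet>\<^bsub>PM\<^esub>\<langle>1\<rangle> h)"
      using g h circ_PM[OF s] by (simp add: mhom_iff circ_def[of PM g 1 "as_loose h", simplified] argument_as_loose pSub_def as_loose_multi)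
  next
    fix f h a b c assume f: "f \<in> mhom PM Tight [b] c" and h: "h \<in> mhom PM Tight [a] b"
    have s: "pShape f 1 h" using f h by (intro pShapeI) (simp_all add: mhom_iff)
    show "f \<bullet>\<^bsub>PM\<^esub>\<langle>1\<rangle> (J PM h) = J PM (f \<bullet>\<^bsub>PM\<^esub>\<langle>1\<rangle> h)"
      using f h circ_PM[OF s] post_PM(1)[of f "as_loose h"] as_loose_pMaps[of h]
      by (simp add: mhom_iff circ_def[of PM f 1 "as_loose h", simplified] argument_as_loose pSub_def as_loose_multi)
  next
    fix g h a b c d assume h: "h \<in> mhom PM Tight [c] d" and g: "g \<in> mhom PM Tight [a, b] c"
    have s: "pShape h 1 g" using g h by (intro pShapeI) (simp_all add: mhom_iff)
    show "(J PM h) \<bullet>\<^bsub>PM\<^esub>\<langle>1\<rangle> g = J PM (h \<bullet>\<^bsub>PM\<^esub>\<langle>1\<rangle> g)"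
      using g h circ_PM[OF s] by (simp add: mhom_iff circ_def[of PM "as_loose h" 1 g, simplified] pSub_def as_loose_multi)
  next
    fix h v c d assume h: "h \<in> mhom PM Tight [c] d" and v: "v \<in> mhom PM Loose [] c"
    have s: "pShape h 1 v" using v h by (intro pShapeI) (simp_all add: mhom_iff)
    show "(J PM h) \<bullet>\<^bsub>PM\<^esub>\<langle>1\<rangle> v = h \<bullet>\<^bsub>PM\<^esub>\<langle>1\<rangle> v"
      using v h circ_PM[OF s] by (simp add: mhom_iff circ_def[of PM "as_loose h" 1 v, simplified] pSub_def)
  qed (auto simp: pMaps_def simp del: pMapsD dest: tgt_Ob[unfolded PM_simps])
qed

end

context left_normal_braided
begin

text \<open>
  Precomposition with an isomorphism between tensor products is bijective on multimaps. This gives both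
  the invertibility of the braiding and the universality of the canonical representation.
\<close>

lemma precompose_bij:
  assumes \<sigma>: "invertible_arrow M \<sigma>" "src \<sigma> = tens_list M bs" "tgt \<sigma> = tens_list M as"
    and ob: "set as \<subseteq> Ob M" "set bs \<subseteq> Ob M"
    and x: "x = Tight \<and> 1 \<le> length as \<and> length as \<le> 4 \<or> x = Loose \<and> length as \<le> 2"
    and y: "y = Tight \<and> 1 \<le> length bs \<and> length bs \<le> 4 \<or> y = Loose \<and> length bs \<le> 2"
  shows "bij_betw (\<lambda>f. multi y bs (arrow_of M f \<cdot> \<sigma>)) (mhom PM x as b) (mhom PM y bs b)"
proof -
  obtain \<sigma>' where i: "inverse_arrows M \<sigma> \<sigma>'" using \<sigma>(1) by (auto simp: invertible_arrow_def)
  note [simp] = inverse_arrowsD[OF i] \<sigma>(2,3)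
  show ?thesis
  proof (rule bij_betw_byWitness[where f' = "\<lambda>f. multi x as (arrow_of M f \<cdot> \<sigma>')"])
    show "\<forall>f\<in>mhom PM x as b. multi x as (arrow_of M (multi y bs (arrow_of M f \<cdot> \<sigma>)) \<cdot> \<sigma>') = f"
      using ob by (auto simp: mhom_iff multi_arrow_of)
    show "\<forall>f\<in>mhom PM y bs b. multi y bs (arrow_of M (multi x as (arrow_of M f \<cdot> \<sigma>')) \<cdot> \<sigma>) = f"
      using ob by (auto simp: mhom_iff multi_arrow_of)
    show "(\<lambda>f. multi y bs (arrow_of M f \<cdot> \<sigma>)) ` mhom PM x as b \<subseteq> mhom PM y bs b"
      using ob y by (auto simp: mhom_iff intro!: multi_pMaps)
    show "(\<lambda>f. multi x as (arrow_of M f \<cdot> \<sigma>')) ` mhom PM y bs b \<subseteq> mhom PM x as b"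
      using ob x by (auto simp: mhom_iff intro!: multi_pMaps)
  qed
qed

text \<open>
  Inputs are exchanged by precomposing with the inverse permutation of the tensor factors, hence
  \<open>s a c b\<close>, with target \<open>a \<otimes> b \<otimes> c\<close>, in the first clause.
\<close>

definition PB :: "('o, 'm) sbraid" where
  "PB = \<lparr>Br32 = (\<lambda>f. case inputs f of a # b # c # _ \<Rightarrow> multi Tight [a, c, b] (arrow_of M f \<cdot> s a c b)),
         Br42 = (\<lambda>f. case inputs f of a # b # c # d # _ \<Rightarrow> multi Tight [a, c, b, d] (arrow_of M f \<cdot> (s a c b \<star> \<one> d))),
         Br43 = (\<lambda>f. case inputs f of a # b # c # d # _ \<Rightarrow> multi Tight [a, b, d, c] (arrow_of M f \<cdot> s (a \<otimes> b) d c))\<rparr>"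

lemma PB_simps:
  "inputs f = [a, b, c] \<Longrightarrow> Br32 PB f = multi Tight [a, c, b] (arrow_of M f \<cdot> s a c b)"
  "inputs f = [a, b, c, d] \<Longrightarrow> Br42 PB f = multi Tight [a, c, b, d] (arrow_of M f \<cdot> (s a c b \<star> \<one> d))"
  "inputs f = [a, b, c, d] \<Longrightarrow> Br43 PB f = multi Tight [a, b, d, c] (arrow_of M f \<cdot> s (a \<otimes> b) d c)"
  by (simp_all add: PB_def)

lemma circ_binary_ternary:
  assumes g: "g \<in> mhom PM Tight [b1, b2] c" and f: "f \<in> mhom PM Tight [x, y, z] e"
  shows "e = b1 \<Longrightarrow> g \<bullet>\<^bsub>PM\<^esub>\<langle>1\<rangle> f = multi Tight [x, y, z, b2] (arrow_of M g \<cdot> (arrow_of M f \<star> \<one> b2))"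
    and "e = b2 \<Longrightarrow> g \<bullet>\<^bsub>PM\<^esub>\<langle>2\<rangle> f = multi Tight [b1, x, y, z] (arrow_of M g \<cdot> (\<one> b1 \<star> arrow_of M f) \<cdot> \<alpha> b1 (x \<otimes> y) z \<cdot> (\<alpha> b1 x y \<star> \<one> z))"
proof -
  show "g \<bullet>\<^bsub>PM\<^esub>\<langle>1\<rangle> f = multi Tight [x, y, z, b2] (arrow_of M g \<cdot> (arrow_of M f \<star> \<one> b2))" if "e = b1"
  proof -
    have "pShape g 1 f" using g f that by (intro pShapeI) (simp_all add: mhom_iff)
    from circ_PM[OF this] show ?thesis using g f by (simp add: mhom_iff pSub_def argument_concrete arg1_def)
  qed
  show "g \<bullet>\<^bsub>PM\<^esub>\<langle>2\<rangle> f = multi Tight [b1, x, y, z] (arrow_of M g \<cdot> (\<one> b1 \<star> arrow_of M f) \<cdot> \<alpha> b1 (x \<otimes> y) z \<cdot> (\<alpha> b1 x y \<star> \<one> z))" if "e = b2"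
  proof -
    have "pShape g 2 f" using g f that by (intro pShapeI) (simp_all add: mhom_iff)
    from circ_PM[OF this] show ?thesis using g f by (simp add: mhom_iff pSub_def argument_concrete arg2_def)
  qed
qed

lemma circ_ternary_binary:
  assumes g: "g \<in> mhom PM Tight [b1, b2, b3] c" and f: "f \<in> mhom PM Tight [x, y] e"
  shows "e = b1 \<Longrightarrow> g \<bullet>\<^bsub>PM\<^esub>\<langle>1\<rangle> f = multi Tight [x, y, b2, b3] (arrow_of M g \<cdot> (arrow_of M f \<star> \<one> b2 \<star> \<one> b3))"
    and "e = b2 \<Longrightarrow> g \<bullet>\<^bsub>PM\<^esub>\<langle>2\<rangle> f = multi Tight [b1, x, y, b3] (arrow_of M g \<cdot> (((\<one> b1 \<star> arrow_of M f) \<cdot> \<alpha> b1 x y) \<star> \<one> b3))"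
    and "e = b3 \<Longrightarrow> g \<bullet>\<^bsub>PM\<^esub>\<langle>3\<rangle> f = multi Tight [b1, b2, x, y] (arrow_of M g \<cdot> (\<one> (b1 \<otimes> b2) \<star> arrow_of M f) \<cdot> \<alpha> (b1 \<otimes> b2) x y)"
proof -
  have s: "pShape g i f" if "1 \<le> i" "i \<le> 3" "[b1, b2, b3] ! (i - 1) = e" for i
    using g f that by (intro pShapeI) (simp_all add: mhom_iff)
  show "g \<bullet>\<^bsub>PM\<^esub>\<langle>1\<rangle> f = multi Tight [x, y, b2, b3] (arrow_of M g \<cdot> (arrow_of M f \<star> \<one> b2 \<star> \<one> b3))" if "e = b1"
    using circ_PM[OF s[of 1]] that g f by (simp add: mhom_iff pSub_def argument_concrete arg1_def)
  show "g \<bullet>\<^bsub>PM\<^esub>\<langle>2\<rangle> f = multi Tight [b1, x, y, b3] (arrow_of M g \<cdot> (((\<one> b1 \<star> arrow_of M f) \<cdot> \<alpha> b1 x y) \<star> \<one> b3))" if "e = b2"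
    using circ_PM[OF s[of 2]] that g f by (simp add: mhom_iff pSub_def argument_concrete arg2_def)
  show "g \<bullet>\<^bsub>PM\<^esub>\<langle>3\<rangle> f = multi Tight [b1, b2, x, y] (arrow_of M g \<cdot> (\<one> (b1 \<otimes> b2) \<star> arrow_of M f) \<cdot> \<alpha> (b1 \<otimes> b2) x y)" if "e = b3"
    using circ_PM[OF s[of 3]] that g f by (simp add: mhom_iff pSub_def argument_concrete arg2_def)
qed

lemma mhom_PM_Ob: "f \<in> mhom PM x as b \<Longrightarrow> set as \<subseteq> Ob M \<and> b \<in> Ob M \<and> arrow_of M f \<in> Arr M"
  by (auto simp: mhom_iff pMaps_Ob)

lemma multi_mhom:
  "p \<in> Arr M \<Longrightarrow> src p = tens_list M as \<Longrightarrow> set as \<subseteq> Ob M \<Longrightarrow>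
   x = Tight \<and> 1 \<le> length as \<and> length as \<le> 4 \<or> x = Loose \<and> length as \<le> 2 \<Longrightarrow> tgt p = b \<Longrightarrow> multi x as p \<in> mhom PM x as b"
  by (simp add: mhom_iff multi_pMaps)

text \<open>
  The four axioms of \<open>s\<close> appear one by one: \<open>s_braid\<close> is the braid relation, \<open>s_Assoc_3\<close> is substitution of
  a ternary map into the second input of a binary map, and \<open>s_Assoc_1\<close> and \<open>s_Assoc_2\<close> are substitution of a
  binary map into the second and third input of a ternary map. The remaining axioms are naturality of
  \<open>s\<close>.
\<close>

lemma short_braiding_PB: "short_braiding PM PB"
proof -
  interpret P: short_skew_multicategory PM by (rule short_skew_multicategory_PM)
  have inv [simp]: "invertible_arrow M (s a b c)" if "a \<in> Ob M" "b \<in> Ob M" "c \<in> Ob M" for a b c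
    using s_invertible[OF that] .
  show ?thesis
  proof
    fix a1 a2 a3 b assume ob: "{a1, a2, a3, b} \<subseteq> Ob PM"
    have "bij_betw (\<lambda>f. multi Tight [a1, a3, a2] (arrow_of M f \<cdot> s a1 a3 a2)) (mhom PM Tight [a1, a2, a3] b) (mhom PM Tight [a1, a3, a2] b)"
      using ob by (intro precompose_bij) simp_all
    then show "bij_betw (Br32 PB) (mhom PM Tight [a1, a2, a3] b) (mhom PM Tight [a1, a3, a2] b)"
      by (rule bij_betw_cong[THEN iffD1, rotated]) (simp add: mhom_iff PB_simps)
  next
    fix a1 a2 a3 a4 b assume ob: "{a1, a2, a3, a4, b} \<subseteq> Ob PM"
    have "bij_betw (\<lambda>f. multi Tight [a1, a3, a2, a4] (arrow_of M f \<cdot> (s a1 a3 a2 \<star> \<one> a4))) (mhom PM Tight [a1, a2, a3, a4] b) (mhom PM Tight [a1, a3, a2, a4] b)"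
      using ob by (intro precompose_bij) (simp_all add: invertible_TensA)
    then show "bij_betw (Br42 PB) (mhom PM Tight [a1, a2, a3, a4] b) (mhom PM Tight [a1, a3, a2, a4] b)"
      by (rule bij_betw_cong[THEN iffD1, rotated]) (simp add: mhom_iff PB_simps)
    have "bij_betw (\<lambda>f. multi Tight [a1, a2, a4, a3] (arrow_of M f \<cdot> s (a1 \<otimes> a2) a4 a3)) (mhom PM Tight [a1, a2, a3, a4] b) (mhom PM Tight [a1, a2, a4, a3] b)"
      using ob by (intro precompose_bij) simp_all
    then show "bij_betw (Br43 PB) (mhom PM Tight [a1, a2, a3, a4] b) (mhom PM Tight [a1, a2, a4, a3] b)"
      by (rule bij_betw_cong[THEN iffD1, rotated]) (simp add: mhom_iff PB_simps)
  next
    fix f a1 a2 a3 b p1 p2 p3 q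
    assume f: "f \<in> mhom PM Tight [a1, a2, a3] b" and p: "into_inputs PM [p1, p2, p3] [a1, a2, a3]" and q: "q \<in> Arr PM" "src q = b"
    have [simp]: "arrow_of M f \<in> Arr M" "f \<in> pMaps" "inputs f = [a1, a2, a3]" "mode f = Tight" "outcome f = b" "p1 \<in> Arr M" "p2 \<in> Arr M" "p3 \<in> Arr M"
      "a1 = tgt p1" "a2 = tgt p2" "a3 = tgt p3" "q \<in> Arr M" "src q = b" using f p q by (simp_all add: mhom_iff)
    show "Br32 PB (Act PM [p1, p2, p3] q f) = Act PM [p1, p3, p2] q (Br32 PB f)"
      using s_nat[of p1 p3 p2] by (simp add: pAct_def PB_simps)
  next
    fix f a1 a2 a3 a4 b p1 p2 p3 p4 q
    assume f: "f \<in> mhom PM Tight [a1, a2, a3, a4] b" and p: "into_inputs PM [p1, p2, p3, p4] [a1, a2, a3, a4]" and q: "q \<in> Arr PM" "src q = b"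
    have [simp]: "arrow_of M f \<in> Arr M" "f \<in> pMaps" "inputs f = [a1, a2, a3, a4]" "mode f = Tight" "outcome f = b" "p1 \<in> Arr M" "p2 \<in> Arr M" "p3 \<in> Arr M"
      "p4 \<in> Arr M" "a1 = tgt p1" "a2 = tgt p2" "a3 = tgt p3" "a4 = tgt p4" "q \<in> Arr M" "src q = b" using f p q by (simp_all add: mhom_iff)
    have "(s (tgt p1) (tgt p3) (tgt p2) \<star> \<one> (tgt p4)) \<cdot> (p1 \<star> p3 \<star> p2 \<star> p4) = (p1 \<star> p2 \<star> p3 \<star> p4) \<cdot> (s (src p1) (src p3) (src p2) \<star> \<one> (src p4))"
      using s_nat[of p1 p3 p2] by (simp flip: TensA_Comp)
    then show "Br42 PB (Act PM [p1, p2, p3, p4] q f) = Act PM [p1, p3, p2, p4] q (Br42 PB f)"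
      by (simp add: pAct_def PB_simps)
    show "Br43 PB (Act PM [p1, p2, p3, p4] q f) = Act PM [p1, p2, p4, p3] q (Br43 PB f)"
      using s_nat[of "p1 \<star> p2" p4 p3] by (simp add: pAct_def PB_simps)
  next
    fix h assume h: "h \<in> Maps PM" "mode h = Tight" "arity h = 4"
    obtain a b c d where i: "inputs h = [a, b, c, d]" using h(3) by (auto simp: arity_cases)
    have [simp]: "a \<in> Ob M" "b \<in> Ob M" "c \<in> Ob M" "d \<in> Ob M" "arrow_of M h \<in> Arr M" using h i pMaps_Ob[of h] by simp_all
    show "Br42 PB (Br43 PB (Br42 PB h)) = Br43 PB (Br42 PB (Br43 PB h))"
      using s_braid[of a d c b] i by (simp add: PB_simps)
  next
    fix g b1 b2 c f x y z assume g: "g \<in> mhom PM Tight [b1, b2] c" and f: "f \<in> mhom PM Tight [x, y, z] b1"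
    have [simp]: "b1 \<in> Ob M" "b2 \<in> Ob M" "x \<in> Ob M" "y \<in> Ob M" "z \<in> Ob M" "arrow_of M f \<in> Arr M" "arrow_of M g \<in> Arr M"
       "inputs f = [x, y, z]" "outcome f = b1" "inputs g = [b1, b2]"
      using mhom_PM_Ob[OF f] mhom_PM_Ob[OF g] f g by (simp_all add: mhom_iff)
    have b: "Br32 PB f \<in> mhom PM Tight [x, z, y] b1" by (simp add: PB_simps multi_mhom)
    show "g \<bullet>\<^bsub>PM\<^esub>\<langle>1\<rangle> Br32 PB f = Br42 PB (g \<bullet>\<^bsub>PM\<^esub>\<langle>1\<rangle> f)"
      unfolding circ_binary_ternary(1)[OF g b refl] circ_binary_ternary(1)[OF g f refl] by (simp add: PB_simps TensA_Comp_left)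
  next
    fix g b1 b2 c f x y z assume g: "g \<in> mhom PM Tight [b1, b2] c" and f: "f \<in> mhom PM Tight [x, y, z] b2"
    have [simp]: "b1 \<in> Ob M" "b2 \<in> Ob M" "x \<in> Ob M" "y \<in> Ob M" "z \<in> Ob M" "arrow_of M f \<in> Arr M" "arrow_of M g \<in> Arr M"
       "inputs f = [x, y, z]" "outcome f = b2" "inputs g = [b1, b2]"
      using mhom_PM_Ob[OF f] mhom_PM_Ob[OF g] f g by (simp_all add: mhom_iff)
    have b: "Br32 PB f \<in> mhom PM Tight [x, z, y] b2" by (simp add: PB_simps multi_mhom)
    show "g \<bullet>\<^bsub>PM\<^esub>\<langle>2\<rangle> Br32 PB f = Br43 PB (g \<bullet>\<^bsub>PM\<^esub>\<langle>2\<rangle> f)"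
      unfolding circ_binary_ternary(2)[OF g b refl] circ_binary_ternary(2)[OF g f refl]
      using s_Assoc_3[of b1 x z y] by (simp add: PB_simps TensA_Comp_right)
  next
    fix g b1 b2 b3 c f x y assume g: "g \<in> mhom PM Tight [b1, b2, b3] c" and f: "f \<in> mhom PM Tight [x, y] b1"
    have [simp]: "b1 \<in> Ob M" "b2 \<in> Ob M" "b3 \<in> Ob M" "x \<in> Ob M" "y \<in> Ob M" "arrow_of M f \<in> Arr M" "arrow_of M g \<in> Arr M"
       "inputs f = [x, y]" "outcome f = b1" "inputs g = [b1, b2, b3]" "outcome g = c"
      using mhom_PM_Ob[OF f] mhom_PM_Ob[OF g] f g by (simp_all add: mhom_iff)
    have b: "Br32 PB g \<in> mhom PM Tight [b1, b3, b2] c" by (simp add: PB_simps multi_mhom)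
    show "Br43 PB (g \<bullet>\<^bsub>PM\<^esub>\<langle>1\<rangle> f) = Br32 PB g \<bullet>\<^bsub>PM\<^esub>\<langle>1\<rangle> f"
      unfolding circ_ternary_binary(1)[OF g f refl] circ_ternary_binary(1)[OF b f refl]
      using s_nat[of "arrow_of M f" "\<one> b3" "\<one> b2"] by (simp add: PB_simps)
  next
    fix g b1 b2 b3 c f x y assume g: "g \<in> mhom PM Tight [b1, b2, b3] c" and f: "f \<in> mhom PM Tight [x, y] b2"
    have [simp]: "b1 \<in> Ob M" "b2 \<in> Ob M" "b3 \<in> Ob M" "x \<in> Ob M" "y \<in> Ob M" "arrow_of M f \<in> Arr M" "arrow_of M g \<in> Arr M"
       "inputs f = [x, y]" "outcome f = b2" "inputs g = [b1, b2, b3]" "outcome g = c"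
      using mhom_PM_Ob[OF f] mhom_PM_Ob[OF g] f g by (simp_all add: mhom_iff)
    have b: "Br32 PB g \<in> mhom PM Tight [b1, b3, b2] c" by (simp add: PB_simps multi_mhom)
    have "(s b1 b3 b2 \<cdot> (\<one> (b1 \<otimes> b3) \<star> arrow_of M f)) \<cdot> \<alpha> (b1 \<otimes> b3) x y =
       (\<one> b1 \<star> arrow_of M f \<star> \<one> b3) \<cdot> (s b1 b3 (x \<otimes> y) \<cdot> \<alpha> (b1 \<otimes> b3) x y)"
      using s_nat[of "\<one> b1" "\<one> b3" "arrow_of M f"] by simp
    also have "\<dots> = (\<one> b1 \<star> arrow_of M f \<star> \<one> b3) \<cdot> (\<alpha> b1 x y \<star> \<one> b3) \<cdot> s (b1 \<otimes> x) b3 y \<cdot> (s b1 b3 x \<star> \<one> y)"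
      by (simp add: s_Assoc_1)
    finally show "Br42 PB (Br43 PB (g \<bullet>\<^bsub>PM\<^esub>\<langle>2\<rangle> f)) = Br32 PB g \<bullet>\<^bsub>PM\<^esub>\<langle>3\<rangle> f"
      unfolding circ_ternary_binary(2)[OF g f refl] circ_ternary_binary(3)[OF b f refl]
      by (simp add: PB_simps TensA_Comp_left)
  next
    fix g b1 b2 b3 c f x y assume g: "g \<in> mhom PM Tight [b1, b2, b3] c" and f: "f \<in> mhom PM Tight [x, y] b3"
    have [simp]: "b1 \<in> Ob M" "b2 \<in> Ob M" "b3 \<in> Ob M" "x \<in> Ob M" "y \<in> Ob M" "arrow_of M f \<in> Arr M" "arrow_of M g \<in> Arr M"
       "inputs f = [x, y]" "outcome f = b3" "inputs g = [b1, b2, b3]" "outcome g = c"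
      using mhom_PM_Ob[OF f] mhom_PM_Ob[OF g] f g by (simp_all add: mhom_iff)
    have b: "Br32 PB g \<in> mhom PM Tight [b1, b3, b2] c" by (simp add: PB_simps multi_mhom)
    have "(s b1 b3 b2 \<cdot> (\<one> b1 \<star> arrow_of M f \<star> \<one> b2)) \<cdot> (\<alpha> b1 x y \<star> \<one> b2) =
       (\<one> (b1 \<otimes> b2) \<star> arrow_of M f) \<cdot> (s b1 (x \<otimes> y) b2 \<cdot> (\<alpha> b1 x y \<star> \<one> b2))"
      using s_nat[of "\<one> b1" "arrow_of M f" "\<one> b2"] by simp
    also have "\<dots> = (\<one> (b1 \<otimes> b2) \<star> arrow_of M f) \<cdot> \<alpha> (b1 \<otimes> b2) x y \<cdot> (s b1 x b2 \<star> \<one> y) \<cdot> s (b1 \<otimes> x) y b2"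
      by (simp add: s_Assoc_2)
    finally show "Br43 PB (Br42 PB (g \<bullet>\<^bsub>PM\<^esub>\<langle>3\<rangle> f)) = Br32 PB g \<bullet>\<^bsub>PM\<^esub>\<langle>2\<rangle> f"
      unfolding circ_ternary_binary(3)[OF g f refl] circ_ternary_binary(2)[OF b f refl]
      by (simp add: PB_simps TensA_Comp_left)
  qed
qed

lemma short_symmetric_PB:
  assumes "skew_symmetric M s" shows "short_symmetric PM PB"
proof -
  have "Br32 PB (Br32 PB f) = f" if f: "f \<in> pMaps" "mode f = Tight" "arity f = 3" for f
  proof -
    obtain a b c where i: "inputs f = [a, b, c]" using f(3) by (auto simp: arity_cases)
    have [simp]: "a \<in> Ob M" "b \<in> Ob M" "c \<in> Ob M" "arrow_of M f \<in> Arr M" using f i pMaps_Ob[of f] by simp_all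
    have "s a c b \<cdot> s a b c = \<one> (a \<otimes> b \<otimes> c)"
      using assms by (simp add: skew_symmetric_def inverse_arrows_def)
    then show ?thesis using f(2) i by (simp add: PB_simps multi_arrow_of)
  qed
  then show ?thesis by (simp add: short_symmetric_def)
qed

lemma tight_eq_loose_PM: "tight_eq_loose PM"
proof -
  have "mhom PM Loose as b \<subseteq> as_loose ` mhom PM Tight as b" if "length as \<in> {1, 2}" for as b
  proof
    fix f assume f: "f \<in> mhom PM Loose as b"
    let ?g = "multi Tight as (arrow_of M f)"
    have "?g \<in> mhom PM Tight as b" using f that mhom_PM_Ob[OF f] by (intro multi_mhom) (auto simp: mhom_iff)
    moreover have "f = as_loose ?g" using f by (simp add: as_loose_multi multi_arrow_of mhom_iff)
    ultimately show "f \<in> as_loose ` mhom PM Tight as b" by blast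
  qed
  moreover have "as_loose ` mhom PM Tight as b \<subseteq> mhom PM Loose as b" if "length as \<in> {1, 2}" for as b
    using that as_loose_pMaps by (auto simp: mhom_iff)
  ultimately show ?thesis unfolding tight_eq_loose_def PM_simps by blast
qed

section \<open>Essential surjectivity\<close>

text \<open>
  The universal maps are represented by identity arrows, so that composing with them does not change the
  arrow that represents a map.
\<close>

definition R0 :: "('o, 'm) lrep" where
  "R0 = lrep.make (\<lambda>a b. multi Tight [a, b] (\<one> (a \<otimes> b))) (multi Loose [] (\<one> \<I>))"

lemma R0_simps [simp]: "\<theta>\<^bsub>R0\<^esub> a b = multi Tight [a, b] (\<one> (a \<otimes> b))" "\<u>\<^bsub>R0\<^esub> = multi Loose [] (\<one> \<I>)"
  by (simp_all add: R0_def lrep.defs)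

lemma left_representation_R0: "left_representation PM R0"
  unfolding left_representation_def
proof (intro conjI ballI allI impI)
  fix a b assume "a \<in> Ob PM" "b \<in> Ob PM"
  then have ab [simp]: "a \<in> Ob M" "b \<in> Ob M" by simp_all
  show \<theta>: "\<theta>\<^bsub>R0\<^esub> a b \<in> mhom PM Tight [a, b] (outcome (\<theta>\<^bsub>R0\<^esub> a b))" by (simp add: multi_mhom)
  fix xs d assume xs: "set xs \<subseteq> Ob PM" "length xs + 1 \<in> {1, 2, 3}" and d: "d \<in> Ob PM"
  have len: "length xs \<le> 2" using xs(2) by auto
  have "bij_betw (\<lambda>f. multi Tight (a # b # xs) (arrow_of M f \<cdot> \<one> (tens_list M (a # b # xs))))
     (mhom PM Tight (a \<otimes> b # xs) d) (mhom PM Tight (a # b # xs) d)"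
    using xs(1) len by (intro precompose_bij) simp_all
  moreover have "multi Tight (a # b # xs) (arrow_of M f \<cdot> \<one> (tens_list M (a # b # xs))) = f \<bullet>\<^bsub>PM\<^esub>\<langle>1\<rangle> \<theta>\<^bsub>R0\<^esub> a b"
    if f: "f \<in> mhom PM Tight (a \<otimes> b # xs) d" for f
  proof -
    have sh: "pShape f 1 (\<theta>\<^bsub>R0\<^esub> a b)" using f \<theta> len by (intro pShapeI) (simp_all add: mhom_iff)
    have "length xs \<le> 4" using len by simp
    then have "argument (a \<otimes> b # xs) 1 (\<theta>\<^bsub>R0\<^esub> a b) = \<one> (tens_list M (a # b # xs))"
      by (cases rule: arity_le4_cases) (use xs(1) len in \<open>simp_all add: argument_concrete arg1_def\<close>)
    then show ?thesis using circ_PM[OF sh] f \<theta> by (simp add: mhom_iff pSub_def)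
  qed
  ultimately show "bij_betw (\<lambda>f. f \<bullet>\<^bsub>PM\<^esub>\<langle>1\<rangle> \<theta>\<^bsub>R0\<^esub> a b)
     (mhom PM Tight (outcome (\<theta>\<^bsub>R0\<^esub> a b) # xs) d) (mhom PM Tight (a # b # xs) d)"
    by (subst bij_betw_cong[where g = "\<lambda>f. multi Tight (a # b # xs) (arrow_of M f \<cdot> \<one> (tens_list M (a # b # xs)))"]) simp_all
next
  show u: "\<u>\<^bsub>R0\<^esub> \<in> mhom PM Loose [] (outcome \<u>\<^bsub>R0\<^esub>)" by (simp add: multi_mhom)
  fix xs d assume xs: "set xs \<subseteq> Ob PM" "length xs \<in> {0, 1, 2}" and d: "d \<in> Ob PM"
  \<comment> \<open>Substituting \<open>u\<close> for the first input precomposes with the arrow that introduces the unit.\<close>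
  let ?\<sigma> = "case xs of [] \<Rightarrow> \<one> \<I> | [b] \<Rightarrow> linv b | b # c # _ \<Rightarrow> linv b \<star> \<one> c"
  have len: "length xs \<le> 4" "length xs \<le> 2" using xs(2) by auto
  have inv [simp]: "invertible_arrow M (linv b)" if "b \<in> Ob M" for b
    using inverse_arrows_sym[OF inverse_linv[OF that]] by (auto simp: invertible_arrow_def)
  have "invertible_arrow M ?\<sigma> \<and> src ?\<sigma> = tens_list M xs \<and> tgt ?\<sigma> = tens_list M (\<I> # xs)"
    using len(1) by (cases rule: arity_le4_cases) (use xs(1) len in \<open>simp_all add: invertible_TensA\<close>)
  then have "bij_betw (\<lambda>f. multi Loose xs (arrow_of M f \<cdot> ?\<sigma>)) (mhom PM Tight (\<I> # xs) d) (mhom PM Loose xs d)"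
    using xs(1) len by (intro precompose_bij) simp_all
  moreover have "multi Loose xs (arrow_of M f \<cdot> ?\<sigma>) = f \<bullet>\<^bsub>PM\<^esub>\<langle>1\<rangle> \<u>\<^bsub>R0\<^esub>"
    if f: "f \<in> mhom PM Tight (\<I> # xs) d" for f
  proof -
    have sh: "pShape f 1 \<u>\<^bsub>R0\<^esub>" using f u len by (intro pShapeI) (simp_all add: mhom_iff)
    have "argument (\<I> # xs) 1 \<u>\<^bsub>R0\<^esub> = ?\<sigma>"
      using len(1) by (cases rule: arity_le4_cases) (use xs(1) len in \<open>simp_all add: argument_concrete arg1_def\<close>)
    then show ?thesis using circ_PM[OF sh] f u by (simp add: mhom_iff pSub_def)
  qed
  ultimately show "bij_betw (\<lambda>f. f \<bullet>\<^bsub>PM\<^esub>\<langle>1\<rangle> \<u>\<^bsub>R0\<^esub>) (mhom PM Tight (outcome \<u>\<^bsub>R0\<^esub> # xs) d) (mhom PM Loose xs d)"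
    by (subst bij_betw_cong[where g = "\<lambda>f. multi Loose xs (arrow_of M f \<cdot> ?\<sigma>)"]) simp_all
qed

sublocale P: represented_braided_multicategory PM R0 PB
proof -
  interpret short_braiding PM PB by (rule short_braiding_PB)
  show "represented_braided_multicategory PM R0 PB"
    by unfold_locales (rule left_representation_R0)
qed

end

context left_normal_braided
begin

no_notation P.tens (infixl "\<odot>" 80) and P.tensA (infixl "\<odot>\<^sub>1" 80) and P.unit ("I")

lemma K_tens_R0 [simp]: "a \<in> Ob M \<Longrightarrow> b \<in> Ob M \<Longrightarrow> K_tens R0 a b = a \<otimes> b"
  by (simp add: K_tens_def)

lemma K_unit_R0 [simp]: "K_unit R0 = \<I>"
  by (simp add: K_unit_def)

lemma post_multi_Id:
  assumes "multi x as (\<one> (tens_list M as)) \<in> pMaps" "p \<in> Arr M" "src p = tens_list M as"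
  shows "post PM p (multi x as (\<one> (tens_list M as))) = multi x as p"
proof -
  have "set as \<subseteq> Ob M" using pMapsD(2)[OF assms(1)] by simp
  then show ?thesis using assms post_pMaps[OF assms(1,2)] tens_list_Ob[of as] by (intro multimap_eqI[of _ _ M]) simp_all
qed

lemma Theta3_R0:
  assumes "a \<in> Ob M" "b \<in> Ob M" "c \<in> Ob M"
  shows "P.\<Theta>3 a b c = multi Tight [a, b, c] (\<one> (a \<otimes> b \<otimes> c))"
  using assms by (simp add: P.\<Theta>3_def pSub_def argument_concrete arg1_def)

lemma post_Theta3_R0:
  assumes "a \<in> Ob M" "b \<in> Ob M" "c \<in> Ob M" "p \<in> Arr M" "src p = a \<otimes> b \<otimes> c"
  shows "post PM p (P.\<Theta>3 a b c) = multi Tight [a, b, c] p"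
  using assms post_multi_Id[of Tight "[a, b, c]" p] P.theta3_simps(1)[of a b c] by (simp add: Theta3_R0)

text \<open>
  The structure of \<open>K\<close> for the canonical representation is that of \<open>M\<close> on objects and arrows of \<open>M\<close>.
  Outside of them the two records may differ, which is why they are only compared on morphisms of
  \<open>BrdSkMon\<close>, in \<open>lax_into\<close> and \<open>lax_out_of\<close>.
\<close>

lemma K_tensA_R0: "f \<in> Arr M \<Longrightarrow> g \<in> Arr M \<Longrightarrow> K_tensA PM R0 f g = f \<star> g"
  using post_multi_Id[of Tight "[src f, src g]" "f \<star> g"] P.theta_simps(1)[of "src f" "src g"]
  by (intro P.K_tensA_eqI) (simp_all add: pAct_def)

lemma K_assoc_R0:
  assumes [simp]: "a \<in> Ob M" "b \<in> Ob M" "c \<in> Ob M"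
  shows "K_assoc PM R0 a b c = \<alpha> a b c"
proof (rule P.cancel3[of _ a b c])
  show "post PM (K_assoc PM R0 a b c) (P.\<Theta>3 a b c) = post PM (\<alpha> a b c) (P.\<Theta>3 a b c)"
    using P.post_assoc[of a b c] by (simp add: post_Theta3_R0 pSub_def argument_concrete arg2_def)
qed (use P.K_assoc_simps[of a b c] in simp_all)

lemma K_lunit_R0:
  assumes [simp]: "a \<in> Ob M"
  shows "K_lunit PM R0 a = \<l> a"
proof (rule P.cancel_Loose1[of _ a])
  have v: "Sub PM (\<theta>\<^bsub>R0\<^esub> (K_unit R0) a) 1 \<u>\<^bsub>R0\<^esub> = multi Loose [a] (linv a)"
    by (simp add: pSub_def argument_concrete arg1_def)
  have "multi Loose [a] (linv a) \<in> pMaps" by (intro multi_pMaps) simp_all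
  from post_pMaps[OF this, of "\<l> a"] have "post PM (\<l> a) (multi Loose [a] (linv a)) = multi Loose [a] (\<one> a)"
    by (intro multimap_eqI[of _ _ M]) simp_all
  moreover have "\<j>\<^bsub>PM\<^esub> (to_multi (\<one> a)) = multi Loose [a] (\<one> a)"
    by (intro multimap_eqI[of _ _ M]) simp_all
  ultimately show "post PM (K_lunit PM R0 a) (Sub PM (\<theta>\<^bsub>R0\<^esub> (K_unit R0) a) 1 \<u>\<^bsub>R0\<^esub>) = post PM (\<l> a) (Sub PM (\<theta>\<^bsub>R0\<^esub> (K_unit R0) a) 1 \<u>\<^bsub>R0\<^esub>)"
    using P.post_lunit[of a] unfolding v by simp
qed (use P.K_lunit_simps[of a] in simp_all)

lemma K_runit_R0:
  assumes [simp]: "a \<in> Ob M"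
  shows "K_runit PM R0 a = \<r> a"
proof -
  have "to_multi (K_runit PM R0 a) = to_multi (\<r> a)"
    using P.to_multi_runit[of a]
    by (intro multimap_eqI[of _ _ M]) (simp_all add: pSub_def argument_concrete arg2_def)
  then show ?thesis by simp
qed

lemma K_braid_R0:
  assumes [simp]: "x \<in> Ob M" "a \<in> Ob M" "b \<in> Ob M"
  shows "K_braid PM R0 PB x a b = s x a b"
  by (rule P.K_braid_eqI) (simp_all add: post_Theta3_R0, simp add: Theta3_R0 PB_simps)

lemmas K_R0 = K_tensA_R0 K_assoc_R0 K_lunit_R0 K_runit_R0 K_braid_R0

lemma lax_into:
  assumes F: "braided_lax_monoidal (N, t) (K_skmon PM R0, K_braid PM R0 PB) F" and N: "skew_braiding N t"
  shows "braided_lax_monoidal (N, t) (M, s) F"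
proof -
  interpret N: skew_braiding N t by fact
  interpret F: lax_monoidal N "K_skmon PM R0" F using F by (simp add: braided_lax_monoidal_def)
  have [simp]: "a \<in> Ob N \<Longrightarrow> fob F a \<in> Ob M" "f \<in> Arr N \<Longrightarrow> farr F f \<in> Arr M" "f \<in> Arr N \<Longrightarrow> src (farr F f) = fob F (src f)"
    "f \<in> Arr N \<Longrightarrow> tgt (farr F f) = fob F (tgt f)" for a f
    using F.fob_Ob[of a] F.farr_simps[of f] by simp_all
  have l0 [simp]: "lax0 F \<in> Arr M" "src (lax0 F) = \<I>" "tgt (lax0 F) = fob F (Unit N)"
    using F.lax0_simps by simp_all
  have l2 [simp]: "lax2 F a b \<in> Arr M" "src (lax2 F a b) = fob F a \<otimes> fob F b" "tgt (lax2 F a b) = fob F (a \<otimes>\<^bsub>N\<^esub> b)"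
    if "a \<in> Ob N" "b \<in> Ob N" for a b
    using F.lax2_simps[OF that] that by simp_all
  have "lax_monoidal N M F"
  proof unfold_locales
    fix f g assume "f \<in> Arr N" "g \<in> Arr N" "tgt f = src g"
    then show "farr F (g \<cdot>\<^bsub>N\<^esub> f) = farr F g \<cdot> farr F f" using F.farr_Comp[of f g] by simp
  next
    fix f g assume "f \<in> Arr N" "g \<in> Arr N"
    then show "lax2 F (tgt f) (tgt g) \<cdot> (farr F f \<star> farr F g) = farr F (f \<star>\<^bsub>N\<^esub> g) \<cdot> lax2 F (src f) (src g)"
      using F.lax2_nat[of f g] by (simp add: K_R0)
  next
    fix a b c assume "a \<in> Ob N" "b \<in> Ob N" "c \<in> Ob N"
    then show "farr F (\<alpha>\<^bsub>N\<^esub> a b c) \<cdot> lax2 F (a \<otimes>\<^bsub>N\<^esub> b) c \<cdot> (lax2 F a b \<star> \<one> (fob F c)) =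
      lax2 F a (b \<otimes>\<^bsub>N\<^esub> c) \<cdot> (\<one> (fob F a) \<star> lax2 F b c) \<cdot> \<alpha> (fob F a) (fob F b) (fob F c)"
      using F.lax_Assoc[of a b c] by (simp add: K_R0)
  next
    fix a assume "a \<in> Ob N"
    then show "farr F (\<l>\<^bsub>N\<^esub> a) \<cdot> lax2 F \<I>\<^bsub>N\<^esub> a \<cdot> (lax0 F \<star> \<one> (fob F a)) = \<l> (fob F a)"
      "lax2 F a \<I>\<^bsub>N\<^esub> \<cdot> (\<one> (fob F a) \<star> lax0 F) \<cdot> \<r> (fob F a) = farr F (\<r>\<^bsub>N\<^esub> a)"
      using F.lax_LUnit[of a] F.lax_RUnit[of a] by (simp_all add: K_R0)
  next
    fix a assume "a \<in> Ob N"
    then show "farr F (\<one>\<^bsub>N\<^esub> a) = \<one> (fob F a)" using F.farr_Id[of a] by simp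
  qed (simp_all add: hom_iff)
  moreover have "\<forall>x\<in>Ob N. \<forall>a\<in>Ob N. \<forall>b\<in>Ob N.
         farr F (t x a b) \<cdot> lax2 F (x \<otimes>\<^bsub>N\<^esub> a) b \<cdot> (lax2 F x a \<star> \<one> (fob F b)) =
         lax2 F (x \<otimes>\<^bsub>N\<^esub> b) a \<cdot> (lax2 F x b \<star> \<one> (fob F a)) \<cdot> s (fob F x) (fob F a) (fob F b)"
    using F unfolding braided_lax_monoidal_def by (simp add: K_R0)
  ultimately show ?thesis by (simp add: braided_lax_monoidal_def)
qed

lemma lax_out_of:
  assumes F: "braided_lax_monoidal (K_skmon PM R0, K_braid PM R0 PB) (N, t) F"
  shows "braided_lax_monoidal (M, s) (N, t) F"
proof -
  interpret F: lax_monoidal "K_skmon PM R0" N F using F by (simp add: braided_lax_monoidal_def)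
  have [simp]: "a \<in> Ob M \<Longrightarrow> fob F a \<in> Ob N" "f \<in> Arr M \<Longrightarrow> farr F f \<in> hom N (fob F (src f)) (fob F (tgt f))"
     "a \<in> Ob M \<Longrightarrow> farr F (\<one> a) = \<one>\<^bsub>N\<^esub> (fob F a)" for a f
    using F.fob_Ob[of a] F.farr_hom[of f] F.farr_Id[of a] by simp_all
  have "lax_monoidal M N F"
  proof unfold_locales
    fix f g assume "f \<in> Arr M" "g \<in> Arr M" "tgt f = src g"
    then show "farr F (g \<cdot> f) = farr F g \<cdot>\<^bsub>N\<^esub> farr F f" using F.farr_Comp[of f g] by simp
  next
    show "lax0 F \<in> hom N \<I>\<^bsub>N\<^esub> (fob F \<I>)" using F.lax0_hom by simp
  next
    fix a b assume "a \<in> Ob M" "b \<in> Ob M"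
    then show "lax2 F a b \<in> hom N (fob F a \<otimes>\<^bsub>N\<^esub> fob F b) (fob F (a \<otimes> b))" using F.lax2_hom[of a b] by simp
  next
    fix f g assume "f \<in> Arr M" "g \<in> Arr M"
    then show "lax2 F (tgt f) (tgt g) \<cdot>\<^bsub>N\<^esub> (farr F f \<star>\<^bsub>N\<^esub> farr F g) = farr F (f \<star> g) \<cdot>\<^bsub>N\<^esub> lax2 F (src f) (src g)"
      using F.lax2_nat[of f g] by (simp add: K_R0)
  next
    fix a b c assume "a \<in> Ob M" "b \<in> Ob M" "c \<in> Ob M"
    then show "farr F (\<alpha> a b c) \<cdot>\<^bsub>N\<^esub> lax2 F (a \<otimes> b) c \<cdot>\<^bsub>N\<^esub> (lax2 F a b \<star>\<^bsub>N\<^esub> \<one>\<^bsub>N\<^esub> (fob F c)) =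
      lax2 F a (b \<otimes> c) \<cdot>\<^bsub>N\<^esub> (\<one>\<^bsub>N\<^esub> (fob F a) \<star>\<^bsub>N\<^esub> lax2 F b c) \<cdot>\<^bsub>N\<^esub> \<alpha>\<^bsub>N\<^esub> (fob F a) (fob F b) (fob F c)"
      using F.lax_Assoc[of a b c] by (simp add: K_R0)
  next
    fix a assume "a \<in> Ob M"
    then show "farr F (\<l> a) \<cdot>\<^bsub>N\<^esub> lax2 F \<I> a \<cdot>\<^bsub>N\<^esub> (lax0 F \<star>\<^bsub>N\<^esub> \<one>\<^bsub>N\<^esub> (fob F a)) = \<l>\<^bsub>N\<^esub> (fob F a)"
      "lax2 F a \<I> \<cdot>\<^bsub>N\<^esub> (\<one>\<^bsub>N\<^esub> (fob F a) \<star>\<^bsub>N\<^esub> lax0 F) \<cdot>\<^bsub>N\<^esub> \<r>\<^bsub>N\<^esub> (fob F a) = farr F (\<r> a)"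
      using F.lax_LUnit[of a] F.lax_RUnit[of a] by (simp_all add: K_R0)
  qed simp_all
  moreover have "\<forall>x\<in>Ob M. \<forall>a\<in>Ob M. \<forall>b\<in>Ob M.
         farr F (s x a b) \<cdot>\<^bsub>N\<^esub> lax2 F (x \<otimes> a) b \<cdot>\<^bsub>N\<^esub> (lax2 F x a \<star>\<^bsub>N\<^esub> \<one>\<^bsub>N\<^esub> (fob F b)) =
         lax2 F (x \<otimes> b) a \<cdot>\<^bsub>N\<^esub> (lax2 F x b \<star>\<^bsub>N\<^esub> \<one>\<^bsub>N\<^esub> (fob F a)) \<cdot>\<^bsub>N\<^esub> t (fob F x) (fob F a) (fob F b)"
    using F unfolding braided_lax_monoidal_def by (simp add: K_R0)
  ultimately show ?thesis by (simp add: braided_lax_monoidal_def)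
qed

lemma PM_object: "(PM, PB) \<in> Ob BrdShSkMulti_lr"
  using left_representation_R0 short_braiding_PB by (auto simp: BrdShSkMulti_simps(1) left_representable_def)

text \<open>
  The identity multifunctor, viewed as a morphism between the chosen and the canonical representation,
  yields mutually inverse lax monoidal functors by functoriality of \<open>K\<close>.
\<close>

lemma K_PM_iso:
  assumes R: "left_representation PM R"
  shows "\<exists>e\<in>hom BrdSkMon (K_skmon PM R, K_braid PM R PB) (M, s). invertible_arrow BrdSkMon e"
proof -
  interpret R: represented_braided_multicategory PM R PB
    by unfold_locales (rule R)
  note R_rep = R.represented_multicategory_axioms and P_rep = P.represented_multicategory_axioms
  note R_br = R.represented_braided_multicategory_axioms and P_br = P.represented_braided_multicategory_axioms
  let ?N = "K_skmon PM R" and ?t = "K_braid PM R PB" and ?F = "id_mmor PM"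
  let ?\<phi> = "K_lax PM R PM R0 ?F" and ?\<psi> = "K_lax PM R0 PM R ?F"
  have mf: "multifunctor PM PM ?F" by (rule multifunctor_id[OF short_skew_multicategory_PM])
  have id: "braided_multifunctor (PM, PB) (PM, PB) ?F" by (rule braided_multifunctor_id[OF short_braiding_PB])
  interpret F: multifunctor PM PM ?F by (rule mf)
  interpret \<phi>: represented_multifunctor PM PM ?F R R0 ..
  interpret \<psi>: represented_multifunctor PM PM ?F R0 R ..
  have sN: "skew_braiding ?N ?t" by (rule R.skew_braiding_K_braid)
  have \<phi>: "braided_lax_monoidal (?N, ?t) (M, s) ?\<phi>"
    by (rule lax_into[OF braided_lax_monoidal_K[OF R_br P_br id] sN])
  have \<psi>: "braided_lax_monoidal (M, s) (?N, ?t) ?\<psi>"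
    by (rule lax_out_of[OF braided_lax_monoidal_K[OF P_br R_br id]])
  have ext: "laxmor_extensional ?N ?\<phi>" by (rule \<phi>.K_extensional[OF mmor_extensional_id_comp(1)])
  have "laxmor_extensional (K_skmon PM R0) ?\<psi>" by (rule \<psi>.K_extensional[OF mmor_extensional_id_comp(1)])
  then have ext': "laxmor_extensional M ?\<psi>"
    by (simp add: laxmor_extensional_def fctr_extensional_def)
  have idid: "comp_mmor PM ?F ?F = ?F"
    by (rule comp_mmor_id[OF mf mmor_extensional_id_comp(1)])
  have \<psi>\<phi>: "comp_laxmor ?N ?N ?\<psi> ?\<phi> = id_laxmor ?N"
    using K_lax_comp[OF R_rep P_rep R_rep mf mf] K_lax_id[OF R_rep] idid by simp
  have "comp_laxmor (K_skmon PM R0) (K_skmon PM R0) ?\<phi> ?\<psi> = id_laxmor (K_skmon PM R0)"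
    using K_lax_comp[OF P_rep R_rep P_rep mf mf] K_lax_id[OF P_rep] idid by simp
  moreover have "comp_laxmor (K_skmon PM R0) (K_skmon PM R0) ?\<phi> ?\<psi> = comp_laxmor M M ?\<phi> ?\<psi>"
    by (simp add: comp_laxmor_def cong: if_cong)
  moreover have "id_laxmor (K_skmon PM R0) = id_laxmor M"
    by (auto simp: id_laxmor_def fun_eq_iff)
  ultimately have \<phi>\<psi>: "comp_laxmor M M ?\<phi> ?\<psi> = id_laxmor M" by simp
  have ob: "(?N, ?t) \<in> Ob BrdSkMon" "(M, s) \<in> Ob BrdSkMon"
    using sN skew_braiding_axioms by (simp_all add: BrdSkMon_simps(1))
  have "inverse_arrows BrdSkMon (Arrow (?N, ?t) (M, s) ?\<phi>) (Arrow (M, s) (?N, ?t) ?\<psi>)"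
    using ob \<phi> \<psi> ext ext' \<phi>\<psi> \<psi>\<phi> by (simp add: inverse_arrows_def hom_iff BrdSkMon_simps(2-4))
  moreover have "Arrow (?N, ?t) (M, s) ?\<phi> \<in> hom BrdSkMon (?N, ?t) (M, s)"
    using ob \<phi> ext by (simp add: hom_iff BrdSkMon_simps(2))
  ultimately show ?thesis by (auto simp: invertible_arrow_def)
qed

end

section \<open>The equivalences\<close>

text \<open>
  The braided and the symmetric case differ only in the properties that cut out the full subcategories.
  It is enough that \<open>K\<close> and the construction of the multicategory preserve these properties.
\<close>

lemma equivalence_on_full_subcategories:
  fixes ch :: "('o, 'm) ssmulti \<Rightarrow> ('o, 'm) lrep"
  assumes ch: "choice_of_representations ch"
    and P: "\<And>X. X \<in> Ob BrdShSkMulti_lr \<Longrightarrow> P X \<Longrightarrow> tight_eq_loose (fst X) \<and> Q (K_ob ch X)"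
    and Q: "\<And>M s. skew_braiding M s \<Longrightarrow> Q (M, s) \<Longrightarrow> invertible_constraints M"
    and PQ: "\<And>M s. left_normal_braided M s \<Longrightarrow> Q (M, s) \<Longrightarrow> P (left_normal_braided.PM M, left_normal_braided.PB M s)"
  defines "A \<equiv> full_subcategory BrdShSkMulti_lr P" and "B \<equiv> full_subcategory BrdSkMon Q"
  shows "equivalence_of_categories A B (restrict_fctr (K_brd ch) A)"
proof (rule equivalence_if_fully_faithful_ess_surj)
  interpret K: functor_on BrdShSkMulti_lr BrdSkMon "K_brd ch" by (rule functor_K_brd[OF ch])
  let ?K = "restrict_fctr (K_brd ch) A"
  have obA: "X \<in> Ob A \<longleftrightarrow> X \<in> Ob BrdShSkMulti_lr \<and> P X" for X by (simp add: A_def full_subcategory_def)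
  have arrA: "f \<in> Arr A \<longleftrightarrow> f \<in> Arr BrdShSkMulti_lr \<and> P (src f) \<and> P (tgt f)" for f by (simp add: A_def full_subcategory_def)
  have obB: "Y \<in> Ob B \<longleftrightarrow> Y \<in> Ob BrdSkMon \<and> Q Y" for Y by (simp add: B_def full_subcategory_def)
  have arrB: "f \<in> Arr B \<longleftrightarrow> f \<in> Arr BrdSkMon \<and> Q (src f) \<and> Q (tgt f)" for f by (simp add: B_def full_subcategory_def)
  have opA: "Id A = Id BrdShSkMulti_lr" "Comp A = Comp BrdShSkMulti_lr" "Id B = Id BrdSkMon" "Comp B = Comp BrdSkMon"
    by (simp_all add: A_def B_def full_subcategory_def)
  interpret A: category A unfolding A_def by (rule full_subcategory_category[OF category_BrdShSkMulti])
  interpret B: category B unfolding B_def by (rule full_subcategory_category[OF category_BrdSkMon])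
  have fobK [simp]: "fob ?K X = K_ob ch X" if "X \<in> Ob A" for X
    using that by (simp add: restrict_fctr_def K_brd_def)
  have farrK [simp]: "farr ?K f = farr (K_brd ch) f" if "f \<in> Arr A" for f
    using that by (simp add: restrict_fctr_def)
  have KQ: "Q (K_ob ch X)" if "X \<in> Ob A" for X
    using P[of X] that by (simp add: obA)
  have K_brd_fob: "fob (K_brd ch) X = K_ob ch X" for X by (simp add: K_brd_def)
  have farrKA: "farr (K_brd ch) f \<in> Arr B" "src (farr (K_brd ch) f) = K_ob ch (src f)" "tgt (farr (K_brd ch) f) = K_ob ch (tgt f)"
    if "f \<in> Arr A" for f
  proof -
    have "farr (K_brd ch) f \<in> Arr BrdSkMon" using that by (simp add: arrA)
    moreover show *: "src (farr (K_brd ch) f) = K_ob ch (src f)" "tgt (farr (K_brd ch) f) = K_ob ch (tgt f)"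
      by (simp_all add: K_brd_def)
    ultimately show "farr (K_brd ch) f \<in> Arr B" using KQ[of "src f"] KQ[of "tgt f"] that by (simp add: arrB)
  qed
  show "functor_on A B ?K"
  proof
    fix X assume "X \<in> Ob A"
    then show "fob ?K X \<in> Ob B" using K.fob_Ob[of X] KQ[of X] by (simp add: obA obB K_brd_fob)
  next
    fix f assume "f \<in> Arr A"
    then show "farr ?K f \<in> hom B (fob ?K (src f)) (fob ?K (tgt f))" using farrKA[of f] by (simp add: hom_iff)
  next
    fix X assume X: "X \<in> Ob A"
    then have "farr ?K (\<one>\<^bsub>A\<^esub> X) = farr (K_brd ch) (\<one>\<^bsub>A\<^esub> X)" by simp
    also have "\<dots> = \<one>\<^bsub>B\<^esub> (K_ob ch X)" using K.farr_Id[of X] X by (simp add: opA obA K_brd_fob)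
    finally show "farr ?K (\<one>\<^bsub>A\<^esub> X) = \<one>\<^bsub>B\<^esub> (fob ?K X)" using X by simp
  next
    fix f g assume fg: "f \<in> Arr A" "g \<in> Arr A" "tgt f = src g"
    have "farr ?K (g \<cdot>\<^bsub>A\<^esub> f) = farr (K_brd ch) (g \<cdot>\<^bsub>A\<^esub> f)" using fg by simp
    also have "\<dots> = farr (K_brd ch) g \<cdot>\<^bsub>BrdSkMon\<^esub> farr (K_brd ch) f"
      using K.farr_Comp[of f g] fg by (simp add: arrA opA(2))
    finally show "farr ?K (g \<cdot>\<^bsub>A\<^esub> f) = farr ?K g \<cdot>\<^bsub>B\<^esub> farr ?K f" using fg by (simp add: opA(4))
  qed
  have rep: "represented_braided_multicategory (fst X) (ch (fst X)) (snd X)" if "X \<in> Ob A" for X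
    using BrdShSkMulti_represented[OF ch, of X] that by (simp add: obA)
  show "\<exists>f\<in>hom A X Y. farr ?K f = g" if XY: "X \<in> Ob A" "Y \<in> Ob A" and g: "g \<in> hom B (fob ?K X) (fob ?K Y)" for X Y g
  proof -
    obtain C \<beta> where X: "X = (C, \<beta>)" by (cases X)
    obtain D \<gamma> where Y: "Y = (D, \<gamma>)" by (cases Y)
    have tl: "tight_eq_loose C" "tight_eq_loose D" using P[of X] P[of Y] XY by (simp_all add: obA X Y)
    have repC: "represented_braided_multicategory C (ch C) \<beta>" and repD: "represented_braided_multicategory D (ch D) \<gamma>"
      using rep[OF XY(1)] rep[OF XY(2)] by (simp_all add: X Y)
    have g': "g \<in> Arr BrdSkMon" "src g = K_ob ch (C, \<beta>)" "tgt g = K_ob ch (D, \<gamma>)"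
      using g XY by (simp_all add: hom_iff arrB X Y)
    have lax: "braided_lax_monoidal (K_skmon C (ch C), K_braid C (ch C) \<beta>) (K_skmon D (ch D), K_braid D (ch D) \<gamma>) (lbl g)"
      "laxmor_extensional (K_skmon C (ch C)) (lbl g)"
      using BrdSkMon_ArrD(5,6)[OF g'(1)] by (simp_all add: g'(2,3) K_ob_def)
    obtain F where F: "braided_multifunctor (C, \<beta>) (D, \<gamma>) F" "mmor_extensional C F" "K_lax C (ch C) D (ch D) F = lbl g"
      using full_K[OF repC repD tl lax] .
    let ?f = "Arrow X Y F"
    have f: "?f \<in> Arr A" using F(1,2) XY by (simp add: arrA BrdShSkMulti_simps(2) obA) (simp add: X Y)
    moreover have "farr (K_brd ch) ?f = g"
      using F(3) g' by (cases g) (simp add: K_brd_def X Y)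
    ultimately have "?f \<in> hom A X Y \<and> farr ?K ?f = g" by (simp add: hom_iff)
    then show ?thesis by blast
  qed
  show "f = f'" if f: "f \<in> hom A X Y" and f': "f' \<in> hom A X Y" and eq: "farr ?K f = farr ?K f'" for X Y f f'
  proof -
    have a: "f \<in> Arr A" "src f = X" "tgt f = Y" "f' \<in> Arr A" "src f' = X" "tgt f' = Y" using f f' by (simp_all add: hom_iff)
    have XY: "X \<in> Ob A" "Y \<in> Ob A" using A.src_Ob[OF a(1)] A.tgt_Ob[OF a(1)] a by simp_all
    interpret X: represented_braided_multicategory "fst X" "ch (fst X)" "snd X" using rep[OF XY(1)] .
    interpret Y: represented_braided_multicategory "fst Y" "ch (fst Y)" "snd Y" using rep[OF XY(2)] .
    have fa: "f \<in> Arr BrdShSkMulti_lr" and fa': "f' \<in> Arr BrdShSkMulti_lr" using a by (simp_all add: arrA)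
    have m: "multifunctor (fst X) (fst Y) (lbl f)" "mmor_extensional (fst X) (lbl f)"
      and m': "multifunctor (fst X) (fst Y) (lbl f')" "mmor_extensional (fst X) (lbl f')"
      using BrdShSkMulti_ArrD(6,7)[OF fa] BrdShSkMulti_ArrD(6,7)[OF fa'] a by simp_all
    have r: "represented_multifunctor (fst X) (fst Y) (lbl f) (ch (fst X)) (ch (fst Y))"
      and r': "represented_multifunctor (fst X) (fst Y) (lbl f') (ch (fst X)) (ch (fst Y))"
      using m(1) m'(1) X.represented_multicategory_axioms Y.represented_multicategory_axioms
      by (simp_all add: represented_multifunctor_def)
    have K: "K_lax (fst X) (ch (fst X)) (fst Y) (ch (fst Y)) (lbl f) = K_lax (fst X) (ch (fst X)) (fst Y) (ch (fst Y)) (lbl f')"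
    proof -
      have "farr (K_brd ch) f = farr (K_brd ch) f'" using eq a by simp
      then show ?thesis using a by (simp add: K_brd_def)
    qed
    have "lbl f = lbl f'"
    proof (rule mmor_eqI[OF m(2) m'(2)])
      show "fmulti (lbl f) h = fmulti (lbl f') h" if "h \<in> Maps (fst X)" for h
        by (rule fmulti_eqI[OF r r' K that])
    qed (use arg_cong[OF K, of fob] arg_cong[OF K, of farr] in \<open>simp_all add: K_lax_def\<close>)
    then show ?thesis using a by (cases f; cases f') simp
  qed
  show "\<exists>X\<in>Ob A. \<exists>e\<in>hom B (fob ?K X) Y. invertible_arrow B e" if Y: "Y \<in> Ob B" for Y
  proof -
    obtain M s where Ms: "Y = (M, s)" by (cases Y)
    have sb: "skew_braiding M s" and q: "Q (M, s)" using Y by (simp_all add: obB Ms BrdSkMon_simps(1))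
    have inv: "\<forall>a\<in>Ob M. invertible_arrow M (LUnit M a)" using Q[OF sb q] by (simp add: invertible_constraints_def)
    interpret M: left_normal_braided M s using sb inv by (simp add: left_normal_braided_def left_normal_braided_axioms_def)
    let ?X = "(M.PM, M.PB)"
    have X: "?X \<in> Ob A" using M.PM_object PQ[OF M.left_normal_braided_axioms q] by (simp add: obA)
    have "left_representation M.PM (ch M.PM)"
      using rep[OF X] by (simp add: represented_braided_multicategory_def represented_multicategory_def represented_multicategory_axioms_def)
    from M.K_PM_iso[OF this] obtain e where e: "e \<in> hom BrdSkMon (K_ob ch ?X) (M, s)" "invertible_arrow BrdSkMon e"
      by (auto simp: K_ob_def)
    obtain e' where e': "inverse_arrows BrdSkMon e e'" using e(2) by (auto simp: invertible_arrow_def)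
    have "inverse_arrows B e e'"
      using e' e(1) KQ[OF X] q by (auto simp: inverse_arrows_def hom_iff arrB opA)
    moreover have "e \<in> hom B (fob ?K ?X) Y" using e(1) KQ[OF X] q X by (auto simp: hom_iff arrB Ms)
    ultimately show ?thesis using X unfolding invertible_arrow_def by blast
  qed
qed

lemma K_ob_constraints:
  assumes ch: "choice_of_representations ch" and X: "X \<in> Ob BrdShSkMulti_lr" "tight_eq_loose (fst X)"
  shows "invertible_constraints (fst (K_ob ch X))"
proof -
  interpret represented_braided_multicategory "fst X" "ch (fst X)" "snd X" by (rule BrdShSkMulti_represented[OF ch X(1)])
  show ?thesis using invertible_constraints_K[OF X(2)] by (simp add: K_ob_def)
qed

lemma K_ob_symmetric:
  assumes ch: "choice_of_representations ch" and X: "X \<in> Ob BrdShSkMulti_lr" "short_symmetric (fst X) (snd X)"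
  shows "skew_symmetric (fst (K_ob ch X)) (snd (K_ob ch X))"
proof -
  interpret represented_braided_multicategory "fst X" "ch (fst X)" "snd X" by (rule BrdShSkMulti_represented[OF ch X(1)])
  show ?thesis using skew_symmetric_K_braid[OF X(2)] by (simp add: K_ob_def)
qed

lemma full_subcategory_full_subcategory:
  "full_subcategory (full_subcategory A P) Q = full_subcategory A (\<lambda>a. P a \<and> Q a)"
  by (simp add: full_subcategory_def conj_ac)

lemma restrict_fctr_restrict_fctr:
  "restrict_fctr (restrict_fctr F A) (full_subcategory A P) = restrict_fctr F (full_subcategory A P)"
  by (auto simp: restrict_fctr_def full_subcategory_def fun_eq_iff)

theorem theorem5p25:
  fixes ch :: "('o, 'm) ssmulti \<Rightarrow> ('o, 'm) lrep"
  assumes "choice_of_representations ch"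
  shows "equivalence_of_categories BrdShMulti_lr BrdMon (restrict_fctr (K_brd ch) BrdShMulti_lr) \<and>
         equivalence_of_categories SymShMulti_lr SymMon (restrict_fctr (K_sym ch) SymShMulti_lr)"
proof
  note ch = assms
  show "equivalence_of_categories BrdShMulti_lr BrdMon (restrict_fctr (K_brd ch) BrdShMulti_lr)"
    unfolding BrdShMulti_lr_def BrdMon_def
    by (rule equivalence_on_full_subcategories[OF ch])
      (use K_ob_constraints[OF ch] left_normal_braided.tight_eq_loose_PM in \<open>auto simp: split_def\<close>)
  have sym: "restrict_fctr (K_sym ch) SymShMulti_lr = restrict_fctr (K_brd ch) SymShMulti_lr"
    unfolding K_sym_def SymShMulti_lr_def by (rule restrict_fctr_restrict_fctr)
  show "equivalence_of_categories SymShMulti_lr SymMon (restrict_fctr (K_sym ch) SymShMulti_lr)"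
    unfolding sym unfolding SymShMulti_lr_def SymMon_def SymShSkMulti_lr_def SymSkMon_def full_subcategory_full_subcategory
    by (rule equivalence_on_full_subcategories[OF ch])
      (use K_ob_constraints[OF ch] K_ob_symmetric[OF ch] left_normal_braided.tight_eq_loose_PM
        left_normal_braided.short_symmetric_PB in \<open>auto simp: split_def\<close>)
qed

end
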